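(* Let $L,H,\beta>0$, let $D_0,\mu_0>0$ and $M>\max(D_0,\mu_0)$. There is a threshold $k_0$ (depending only on $D_0,\mu_0,M,L,H$) such that the following holds for all integers $k_0\le k_1<k_2$. There exists a constant $C>0$ depending only on $\mu_0,D_0,k_1,k_2,M,L,H$ such that for every $c\in W^{1,\infty}(0,H)$, $c>0$, with $0<c_m\le c^{-2}(y)$ on $(0,H)$ for some constant $c_m$, with $\theta=\sqrt{\|c^{-2}\|_{L^\infty}}$, for every $T>2\theta H$, and for all $(D,\mu_a),(\tilde D,\tilde\mu_a)\in\mathcal O_M$ satisfying $D(H)=\tilde D(H)$, $D'(H)=\tilde D'(H)$, $\mu_a'(H)=\tilde\mu_a'(H)$, one has $$\|\underline u_m^2(\mu_a-\tilde\mu_a)\|_{C^0}\le C\Big(\sum_{i=1}^2\int_0^T\Big(\frac{C_M}{T-2\theta H}+\beta\Big)\|\partial_tp_i-\partial_t\tilde p_i\|^2_{L^2(\Gamma_m)}+\|\partial_xp_i-\partial_x\tilde p_i\|^2_{L^2(\Gamma_m)}\,dt\Big)^{1/4}$$ and $$\|\underline u_m^2(D-\tilde D)\|_{C^0}\le C\Big(\sum_{i=1}^2\int_0^T\Big(\frac{C_M}{T-2\theta H}+\beta\Big)\|\partial_tp_i-\partial_t\tilde p_i\|^2_{L^2(\Gamma_m)}+\|\partial_xp_i-\partial_x\tilde p_i\|^2_{L^2(\Gamma_m)}\,dt\Big)^{1/4},$$ where $$C_M=H\,e^{\int_0^Hc^2(s)|\partial_y(c^{-2}(s))|\,ds}\,(c^{-2}(H)+\beta^2),$$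 $$\underline u_m(y)=\frac{D^{1/2}(H)}{D^{1/2}(y)}\,\frac{\sinh(\kappa_m^{1/2}y)}{\sinh(\kappa_m^{1/2}H)},\qquad \kappa_m=\min_{0\le y\le H}\Big(\frac{(D^{1/2})''}{D^{1/2}}+\frac{\mu_a}{D}+\lambda_{k_1}^2\Big),$$ and where $p_i$, $\tilde p_i$ ($i=1,2$) are the acoustic pressures associated with $(D,\mu_a)$ and $(\tilde D,\tilde\mu_a)$ respectively, as defined in the context.
   Context: $\Omega=(0,L)\times(0,H)$ with points $\mathbf x=(x,y)$; $\Gamma_m=(0,L)\times\{y=H\}$, $\Gamma_0=(0,L)\times\{y=0\}$; $\nu$ is the outward unit normal. $\lambda_k=2k\pi/L$ and $\varphi_k(x)=L^{-1/2}e^{i\lambda_kx}$. $\|\cdot\|_{C^0}$ is the sup norm on $[0,H]$. $\mathcal O_M=\{(D,\mu)\in C^3([0,H])^2:\ D>D_0,\ \mu>\mu_0,\ \|D\|_{C^3},\|\mu\|_{C^3}\le M\}$. Optical problem: for $(D,\mu_a)\in\mathcal O_M$ and an integer $k$, $u_k$ is the unique solution of $$-(D(y)u'(y))'+(\mu_a(y)+\lambda_k^2D(y))u(y)=0\ \text{ on }(0,H),\qquad u(H)=1,\ u(0)=0.$$ (Thus $u_k(y)\varphi_k(x)$ solves $-\nabla\cdot D\nabla u+\mu_au=0$ in $\Omega$ with $u=\varphi_k$ on $\Gamma_m$, $u=0$ on $\Gamma_0$, $L$-periodic in $x$.) $\tilde u_k$ denotes the solution with $(\tilde D,\tilde\mu_a)$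 in place of $(D,\mu_a)$. Acoustic problem: given initial data $(f_0,f_1)$, the pressure $p(\mathbf x,t)$ solves $$\partial_{tt}p=c^2(y)\Delta p\ \text{ in }\Omega,\ t\ge0;\quad \partial_\nu p+\beta\partial_tp=0\ \text{ on }\Gamma_m;\quad p=0\ \text{ on }\Gamma_0;\quad p\ \text{ is }L\text{-periodic in }x;\quad p(\cdot,0)=f_0,\ \partial_tp(\cdot,0)=f_1.$$ The initial data $f_0,f_1$ are assumed to have finite Fourier expansions in $x$, $f_j(x,y)=\sum_{|k|\le N}f_{jk}(y)\varphi_k(x)$ for some $N$, and to belong to $D(A)=\{(p,q)\in V\times V:\ \Delta p\in L^2(\Omega),\ \partial_\nu p+\beta q=0\text{ on }\Gamma_m,\ \partial_x p(0,y)=\partial_x p(L,y)\}$, where $V=\{p\in H^1(\Omega):\ p(0,y)=p(L,y)\text{ for }y\in(0,H),\ p=0\text{ on }\Gamma_0\}$; then $p$ is the unique solution with $(p,\partial_tp)\in C([0,\infty),D(A))\cap C^1([0,\infty),V\times L^2(\Omega))$. $p_i$ is the solution with initial pressure $f_0=\mu_a(y)u_{k_i}(y)\varphi_{k_i}(x)$ and some initial speed $f_1=f_1^{(i)}$ such that $(f_0,f_1)$ satisfies these assumptions; $\tilde p_i$ is the solution with initial pressure $\tilde\mu_a(y)\tilde u_{k_i}(y)\varphi_{k_i}(x)$ and some initial speed $\tilde f_1^{(i)}$ such that the same assumptions hold. *)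

theory Defs
  imports "HOL-Probability.Essential_Supremum"
begin

text \<open>
  Elements of Lebesgue spaces are represented by Borel functions on the whole type, of which only
  the restriction to \<open>S\<close> matters.
\<close>

definition L2 :: "'a::euclidean_space set \<Rightarrow> ('a \<Rightarrow> complex) \<Rightarrow> bool" where
  "L2 S u \<longleftrightarrow> set_borel_measurable lborel S u \<and> set_integrable lborel S (\<lambda>z. (norm (u z))\<^sup>2)"

definition l2norm :: "'a::euclidean_space set \<Rightarrow> ('a \<Rightarrow> complex) \<Rightarrow> real" where
  "l2norm S u = sqrt (set_lebesgue_integral lborel S (\<lambda>z. (norm (u z))\<^sup>2))"

definition Linf_norm :: "'a::euclidean_space set \<Rightarrow> ('a \<Rightarrow> real) \<Rightarrow> ereal" where
  "Linf_norm S u = esssup (restrict_space lborel S) (\<lambda>z. ereal \<bar>u z\<bar>)"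

definition Linf :: "'a::euclidean_space set \<Rightarrow> ('a \<Rightarrow> real) \<Rightarrow> bool" where
  "Linf S u \<longleftrightarrow> set_borel_measurable lborel S u \<and> Linf_norm S u < \<infinity>"

definition loc_integrable ::
  "'a::euclidean_space set \<Rightarrow> ('a \<Rightarrow> 'b::{banach, second_countable_topology}) \<Rightarrow> bool" where
  "loc_integrable S u \<longleftrightarrow> (\<forall>K. compact K \<and> K \<subseteq> S \<longrightarrow> set_integrable lborel K u)"

definition pd :: "'a::euclidean_space \<Rightarrow> ('a \<Rightarrow> 'b::real_normed_vector) \<Rightarrow> 'a \<Rightarrow> 'b" where
  "pd e f z = frechet_derivative f (at z) e"

primrec Ck :: "nat \<Rightarrow> ('a::euclidean_space \<Rightarrow> 'b::real_normed_vector) \<Rightarrow> bool" where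
  "Ck 0 f \<longleftrightarrow> continuous_on UNIV f"
| "Ck (Suc n) f \<longleftrightarrow> (\<forall>z. f differentiable (at z)) \<and> (\<forall>e\<in>Basis. Ck n (pd e f))"

definition smooth :: "('a::euclidean_space \<Rightarrow> 'b::real_normed_vector) \<Rightarrow> bool" where
  "smooth f \<longleftrightarrow> (\<forall>n. Ck n f)"

definition test_fun :: "'a::euclidean_space set \<Rightarrow> ('a \<Rightarrow> real) \<Rightarrow> bool" where
  "test_fun S \<phi> \<longleftrightarrow> smooth \<phi> \<and> (\<exists>K. compact K \<and> K \<subseteq> S \<and> (\<forall>z. z \<notin> K \<longrightarrow> \<phi> z = 0))"

text \<open>
  Weak derivatives are unique up to null sets, so that \<open>wderiv\<close> and \<open>lapl\<close> are well defined
  almost everywhere on \<open>S\<close> whenever a weak derivative exists. Local integrability is demanded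
  explicitly because the integral of a non-integrable function is \<open>0\<close> by convention.
\<close>

definition weak_deriv :: "'a::euclidean_space set \<Rightarrow> 'a \<Rightarrow>
    ('a \<Rightarrow> 'b::{banach, second_countable_topology}) \<Rightarrow> ('a \<Rightarrow> 'b) \<Rightarrow> bool" where
  "weak_deriv S e u g \<longleftrightarrow> loc_integrable S u \<and> loc_integrable S g \<and>
     (\<forall>\<phi>. test_fun S \<phi> \<longrightarrow>
        set_lebesgue_integral lborel S (\<lambda>z. pd e \<phi> z *\<^sub>R u z) =
        - set_lebesgue_integral lborel S (\<lambda>z. \<phi> z *\<^sub>R g z))"

definition wderiv :: "'a::euclidean_space set \<Rightarrow> 'a \<Rightarrow>
    ('a \<Rightarrow> 'b::{banach, second_countable_topology}) \<Rightarrow> 'a \<Rightarrow> 'b" where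
  "wderiv S e u = (SOME g. weak_deriv S e u g)"

definition weak_lapl ::
  "'a::euclidean_space set \<Rightarrow> ('a \<Rightarrow> complex) \<Rightarrow> ('a \<Rightarrow> complex) \<Rightarrow> bool" where
  "weak_lapl S u g \<longleftrightarrow> loc_integrable S u \<and> loc_integrable S g \<and>
     (\<forall>\<phi>. test_fun S \<phi> \<longrightarrow>
        set_lebesgue_integral lborel S (\<lambda>z. (\<Sum>e\<in>Basis. pd e (pd e \<phi>) z) *\<^sub>R u z) =
        set_lebesgue_integral lborel S (\<lambda>z. \<phi> z *\<^sub>R g z))"

definition lapl :: "'a::euclidean_space set \<Rightarrow> ('a \<Rightarrow> complex) \<Rightarrow> 'a \<Rightarrow> complex" where
  "lapl S u = (SOME g. weak_lapl S u g)"

definition H1 :: "'a::euclidean_space set \<Rightarrow> ('a \<Rightarrow> complex) \<Rightarrow> bool" where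
  "H1 S u \<longleftrightarrow> L2 S u \<and> (\<forall>e\<in>Basis. \<exists>g. weak_deriv S e u g \<and> L2 S g)"

definition h1norm :: "'a::euclidean_space set \<Rightarrow> ('a \<Rightarrow> complex) \<Rightarrow> real" where
  "h1norm S u = sqrt ((l2norm S u)\<^sup>2 + (\<Sum>e\<in>Basis. (l2norm S (wderiv S e u))\<^sup>2))"

text \<open>
  The Sobolev space of functions on \<open>(0,H)\<close> which are bounded together with their weak derivative;
  elements are represented by their representative that is continuous on \<open>[0,H]\<close>, so that the
  boundary value at \<open>H\<close> makes sense.
\<close>

definition W1inf :: "real \<Rightarrow> (real \<Rightarrow> real) \<Rightarrow> bool" where
  "W1inf H c \<longleftrightarrow> continuous_on {0..H} c \<and> Linf {0<..<H} c \<and>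
     (\<exists>g. weak_deriv {0<..<H} 1 c g \<and> Linf {0<..<H} g)"

definition Omega :: "real \<Rightarrow> real \<Rightarrow> (real \<times> real) set" where
  "Omega L H = {0<..<L} \<times> {0<..<H}"

text \<open>
  The trace operator is the continuous extension, from the functions that are smooth up to the
  boundary to \<open>H1\<close>, of the restriction to a side of the rectangle. The side is given by a
  parametrization \<open>\<gamma>\<close> by arc length over the interval \<open>I\<close>; \<open>g\<close> is the trace in this parameter.
\<close>

definition is_trace :: "real \<Rightarrow> real \<Rightarrow> (real \<Rightarrow> real \<times> real) \<Rightarrow> real set \<Rightarrow>
    (real \<times> real \<Rightarrow> complex) \<Rightarrow> (real \<Rightarrow> complex) \<Rightarrow> bool" where
  "is_trace L H \<gamma> I u g \<longleftrightarrow> H1 (Omega L H) u \<and> L2 I g \<and>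
     (\<exists>w :: nat \<Rightarrow> real \<times> real \<Rightarrow> complex. (\<forall>n. smooth (w n)) \<and>
        (\<lambda>n. h1norm (Omega L H) (\<lambda>z. w n z - u z)) \<longlonglongrightarrow> 0 \<and>
        (\<lambda>n. l2norm I (\<lambda>s. w n (\<gamma> s) - g s)) \<longlonglongrightarrow> 0)"

definition is_trace_top :: "real \<Rightarrow> real \<Rightarrow> (real \<times> real \<Rightarrow> complex) \<Rightarrow> (real \<Rightarrow> complex) \<Rightarrow> bool" where
  "is_trace_top L H = is_trace L H (\<lambda>x. (x, H)) {0<..<L}"

definition is_trace_bot :: "real \<Rightarrow> real \<Rightarrow> (real \<times> real \<Rightarrow> complex) \<Rightarrow> (real \<Rightarrow> complex) \<Rightarrow> bool" where
  "is_trace_bot L H = is_trace L H (\<lambda>x. (x, 0)) {0<..<L}"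

definition is_trace_left :: "real \<Rightarrow> real \<Rightarrow> (real \<times> real \<Rightarrow> complex) \<Rightarrow> (real \<Rightarrow> complex) \<Rightarrow> bool" where
  "is_trace_left L H = is_trace L H (\<lambda>y. (0, y)) {0<..<H}"

definition is_trace_right :: "real \<Rightarrow> real \<Rightarrow> (real \<times> real \<Rightarrow> complex) \<Rightarrow> (real \<Rightarrow> complex) \<Rightarrow> bool" where
  "is_trace_right L H = is_trace L H (\<lambda>y. (L, y)) {0<..<H}"

definition tr_top :: "real \<Rightarrow> real \<Rightarrow> (real \<times> real \<Rightarrow> complex) \<Rightarrow> real \<Rightarrow> complex" where
  "tr_top L H u = (SOME g. is_trace_top L H u g)"

text \<open>The tangential derivative on the top side, that is, the x-derivative of the trace.\<close>

definition dx_top :: "real \<Rightarrow> real \<Rightarrow> (real \<times> real \<Rightarrow> complex) \<Rightarrow> real \<Rightarrow> complex" where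
  "dx_top L H u = wderiv {0<..<L} 1 (tr_top L H u)"

definition V_space :: "real \<Rightarrow> real \<Rightarrow> (real \<times> real \<Rightarrow> complex) \<Rightarrow> bool" where
  "V_space L H u \<longleftrightarrow> H1 (Omega L H) u \<and>
     (\<exists>g. is_trace_left L H u g \<and> is_trace_right L H u g) \<and>
     is_trace_bot L H u (\<lambda>_. 0)"

text \<open>
  The normal derivative of \<open>p\<close> in \<open>H1\<close> with square integrable Laplacian is the functional on
  boundary values given by Green's formula.
\<close>

definition normal_pairing ::
  "real \<Rightarrow> real \<Rightarrow> (real \<times> real \<Rightarrow> complex) \<Rightarrow> (real \<times> real \<Rightarrow> complex) \<Rightarrow> complex" where
  "normal_pairing L H p v = set_lebesgue_integral lborel (Omega L H)
     (\<lambda>z. lapl (Omega L H) p z * v z +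
          (\<Sum>e\<in>Basis. wderiv (Omega L H) e p z * wderiv (Omega L H) e v z))"

text \<open>
  For \<open>v\<close> in \<open>V_space\<close>, which is L-periodic in x and vanishes on the bottom side, the normal pairing
  stands for
  \<open>(\<integral>x\<in>(0,L). \<partial>\<^sub>y p(x,H) v(x,H)) + (\<integral>y\<in>(0,H). (\<partial>\<^sub>x p(L,y) - \<partial>\<^sub>x p(0,y)) v(0,y))\<close>.
  Hence the last conjunct below is the weak form of the pair of conditions
  \<open>\<partial>\<^sub>\<nu> p + \<beta> q = 0\<close> on the top side and \<open>\<partial>\<^sub>x p(0,y) = \<partial>\<^sub>x p(L,y)\<close>, the values of \<open>v\<close> on the top
  side and on the lateral side being arbitrary.
\<close>

definition D_A :: "real \<Rightarrow> real \<Rightarrow> real \<Rightarrow>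
    (real \<times> real \<Rightarrow> complex) \<Rightarrow> (real \<times> real \<Rightarrow> complex) \<Rightarrow> bool" where
  "D_A L H \<beta> p q \<longleftrightarrow> V_space L H p \<and> V_space L H q \<and>
     (\<exists>g. weak_lapl (Omega L H) p g \<and> L2 (Omega L H) g) \<and>
     (\<forall>v. V_space L H v \<longrightarrow>
        normal_pairing L H p v +
        complex_of_real \<beta> *
          set_lebesgue_integral lborel {0<..<L} (\<lambda>x. tr_top L H q x * tr_top L H v x) = 0)"

text \<open>
  A norm on \<open>D_A\<close> equivalent to the graph norm of \<open>(p, q) \<mapsto> (q, c\<^sup>2 \<Delta>p)\<close> on
  \<open>V \<times> L2\<close>, since \<open>c\<close> is bounded and bounded away from \<open>0\<close>.
\<close>

definition D_A_norm :: "real \<Rightarrow> real \<Rightarrow>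
    (real \<times> real \<Rightarrow> complex) \<Rightarrow> (real \<times> real \<Rightarrow> complex) \<Rightarrow> real" where
  "D_A_norm L H p q =
     h1norm (Omega L H) p + h1norm (Omega L H) q + l2norm (Omega L H) (lapl (Omega L H) p)"

text \<open>Differentiability on \<open>[0,\<infinity>)\<close> (one-sided at \<open>0\<close>) with respect to a seminorm \<open>N\<close>.\<close>

definition time_deriv :: "(('z \<Rightarrow> complex) \<Rightarrow> real) \<Rightarrow> (real \<Rightarrow> 'z \<Rightarrow> complex) \<Rightarrow>
    (real \<Rightarrow> 'z \<Rightarrow> complex) \<Rightarrow> bool" where
  "time_deriv N p q \<longleftrightarrow> (\<forall>t\<ge>0.
     ((\<lambda>s. N (\<lambda>z. (p s z - p t z) / complex_of_real (s - t) - q t z)) \<longlongrightarrow> 0) (at t within {0..}))"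

text \<open>
  \<open>acoustic_solution L H \<beta> c f0 f1 p pt\<close>: the solution of the acoustic problem with data
  \<open>(f0, f1)\<close> is \<open>p\<close>, and \<open>pt\<close> is its time derivative; here \<open>p t\<close> is the function \<open>p(\<cdot>,t)\<close>.
\<close>

definition acoustic_solution :: "real \<Rightarrow> real \<Rightarrow> real \<Rightarrow> (real \<Rightarrow> real) \<Rightarrow>
    (real \<times> real \<Rightarrow> complex) \<Rightarrow> (real \<times> real \<Rightarrow> complex) \<Rightarrow>
    (real \<Rightarrow> real \<times> real \<Rightarrow> complex) \<Rightarrow> (real \<Rightarrow> real \<times> real \<Rightarrow> complex) \<Rightarrow> bool" where
  "acoustic_solution L H \<beta> c f0 f1 p pt \<longleftrightarrow>
     (\<forall>t\<ge>0. D_A L H \<beta> (p t) (pt t)) \<and>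
     (\<forall>t\<ge>0. ((\<lambda>s. D_A_norm L H (\<lambda>z. p s z - p t z) (\<lambda>z. pt s z - pt t z)) \<longlongrightarrow> 0)
        (at t within {0..})) \<and>
     time_deriv (h1norm (Omega L H)) p pt \<and>
     (\<exists>ptt. (\<forall>t\<ge>0. L2 (Omega L H) (ptt t)) \<and>
        time_deriv (l2norm (Omega L H)) pt ptt \<and>
        (\<forall>t\<ge>0. ((\<lambda>s. l2norm (Omega L H) (\<lambda>z. ptt s z - ptt t z)) \<longlongrightarrow> 0) (at t within {0..})) \<and>
        (\<forall>t\<ge>0. AE z in lborel. z \<in> Omega L H \<longrightarrow>
           ptt t z = complex_of_real ((c (snd z))\<^sup>2) * lapl (Omega L H) (p t) z)) \<and>
     (AE z in lborel. z \<in> Omega L H \<longrightarrow> p 0 z = f0 z) \<and>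
     (AE z in lborel. z \<in> Omega L H \<longrightarrow> pt 0 z = f1 z)"

definition lam :: "real \<Rightarrow> int \<Rightarrow> real" where
  "lam L k = 2 * of_int k * pi / L"

definition phi :: "real \<Rightarrow> int \<Rightarrow> real \<Rightarrow> complex" where
  "phi L k x = complex_of_real (1 / sqrt L) * exp (\<i> * complex_of_real (lam L k * x))"

definition finite_fourier :: "real \<Rightarrow> real \<Rightarrow> (real \<times> real \<Rightarrow> complex) \<Rightarrow> bool" where
  "finite_fourier L H f \<longleftrightarrow> (\<exists>(N::nat) (fk :: int \<Rightarrow> real \<Rightarrow> complex).
     AE z in lborel. z \<in> Omega L H \<longrightarrow>
       f z = (\<Sum>k=-int N..int N. fk k (snd z) * phi L k (fst z)))"

text \<open>
  \<open>p\<close> is a pressure generated by the absorption \<open>\<mu>\<close> and the optical solution \<open>u\<close> of mode \<open>k\<close>,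
  for some admissible initial speed \<open>f1\<close>.
\<close>

definition acoustic_pressure :: "real \<Rightarrow> real \<Rightarrow> real \<Rightarrow> (real \<Rightarrow> real) \<Rightarrow> int \<Rightarrow>
    (real \<Rightarrow> real) \<Rightarrow> (real \<Rightarrow> real) \<Rightarrow>
    (real \<Rightarrow> real \<times> real \<Rightarrow> complex) \<Rightarrow> (real \<Rightarrow> real \<times> real \<Rightarrow> complex) \<Rightarrow> bool" where
  "acoustic_pressure L H \<beta> c k \<mu> u p pt \<longleftrightarrow>
     (\<exists>f0 f1. f0 = (\<lambda>z. complex_of_real (\<mu> (snd z) * u (snd z)) * phi L k (fst z)) \<and>
        finite_fourier L H f0 \<and> finite_fourier L H f1 \<and> D_A L H \<beta> f0 f1 \<and>
        acoustic_solution L H \<beta> c f0 f1 p pt)"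

text \<open>Derivatives on \<open>[0,H]\<close> are one-sided at the end points.\<close>

definition dI :: "real \<Rightarrow> (real \<Rightarrow> real) \<Rightarrow> real \<Rightarrow> real" where
  "dI H f y = vector_derivative f (at y within {0..H})"

definition Cn_on :: "real \<Rightarrow> nat \<Rightarrow> (real \<Rightarrow> real) \<Rightarrow> bool" where
  "Cn_on H n f \<longleftrightarrow>
     (\<forall>j<n. \<forall>y\<in>{0..H}. ((dI H ^^ j) f) differentiable (at y within {0..H})) \<and>
     continuous_on {0..H} ((dI H ^^ n) f)"

definition sup_norm :: "real \<Rightarrow> (real \<Rightarrow> real) \<Rightarrow> real" where
  "sup_norm H f = (SUP y\<in>{0..H}. \<bar>f y\<bar>)"

text \<open>The \<open>C\<^sup>n\<close> norm is taken as the sum, not the maximum, of the sup norms of the derivatives.\<close>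

definition Cn_norm :: "real \<Rightarrow> nat \<Rightarrow> (real \<Rightarrow> real) \<Rightarrow> real" where
  "Cn_norm H n f = (\<Sum>j\<le>n. sup_norm H ((dI H ^^ j) f))"

definition O_M :: "real \<Rightarrow> real \<Rightarrow> real \<Rightarrow> real \<Rightarrow> ((real \<Rightarrow> real) \<times> (real \<Rightarrow> real)) set" where
  "O_M H D0 \<mu>0 M = {(D, \<mu>). Cn_on H 3 D \<and> Cn_on H 3 \<mu> \<and>
     (\<forall>y\<in>{0..H}. D y > D0 \<and> \<mu> y > \<mu>0) \<and> Cn_norm H 3 D \<le> M \<and> Cn_norm H 3 \<mu> \<le> M}"

definition optical_solution :: "real \<Rightarrow> real \<Rightarrow> (real \<Rightarrow> real) \<Rightarrow> (real \<Rightarrow> real) \<Rightarrow> int \<Rightarrow>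
    (real \<Rightarrow> real) \<Rightarrow> bool" where
  "optical_solution L H D \<mu> k u \<longleftrightarrow>
     continuous_on {0..H} u \<and>
     (\<forall>y\<in>{0<..<H}. u differentiable (at y) \<and> (\<lambda>s. D s * deriv u s) differentiable (at y) \<and>
        - deriv (\<lambda>s. D s * deriv u s) y + (\<mu> y + (lam L k)\<^sup>2 * D y) * u y = 0) \<and>
     u H = 1 \<and> u 0 = 0"

definition theta :: "real \<Rightarrow> (real \<Rightarrow> real) \<Rightarrow> real" where
  "theta H c = sqrt (real_of_ereal (Linf_norm {0<..<H} (\<lambda>y. 1 / (c y)\<^sup>2)))"

definition C_M :: "real \<Rightarrow> real \<Rightarrow> (real \<Rightarrow> real) \<Rightarrow> real" where
  "C_M H \<beta> c = H * exp (set_lebesgue_integral lborel {0<..<H}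
       (\<lambda>s. (c s)\<^sup>2 * \<bar>wderiv {0<..<H} 1 (\<lambda>y. 1 / (c y)\<^sup>2) s\<bar>)) * (1 / (c H)\<^sup>2 + \<beta>\<^sup>2)"

text \<open>For \<open>D\<close>, \<open>\<mu>\<close> as in \<open>O_M\<close> the infimum is attained, so it is the minimum over \<open>[0,H]\<close>.\<close>

definition kappa_m :: "real \<Rightarrow> real \<Rightarrow> (real \<Rightarrow> real) \<Rightarrow> (real \<Rightarrow> real) \<Rightarrow> int \<Rightarrow> real" where
  "kappa_m L H D \<mu> k1 = (INF y\<in>{0..H}.
     (dI H ^^ 2) (\<lambda>s. sqrt (D s)) y / sqrt (D y) + \<mu> y / D y + (lam L k1)\<^sup>2)"

definition u_m :: "real \<Rightarrow> real \<Rightarrow> (real \<Rightarrow> real) \<Rightarrow> (real \<Rightarrow> real) \<Rightarrow> int \<Rightarrow> real \<Rightarrow> real" where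
  "u_m L H D \<mu> k1 y = sqrt (D H) / sqrt (D y) *
     (sinh (sqrt (kappa_m L H D \<mu> k1) * y) / sinh (sqrt (kappa_m L H D \<mu> k1) * H))"

definition boundary_misfit :: "real \<Rightarrow> real \<Rightarrow> real \<Rightarrow> (real \<Rightarrow> real) \<Rightarrow> real \<Rightarrow>
    (real \<Rightarrow> real \<times> real \<Rightarrow> complex) \<Rightarrow> (real \<Rightarrow> real \<times> real \<Rightarrow> complex) \<Rightarrow>
    (real \<Rightarrow> real \<times> real \<Rightarrow> complex) \<Rightarrow> (real \<Rightarrow> real \<times> real \<Rightarrow> complex) \<Rightarrow> real" where
  "boundary_misfit L H \<beta> c T p pt p' pt' =
     set_lebesgue_integral lborel {0..T} (\<lambda>t.
       (C_M H \<beta> c / (T - 2 * theta H c * H) + \<beta>) *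
          (l2norm {0<..<L} (\<lambda>x. tr_top L H (pt t) x - tr_top L H (pt' t) x))\<^sup>2 +
       (l2norm {0<..<L} (\<lambda>x. dx_top L H (p t) x - dx_top L H (p' t) x))\<^sup>2)"

end

theory Submission
  imports Defs "HOL-Computational_Algebra.Polynomial"
begin

text \<open>
 On the side \<open>y = H\<close> the traces split into Fourier modes in \<open>x\<close>, and each mode of the pressure solves a
 wave equation in \<open>(0,H)\<close> with the potential \<open>(lam L k)^2\<close>. A sideways energy estimate, with weight
 \<open>exp (- G)\<close> where \<open>G y = (\<integral>s\<in>(y,H). c^2 |(c^-2)'|)\<close>, bounds the initial energy of the mode \<open>k\<close> by its trace, so the
 measurements control \<open>h_i = mu * u_i\<close> for the two optical modes in \<open>H1\<close> and, by interpolation, in \<open>C1\<close>.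
 The Wronskian \<open>J = D (u_1 u_2' - u_2 u_1')\<close> satisfies \<open>(ln J)' = (La_2 - La_1) h_1 h_2 / (h_1 h_2' - h_2 h_1')\<close>, which
 determines \<open>mu^2 / D\<close> from the data; then \<open>(1 / u_1, D u_1')\<close> solves a linear system with known
 coefficients and known values at \<open>H\<close>, whence \<open>mu\<close> and \<open>D\<close>. All constants lose at most a factor
 \<open>y^-2\<close>, which is compensated by the square of \<open>u_m\<close>. This works for \<open>k0 = 0\<close>.
\<close>

text \<open>The frequency does not occur in \<open>C_M\<close>, so the potential must not enter the
  sideways estimate through the weight. It is moved into the nonlocal variable
  \<open>B = b + La * R\<close>, whose y-derivative is free of it, and costs an exponential factor
  in \<open>La\<close>, which \<open>C\<close> may contain because \<open>C\<close> depends on the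
  modes. The speed is merely Lipschitz, so the weights \<open>exp (- G)\<close> and
  \<open>sg * exp (- G)\<close> are never differentiated; only their monotonicity enters. Pressures
  in \<open>D_A\<close> are too rough for multiplying the equation by derivatives, whence averages
  in time. Traces, weak derivatives and Laplacians are given by choice; they are pinned down by
  pairings with functions \<open>phi L (- j) x * m y\<close>, which turn everything into continuous
  functions of \<open>y\<close>. Both optical modes vanish linearly at 0, so their Wronskian is of
  third order there, and dividing by it is what costs the powers of \<open>y\<close>. The threshold
  0 is possible because \<open>0 <= k1 < k2\<close> already makes \<open>(lam L k)^2\<close>
  strictly increasing.\<close>

lemmas hk_integrable_diff = Henstock_Kurzweil_Integration.integrable_diff
lemmas hk_integrable_neg = Henstock_Kurzweil_Integration.integrable_neg
lemmas hk_integral_add = Henstock_Kurzweil_Integration.integral_add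
lemmas hk_integral_combine = Henstock_Kurzweil_Integration.integral_combine
lemmas hk_integral_cong = Henstock_Kurzweil_Integration.integral_cong
lemmas hk_integral_diff = Henstock_Kurzweil_Integration.integral_diff
abbreviation (input) cor where "cor == complex_of_real"
abbreviation (input) msb where "msb == borel_measurable"
abbreviation (input) cts where "cts == continuous_on"
abbreviation (input) sint where "sint == set_integrable lborel"
abbreviation (input) sli where "sli == set_lebesgue_integral lborel"
lemmas cints = continuous_intros
lemmas deqs = derivative_eq_intros
notation (input) scaleR (infixr "*R" 75)
notation (input) tendsto (infixr "--->" 55)
abbreviation (input) lims (infixr "---->" 60) where "X ----> l == X \<longlonglongrightarrow> l"
abbreviation (input) hrd (infix "hrd" 50) where "f hrd d == f has_real_derivative d"
abbreviation (input) hvd (infix "hvd" 50) where "f hvd d == f has_vector_derivative d"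
lemmas set_int_def = set_lebesgue_integral_def
lemmas real_deriv_iff = has_real_derivative_iff_has_vector_derivative
lemmas int_cont = integrable_continuous_real
lemmas cont_sub = continuous_on_subset
lemmas cont_comp = continuous_on_compose2
lemmas borel_cont = borel_measurable_continuous_onI
lemmas set_meas_def = set_borel_measurable_def

section \<open>Test functions\<close>

lemma pd_eq:
 assumes "(f has_derivative f') (at z)"
 shows "pd e f z = f' e"
 unfolding pd_def using frechet_derivative_at[OF assms] by simp

lemma pd_has_derivative:
 assumes "f differentiable (at z)"
 shows "(f has_derivative (%e. pd e f z)) (at z)"
 using assms unfolding pd_def by (simp add: frechet_derivative_works)

lemma Ck_imp_continuous: "Ck n f ==> cts UNIV f"
proof (cases n)
 case (Suc m)
 moreover assume "Ck n f"
 ultimately have "f differentiable (at z)" for z by simp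
 thus ?thesis
 by (intro continuous_at_imp_continuous_on) (simp add: differentiable_imp_continuous_within)
qed simp

lemma Ck_SucD: "Ck (Suc n) f ==> Ck n f"
proof (induction n arbitrary: f)
 case 0
 thus ?case using Ck_imp_continuous[OF 0] by simp
next
 case (Suc n)
 hence "ALL z. f differentiable (at z)" "ALL e:Basis. Ck (Suc n) (pd e f)"
 by (simp_all only: Ck.simps(2)[of "Suc n"] conj_commute) blast+
 with Suc.IH show ?case by simp
qed

lemma Ck_const: "Ck n (%_. c)"
proof (induction n arbitrary: c)
 case (Suc n)
 have "pd e (%_. c) = (%_. 0)" for e :: 'a
 by (rule ext, rule trans[OF pd_eq[OF has_derivative_const]]) simp
 thus ?case using Suc by simp
qed simp

lemma Ck_add:
 assumes "Ck n f" "Ck n g"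
 shows "Ck n (%z. f z + g z)"
 using assms
proof (induction n arbitrary: f g)
 case 0
 thus ?case by (auto intro: cints)
next
 case (Suc n)
 have d: "((%z. f z + g z) has_derivative (%e. pd e f z + pd e g z)) (at z)" for z
 using Suc.prems by (intro derivative_intros pd_has_derivative) auto
 hence "pd e (%z. f z + g z) = (%z. pd e f z + pd e g z)" for e
 by (intro ext pd_eq)
 with d Suc show ?case by (auto simp: differentiable_def)
qed

lemma Ck_bounded_linear:
 assumes "bounded_linear h" "Ck n f"
 shows "Ck n (%z. h (f z))"
 using assms(2)
proof (induction n arbitrary: f)
 case 0
 thus ?case
 using assms(1) by (auto intro: linear_continuous_on_compose simp: bounded_linear.continuous_on)
next
 case (Suc n)
 have d: "((%z. h (f z)) has_derivative (%e. h (pd e f z))) (at z)" for z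
 using Suc.prems assms(1)
 by (intro bounded_linear.has_derivative[OF assms(1)] pd_has_derivative) auto
 hence "pd e (%z. h (f z)) = (%z. h (pd e f z))" for e
 by (intro ext pd_eq)
 with d Suc show ?case by (auto simp: differentiable_def)
qed

lemma Ck_bounded_bilinear:
 assumes "bounded_bilinear h" "Ck n f" "Ck n g"
 shows "Ck n (%z. h (f z) (g z))"
 using assms(2,3)
proof (induction n arbitrary: f g)
 case 0
 thus ?case by (auto intro: bounded_bilinear.continuous_on[OF assms(1)])
next
 case (Suc n)
 have d: "((%z. h (f z) (g z)) has_derivative (%e. h (f z) (pd e g z) + h (pd e f z) (g z))) (at z)" for z
 using Suc.prems
 by (intro bounded_bilinear.FDERIV[OF assms(1)] pd_has_derivative) auto
 hence "pd e (%z. h (f z) (g z)) = (%z. h (f z) (pd e g z) + h (pd e f z) (g z))" for e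
 by (intro ext pd_eq)
 moreover have "Ck n f" "Ck n g" using Suc.prems Ck_SucD by blast+
 ultimately show ?case using d Suc by (auto simp: differentiable_def intro!: Ck_add)
qed

lemmas Ck_scaleR = Ck_bounded_bilinear[OF bounded_bilinear_scaleR]
lemmas Ck_mult = Ck_bounded_bilinear[OF bounded_bilinear_mult]

lemma Ck_prod:
 fixes f :: "'i => 'a::euclidean_space => real"
 assumes "!!i. i : I ==> Ck n (f i)"
 shows "Ck n (%z. \<Prod>i\<in>I. f i z)"
 using assms by (induction I rule: infinite_finite_induct) (auto intro: Ck_const Ck_mult)

text \<open>The chain rule stays within the same class: the partial derivative along
  \<open>e\<close> is the constant \<open>l e\<close> times \<open>pd 1 f\<close> composed with the
  same affine map, so induction on \<open>n\<close> applies.\<close>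

lemma Ck_affine:
 fixes f :: "real => 'b::real_normed_vector"
 assumes l: "bounded_linear l" and f: "Ck n f"
 shows "Ck n (%z. f (l z + d))"
 using f
proof (induction n arbitrary: f)
 case 0
 have "cts UNIV (%z. l z + d)"
 using l by (intro cints bounded_linear.continuous_on[OF l])
 thus ?case
 using 0 cont_comp[of UNIV f UNIV "%z. l z + d"] by auto
next
 case (Suc n)
 have d: "((%z. f (l z + d)) has_derivative (%e. l e *R pd 1 f (l z + d))) (at z)" for z
 proof -
 have f': "(f has_derivative (%e. pd e f (l z + d))) (at (l z + d))"
 using Suc.prems by (intro pd_has_derivative) auto
 have lin: "linear (%e. pd e f (l z + d))"
 using has_derivative_linear[OF f'] .
 have "((%z. l z + d) has_derivative l) (at z)"
 using bounded_linear_imp_has_derivative[OF l] by (auto intro!: deqs)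
 from has_derivative_compose[OF this f'] have "((%z. f (l z + d)) has_derivative (%e. pd (l e) f (l z + d))) (at z)" .
 moreover have "pd (l e) f (l z + d) = l e *R pd 1 f (l z + d)" for e
 using linear_scale[OF lin, of "l e" 1] by simp
 ultimately show ?thesis by simp
 qed
 hence "pd e (%z. f (l z + d)) = (%z. l e *R pd 1 f (l z + d))" for e
 by (intro ext pd_eq)
 moreover have "Ck n (%z. pd 1 f (l z + d))" using Suc by auto
 ultimately show ?case using d
 by (auto simp: differentiable_def intro!: Ck_scaleR Ck_const)
qed

lemma pd_real_eq:
 fixes f :: "real => 'b::real_normed_vector"
 assumes "(f hvd d) (at x)"
 shows "pd 1 f x = d"
 using pd_eq[OF assms[unfolded has_vector_derivative_def]] by simp

lemma Ck_antiderivative: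
 fixes f :: "real => 'b::real_normed_vector"
 assumes "!!x. (F hvd f x) (at x)" "Ck n f"
 shows "Ck (Suc n) F"
proof -
 have "pd 1 F = f" using assms(1) by (intro ext pd_real_eq)
 thus ?thesis
 using assms unfolding has_vector_derivative_def by (auto simp: differentiable_def)
qed

text \<open>Smoothness of an explicit function is obtained from a sequence in which each function is
  the derivative of its predecessor. The index \<open>m\<close> is independent of the order
  \<open>n\<close>, so that the induction can pass from \<open>m\<close> to its successor.\<close>

lemma Ck_derivative_sequence:
 fixes F :: "nat => real => 'b::real_normed_vector"
 assumes "!!n x. (F n hvd F (Suc n) x) (at x)"
 shows "Ck n (F m)"
proof (induction n arbitrary: m)
 case 0
 thus ?case
 using assms by (auto intro!: continuous_at_imp_continuous_on has_vector_derivative_continuous)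
next
 case (Suc n)
 show ?case using assms Suc by (rule Ck_antiderivative)
qed

lemma smooth_mult:
 fixes f g :: "'a::euclidean_space => 'b::real_normed_algebra"
 shows "smooth f ==> smooth g ==> smooth (%z. f z * g z)"
 by (simp add: smooth_def Ck_mult)

lemma smooth_affine:
 fixes f :: "real => 'b::real_normed_vector"
 shows "bounded_linear l ==> smooth f ==> smooth (%z. f (l z + d))"
 unfolding smooth_def using Ck_affine by blast

lemma smooth_cont: "smooth f ==> cts A f"
 by (metis smooth_def Ck_imp_continuous cont_sub subset_UNIV)

lemma smooth_pd: "smooth f ==> e : Basis ==> smooth (pd e f)"
 unfolding smooth_def by (metis Ck.simps(2))

lemma smooth_differentiable: "smooth f ==> f differentiable (at z)"
 unfolding smooth_def by (metis Ck.simps(2))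

text \<open>The functions \<open>poly p (1 / x) * exp (- (1 / x))\<close>, continued by 0 to
  \<open>x <= 0\<close>, form a class closed under differentiation: the derivative replaces
  \<open>p\<close> by \<open>X^2 * (p - p')\<close>. This is the classical reason why
  \<open>exp (- (1 / x))\<close> is smooth at 0.\<close>

definition smstep_p :: "real poly => real => real" where
 "smstep_p p x = (if x <= 0 then 0 else poly p (1 / x) * exp (- (1 / x)))"

lemma poly_exp_tendsto_0: "((%s. poly p s * exp (- s)) ---> (0::real)) at_top"
proof -
 have "((%s. \<Sum>i\<le>degree p. coeff p i * (s ^ i / exp s)) ---> (\<Sum>i\<le>degree p. coeff p i * 0)) at_top"
 by (intro tendsto_intros tendsto_power_div_exp_0)
 thus ?thesis
 by (simp add: poly_altdef sum_distrib_right exp_minus divide_inverse mult.assoc)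
qed

lemma smstep_p_deriv:
 "(smstep_p p hrd smstep_p ([:0, 0, 1:] * (p - pderiv p)) x) (at x)"
proof -
 consider "x < 0" | "x = 0" | "x > 0" by linarith
 thus ?thesis
 proof cases
 case 1
 have "((%_. 0) hrd 0) (at x)" by simp
 hence "(smstep_p p hrd 0) (at x)"
 by (rule has_field_derivative_transform_within_open[where S="{..<0}"])
 (use 1 in \<open>auto simp: smstep_p_def\<close>)
 with 1 show ?thesis by (simp add: smstep_p_def)
 next
 case 2
 \<comment> \<open>The difference quotient at 0 carries an additional factor \<open>1 / h\<close>,
   which is absorbed into the polynomial as \<open>pCons 0 p\<close>.\<close>
 have "((%h. poly (pCons 0 p) (1 / h) * exp (- (1 / h))) ---> 0) (at_right (0::real))"
 by (rule filterlim_compose[OF poly_exp_tendsto_0])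
 (simp add: filterlim_inverse_at_top_right flip: inverse_eq_divide)
 hence "((%h. smstep_p p h / h) ---> 0) (at_right 0)"
 by (rule Lim_transform_eventually)
 (auto simp: eventually_at_filter smstep_p_def field_simps)
 moreover have "((%h. smstep_p p h / h) ---> 0) (at_left 0)"
 by (rule tendsto_eventually) (auto simp: eventually_at_filter smstep_p_def)
 ultimately have "((%h. smstep_p p h / h) ---> 0) (at 0)"
 by (simp add: filterlim_at_split)
 thus ?thesis using 2 by (simp add: DERIV_def smstep_p_def)
 next
 case 3
 have "((%x. poly p (1 / x) * exp (- (1 / x))) has_real_derivative
 smstep_p ([:0, 0, 1:] * (p - pderiv p)) x) (at x)"
 using 3 by (auto intro!: deqs simp: smstep_p_def field_simps power2_eq_square)
 thus ?thesis
 by (rule has_field_derivative_transform_within_open[where S="{0<..}"])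
 (use 3 in \<open>auto simp: smstep_p_def\<close>)
 qed
qed

definition smstep :: "real => real" where
 "smstep x = (if x <= 0 then 0 else exp (- (1 / x)))"

lemma smooth_smstep: "smooth smstep"
proof -
 define F where "F n = smstep_p (((%p. [:0, 0, 1:] * (p - pderiv p)) ^^ n) 1)" for n
 have "(F n hvd F (Suc n) x) (at x)" for n x
 using smstep_p_deriv by (simp add: F_def real_deriv_iff)
 hence "Ck n (F 0)" for n by (rule Ck_derivative_sequence)
 moreover have "F 0 = smstep" by (auto simp: F_def smstep_p_def smstep_def)
 ultimately show ?thesis by (simp add: smooth_def)
qed

lemma smstep_nonneg: "0 <= smstep x" and smstep_le_1: "smstep x <= 1"
 by (auto simp: smstep_def)

lemma smstep_eq_0: "x <= 0 ==> smstep x = 0"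
 by (simp add: smstep_def)

text \<open>Dilations of the step tend to the indicator of the open half line. They serve as smooth
  approximations of indicators of boxes, of truncated linear functions, and as cut-offs in
  time.\<close>

lemma smstep_scaled_tendsto:
 "(%n. smstep (real (Suc n) * x)) ----> (if x > 0 then 1 else 0)"
proof (cases "x > 0")
 case True
 have "(%n. exp (- (inverse (real (Suc n)) * (1 / x)))) ----> exp (- (0 * (1 / x)))"
 by (intro tendsto_intros LIMSEQ_inverse_real_of_nat)
 moreover have "inverse (real (Suc n)) * (1 / x) = 1 / (real (Suc n) * x)" for n
 by (simp add: divide_inverse del: of_nat_Suc)
 ultimately have "(%n. exp (- (1 / (real (Suc n) * x)))) ----> 1" by (simp del: of_nat_Suc)
 moreover have "smstep (real (Suc n) * x) = exp (- (1 / (real (Suc n) * x)))" for n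
 using True by (simp add: smstep_def mult_le_0_iff del: of_nat_Suc)
 ultimately show ?thesis using True by (simp del: of_nat_Suc)
qed (simp add: smstep_def mult_le_0_iff del: of_nat_Suc)

section \<open>The fundamental lemma of the calculus of variations\<close>

lemma AE_zero_if_box_integrals_zero:
 fixes g :: "'a::euclidean_space => real"
 assumes int: "integrable lborel g"
 and box: "!!a b. sli (box a b) g = 0"
 shows "AE x in lborel. g x = 0"
proof -
 have [measurable]: "g : msb borel" using int by auto
 have si: "sint A g" if "A : sets borel" for A
 using that int unfolding set_integrable_def
 by (intro integrable_mult_indicator) auto
 \<comment> \<open>Boxes generate the Borel sets and are stable under intersection, so Dynkin's
   theorem extends the vanishing integrals to all Borel sets. The complement case needs the integral
   over the whole space, which is not a box and is reached by exhaustion.\<close>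
 let ?G = "range (%(a, b). box a b :: 'a set)"
 have UN: "(\<Union>n. box (- (real n *R One)) (real n *R One)) = (UNIV :: 'a set)"
 by (rule UN_box_eq_UNIV)
 have all: "sli UNIV g = 0"
 proof -
 have "(%n. sli (box (- (real n *R One)) (real n *R One)) g) \<longlonglongrightarrow>
 sli (\<Union>n. box (- (real n *R One)) (real n *R (One::'a))) g"
 proof (intro set_integral_cont_up)
 show "incseq (%n. box (- (real n *R One)) (real n *R (One::'a)))"
 proof (intro incseq_SucI subsetI)
 fix n and x :: 'a assume "x : box (- (real n *R One)) (real n *R One)"
 hence "- real n < x \<bullet> i & x \<bullet> i < real n" if "i : Basis" for i
 using that by (simp add: mem_box)
 thus "x : box (- (real (Suc n) *R One)) (real (Suc n) *R One)"
 by (force simp: mem_box)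
 qed
 qed (auto intro!: si)
 thus ?thesis by (simp add: box UN LIMSEQ_const_iff)
 qed
 have G: "Int_stable ?G" "?G <= Pow UNIV" by (auto simp: Int_stable_def box_Int_box)
 have A: "sli A g = 0" if "A : sigma_sets UNIV ?G" for A
 using G that
 proof (induction rule: sigma_sets_induct_disjoint)
 case (basic A)
 thus ?case using box by auto
 next
 case (compl A)
 hence m: "A : sets borel" by (simp add: borel_eq_box)
 have "sli (A \<union> (UNIV - A)) g =
 sli A g + sli (UNIV - A) g"
 using m by (intro set_integral_Un si) auto
 thus ?case using compl all by simp
 next
 case (union F)
 hence m: "F i : sets borel" for i by (auto simp: borel_eq_box)
 have "sli (\<Union>i. F i) g = (\<Sum>i. sli (F i) g)"
 using union(1) m by (intro lebesgue_integral_countable_add si) (auto simp: disjoint_family_on_def)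
 thus ?case using union by simp
 qed (simp add: set_int_def)
 have A: "sli A g = 0" if "A : sets borel" for A
 using A that by (simp add: borel_eq_box)
 have P: "AE x in lborel. indicator {x. g x > 0} x *R g x = 0"
 using A[of "{x. g x > 0}"] si[of "{x. g x > 0}"]
 unfolding set_int_def set_integrable_def
 by (subst integral_nonneg_eq_0_iff_AE[symmetric]) (auto simp: indicator_def)
 have N: "AE x in lborel. indicator {x. g x < 0} x *R (- g x) = 0"
 using A[of "{x. g x < 0}"] si[of "{x. g x < 0}"]
 unfolding set_int_def set_integrable_def
 by (subst integral_nonneg_eq_0_iff_AE[symmetric]) (auto simp: indicator_def)
 show ?thesis using P N by eventually_elim (auto simp: indicator_def split: if_splits)
qed

lemma fundamental_lemma_box:
 fixes g :: "'a::euclidean_space => real"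
 assumes g: "loc_integrable S g"
 and z: "!!ph. test_fun S ph ==> sli S (%z. ph z *R g z) = 0"
 and ab: "cbox a b <= S"
 shows "sli (box a b) g = 0"
proof -
 \<comment> \<open>Two steps per coordinate: the product is positive exactly on
   \<open>box a b\<close>, tends to its indicator, and vanishes outside the compact set
   \<open>cbox a b\<close>, which lies in \<open>S\<close>.\<close>
 define ph where "ph n z = (\<Prod>i\<in>Basis. smstep (real (Suc n) * (z \<bullet> i - a \<bullet> i)) *
 smstep (real (Suc n) * (b \<bullet> i - z \<bullet> i)))" for n z
 have sm: "smooth (ph n)" for n
 proof -
 have *: "smooth (%z::'a. smstep (c * (z \<bullet> i) + d))" for i :: 'a and c d
 by (intro smooth_affine[OF _ smooth_smstep] bounded_linear_const_mult bounded_linear_inner_left)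
 have "smooth (%z::'a. smstep (real (Suc n) * (z \<bullet> i - a \<bullet> i)))" for i
 using *[of "real (Suc n)" i "- real (Suc n) * (a \<bullet> i)"] by (simp add: right_diff_distrib del: of_nat_Suc)
 moreover have "smooth (%z::'a. smstep (real (Suc n) * (b \<bullet> i - z \<bullet> i)))" for i
 using *[of "- real (Suc n)" i "real (Suc n) * (b \<bullet> i)"]
 by (simp add: right_diff_distrib del: of_nat_Suc)
 ultimately show ?thesis
 unfolding ph_def smooth_def by (intro allI Ck_prod Ck_mult) (simp_all del: of_nat_Suc)
 qed
 have out: "ph n z = 0" if "z ~: box a b" for n z
 proof -
 from that obtain i where "i : Basis" "z \<bullet> i - a \<bullet> i <= 0 \<or> b \<bullet> i - z \<bullet> i <= 0"
 by (auto simp: mem_box not_less)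
 hence "smstep (real (Suc n) * (z \<bullet> i - a \<bullet> i)) * smstep (real (Suc n) * (b \<bullet> i - z \<bullet> i)) = 0"
 by (auto simp: smstep_eq_0 mult_nonneg_nonpos simp del: of_nat_Suc)
 thus ?thesis
 unfolding ph_def using \<open>i : Basis\<close> by (intro prod_zero) auto
 qed
 have test: "test_fun S (ph n)" for n
 proof -
 have "ph n z = 0" if "z ~: cbox a b" for z
 using out that box_subset_cbox[of a b] by (meson subsetD)
 thus ?thesis unfolding test_fun_def using sm ab compact_cbox[of a b] by meson
 qed
 have lim: "(%n. ph n z) ----> indicator (box a b) z" for z
 proof -
 have "(%n. ph n z) ----> (\<Prod>i\<in>Basis. (if z \<bullet> i - a \<bullet> i > 0 then 1 else 0) * (if b \<bullet> i - z \<bullet> i > 0 then 1 else 0))"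
 unfolding ph_def by (intro tendsto_prod tendsto_mult smstep_scaled_tendsto)
 also have "(\<Prod>i\<in>Basis. (if z \<bullet> i - a \<bullet> i > 0 then 1 else 0) * (if b \<bullet> i - z \<bullet> i > 0 then 1 else 0)) =
 (indicator (box a b) z :: real)"
 by (cases "z : box a b") (auto simp: mem_box indicator_def intro!: prod_zero)
 finally show ?thesis .
 qed
 have ph1: "abs (ph n z) <= 1" for n z
 unfolding ph_def abs_prod
 by (intro prod_le_1 conjI abs_ge_zero)
 (simp only: abs_mult abs_of_nonneg smstep_nonneg, intro mult_le_one smstep_nonneg smstep_le_1)
 have si: "sint (cbox a b) g"
 using g ab by (auto simp: loc_integrable_def)
 have "(%n. LINT z|lborel. ph n z *R (indicator (cbox a b) z *R g z)) \<longlonglongrightarrow>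
 (LINT z|lborel. indicator (box a b) z *R (indicator (cbox a b) z *R g z))"
 proof (rule integral_dominated_convergence[where w="%z. norm (indicator (cbox a b) z *R g z)"])
 have [measurable]: "ph n : msb borel" for n
 using sm smooth_cont borel_cont by blast
 have [measurable]: "(%z. indicator (cbox a b) z *R g z) : msb borel"
 using si by (auto simp: set_integrable_def)
 show "(%z. ph n z *R (indicator (cbox a b) z *R g z)) : msb lborel" for n
 by measurable
 show "(%z. indicator (box a b) z *R (indicator (cbox a b) z *R g z)) : msb lborel"
 by measurable
 show "integrable lborel (%z. norm (indicator (cbox a b) z *R g z))"
 using si by (auto simp: set_integrable_def)
 show "AE z in lborel. (%n. ph n z *R (indicator (cbox a b) z *R g z)) \<longlonglongrightarrow>
 indicator (box a b) z *R (indicator (cbox a b) z *R g z)"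
 by (intro AE_I2 tendsto_intros lim)
 show "AE z in lborel. norm (ph n z *R (indicator (cbox a b) z *R g z))
 <= norm (indicator (cbox a b) z *R g z)" for n
 by (intro AE_I2) (simp only: norm_scaleR[of "ph _ _"], intro mult_left_le_one_le norm_ge_zero abs_ge_zero ph1)
 qed
 moreover have "(LINT z|lborel. ph n z *R (indicator (cbox a b) z *R g z)) = 0" for n
 proof -
 have "(LINT z|lborel. ph n z *R (indicator (cbox a b) z *R g z)) =
 sli S (%z. ph n z *R g z)"
 unfolding set_int_def
 proof (intro Bochner_Integration.integral_cong refl)
 fix z
 have "z : cbox a b & z : S \<or> ph n z = 0"
 using out ab box_subset_cbox[of a b] by (meson subsetD)
 thus "ph n z *R (indicator (cbox a b) z *R g z) = indicator S z *R ph n z *R g z"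
 by (elim disjE) simp_all
 qed
 thus ?thesis using z[OF test] by simp
 qed
 moreover have "(LINT z|lborel. indicator (box a b) z *R (indicator (cbox a b) z *R g z)) =
 sli (box a b) g"
 unfolding set_int_def using box_subset_cbox[of a b]
 by (intro Bochner_Integration.integral_cong) (auto simp: indicator_def)
 ultimately show ?thesis by (simp add: LIMSEQ_const_iff)
qed

lemma AE_cbox_box: "AE z in lborel. z : cbox a b --> z : box a (b::'a::euclidean_space)"
proof (rule AE_I')
 have "cbox a b - box a b : null_sets lebesgue"
 using negligible_frontier_interval[of a b] by (simp add: negligible_iff_null_sets)
 thus "cbox a b - box a b : null_sets lborel"
 by (subst (asm) null_sets_completion_iff) auto
qed auto

text \<open>An open set is a countable union of closed boxes. On each of them the vanishing box
  integrals force the function to vanish almost everywhere, and countably many null sets add up to a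
  null set.\<close>

lemma fundamental_lemma_real:
 fixes g :: "'a::euclidean_space => real"
 assumes S: "open S" and g: "loc_integrable S g"
 and z: "!!ph. test_fun S ph ==> sli S (%z. ph z *R g z) = 0"
 shows "AE z in lborel. z : S --> g z = 0"
proof -
 obtain DD where D: "countable DD" "DD <= Pow S" "!!X. X : DD ==> EX a b. X = cbox a b" "\<Union>DD = S"
 using open_countable_Union_open_cbox[OF S] by metis
 have "AE z in lborel. z : X --> g z = 0" if X: "X : DD" for X
 proof -
 obtain k l where kl: "X = cbox k l" using D X by blast
 hence S': "cbox k l <= S" using D X by auto
 have "AE z in lborel. indicator (cbox k l) z *R g z = 0"
 proof (rule AE_zero_if_box_integrals_zero)
 show "integrable lborel (%z. indicator (cbox k l) z *R g z)"
 using g S' by (auto simp: loc_integrable_def set_integrable_def)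
 hence [measurable]: "(%z. indicator (cbox k l) z *R g z) : msb borel"
 by auto
 fix a b
 obtain a' b' where ab: "box a b \<inter> box k l = box a' b'" using box_Int_box by (rule that)
 have "sli (box a b) (%z. indicator (cbox k l) z *R g z) =
 sli (box a' b') (%z. indicator (cbox k l) z *R g z)"
 unfolding set_int_def ab[symmetric]
 proof (intro integral_cong_AE eventually_mono[OF AE_cbox_box[of k l]])
 show "(%x. indicator (box a b) x *R indicator (cbox k l) x *R g x) : msb lborel"
 "(%x. indicator (box a b \<inter> box k l) x *R indicator (cbox k l) x *R g x) : msb lborel"
 by measurable
 qed (auto simp: indicator_def)
 also have "... = sli (box a' b') g"
 unfolding set_int_def ab[symmetric] using box_subset_cbox[of k l]
 by (intro Bochner_Integration.integral_cong) (auto simp: indicator_def)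
 also have "... = 0"
 proof (cases "box a' b' = {}")
 case False
 hence "cbox a' b' = closure (box a' b')" by simp
 also have "... <= cbox k l"
 unfolding ab[symmetric] using box_subset_cbox[of k l] by (intro closure_minimal) auto
 finally show ?thesis using fundamental_lemma_box[OF g z] S' by blast
 qed (simp add: set_int_def)
 finally show "sli (box a b) (%z. indicator (cbox k l) z *R g z) = 0" .
 qed
 thus ?thesis by eventually_elim (auto simp: kl indicator_def split: if_splits)
 qed
 hence "AE z in lborel. ALL X:DD. z : X --> g z = 0"
 by (subst AE_ball_countable[OF D(1)]) blast
 thus ?thesis using D(4) by (elim eventually_mono) blast
qed

lemma fundamental_lemma:
 fixes g :: "'a::euclidean_space => 'b::euclidean_space"
 assumes S: "open S" and g: "loc_integrable S g"
 and z: "!!ph. test_fun S ph ==> sli S (%z. ph z *R g z) = 0"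
 shows "AE z in lborel. z : S --> g z = 0"
proof -
 have "AE z in lborel. z : S --> g z \<bullet> i = 0" if i: "i : Basis" for i
 proof (rule fundamental_lemma_real[OF S])
 have gi: "sint K g" if "compact K" "K <= S" for K
 using g that by (auto simp: loc_integrable_def)
 show "loc_integrable S (%z. g z \<bullet> i)"
 unfolding loc_integrable_def
 proof safe
 fix K assume "compact K" "K <= S"
 from gi[OF this] show "sint K (%z. g z \<bullet> i)"
 unfolding set_integrable_def using integrable_inner_left[of i lborel "%x. indicator K x *R g x"] by simp
 qed
 fix ph assume t: "test_fun S ph"
 then obtain K where K: "compact K" "K <= S" "!!z. z ~: K ==> ph z = 0"
 by (auto simp: test_fun_def)
 have sm: "smooth ph" using t by (simp add: test_fun_def)
 obtain B where B: "!!z. z : K ==> norm (ph z) <= B"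
 using compact_imp_bounded[OF compact_continuous_image[OF smooth_cont[OF sm] K(1)]]
 by (auto simp: bounded_iff)
 have "integrable lborel (%z. ph z *R (indicator K z *R g z))"
 proof (rule Bochner_Integration.integrable_bound)
 show "integrable lborel (%z. B *R (indicator K z *R g z))"
 using gi[OF K(1,2)] unfolding set_integrable_def by (intro integrable_scaleR_right)
 have [measurable]: "ph : msb borel"
 using sm smooth_cont borel_cont by blast
 have [measurable]: "(%z. indicator K z *R g z) : msb borel"
 using gi[OF K(1,2)] by (auto simp: set_integrable_def)
 show "(%z. ph z *R (indicator K z *R g z)) : msb lborel" by measurable
 show "AE z in lborel. norm (ph z *R (indicator K z *R g z)) <= norm (B *R (indicator K z *R g z))"
 using B by (intro AE_I2) (auto simp: indicator_def intro!: mult_right_mono order_trans[OF _ abs_ge_self])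
 qed
 moreover have eq: "ph z *R (indicator K z *R g z) = indicator S z *R ph z *R g z" for z
 using K by (auto simp: indicator_def)
 ultimately have "integrable lborel (%z. indicator S z *R ph z *R g z)"
 by (simp only: eq)
 from integral_inner_left[OF this, of i]
 have "sli S (%z. ph z *R (g z \<bullet> i)) = sli S (%z. ph z *R g z) \<bullet> i"
 by (simp add: set_int_def mult.assoc)
 thus "sli S (%z. ph z *R (g z \<bullet> i)) = 0" using z[OF t] by simp
 qed
 hence "AE z in lborel. ALL i:Basis. z : S --> g z \<bullet> i = 0"
 by (intro AE_finite_allI) auto
 thus ?thesis by eventually_elim (auto intro: euclidean_eqI)
qed

section \<open>Integrals of derivatives of compactly supported functions\<close>

lemma integral_translate:
 fixes f :: "'a::euclidean_space => 'b::{banach, second_countable_topology}"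
 assumes "f : msb borel"
 shows "(LINT z|lborel. f (c + z)) = (LINT z|lborel. f z)"
proof -
 have "(LINT z|lborel. f (c + z)) = (LINT z|distr lborel borel ((+) c). f z)"
 using assms by (subst integral_distr) auto
 thus ?thesis by (simp add: lborel_distr_plus)
qed

lemma integrable_translate:
 fixes f :: "'a::euclidean_space => 'b::{banach, second_countable_topology}"
 assumes "integrable lborel f"
 shows "integrable lborel (%z. f (c + z))"
proof -
 have "integrable (distr lborel borel ((+) c)) f" using assms by (simp add: lborel_distr_plus)
 thus ?thesis using assms by (subst (asm) integrable_distr_eq) auto
qed

text \<open>The difference quotients of \<open>f\<close> along \<open>e\<close> have integral 0 by
  translation invariance of Lebesgue measure; they converge to \<open>pd e f\<close>, uniformly
  bounded and with supports in one ball.\<close>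

lemma integral_pd_compact_support:
 fixes f :: "'a::euclidean_space => 'b::{banach, second_countable_topology}"
 assumes f: "Ck 1 f" and e: "e : Basis" and K: "compact K" "!!z. z ~: K ==> f z = 0"
 shows "(LINT z|lborel. pd e f z) = 0"
proof -
 have d: "f differentiable (at z)" for z using f by simp
 have c: "cts UNIV (pd e f)" using f e by simp
 have cf: "cts UNIV f" using f Ck_imp_continuous by blast
 have [measurable]: "f : msb borel" "pd e f : msb borel"
 using c cf by (auto intro: borel_cont)
 obtain R where R: "!!z. z : K ==> norm z <= R" using compact_imp_bounded[OF K(1)] by (auto simp: bounded_iff)
 obtain B where B: "!!z. norm z <= R + 2 ==> norm (pd e f z) <= B"
 proof -
 have "compact (pd e f ` cball 0 (R + 2))"
 by (intro compact_continuous_image cont_sub[OF c]) auto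
 from compact_imp_bounded[OF this] obtain B where "ALL x:cball 0 (R + 2). norm (pd e f x) <= B"
 by (auto simp: bounded_iff)
 thus ?thesis using that[of B] by simp
 qed
 define q where "q n z = real (Suc n) *R (f ((1 / real (Suc n)) *R e + z) - f z)" for n z
 have vd: "((%s. f (s *R e + z)) hvd pd e f (s *R e + z)) (at s)" for s z
 proof -
 have "((%s. s *R e + z) has_derivative (%h. h *R e)) (at s)"
 by (auto intro!: deqs)
 from has_derivative_compose[OF this pd_has_derivative[OF d]]
 have "((%s. f (s *R e + z)) has_derivative (%h. pd (h *R e) f (s *R e + z))) (at s)" .
 moreover have "pd (h *R e) f (s *R e + z) = h *R pd e f (s *R e + z)" for h
 using linear_scale[OF has_derivative_linear[OF pd_has_derivative[OF d]]] by blast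
 ultimately show ?thesis by (simp add: has_vector_derivative_def)
 qed
 have ne: "norm e = 1" using e by simp
 have fint: "integrable lborel f"
 proof -
 have "integrable lborel (%z. indicator K z *R f z)"
 using borel_integrable_compact[OF K(1) cont_sub[OF cf]] by (simp add: set_integrable_def)
 moreover have "indicator K z *R f z = f z" for z using K(2) by (auto simp: indicator_def)
 ultimately show ?thesis by simp
 qed
 have q0: "(LINT z|lborel. q n z) = 0" for n
 proof -
 have "(LINT z|lborel. f ((1 / real (Suc n)) *R e + z) - f z) =
 (LINT z|lborel. f ((1 / real (Suc n)) *R e + z)) - (LINT z|lborel. f z)"
 by (intro Bochner_Integration.integral_diff integrable_translate fint)
 also have "... = 0" by (subst integral_translate) auto
 finally show ?thesis unfolding q_def by (subst integral_scaleR_right) simp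
 qed
 have "(%n. LINT z|lborel. q n z) ----> (LINT z|lborel. pd e f z)"
 \<comment> \<open>The shift has length at most 1, so the quotients vanish outside the ball of
   radius \<open>R + 1\<close>; the segments in the mean value estimate stay within radius
   \<open>R + 2\<close>, where \<open>B\<close> bounds the derivative.\<close>
 proof (rule integral_dominated_convergence[where w="%z. indicator (cball 0 (R+1)) z * B"])
 show "q n : msb lborel" for n unfolding q_def by measurable
 show "pd e f : msb lborel" by simp
 show "integrable lborel (%z. indicator (cball 0 (R + 1)) z * B)"
 using borel_integrable_compact[of "cball 0 (R+1)" "%_. B"] by (simp add: set_integrable_def)
 show "AE z in lborel. (%n. q n z) ----> pd e f z"
 proof (rule AE_I2)
 fix z
 have "((%s. f (s *R e + z)) hvd pd e f z) (at 0)"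
 using vd[of z 0] by simp
 hence lim: "((%h. norm (f (h *R e + z) - f z - h *R pd e f z) / norm h) ---> 0) (at 0)"
 by (simp add: has_vector_derivative_def has_derivative_at)
 have eq: "norm (f (h *R e + z) - f z - h *R pd e f z) / norm h =
 norm ((f (h *R e + z) - f z) /\<^sub>R h - pd e f z)" if "h ~= 0" for h
 proof -
 have "(f (h *R e + z) - f z) /\<^sub>R h - pd e f z = (f (h *R e + z) - f z - h *R pd e f z) /\<^sub>R h"
 using that by (simp add: scaleR_diff_right)
 thus ?thesis by (simp add: divide_inverse_commute)
 qed
 have "((%h. norm ((f (h *R e + z) - f z) /\<^sub>R h - pd e f z)) ---> 0) (at 0)"
 by (rule Lim_transform_eventually[OF lim]) (unfold eventually_at_filter, intro always_eventually allI impI eq)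
 hence "((%h. (f (h *R e + z) - f z) /\<^sub>R h) ---> pd e f z) (at 0)"
 by (metis Lim_null tendsto_norm_zero_iff)
 hence "(%n. (f ((1 / real (Suc n)) *R e + z) - f z) /\<^sub>R (1 / real (Suc n))) ----> pd e f z"
 by (rule filterlim_compose)
 (use LIMSEQ_inverse_real_of_nat in \<open>auto simp: filterlim_at inverse_eq_divide\<close>)
 thus "(%n. q n z) ----> pd e f z" by (simp add: q_def)
 qed
 show "AE z in lborel. norm (q n z) <= indicator (cball 0 (R + 1)) z * B" for n
 proof (rule AE_I2)
 fix z
 have n1: "1 / real (Suc n) <= 1" by simp
 show "norm (q n z) <= indicator (cball 0 (R + 1)) z * B"
 proof (cases "norm z <= R + 1")
 case True
 have "norm (f ((1 / real (Suc n)) *R e + z) - f (0 *R e + z)) <= B * norm (1 / real (Suc n) - 0)"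
 proof (rule differentiable_bound[where S="{0..1/real (Suc n)}" and f'="%s h. h *R pd e f (s *R e + z)"])
 fix s assume s: "s : {0..1/real (Suc n)}"
 show "((%s. f (s *R e + z)) has_derivative (%h. h *R pd e f (s *R e + z))) (at s within {0..1/real (Suc n)})"
 using vd[of z s] unfolding has_vector_derivative_def by (rule has_derivative_at_withinI)
 have "norm (s *R e) <= 1" using order_trans[OF _ n1, of s] s ne by (simp del: of_nat_Suc)
 hence "norm (s *R e + z) <= R + 2" using True norm_triangle_ineq[of "s *R e" z] by linarith
 from B[OF this] show "onorm (%h. h *R pd e f (s *R e + z)) <= B"
 by (intro onorm_le) (simp add: mult_left_mono mult.commute[of B])
 qed auto
 hence "norm (f ((1 / real (Suc n)) *R e + z) - f z) * real (Suc n) <= B"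
 by (simp add: pos_le_divide_eq[symmetric] del: of_nat_Suc)
 thus ?thesis using True by (simp add: q_def mult.commute del: of_nat_Suc)
 next
 case False
 have "norm ((1 / real (Suc n)) *R e) <= 1" using ne n1 by simp
 hence "norm ((1 / real (Suc n)) *R e + z) > R"
 using False norm_triangle_ineq4[of "(1 / real (Suc n)) *R e + z" "(1 / real (Suc n)) *R e"]
 unfolding add_diff_cancel_left' by linarith
 hence "f ((1 / real (Suc n)) *R e + z) = 0" using K(2) R not_less by blast
 moreover have "f z = 0" using False K(2) R by fastforce
 ultimately show ?thesis using False by (simp add: q_def)
 qed
 qed
 qed
 thus ?thesis by (simp add: q0 LIMSEQ_const_iff)
qed

section \<open>Weak derivatives\<close>

lemma integrable_compact_support_scaleR:
 fixes g :: "'a::euclidean_space => 'b::{banach, second_countable_topology}"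
 assumes ph: "cts UNIV ph" and K: "compact K" "K <= S" "!!z. z ~: K ==> ph z = 0"
 and g: "loc_integrable S g"
 shows "sint S (%z. ph z *R g z)"
proof -
 have gi: "sint K g" using g K by (auto simp: loc_integrable_def)
 obtain B where B: "!!z. z : K ==> norm (ph z) <= B"
 using compact_imp_bounded[OF compact_continuous_image[OF cont_sub[OF ph] K(1)]]
 by (auto simp: bounded_iff)
 have "integrable lborel (%z. ph z *R (indicator K z *R g z))"
 proof (rule Bochner_Integration.integrable_bound)
 show "integrable lborel (%z. B *R (indicator K z *R g z))"
 using gi unfolding set_integrable_def by (intro integrable_scaleR_right)
 have [measurable]: "ph : msb borel"
 using ph borel_cont by blast
 have [measurable]: "(%z. indicator K z *R g z) : msb borel"
 using gi by (auto simp: set_integrable_def)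
 show "(%z. ph z *R (indicator K z *R g z)) : msb lborel" by measurable
 show "AE z in lborel. norm (ph z *R (indicator K z *R g z)) <= norm (B *R (indicator K z *R g z))"
 using B by (intro AE_I2) (auto simp: indicator_def intro!: mult_right_mono order_trans[OF _ abs_ge_self])
 qed
 moreover have "ph z *R (indicator K z *R g z) = indicator S z *R ph z *R g z" for z
 using K by (auto simp: indicator_def)
 ultimately show ?thesis by (simp only: set_integrable_def)
qed

lemma pd_zero_outside:
 assumes "closed K" "!!z. z ~: K ==> f z = 0" "z ~: K"
 shows "pd e f z = 0"
proof -
 have "((%_. 0) has_derivative (%_. 0)) (at z)" by simp
 hence "(f has_derivative (%_. 0)) (at z)"
 by (rule has_derivative_transform_within_open[where s="- K"]) (use assms in auto)
 thus ?thesis by (rule pd_eq)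
qed

lemma test_fun_pd:
 assumes "test_fun S ph" "e : Basis"
 shows "test_fun S (pd e ph)"
proof -
 obtain K where K: "compact K" "K <= S" "!!z. z ~: K ==> ph z = 0"
 using assms by (auto simp: test_fun_def)
 have "pd e ph z = 0" if "z ~: K" for z
 using pd_zero_outside[OF compact_imp_closed[OF K(1)] K(3) that] .
 thus ?thesis using assms K(1,2) by (auto simp: test_fun_def smooth_pd)
qed

lemma test_fun_integrable:
 fixes g :: "'a::euclidean_space => 'b::{banach, second_countable_topology}"
 assumes "test_fun S ph" "loc_integrable S g"
 shows "sint S (%z. ph z *R g z)"
proof -
 obtain K where K: "compact K" "K <= S" "!!z. z ~: K ==> ph z = 0"
 using assms by (auto simp: test_fun_def)
 thus ?thesis
 using assms by (intro integrable_compact_support_scaleR[of ph K]) (auto simp: test_fun_def smooth_cont)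
qed

lemma loc_integrable_continuous:
 fixes w :: "'a::euclidean_space => 'b::{banach, second_countable_topology}"
 shows "cts UNIV w ==> loc_integrable S w"
 unfolding loc_integrable_def set_integrable_def
 by (auto intro: borel_integrable_compact cont_sub)

lemma loc_integrable_diff:
 "loc_integrable S u ==> loc_integrable S v ==> loc_integrable S (%z. u z - v z)"
 by (auto simp: loc_integrable_def)

lemma loc_integrable_cmult:
 fixes u :: "'a::euclidean_space => complex"
 shows "loc_integrable S u ==> loc_integrable S (%z. c * u z)"
 by (auto simp: loc_integrable_def)

lemma integral_by_parts_test:
 fixes w :: "'a::euclidean_space => 'b::{banach, second_countable_topology}"
 assumes ph: "test_fun S ph" and w: "Ck 1 w" and e: "e : Basis"
 shows "sli S (%z. pd e ph z *R w z) =
 - sli S (%z. ph z *R pd e w z)"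
proof -
 obtain K where K: "compact K" "K <= S" "!!z. z ~: K ==> ph z = 0"
 using ph by (auto simp: test_fun_def)
 have sm: "Ck 1 ph" using ph by (auto simp: test_fun_def smooth_def)
 have d: "((%z. ph z *R w z) has_derivative (%e. ph z *R pd e w z + pd e ph z *R w z)) (at z)" for z
 using sm w by (intro derivative_intros pd_has_derivative) auto
 have pd: "pd e (%z. ph z *R w z) z = ph z *R pd e w z + pd e ph z *R w z" for z
 by (rule pd_eq[OF d])
 have "(LINT z|lborel. pd e (%z. ph z *R w z) z) = 0"
 using K by (intro integral_pd_compact_support[of _ _ K] Ck_scaleR sm w e) auto
 moreover have "pd e (%z. ph z *R w z) z = indicator S z *R ph z *R pd e w z + indicator S z *R pd e ph z *R w z" for z
 proof (cases "z : S")
 case False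
 hence "z ~: K" using K by auto
 thus ?thesis unfolding pd using pd_zero_outside[OF compact_imp_closed[OF K(1)] K(3)] K(3) False by simp
 qed (simp add: pd)
 moreover have "cts UNIV w" "cts UNIV (pd e w)"
 using w e Ck_imp_continuous by (blast, simp)
 hence "sint S (%z. ph z *R pd e w z)" "sint S (%z. pd e ph z *R w z)"
 using ph test_fun_pd[OF ph e] by (auto intro: test_fun_integrable loc_integrable_continuous)
 ultimately have "sli S (%z. ph z *R pd e w z) +
 sli S (%z. pd e ph z *R w z) = 0"
 by (simp add: set_int_def set_integrable_def)
 thus ?thesis by (simp add: eq_neg_iff_add_eq_0 add.commute)
qed

lemma weak_deriv_Ck1:
 fixes w :: "'a::euclidean_space => 'b::{banach, second_countable_topology}"
 assumes w: "Ck 1 w" and e: "e : Basis"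
 shows "weak_deriv S e w (pd e w)"
proof -
 have "cts UNIV w" "cts UNIV (pd e w)"
 using w e Ck_imp_continuous by (blast, simp)
 thus ?thesis
 using assms by (auto simp: weak_deriv_def loc_integrable_continuous integral_by_parts_test)
qed

lemma weak_deriv_diff:
 assumes "weak_deriv S e u g" "weak_deriv S e v h" "e : Basis"
 shows "weak_deriv S e (%z. u z - v z) (%z. g z - h z)"
 unfolding weak_deriv_def
proof (intro conjI allI impI)
 fix ph assume t: "test_fun S ph"
 have "sli S (%z. pd e ph z *R (u z - v z)) =
 sli S (%z. pd e ph z *R u z) - sli S (%z. pd e ph z *R v z)"
 using assms t test_fun_pd[OF t]
 by (subst set_integral_diff(2)[symmetric])
 (auto simp: weak_deriv_def scaleR_diff_right intro!: test_fun_integrable)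
 also have "... = - (sli S (%z. ph z *R g z) - sli S (%z. ph z *R h z))"
 using assms t by (simp add: weak_deriv_def)
 also have "sli S (%z. ph z *R g z) - sli S (%z. ph z *R h z) =
 sli S (%z. ph z *R (g z - h z))"
 using assms t
 by (subst set_integral_diff(2)[symmetric])
 (auto simp: weak_deriv_def scaleR_diff_right intro!: test_fun_integrable)
 finally show "sli S (%z. pd e ph z *R (u z - v z)) =
 - sli S (%z. ph z *R (g z - h z))" .
qed (use assms in \<open>auto simp: weak_deriv_def loc_integrable_diff\<close>)

lemma weak_deriv_cmult:
 fixes u g :: "'a::euclidean_space => complex"
 assumes "weak_deriv S e u g"
 shows "weak_deriv S e (%z. c * u z) (%z. c * g z)"
 using assms unfolding weak_deriv_def by (auto simp: loc_integrable_cmult simp flip: mult_scaleR_right)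

lemma weak_lapl_diff:
 assumes "weak_lapl S u g" "weak_lapl S v h"
 shows "weak_lapl S (%z. u z - v z) (%z. g z - h z)"
 unfolding weak_lapl_def
proof (intro conjI allI impI)
 fix ph assume t: "test_fun S ph"
 let ?L = "%z. \<Sum>e\<in>Basis. pd e (pd e ph) z"
 have i: "sint S (%z. ?L z *R u z)" if "loc_integrable S u" for u :: "'a => complex"
 proof -
 have "sint S (%z. pd e (pd e ph) z *R u z)" if "e : Basis" for e
 using that t \<open>loc_integrable S u\<close> by (intro test_fun_integrable test_fun_pd)
 thus ?thesis
 unfolding set_integrable_def scaleR_sum_left scaleR_sum_right by (intro Bochner_Integration.integrable_sum)
 qed
 have "sli S (%z. ?L z *R (u z - v z)) =
 sli S (%z. ?L z *R u z) - sli S (%z. ?L z *R v z)"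
 using assms i
 by (subst set_integral_diff(2)[symmetric]) (auto simp: weak_lapl_def scaleR_diff_right)
 also have "... = sli S (%z. ph z *R g z) - sli S (%z. ph z *R h z)"
 using assms t by (simp add: weak_lapl_def)
 also have "sli S (%z. ph z *R g z) - sli S (%z. ph z *R h z) =
 sli S (%z. ph z *R (g z - h z))"
 using assms t
 by (subst set_integral_diff(2)[symmetric])
 (auto simp: weak_lapl_def scaleR_diff_right intro!: test_fun_integrable)
 finally show "sli S (%z. ?L z *R (u z - v z)) =
 sli S (%z. ph z *R (g z - h z))" .
qed (use assms in \<open>auto simp: weak_lapl_def loc_integrable_diff\<close>)

lemma AE_eq_if_test_integrals_eq:
 fixes g h :: "'a::euclidean_space => 'b::euclidean_space"
 assumes S: "open S" and g: "loc_integrable S g" and h: "loc_integrable S h"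
 and eq: "!!ph. test_fun S ph ==> sli S (%z. ph z *R g z) =
 sli S (%z. ph z *R h z)"
 shows "AE z in lborel. z : S --> g z = h z"
proof -
 have "AE z in lborel. z : S --> g z - h z = 0"
 proof (rule fundamental_lemma[OF S loc_integrable_diff[OF g h]])
 fix ph assume t: "test_fun S ph"
 show "sli S (%z. ph z *R (g z - h z)) = 0"
 using eq[OF t] t g h
 by (simp add: scaleR_diff_right test_fun_integrable set_integral_diff)
 qed
 thus ?thesis by simp
qed

text \<open>\<open>SOME\<close> returns a weak derivative as soon as one exists; the fundamental
  lemma makes the choice immaterial up to a null set.\<close>

lemma wderiv_AE_eq:
 fixes u g :: "'a::euclidean_space => 'b::euclidean_space"
 assumes S: "open S" and g: "weak_deriv S e u g"
 shows "weak_deriv S e u (wderiv S e u)" "AE z in lborel. z : S --> wderiv S e u z = g z"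
proof -
 show w: "weak_deriv S e u (wderiv S e u)" unfolding wderiv_def using g by (rule someI[of "weak_deriv S e u"])
 show "AE z in lborel. z : S --> wderiv S e u z = g z"
 using g w by (intro AE_eq_if_test_integrals_eq[OF S]) (auto simp: weak_deriv_def)
qed

lemma lapl_AE_eq:
 assumes S: "open S" and g: "weak_lapl S u g"
 shows "weak_lapl S u (lapl S u)" "AE z in lborel. z : S --> lapl S u z = g z"
proof -
 show w: "weak_lapl S u (lapl S u)" unfolding lapl_def using g by (rule someI[of "weak_lapl S u"])
 show "AE z in lborel. z : S --> lapl S u z = g z"
 using g w by (intro AE_eq_if_test_integrals_eq[OF S]) (auto simp: weak_lapl_def)
qed

text \<open>A function obtained by choice as a weak derivative is a priori measurable only on
  compact subsets of \<open>S\<close>. Exhausting \<open>S\<close> by compact sets gives the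
  measurability on \<open>S\<close> that the L2 space requires.\<close>

lemma set_borel_measurable_loc_integrable:
 fixes g :: "'a::euclidean_space => 'b::{banach, second_countable_topology}"
 assumes S: "open S" and g: "loc_integrable S g"
 shows "set_borel_measurable lborel S g"
proof -
 obtain K :: "nat => 'a set" where K: "!!n. compact (K n)" "!!n. K n <= S" "!!n. K n <= K (Suc n)" "(\<Union>n. K n) = S"
 using open_Union_compact_subsets[OF S] interior_subset by (metis (no_types) subset_trans)
 have "(%z. indicator S z *R g z) : msb lborel"
 proof (rule borel_measurable_LIMSEQ_metric)
 have "sint (K n) g" for n
 using g K(1,2) unfolding loc_integrable_def by blast
 thus "(%z. indicator (K n) z *R g z) : msb lborel" for n
 unfolding set_integrable_def by (rule borel_measurable_integrable)
 fix z
 show "(%n. indicator (K n) z *R g z) ----> indicator S z *R g z"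
 proof (cases "z : S")
 case True
 then obtain N where "z : K N" using K(4) by auto
 moreover have "K N <= K n" if "n >= N" for n using lift_Suc_mono_le[of K N n] K(3) that by auto
 ultimately have "\<forall>\<^sub>F n in sequentially. indicator (K n) z *R g z = indicator S z *R g z"
 using True by (intro eventually_sequentiallyI[of N]) (auto simp: indicator_def)
 thus ?thesis by (rule tendsto_eventually)
 next
 case False
 hence "z ~: K n" for n using K(2) by blast
 with False show ?thesis by simp
 qed
 qed
 thus ?thesis by (simp add: set_meas_def)
qed

section \<open>Square integrable functions\<close>

text \<open>Equality almost everywhere does not transfer measurability, since \<open>lborel\<close>
  is not complete; hence the separate hypothesis on \<open>v\<close>.\<close>

lemma L2_cong_AE:
 assumes u: "L2 S u" and v: "set_borel_measurable lborel S v"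
 and eq: "AE z in lborel. z : S --> v z = u z"
 shows "L2 S v" "l2norm S v = l2norm S u"
proof -
 have [measurable]: "(%z. indicator S z *R v z) : msb lborel"
 "(%z. indicator S z *R u z) : msb lborel"
 using u v by (auto simp: set_meas_def L2_def)
 have n: "indicator S z *R (norm (f z))^2 = (norm (indicator S z *R f z))^2" for f :: "'a => complex" and z
 by (auto simp: indicator_def)
 have ae: "AE z in lborel. (norm (indicator S z *R u z))^2 = (norm (indicator S z *R v z))^2"
 using eq by eventually_elim (auto simp: indicator_def)
 have "integrable lborel (%z. indicator S z *R (norm (u z))^2)"
 using u by (simp add: L2_def set_integrable_def)
 hence "integrable lborel (%z. (norm (indicator S z *R u z))^2)"
 unfolding n .
 hence "integrable lborel (%z. (norm (indicator S z *R v z))^2)"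
 proof (rule integrable_cong_AE_imp)
 show "(%z. (norm (indicator S z *R v z))^2) : msb lborel" by measurable
 show "AE z in lborel. (norm (indicator S z *R u z))^2 = (norm (indicator S z *R v z))^2"
 by (rule ae)
 qed
 hence "integrable lborel (%z. indicator S z *R (norm (v z))^2)"
 unfolding n .
 thus "L2 S v" using v by (simp add: L2_def set_integrable_def)
 show "l2norm S v = l2norm S u"
 unfolding l2norm_def set_int_def n
 proof (intro arg_cong[of _ _ sqrt] integral_cong_AE)
 show "(%z. (norm (indicator S z *R v z))^2) : msb lborel"
 "(%z. (norm (indicator S z *R u z))^2) : msb lborel" by measurable
 show "AE z in lborel. (norm (indicator S z *R v z))^2 = (norm (indicator S z *R u z))^2"
 using ae by eventually_elim (rule sym)
 qed
qed

lemma l2norm_nonneg: "0 <= l2norm S u"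
 by (simp add: l2norm_def set_int_def)

lemma l2norm_sq: "(l2norm S u)^2 = sli S (%z. (norm (u z))^2)"
 by (simp add: l2norm_def set_int_def)

lemma L2_mult_integrable:
 assumes u: "L2 S u" and v: "L2 S v"
 shows "sint S (%z. u z * v z)"
proof -
 have [measurable]: "(%z. indicator S z *R v z) : msb lborel"
 "(%z. indicator S z *R u z) : msb lborel"
 using u v by (auto simp: set_meas_def L2_def)
 have "integrable lborel (%z. (indicator S z *R u z) * (indicator S z *R v z))"
 proof (rule Bochner_Integration.integrable_bound)
 show "integrable lborel (%z. indicator S z *R (norm (u z))^2 + indicator S z *R (norm (v z))^2)"
 using u v by (simp add: L2_def set_integrable_def)
 show "AE z in lborel. norm ((indicator S z *R u z) * (indicator S z *R v z))
 <= norm (indicator S z *R (norm (u z))^2 + indicator S z *R (norm (v z))^2)"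
 proof (rule AE_I2)
 fix z
 have "norm (u z) * norm (v z) <= (norm (u z))^2 + (norm (v z))^2"
 using sum_squares_bound[of "norm (u z)" "norm (v z)"]
 mult_nonneg_nonneg[OF norm_ge_zero[of "u z"] norm_ge_zero[of "v z"]] by linarith
 thus "norm ((indicator S z *R u z) * (indicator S z *R v z))
 <= norm (indicator S z *R (norm (u z))^2 + indicator S z *R (norm (v z))^2)"
 by (auto simp: indicator_def norm_mult)
 qed
 qed measurable
 moreover have "(indicator S z *R u z) * (indicator S z *R v z) = indicator S z *R (u z * v z)" for z
 by (cases "z : S") auto
 ultimately show ?thesis by (simp only: set_integrable_def)
qed

text \<open>The optimal \<open>t = b / a\<close> turns the right-hand side into
  \<open>2 * a * b\<close>. In this way Cauchy-Schwarz is reduced to the pointwise inequality of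
  arithmetic and geometric means.\<close>

lemma le_sqrt_mult_if_AMGM:
 fixes x a b :: real
 assumes a: "0 <= a" and b: "0 <= b" and h: "!!t. t > 0 ==> 2 * x <= t * a^2 + b^2 / t"
 shows "x <= a * b"
proof (rule field_le_epsilon)
 fix e :: real assume e: "e > 0"
 \<comment> \<open>Both numbers are shifted by \<open>d\<close>, so that
   \<open>t = (b + d) / (a + d)\<close> stays positive when \<open>a\<close> or \<open>b\<close>
   vanishes; \<open>d\<close> is so small that the shift costs at most \<open>e\<close>.\<close>
 define d where "d = min 1 (e / (a + b + 1))"
 have "d <= e / (a + b + 1)" by (simp add: d_def)
 hence "d * (a + b + 1) <= e" using a b by (subst (asm) pos_le_divide_eq) auto
 moreover have "d > 0" "d <= 1" using e a b by (auto simp: d_def)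
 ultimately have d: "d > 0" "d <= 1" "d * (a + b + 1) <= e" by auto
 have "2 * x <= ((b + d) / (a + d)) * a^2 + b^2 / ((b + d) / (a + d))"
 using a b d by (intro h) (auto intro!: divide_pos_pos add_nonneg_pos)
 also have "... = (b + d) * (a^2 / (a + d)) + (a + d) * (b^2 / (b + d))"
 by simp
 also have "... <= (b + d) * a + (a + d) * b"
 proof (intro add_mono mult_left_mono)
 show "a^2 / (a + d) <= a" "b^2 / (b + d) <= b"
 using a b d by (auto simp: divide_le_eq power2_eq_square algebra_simps add_nonneg_pos intro!: add_increasing2)
 qed (use a b d in auto)
 also have "... <= 2 * (a * b + d * (a + b + 1))" using a b d by (simp add: algebra_simps)
 finally show "x <= a * b + e" using d by simp
qed

lemma l2_Cauchy_Schwarz_norm: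
 assumes u: "L2 S u" and v: "L2 S v"
 shows "sli S (%z. norm (u z) * norm (v z)) <= l2norm S u * l2norm S v"
proof (rule le_sqrt_mult_if_AMGM[OF l2norm_nonneg l2norm_nonneg])
 fix t :: real assume t: "t > 0"
 have i: "sint S (%z. norm (u z) * norm (v z))"
 using set_integrable_norm[OF L2_mult_integrable[OF u v]] by (simp add: norm_mult)
 have iu: "sint S (%z. (norm (u z))^2)" "sint S (%z. (norm (v z))^2)"
 using u v by (auto simp: L2_def)
 have "sli S (%z. 2 * (norm (u z) * norm (v z))) \<le>
 sli S (%z. t * (norm (u z))^2 + (norm (v z))^2 / t)"
 proof (intro set_integral_mono)
 fix z
 have "0 <= (t * norm (u z) - norm (v z))^2 / t" using t by simp
 also have "... = t * (norm (u z))^2 + (norm (v z))^2 / t - 2 * (norm (u z) * norm (v z))"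
 using t by (simp add: power2_eq_square field_simps)
 finally show "2 * (norm (u z) * norm (v z)) <= t * (norm (u z))^2 + (norm (v z))^2 / t" by simp
 qed (use i iu in auto)
 thus "2 * sli S (%z. norm (u z) * norm (v z)) <= t * (l2norm S u)^2 + (l2norm S v)^2 / t"
 using i iu by (simp add: l2norm_sq)
qed

lemma l2_Cauchy_Schwarz:
 assumes u: "L2 S u" and v: "L2 S v"
 shows "norm (sli S (%z. u z * v z)) <= l2norm S u * l2norm S v"
proof -
 have "norm (sli S (%z. u z * v z)) \<le>
 sli S (%z. norm (u z * v z))"
 by (rule set_integral_norm_bound[OF L2_mult_integrable[OF u v]])
 also have "... <= l2norm S u * l2norm S v"
 using l2_Cauchy_Schwarz_norm[OF u v] by (simp add: norm_mult)
 finally show ?thesis .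
qed

lemma L2_add:
 assumes u: "L2 S u" and v: "L2 S v"
 shows "L2 S (%z. u z + v z)"
proof -
 have [measurable]: "(%z. indicator S z *R v z) : msb lborel"
 "(%z. indicator S z *R u z) : msb lborel"
 using u v by (auto simp: set_meas_def L2_def)
 have m: "(%z. indicator S z *R (u z + v z)) : msb lborel"
 unfolding scaleR_add_right by measurable
 have "integrable lborel (%z. indicator S z *R (norm (u z + v z))^2)"
 proof (rule Bochner_Integration.integrable_bound)
 show "integrable lborel (%z. 2 * (indicator S z *R (norm (u z))^2) + 2 * (indicator S z *R (norm (v z))^2))"
 using u v by (auto simp: L2_def set_integrable_def)
 have "(%z. (norm (indicator S z *R (u z + v z)))^2) : msb lborel" using m by measurable
 moreover have "(%z. (norm (indicator S z *R (u z + v z)))^2) = (%z. indicator S z *R (norm (u z + v z))^2)"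
 by (auto simp: indicator_def)
 ultimately show "(%z. indicator S z *R (norm (u z + v z))^2) : msb lborel" by simp
 show "AE z in lborel. norm (indicator S z *R (norm (u z + v z))^2) \<le>
 norm (2 * (indicator S z *R (norm (u z))^2) + 2 * (indicator S z *R (norm (v z))^2))"
 proof (rule AE_I2)
 fix z
 have "(norm (u z + v z))^2 <= (norm (u z) + norm (v z))^2"
 by (intro power_mono norm_triangle_ineq) simp
 also have "... <= 2 * (norm (u z))^2 + 2 * (norm (v z))^2"
 using sum_squares_bound[of "norm (u z)" "norm (v z)"] by (simp add: power2_sum)
 finally show "norm (indicator S z *R (norm (u z + v z))^2) \<le>
 norm (2 * (indicator S z *R (norm (u z))^2) + 2 * (indicator S z *R (norm (v z))^2))"
 by (auto simp: indicator_def)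
 qed
 qed
 thus ?thesis using m by (simp add: L2_def set_meas_def set_integrable_def)
qed

lemma L2_cmult:
 assumes "L2 S u"
 shows "L2 S (%z. c * u z)" "l2norm S (%z. c * u z) = norm c * l2norm S u"
proof -
 have m: "(%z. indicator S z *R u z) : msb lborel"
 using assms by (simp add: L2_def set_meas_def)
 have "(%z. c * (indicator S z *R u z)) : msb lborel" using m by measurable
 thus "L2 S (%z. c * u z)"
 using assms by (auto simp: L2_def set_meas_def norm_mult power_mult_distrib)
 show "l2norm S (%z. c * u z) = norm c * l2norm S u"
 by (simp add: l2norm_def norm_mult power_mult_distrib real_sqrt_mult)
qed

lemma L2_uminus: "L2 S u ==> L2 S (%z. - u z)"
 using L2_cmult[of S u "-1"] by simp

lemma L2_diff: "L2 S u ==> L2 S v ==> L2 S (%z. u z - v z)"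
 using L2_add[of S u "%z. - v z"] L2_uminus[of S v] by simp

lemma L2_sum: "(!!i. i : I ==> L2 S (u i)) ==> L2 S (%z. \<Sum>i\<in>I. u i z)"
proof (induction I rule: infinite_finite_induct)
 case (insert x F)
 thus ?case by (simp add: L2_add)
qed (auto simp: L2_def set_meas_def set_integrable_def)

lemma l2norm_triangle:
 assumes u: "L2 S u" and v: "L2 S v"
 shows "l2norm S (%z. u z + v z) <= l2norm S u + l2norm S v"
proof (rule power2_le_imp_le)
 have i: "sint S (%z. norm (u z) * norm (v z))"
 using set_integrable_norm[OF L2_mult_integrable[OF u v]] by (simp add: norm_mult)
 have iu: "sint S (%z. (norm (u z))^2)" "sint S (%z. (norm (v z))^2)"
 "sint S (%z. (norm (u z + v z))^2)"
 using u v L2_add[OF u v] by (auto simp: L2_def)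
 have "(l2norm S (%z. u z + v z))^2 \<le>
 sli S (%z. (norm (u z))^2 + (norm (v z))^2 + 2 * (norm (u z) * norm (v z)))"
 unfolding l2norm_sq
 proof (intro set_integral_mono)
 fix z
 have "(norm (u z + v z))^2 <= (norm (u z) + norm (v z))^2"
 by (intro power_mono norm_triangle_ineq) simp
 thus "(norm (u z + v z))^2 <= (norm (u z))^2 + (norm (v z))^2 + 2 * (norm (u z) * norm (v z))"
 by (simp add: power2_sum)
 qed (use i iu in auto)
 also have "... <= (l2norm S u + l2norm S v)^2"
 using i iu l2_Cauchy_Schwarz_norm[OF u v] by (simp add: power2_sum l2norm_sq)
 finally show "(l2norm S (%z. u z + v z))^2 <= (l2norm S u + l2norm S v)^2" .
qed (simp add: l2norm_nonneg)

lemma l2norm_bounded: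
 assumes S: "S : sets borel" "emeasure lborel S < \<infinity>" and m: "m : msb borel"
 and B: "!!z. z : S ==> norm (m z) <= B"
 shows "L2 S m" "l2norm S m <= B * sqrt (measure lborel S)"
proof -
 have [measurable]: "m : msb borel" "S : sets borel" using m S by auto
 have c: "sint S (%z. B^2)"
 using S unfolding set_integrable_def by (intro integrable_scaleR_left integrable_real_indicator) auto
 have i: "sint S (%z. (norm (m z))^2)"
 using c unfolding set_integrable_def
 by (rule Bochner_Integration.integrable_bound)
 (auto intro!: AE_I2 power_mono B simp: indicator_def)
 show "L2 S m" using i by (auto simp: L2_def set_meas_def)
 have "(l2norm S m)^2 <= sli S (%z. B^2)"
 unfolding l2norm_sq by (intro set_integral_mono i c power_mono B) auto
 also have "... = B^2 * measure lborel S" using S by (simp add: set_int_def)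
 finally have "l2norm S m <= sqrt (B^2 * measure lborel S)" by (rule real_le_rsqrt)
 also have "... = abs B * sqrt (measure lborel S)" by (simp add: real_sqrt_mult)
 finally have le: "l2norm S m <= abs B * sqrt (measure lborel S)" .
 show "l2norm S m <= B * sqrt (measure lborel S)"
 proof (cases "S = {}")
 case False
 hence "0 <= B" using B norm_ge_zero order_trans by blast
 thus ?thesis using le by simp
 qed (simp add: l2norm_def set_int_def)
qed

lemma L2_imp_loc_integrable:
 fixes u :: "'a::euclidean_space => complex"
 assumes "L2 S u"
 shows "loc_integrable S u"
 unfolding loc_integrable_def
proof safe
 fix K assume K: "compact K" "K <= S"
 have one: "L2 K (%_. 1)"
 using K by (intro l2norm_bounded[where B=1] emeasure_compact_finite) (auto simp: borel_compact)
 have "L2 K u"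
 proof -
 have [measurable]: "K : sets lborel" using K by (simp add: borel_compact)
 have m: "(%z. indicator S z *R u z) : msb lborel"
 using assms by (simp add: L2_def set_meas_def)
 hence "(%z. indicator K z *R (indicator S z *R u z)) : msb lborel" by measurable
 moreover have "(%z. indicator K z *R (indicator S z *R u z)) = (%z. indicator K z *R u z)"
 using K(2) by (intro ext) (auto simp: indicator_def split: if_splits)
 moreover have "sint K (%z. (norm (u z))^2)"
 by (rule set_integrable_subset[of lborel S "%z. (norm (u z))^2" K])
 (use assms K in \<open>auto simp: L2_def borel_compact\<close>)
 ultimately show ?thesis by (simp add: L2_def set_meas_def)
 qed
 from L2_mult_integrable[OF this one] show "sint K u" by simp
qed

section \<open>The first Sobolev space\<close>

lemma H1_wderiv:
 assumes S: "open S" and u: "H1 S u" and e: "e : Basis"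
 shows "weak_deriv S e u (wderiv S e u)" "L2 S (wderiv S e u)"
proof -
 obtain g where g: "weak_deriv S e u g" "L2 S g" using u e by (auto simp: H1_def)
 show w: "weak_deriv S e u (wderiv S e u)" by (rule wderiv_AE_eq[OF S g(1)])
 show "L2 S (wderiv S e u)"
 using w wderiv_AE_eq[OF S g(1)] g(2)
 by (intro L2_cong_AE(1)[OF g(2)] set_borel_measurable_loc_integrable S) (auto simp: weak_deriv_def)
qed

lemma L2_smooth:
 fixes w :: "'a::euclidean_space => complex"
 assumes S: "open S" "bounded S" and w: "smooth w"
 shows "L2 S w"
proof -
 have "compact (w ` closure S)"
 using S smooth_cont[OF w] by (intro compact_continuous_image) (auto simp: compact_eq_bounded_closed)
 from compact_imp_bounded[OF this] obtain B where "ALL z:closure S. norm (w z) <= B"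
 by (auto simp: bounded_iff)
 thus ?thesis
 using S closure_subset[of S] emeasure_bounded_finite[of S] smooth_cont[OF w, of UNIV]
 by (intro l2norm_bounded[where B=B] borel_cont) auto
qed

lemma H1_smooth:
 fixes w :: "'a::euclidean_space => complex"
 assumes S: "open S" "bounded S" and w: "smooth w"
 shows "H1 S w"
proof -
 have "weak_deriv S e w (pd e w)" if "e : Basis" for e
 using w that by (intro weak_deriv_Ck1) (simp_all only: smooth_def)
 thus ?thesis
 unfolding H1_def using L2_smooth[OF S w] L2_smooth[OF S smooth_pd[OF w]] by blast
qed

lemma wderiv_smooth:
 fixes w :: "'a::euclidean_space => complex"
 assumes S: "open S" and w: "smooth w" and e: "e : Basis"
 shows "AE z in lborel. z : S --> wderiv S e w z = pd e w z"
 using w e by (intro wderiv_AE_eq[OF S] weak_deriv_Ck1) (simp_all only: smooth_def)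

lemma l2norm_le_h1norm:
 "l2norm S u <= h1norm S u"
 "e : Basis ==> l2norm S (wderiv S e u) <= h1norm S u"
proof -
 show "l2norm S u <= h1norm S u"
 unfolding h1norm_def by (intro real_le_rsqrt) (simp add: sum_nonneg)
 assume "e : Basis"
 hence "(l2norm S (wderiv S e u))^2 <= (\<Sum>e\<in>Basis. (l2norm S (wderiv S e u))^2)"
 by (intro member_le_sum) auto
 thus "l2norm S (wderiv S e u) <= h1norm S u"
 unfolding h1norm_def by (intro real_le_rsqrt) (simp add: add_increasing)
qed

lemma h1norm_nonneg: "0 <= h1norm S u"
 using l2norm_le_h1norm(1)[of S u] l2norm_nonneg[of S u] by linarith

text \<open>\<open>h1norm\<close> refers to the chosen weak derivative of the difference, and
  \<open>wderiv\<close> is not linear as a function. Uniqueness up to null sets replaces it by the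
  difference of the given derivatives.\<close>

lemma l2norm_wderiv_diff_le:
 assumes S: "open S" and u: "H1 S u" and v: "weak_deriv S e v g" "L2 S g" and e: "e : Basis"
 shows "l2norm S (%z. g z - wderiv S e u z) <= h1norm S (%z. v z - u z)"
proof -
 note wu = H1_wderiv[OF S u e]
 have w: "weak_deriv S e (%z. v z - u z) (%z. g z - wderiv S e u z)"
 by (rule weak_deriv_diff[OF v(1) wu(1) e])
 have "l2norm S (wderiv S e (%z. v z - u z)) = l2norm S (%z. g z - wderiv S e u z)"
 using wderiv_AE_eq[OF S w] w
 by (intro L2_cong_AE(2)[OF L2_diff[OF v(2) wu(2)]] set_borel_measurable_loc_integrable S) (auto simp: weak_deriv_def)
 thus ?thesis using l2norm_le_h1norm(2)[OF e, of S "%z. v z - u z"] by simp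
qed

section \<open>Fubini on rectangles\<close>

lemma set_integral_Times:
 fixes f :: "real \<times> real => 'b::{banach, second_countable_topology}"
 assumes "sint (A \<times> B) f"
 shows "sli (A \<times> B) f = (LBINT x:A. LBINT y:B. f (x, y))"
 and "sli (A \<times> B) f = (LBINT y:B. LBINT x:A. f (x, y))"
proof -
 have i: "integrable (lborel \<Otimes>\<^sub>M lborel) (%z. indicator (A \<times> B) z *R f z)"
 using assms by (simp add: set_integrable_def lborel_prod)
 have ind: "indicator (A \<times> B) (x, y) *R f (x, y) = indicator A x *R indicator B y *R f (x, y)"
 "indicator (A \<times> B) (x, y) *R f (x, y) = indicator B y *R indicator A x *R f (x, y)" for x y
 by (auto simp: indicator_def)
 show "sli (A \<times> B) f = (LBINT x:A. LBINT y:B. f (x, y))"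
 using lborel_pair.integral_fst'[OF i]
 by (simp add: set_int_def lborel_prod ind(1) integral_scaleR_right del: scaleR_scaleR)
 show "sli (A \<times> B) f = (LBINT y:B. LBINT x:A. f (x, y))"
 proof -
 have "(LBINT y. LBINT x. indicator (A \<times> B) (x, y) *R f (x, y)) =
 integral\<^sup>L (lborel \<Otimes>\<^sub>M lborel) (%z. indicator (A \<times> B) z *R f z)"
 using lborel_pair.integral_snd[of "%x y. indicator (A \<times> B) (x, y) *R f (x, y)"] i
 by (simp only: case_prod_beta' prod.collapse)
 thus ?thesis
 unfolding ind(2) by (simp add: set_int_def lborel_prod integral_scaleR_right del: scaleR_scaleR)
 qed
qed

lemma set_integrable_Times_iterated:
 fixes f :: "real \<times> real => 'b::{banach, second_countable_topology}"
 assumes "sint (A \<times> B) f"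
 shows "sint A (%x. LBINT y:B. f (x, y))"
 and "sint B (%y. LBINT x:A. f (x, y))"
 and "AE x in lborel. x : A --> sint B (%y. f (x, y))"
proof -
 have i: "integrable (lborel \<Otimes>\<^sub>M lborel) (%z. indicator (A \<times> B) z *R f z)"
 using assms by (simp add: set_integrable_def lborel_prod)
 have ind: "indicator (A \<times> B) (x, y) *R f (x, y) = indicator A x *R indicator B y *R f (x, y)"
 "indicator (A \<times> B) (x, y) *R f (x, y) = indicator B y *R indicator A x *R f (x, y)" for x y
 by (auto simp: indicator_def)
 show "sint A (%x. LBINT y:B. f (x, y))"
 using lborel_pair.integrable_fst'[OF i]
 by (simp add: set_int_def set_integrable_def ind(1) integral_scaleR_right del: scaleR_scaleR)
 show "sint B (%y. LBINT x:A. f (x, y))"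
 proof -
 have "integrable lborel (%y. LBINT x. indicator (A \<times> B) (x, y) *R f (x, y))"
 using lborel_pair.integrable_snd[of "%x y. indicator (A \<times> B) (x, y) *R f (x, y)"] i
 by (simp only: case_prod_beta' prod.collapse)
 thus ?thesis
 unfolding ind(2) by (simp add: set_int_def set_integrable_def integral_scaleR_right del: scaleR_scaleR)
 qed
 have "AE x in lborel. integrable lborel (%y. indicator (A \<times> B) (x, y) *R f (x, y))"
 by (rule lborel_pair.AE_integrable_fst'[OF i])
 thus "AE x in lborel. x : A --> sint B (%y. f (x, y))"
 unfolding ind(1) set_integrable_def by eventually_elim (intro impI, simp)
qed

text \<open>The product theorem yields the first coordinate as the outer one. After the swap,
  \<open>y\<close> is the outer variable: identities are wanted along almost every horizontal
  line.\<close>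

lemma AE_lborel_pair:
 fixes Q :: "real \<times> real => bool"
 assumes "AE z in lborel. Q z"
 shows "AE y in lborel. AE x in lborel. Q (x, y)"
proof -
 have "AE z in lborel \<Otimes>\<^sub>M lborel. Q z" unfolding lborel_prod by (rule assms)
 hence "AE z in distr (lborel \<Otimes>\<^sub>M lborel) (lborel \<Otimes>\<^sub>M lborel) (%(x, y). (y, x)). Q z"
 by (subst (asm) lborel_pair.distr_pair_swap)
 hence "AE z in lborel \<Otimes>\<^sub>M lborel. Q (case z of (x, y) => (y, x))"
 by (rule AE_distrD[rotated]) simp
 hence "AE z in lborel \<Otimes>\<^sub>M lborel. Q (snd z, fst z)" by (simp add: case_prod_beta')
 from lborel_pair.AE_pair[OF this] show ?thesis by simp
qed

section \<open>Fourier modes on an interval\<close>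

lemma phi_0: "phi L 0 x = cor (1 / sqrt L)"
 by (simp add: phi_def lam_def)

lemma norm_phi: "L > 0 ==> norm (phi L k x) = 1 / sqrt L"
 by (simp add: phi_def norm_mult norm_divide)

lemma phi_has_derivative: "(phi L k hvd \<i> * lam L k * phi L k x) (at x)"
proof -
 define c where "c = cor (1 / sqrt L)"
 have "((%z. c * exp (\<i> * (cor (lam L k) * z)))
 has_field_derivative c * (exp (\<i> * (cor (lam L k) * of_real x)) * (\<i> * lam L k)))
 (at (of_real x))"
 by (auto intro!: deqs)
 from has_vector_derivative_real_field[OF this] show ?thesis
 unfolding phi_def c_def[symmetric] by (simp add: ac_simps)
qed

lemma smooth_phi: "smooth (phi L k)"
proof -
 have "((%x. (\<i> * lam L k) ^ n * phi L k x) hvd (\<i> * lam L k) ^ Suc n * phi L k x) (at x)" for n x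
 using phi_has_derivative[of L k x] by (auto intro!: deqs)
 from Ck_derivative_sequence[of "%n x. (\<i> * lam L k) ^ n * phi L k x", OF this]
 have "Ck n (%x. (\<i> * lam L k) ^ 0 * phi L k x)" for n by blast
 thus ?thesis by (simp add: smooth_def)
qed

lemma continuous_phi: "cts A (phi L k)"
 by (rule smooth_cont[OF smooth_phi])

lemma measurable_phi [measurable]: "phi L k : msb borel"
 by (rule borel_cont[OF continuous_phi])

lemma phi_mult: "phi L j x * phi L k x = phi L (j + k) x / sqrt L"
proof -
 have "lam L (j + k) = lam L j + lam L k" by (simp add: lam_def add_divide_distrib distrib_left distrib_right)
 thus ?thesis by (simp add: phi_def distrib_left distrib_right exp_add)
qed

lemma phi_periodic: "L > 0 ==> phi L k L = phi L k 0"
proof -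
 assume "L > 0"
 hence "\<i> * cor (lam L k * L) = of_int k * (2 * of_real pi * \<i>)"
 by (simp add: lam_def field_simps)
 thus ?thesis by (simp add: phi_def exp_eq_1)
qed

lemma cnj_phi: "cnj (phi L k x) = phi L (- k) x"
 by (simp add: phi_def lam_def exp_cnj)

lemma lam_eq_0_iff: "L > 0 ==> lam L k = 0 \<longleftrightarrow> k = 0"
 by (simp add: lam_def)

lemma integral_phi:
 assumes L: "L > 0"
 shows "(LBINT x:{0<..<L}. phi L k x) = (if k = 0 then sqrt L else 0)"
proof (cases "k = 0")
 case True
 have "(LBINT x:{0<..<L}. phi L k x) = cor (1 / sqrt L) * L"
 using L True by (simp add: phi_0 set_int_def scaleR_conv_of_real)
 also have "... = sqrt L" using L by (simp add: real_div_sqrt flip: of_real_divide of_real_mult)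
 finally show ?thesis using True by simp
next
 case False
 hence l: "lam L k ~= 0" using L by (simp add: lam_eq_0_iff)
 let ?F = "%x. phi L k x / (\<i> * lam L k)"
 have "(LBINT x=ereal 0..ereal L. phi L k x) = ?F L - ?F 0"
 proof (rule interval_integral_FTC_finite)
 show "cts {min 0 L..max 0 L} (phi L k)" by (rule continuous_phi)
 fix x
 have "(?F hvd (\<i> * lam L k * phi L k x) / (\<i> * lam L k)) (at x)"
 using phi_has_derivative[of L k x] by (intro has_vector_derivative_divide)
 thus "(?F hvd phi L k x) (at x within {min 0 L..max 0 L})"
 using l by (auto intro: has_vector_derivative_at_within)
 qed
 thus ?thesis using L False phi_periodic[OF L] by (simp add: interval_lebesgue_integral_def einterval_iff set_int_def)
qed

lemma integral_phi_phi:
 assumes L: "L > 0"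
 shows "(LBINT x:{0<..<L}. phi L k x * phi L (- j) x) = (if k = j then 1 else 0)"
proof -
 have "(LBINT x:{0<..<L}. phi L k x * phi L (- j) x) = (LBINT x:{0<..<L}. phi L (k - j) x) / sqrt L"
 by (simp add: phi_mult)
 thus ?thesis using L by (simp add: integral_phi flip: of_real_mult)
qed

text \<open>The functions \<open>h\<close> for which all Fourier coefficients of
  \<open>f * h\<close> vanish. They form a vector space stable under multiplication by
  \<open>phi L k\<close>, hence by trigonometric polynomials.\<close>

definition annihilates :: "real => (real => complex) => (real => complex) => bool" where
 "annihilates L f h \<longleftrightarrow> cts UNIV h & (ALL j. (LBINT x:{0<..<L}. f x * h x * phi L j x) = 0)"

lemma set_integrable_mult_continuous:
 fixes f h :: "real => complex"
 assumes f: "sint {a<..<b} f" and h: "cts UNIV h"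
 shows "sint {a<..<b} (%x. f x * h x)"
proof -
 obtain B where B: "ALL x:{a..b}. norm (h x) <= B"
 using compact_imp_bounded[OF compact_continuous_image[OF cont_sub[OF h], of "{a..b}"]]
 by (auto simp: bounded_iff)
 have [measurable]: "h : msb borel" using h by (rule borel_cont)
 have fm: "(%x. indicator {a<..<b} x *R f x) : msb lborel"
 using f by (auto simp: set_integrable_def)
 have "integrable lborel (%x. (indicator {a<..<b} x *R f x) * h x)"
 proof (rule Bochner_Integration.integrable_bound)
 show "integrable lborel (%x. cor B * (indicator {a<..<b} x *R f x))"
 using f unfolding set_integrable_def by (rule integrable_mult_right)
 show "(%x. (indicator {a<..<b} x *R f x) * h x) : msb lborel" using fm by measurable
 show "AE x in lborel. norm ((indicator {a<..<b} x *R f x) * h x) <= norm (cor B * (indicator {a<..<b} x *R f x))"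
 proof (intro AE_I2)
 fix x
 have "norm (h x) * norm (f x) <= abs B * norm (f x)" if "x : {a<..<b}"
 using B that by (intro mult_right_mono order_trans[OF _ abs_ge_self]) auto
 thus "norm ((indicator {a<..<b} x *R f x) * h x) <= norm (cor B * (indicator {a<..<b} x *R f x))"
 by (cases "x : {a<..<b}") (auto simp: norm_mult mult.commute)
 qed
 qed
 thus ?thesis by (simp add: set_integrable_def)
qed

lemma annihilates_lin:
 assumes f: "sint {0<..<L} f" and "annihilates L f g" "annihilates L f h"
 shows "annihilates L f (%x. a * g x + b * h x)"
proof -
 have c: "cts UNIV g" "cts UNIV h" using assms by (auto simp: annihilates_def)
 have i: "sint {0<..<L} (%x. f x * g x * phi L j x)" "sint {0<..<L} (%x. f x * h x * phi L j x)" for j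
 by (intro set_integrable_mult_continuous f c continuous_phi)+
 have "(LBINT x:{0<..<L}. f x * (a * g x + b * h x) * phi L j x) =
 (LBINT x:{0<..<L}. a * (f x * g x * phi L j x) + b * (f x * h x * phi L j x))" for j
 by (simp add: algebra_simps)
 also have "... j = a * (LBINT x:{0<..<L}. f x * g x * phi L j x) + b * (LBINT x:{0<..<L}. f x * h x * phi L j x)" for j
 using i[of j] by simp
 finally show ?thesis using assms c by (auto simp: annihilates_def intro!: cints)
qed

lemma annihilates_phi:
 assumes "annihilates L f h"
 shows "annihilates L f (%x. h x * phi L k x)"
proof -
 have "(LBINT x:{0<..<L}. f x * (h x * phi L k x) * phi L j x) = (LBINT x:{0<..<L}. (f x * h x * phi L (k + j) x)) / sqrt L" for j
 by (simp add: mult.assoc phi_mult)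
 thus ?thesis using assms by (auto simp: annihilates_def intro!: cints continuous_phi)
qed

text \<open>\<open>sqrt L * phi L 1 x\<close> is the point of the unit circle with angle
  \<open>2 * pi * x / L\<close>. A real linear form on the plane is
  \<open>A * z + B * cnj z\<close>, hence a combination of \<open>phi L 1\<close> and
  \<open>phi L (- 1)\<close>; sums and products follow from the closure properties.\<close>

lemma annihilates_polynomial:
 assumes L: "L > 0" and f: "sint {0<..<L} f"
 and q: "real_polynomial_function q" and h: "annihilates L f h"
 shows "annihilates L f (%x. h x * cor (q (sqrt L * phi L 1 x)))"
 using q h
proof (induction q arbitrary: h)
 case (linear q)
 have q: "q z = Re z * q 1 + Im z * q \<i>" for z
 proof -
 have "z = Re z *R 1 + Im z *R \<i>" by (simp add: complex_eq_iff)
 hence "q z = q (Re z *R 1 + Im z *R \<i>)" by simp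
 thus ?thesis using linear(1) by (simp add: linear_simps)
 qed
 define A B where "A = (q 1 - \<i> * q \<i>) / 2" and "B = (q 1 + \<i> * q \<i>) / 2"
 have *: "cor (q z) = A * z + B * cnj z" for z
 unfolding q[of z] A_def B_def by (simp add: complex_eq_iff field_simps)
 have "annihilates L f (%x. (A * sqrt L) * (h x * phi L 1 x) + (B * sqrt L) * (h x * phi L (-1) x))"
 by (intro annihilates_lin[OF f] annihilates_phi linear)
 also have "(%x. (A * sqrt L) * (h x * phi L 1 x) + (B * sqrt L) * (h x * phi L (-1) x)) =
 (%x. h x * cor (q (sqrt L * phi L 1 x)))"
 unfolding * by (simp add: cnj_phi distrib_left mult_ac)
 finally show ?case .
next
 case (const c)
 thus ?case using annihilates_lin[OF f const const, of c 0] by (simp add: mult.commute)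
next
 case (add q r)
 hence "annihilates L f (%x. 1 * (h x * cor (q (sqrt L * phi L 1 x))) + 1 * (h x * cor (r (sqrt L * phi L 1 x))))"
 by (intro annihilates_lin[OF f])
 thus ?case by (simp add: algebra_simps)
next
 case (mult q r)
 from mult(4)[OF mult(3)[OF mult(5)]] show ?case by (simp add: algebra_simps)
qed

text \<open>The values of \<open>g\<close> are carried to the circle by the angle.
  \<open>Arg2pi\<close> jumps at the point 1, where continuity is due to \<open>g 0 = g L\<close>;
  it is taken from the correspondence between loops and maps of the circle.\<close>

lemma periodic_extension_circle:
 fixes g :: "real => complex"
 assumes L: "L > 0" and g: "cts {0..L} g" "g 0 = g L"
 obtains G where "cts (sphere 0 1) G" "!!x. x : {0<..<L} ==> G (sqrt L * phi L 1 x) = g x"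
proof -
 define p where "p t = g (L * t)" for t
 have "cts {0..1} p"
 unfolding p_def using L by (intro cont_comp[OF g(1)] cints) (auto simp: mult_le_cancel_left1)
 hence "path p" by (simp add: path_def)
 moreover have "pathfinish p = pathstart p" using g by (simp add: pathfinish_def pathstart_def p_def)
 ultimately have "homotopic_loops UNIV p p" by (simp add: homotopic_loops_refl)
 from homotopic_with_imp_continuous[OF homotopic_loops_imp_homotopic_circlemaps[OF this]]
 have c: "cts (sphere 0 1) (p \<circ> (%z. Arg2pi z / (2 * pi)))" by simp
 have "(p \<circ> (%z. Arg2pi z / (2 * pi))) (sqrt L * phi L 1 x) = g x" if x: "x : {0<..<L}" for x
 proof -
 have "Arg2pi (sqrt L * phi L 1 x) = 2 * pi * x / L"
 proof (rule Arg2pi_unique[of 1])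
 show "cor 1 * exp (\<i> * cor (2 * pi * x / L)) = sqrt L * phi L 1 x"
 using L by (simp add: phi_def lam_def ac_simps)
 qed (use x L in \<open>auto simp: field_simps\<close>)
 thus ?thesis using L by (simp add: p_def)
 qed
 thus ?thesis using that c by blast
qed

text \<open>A test function on \<open>(0,L)\<close> vanishes at both ends, so it is a continuous
  function on the circle and, by Stone-Weierstrass, a uniform limit of polynomials there. Each
  polynomial has integral 0 against \<open>f\<close>, and the error is at most \<open>e\<close>
  times the L1 norm of \<open>f\<close>.\<close>

lemma Fourier_complete:
 fixes f :: "real => complex"
 assumes L: "L > 0" and f: "sint {0<..<L} f"
 and z: "!!j. (LBINT x:{0<..<L}. f x * phi L j x) = 0"
 shows "AE x in lborel. x : {0<..<L} --> f x = 0"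
proof (rule fundamental_lemma)
 show "open {0<..<L}" by simp
 show "loc_integrable {0<..<L} f"
 unfolding loc_integrable_def using set_integrable_subset[OF f] borel_compact by auto
 fix ph :: "real => real" assume t: "test_fun {0<..<L} ph"
 then obtain K where K: "compact K" "K <= {0<..<L}" "!!z. z ~: K ==> ph z = 0"
 by (auto simp: test_fun_def)
 have cph: "cts UNIV ph" using t by (auto simp: test_fun_def smooth_cont)
 have "0 ~: K" "L ~: K" using K(2) by auto
 hence "ph 0 = 0" "ph L = 0" by (simp_all add: K(3))
 then obtain G where G: "cts (sphere 0 1) G"
 "!!x. x : {0<..<L} ==> G (sqrt L * phi L 1 x) = cor (ph x)"
 using periodic_extension_circle[of L "%x. cor (ph x)"] L cph
 by (auto intro!: cints intro: cont_sub)
 have ann1: "annihilates L f (%_. 1)" using z by (simp add: annihilates_def)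
 have sph: "sqrt L * phi L 1 x : sphere 0 1" for x using L by (simp add: norm_mult norm_phi)
 let ?I = "LBINT x:{0<..<L}. f x * cor (ph x)"
 let ?N = "LBINT x:{0<..<L}. norm (f x)"
 have fn: "sint {0<..<L} (%x. norm (f x))" by (rule set_integrable_norm[OF f])
 have N0: "0 <= ?N" by (simp add: set_int_def)
 have "norm ?I <= e * (?N + 1)" if e: "e > 0" for e
 proof -
 obtain P where P: "polynomial_function P" "!!x. x : sphere 0 1 ==> norm (G x - P x) < e"
 using Stone_Weierstrass_polynomial_function[OF compact_sphere G(1) e] by blast
 define q where "q x = P (sqrt L * phi L 1 x)" for x
 have cP: "cts UNIV P" using P(1) by (rule continuous_on_polymonial_function)
 have cq: "cts UNIV q" unfolding q_def
 by (intro cont_comp[OF cP] cints continuous_phi) auto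
 have re: "real_polynomial_function (Re \<circ> P)" "real_polynomial_function (Im \<circ> P)"
 using P(1) by (auto simp: polynomial_function_def bounded_linear_Re bounded_linear_Im)
 have "annihilates L f (%x. 1 * (1 * cor ((Re \<circ> P) (sqrt L * phi L 1 x))) + \<i> * (1 * cor ((Im \<circ> P) (sqrt L * phi L 1 x))))"
 by (intro annihilates_lin[OF f] annihilates_polynomial[OF L f _ ann1] re)
 also have "(%x. 1 * (1 * cor ((Re \<circ> P) (sqrt L * phi L 1 x))) + \<i> * (1 * cor ((Im \<circ> P) (sqrt L * phi L 1 x)))) = q"
 by (auto simp: q_def complex_eq_iff)
 finally have "(LBINT x:{0<..<L}. f x * q x * phi L 0 x) = 0" unfolding annihilates_def by blast
 hence q0: "(LBINT x:{0<..<L}. f x * q x) = 0" using L by (simp add: phi_0)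
 have iph: "sint {0<..<L} (%x. f x * cor (ph x))"
 using cph by (intro set_integrable_mult_continuous f cints)
 have iq: "sint {0<..<L} (%x. f x * q x)"
 by (intro set_integrable_mult_continuous f cq)
 have "?I = (LBINT x:{0<..<L}. f x * cor (ph x) - f x * q x)"
 using iph iq q0 by simp
 also have "norm ... <= (LBINT x:{0<..<L}. norm (f x * cor (ph x) - f x * q x))"
 using iph iq by (intro set_integral_norm_bound) auto
 also have "... <= (LBINT x:{0<..<L}. e * norm (f x))"
 proof (intro set_integral_mono)
 show "sint {0<..<L} (%x. norm (f x * cor (ph x) - f x * q x))"
 using iph iq by (intro set_integrable_norm) auto
 show "sint {0<..<L} (%x. e * norm (f x))" using fn by simp
 fix x assume x: "x : {0<..<L}"
 have "norm (cor (ph x) - q x) <= e"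
 using P(2)[OF sph[of x]] G(2)[OF x] by (simp add: q_def)
 hence "norm (f x) * norm (cor (ph x) - q x) <= norm (f x) * e" by (intro mult_left_mono) auto
 thus "norm (f x * cor (ph x) - f x * q x) <= e * norm (f x)"
 by (simp add: norm_mult mult.commute flip: right_diff_distrib)
 qed
 also have "... = e * ?N" using fn by simp
 also have "... <= e * (?N + 1)" using e by simp
 finally show ?thesis .
 qed
 note small = this
 have "norm ?I <= 0 + e" if "e > 0" for e
 using small[of "e / (?N + 1)"] that N0 by simp
 hence "norm ?I <= 0" by (rule field_le_epsilon)
 thus "(LBINT x:{0<..<L}. ph x *R f x) = 0"
 by (simp add: scaleR_conv_of_real mult.commute)
qed

section \<open>Reduction of the rectangle to Fourier modes\<close>

lemma Basis_real_prod: "(Basis :: (real \<times> real) set) = {(1, 0), (0, 1)}"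
 by (auto simp: Basis_prod_def)

lemma has_vector_derivative_slice_x:
 fixes w :: "real \<times> real => 'b::real_normed_vector"
 assumes "w differentiable (at (x, y))"
 shows "((%x. w (x, y)) hvd pd (1, 0) w (x, y)) (at x)"
proof -
 have "((%x. (x, y)) has_derivative (%h. (h, 0))) (at x)"
 by (auto intro!: deqs)
 from has_derivative_compose[OF this pd_has_derivative[OF assms]]
 have d: "((%x. w (x, y)) has_derivative (%h. pd (h, 0) w (x, y))) (at x)" .
 have "(%h. pd (h, 0) w (x, y)) = (%h. h *R pd (1, 0) w (x, y))"
 proof
 fix h :: real
 have "pd (h, 0) w (x, y) = pd (h *R (1, 0)) w (x, y)" by simp
 also have "... = h *R pd (1, 0) w (x, y)"
 by (rule linear_scale[OF has_derivative_linear[OF pd_has_derivative[OF assms]]])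
 finally show "pd (h, 0) w (x, y) = h *R pd (1, 0) w (x, y)" .
 qed
 with d show ?thesis unfolding has_vector_derivative_def by (simp only:)
qed

lemma has_vector_derivative_slice_y:
 fixes w :: "real \<times> real => 'b::real_normed_vector"
 assumes "w differentiable (at (x, y))"
 shows "((%y. w (x, y)) hvd pd (0, 1) w (x, y)) (at y)"
proof -
 have "((%y. (x, y)) has_derivative (%h. (0, h))) (at y)"
 by (auto intro!: deqs)
 from has_derivative_compose[OF this pd_has_derivative[OF assms]]
 have d: "((%y. w (x, y)) has_derivative (%h. pd (0, h) w (x, y))) (at y)" .
 have "(%h. pd (0, h) w (x, y)) = (%h. h *R pd (0, 1) w (x, y))"
 proof
 fix h :: real
 have "pd (0, h) w (x, y) = pd (h *R (0, 1)) w (x, y)" by simp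
 also have "... = h *R pd (0, 1) w (x, y)"
 by (rule linear_scale[OF has_derivative_linear[OF pd_has_derivative[OF assms]]])
 finally show "pd (0, h) w (x, y) = h *R pd (0, 1) w (x, y)" .
 qed
 with d show ?thesis unfolding has_vector_derivative_def by (simp only:)
qed

lemma set_integral_FTC:
 fixes F :: "real => complex"
 assumes "a <= b" "!!x. (F hvd f x) (at x)" "cts UNIV f"
 shows "(LBINT x:{a<..<b}. f x) = F b - F a"
proof -
 have "(LBINT x=ereal a..ereal b. f x) = F b - F a"
 proof (rule interval_integral_FTC_finite)
 show "cts {min a b..max a b} f" using assms(3) cont_sub by blast
 show "(F hvd f x) (at x within {min a b..max a b})" for x
 by (rule has_vector_derivative_at_within[OF assms(2)])
 qed
 thus ?thesis using assms(1) by (simp add: interval_lebesgue_integral_def einterval_eq)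
qed

definition pr :: "real => real => (real \<times> real => complex) => (real \<times> real => complex) => complex" where
 "pr L H u m = (LBINT z:Omega L H. u z * m z)"

text \<open>A test function of one Fourier mode. \<open>pr\<close> has no conjugation, so the
  exponential carries \<open>- j\<close>, and \<open>pr L H u (md L j m)\<close> is the j-th Fourier
  coefficient of \<open>u\<close> in \<open>x\<close>, integrated against \<open>m\<close> in
  \<open>y\<close>.\<close>

definition md :: "real => int => (real => complex) => real \<times> real => complex" where
 "md L j m z = phi L (- j) (fst z) * m (snd z)"

text \<open>The integral over \<open>(0,y)\<close> of the j-th Fourier coefficient of
  \<open>u\<close>, a continuous function of \<open>y\<close> even for \<open>u\<close> in L2.
  Applied to the y-derivative of a function that vanishes on the bottom side, it is the pointwise
  value of the j-th mode of that function; all modes of the pressure are represented in this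
  way.\<close>

definition low_mode :: "real => real => int => (real \<times> real => complex) => real => complex" where
 "low_mode L H j u y = pr L H u (md L j (%s. if s < y then 1 else 0))"

definition slice_mode :: "real => int => (real \<times> real => complex) => real => complex" where
 "slice_mode L j w y = (LBINT x:{0<..<L}. w (x, y) * phi L (- j) x)"

locale rectangle =
 fixes L H :: real
 assumes L: "L > 0" and H: "H > 0"
begin

abbreviation "Om \<equiv> Omega L H"

lemma open_Omega: "open Om" unfolding Omega_def by (intro open_Times) auto

lemma bounded_Omega: "bounded Om" unfolding Omega_def by (intro bounded_Times) auto

lemma sets_Omega [measurable]: "Om : sets borel" using open_Omega by simp

lemma emeasure_Omega: "emeasure lborel Om < \<infinity>"
 using emeasure_bounded_finite[OF bounded_Omega] .

lemma fst_measurable2 [measurable]: "(fst :: real \<times> real => real) : msb borel"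
 and snd_measurable2 [measurable]: "(snd :: real \<times> real => real) : msb borel"
 by (intro borel_cont cints)+

lemma L2_Omega_bounded:
 assumes "m : msb borel" "!!z. z : Om ==> norm (m z) <= B"
 shows "L2 Om m"
 using l2norm_bounded(1)[OF sets_Omega emeasure_Omega assms] .

lemma md_measurable [measurable]:
 "m : msb borel ==> md L j m : msb borel"
 unfolding md_def
 by (intro borel_measurable_times measurable_compose[OF fst_measurable2 measurable_phi]
 measurable_compose[OF snd_measurable2])

lemma norm_md: "norm (md L j m z) = norm (m (snd z)) / sqrt L"
 using L by (simp add: md_def norm_mult norm_phi)

lemma L2_md:
 assumes "m : msb borel" "!!y. y : {0<..<H} ==> norm (m y) <= B"
 shows "L2 Om (md L j m)"
 using assms L by (intro L2_Omega_bounded[where B="B / sqrt L"])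
 (auto simp: norm_md Omega_def divide_right_mono)

text \<open>The width of the strip enters with exponent 1/2. This is the source of the Hoelder
  continuity of \<open>low_mode\<close> and of the differentiability of pairings with respect to a
  height.\<close>

lemma l2norm_md_strip:
 assumes m: "m : msb borel" and ab: "a <= b"
 and B: "!!y. y : {0<..<H} ==> norm (m y) <= B * indicator {a..b} y"
 shows "l2norm Om (md L j m) <= abs B * sqrt (b - a)"
proof -
 let ?S = "{0<..<L} \<times> {a..b}"
 have S: "?S : sets borel" by (intro borel_Times) auto
 have "emeasure lborel ?S = emeasure lborel {0<..<L} * emeasure lborel {a..b}"
 unfolding lborel_prod[symmetric] by (rule lborel.emeasure_pair_measure_Times) auto
 also have "... = ennreal (L * (b - a))" using L ab by (simp add: ennreal_mult)
 finally have em: "emeasure lborel ?S = ennreal (L * (b - a))" .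
 hence ms: "measure lborel ?S = L * (b - a)" using L ab by (simp add: measure_def)
 have i: "integrable lborel (indicator ?S :: _ => real)" using S em by (intro integrable_real_indicator) auto
 have "(l2norm Om (md L j m))^2 = (LBINT z:Om. (norm (md L j m z))^2)" by (rule l2norm_sq)
 also have "... <= (LINT z|lborel. (B^2 / L) * indicator ?S z)"
 unfolding set_int_def
 proof (rule integral_mono)
 have "L2 Om (md L j m)"
 proof (rule L2_md[OF m, where B="abs B"])
 fix y assume "y : {0<..<H}"
 from B[OF this] show "norm (m y) <= abs B" by (cases "y : {a..b}") auto
 qed
 thus "integrable lborel (%z. indicator Om z *R (norm (md L j m z))^2)"
 by (simp add: L2_def set_integrable_def)
 show "integrable lborel (%z. (B^2 / L) * indicator ?S z)" using i by simp
 fix z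
 show "indicator Om z *R (norm (md L j m z))^2 <= (B^2 / L) * indicator ?S z"
 proof (cases "z : Om")
 case True
 hence "norm (m (snd z)) <= B * indicator {a..b} (snd z)" by (intro B) (auto simp: Omega_def)
 hence "(norm (m (snd z)))^2 <= (B * indicator {a..b} (snd z))^2" by (intro power_mono) auto
 hence "(norm (md L j m z))^2 <= (B^2 / L) * indicator {a..b} (snd z)"
 using L by (auto simp: norm_md power_divide indicator_def divide_right_mono)
 thus ?thesis using True by (cases z; cases "snd z : {a..b}") (auto simp: Omega_def)
 qed (use L in auto)
 qed
 also have "... = B^2 * (b - a)" using ms L by simp
 finally have "l2norm Om (md L j m) <= sqrt (B^2 * (b - a))" by (rule real_le_rsqrt)
 thus ?thesis by (simp add: real_sqrt_mult)
qed

lemma pr_diff: "L2 Om u ==> L2 Om v ==> L2 Om m ==> pr L H (%z. u z - v z) m = pr L H u m - pr L H v m"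
 unfolding pr_def by (simp add: left_diff_distrib L2_mult_integrable)

lemma pr_diff_right: "L2 Om u ==> L2 Om m ==> L2 Om n ==> pr L H u (%z. m z - n z) = pr L H u m - pr L H u n"
 unfolding pr_def by (simp add: right_diff_distrib L2_mult_integrable)

lemma pr_cmult: "pr L H (%z. c * u z) m = c * pr L H u m"
 unfolding pr_def by (simp add: mult.assoc)

lemma pr_cmult_right: "pr L H u (%z. c * m z) = c * pr L H u m"
 unfolding pr_def by (simp add: mult.left_commute)

lemma pr_bound: "L2 Om u ==> L2 Om m ==> norm (pr L H u m) <= l2norm Om u * l2norm Om m"
 unfolding pr_def by (rule l2_Cauchy_Schwarz)

lemma pr_cong_AE:
 assumes "L2 Om u" "L2 Om v" "L2 Om m" "L2 Om n"
 and "AE z in lborel. z : Om --> u z * m z = v z * n z"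
 shows "pr L H u m = pr L H v n"
 unfolding pr_def set_int_def
proof (rule integral_cong_AE)
 show "(%z. indicator Om z *R (u z * m z)) : msb lborel"
 using L2_mult_integrable[OF assms(1,3)] by (auto simp: set_integrable_def)
 show "(%z. indicator Om z *R (v z * n z)) : msb lborel"
 using L2_mult_integrable[OF assms(2,4)] by (auto simp: set_integrable_def)
 show "AE z in lborel. indicator Om z *R (u z * m z) = indicator Om z *R (v z * n z)"
 using assms(5) by eventually_elim (auto simp: indicator_def)
qed

lemma pr_tendsto:
 assumes "\<forall>\<^sub>F s in F. L2 Om (v s)" "L2 Om u" "L2 Om m"
 and "((%s. l2norm Om (%z. v s z - u z)) ---> 0) F"
 shows "((%s. pr L H (v s) m) ---> pr L H u m) F"
proof -
 have "((%s. pr L H (v s) m - pr L H u m) ---> 0) F"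
 proof (rule Lim_null_comparison)
 show "\<forall>\<^sub>F s in F. norm (pr L H (v s) m - pr L H u m) <= l2norm Om (%z. v s z - u z) * l2norm Om m"
 using assms(1)
 proof eventually_elim
 case (elim s)
 thus ?case using pr_bound[OF L2_diff[OF elim assms(2)] assms(3)] by (simp add: pr_diff assms)
 qed
 show "((%s. l2norm Om (%z. v s z - u z) * l2norm Om m) ---> 0) F"
 using tendsto_mult_right[OF assms(4)] by (simp add: tendsto_mult_left_zero assms(4))
 qed
 thus ?thesis by (simp add: LIM_zero_iff)
qed

lemma L2_md_step: "L2 Om (md L j (%s. if s < y then 1 else 0))"
 by (intro L2_md[where B=1]) auto

lemma low_mode_Hoelder:
 assumes u: "L2 Om u" and y: "y <= y'"
 shows "norm (low_mode L H j u y' - low_mode L H j u y) <= l2norm Om u * sqrt (y' - y)"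
proof -
 let ?m = "%s. (if s < y' then 1 else 0) - (if s < y then 1 else 0) :: complex"
 have "md L j ?m = (%z. md L j (%s. if s < y' then 1 else 0) z - md L j (%s. if s < y then 1 else 0) z)"
 by (auto simp: md_def)
 hence "low_mode L H j u y' - low_mode L H j u y = pr L H u (md L j ?m)"
 unfolding low_mode_def by (simp add: pr_diff_right u L2_md_step)
 also have "norm ... <= l2norm Om u * l2norm Om (md L j ?m)"
 by (intro pr_bound u L2_md[where B=1]) auto
 also have "... <= l2norm Om u * (abs 1 * sqrt (y' - y))"
 using y by (intro mult_left_mono l2norm_nonneg l2norm_md_strip) (auto simp: indicator_def)
 finally show ?thesis by simp
qed

lemma low_mode_Hoelder_abs:
 assumes u: "L2 Om u"
 shows "norm (low_mode L H j u y' - low_mode L H j u y) <= l2norm Om u * sqrt (abs (y' - y))"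
 using low_mode_Hoelder[OF u, of y y' j] low_mode_Hoelder[OF u, of y' y j]
 by (cases "y <= y'") (auto simp: norm_minus_commute)

lemma low_mode_0 [simp]: "low_mode L H j u 0 = 0"
 unfolding low_mode_def pr_def set_int_def
 by (intro integral_eq_zero_AE AE_I2) (auto simp: Omega_def md_def indicator_def)

lemma low_mode_bound:
 assumes u: "L2 Om u" and y: "y : {0..H}"
 shows "norm (low_mode L H j u y) <= l2norm Om u * sqrt H"
proof -
 have "norm (low_mode L H j u y) <= l2norm Om u * sqrt y"
 using low_mode_Hoelder_abs[OF u, of j y 0] y by simp
 also have "... <= l2norm Om u * sqrt H" using y by (intro mult_left_mono l2norm_nonneg) auto
 finally show ?thesis .
qed

lemma low_mode_diff: "L2 Om u ==> L2 Om v ==> low_mode L H j (%z. u z - v z) y = low_mode L H j u y - low_mode L H j v y"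
 unfolding low_mode_def by (intro pr_diff L2_md_step)

lemma continuous_on_low_mode:
 assumes "L2 Om u"
 shows "cts A (low_mode L H j u)"
proof (intro continuous_at_imp_continuous_on ballI)
 fix y
 have "((%y'. low_mode L H j u y' - low_mode L H j u y) ---> 0) (at y)"
 proof (rule Lim_null_comparison)
 show "\<forall>\<^sub>F y' in at y. norm (low_mode L H j u y' - low_mode L H j u y) <= l2norm Om u * sqrt (abs (y' - y))"
 using low_mode_Hoelder_abs[OF assms] by simp
 have "((%y'. l2norm Om u * sqrt (abs (y' - y))) ---> l2norm Om u * sqrt (abs (y - y))) (at y)"
 by (intro tendsto_intros)
 thus "((%y'. l2norm Om u * sqrt (abs (y' - y))) ---> 0) (at y)" by simp
 qed
 thus "isCont (low_mode L H j u) y" by (simp add: isCont_def LIM_zero_iff)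
qed

text \<open>Hoelder continuity in \<open>y\<close> and convergence uniform in \<open>y\<close> as
  the time varies together give joint continuity; both bounds depend on \<open>u\<close> only
  through L2 norms.\<close>

lemma continuous_on_low_mode_time:
 fixes A :: "real set"
 assumes u: "!!t. t : A ==> L2 Om (u t)"
 and c: "!!t. t : A ==> ((%s. l2norm Om (%z. u s z - u t z)) ---> 0) (at t within A)"
 shows "cts (A \<times> {0..H}) (%(t, y). low_mode L H j (u t) y)"
 unfolding continuous_on_def
proof
 fix x assume x: "x : A \<times> {0..H}"
 obtain t y where ty: "x = (t, y)" "t : A" "y : {0..H}" using x by auto
 have fst: "((%z. l2norm Om (%w. u (fst z) w - u t w)) ---> 0) (at (t, y) within A \<times> {0..H})"
 proof -
 have "continuous (at t within A) (%s. l2norm Om (%w. u s w - u t w))"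
 using c[OF ty(2)] by (simp add: continuous_within l2norm_def)
 hence "continuous (at (fst (t, y)) within fst ` (A \<times> {0..H})) (%s. l2norm Om (%w. u s w - u t w))"
 by (auto intro: continuous_within_subset)
 with continuous_fst[OF continuous_ident] have "continuous (at (t, y) within A \<times> {0..H}) (%z. l2norm Om (%w. u (fst z) w - u t w))"
 by (rule continuous_within_compose2)
 hence "((%z. l2norm Om (%w. u (fst z) w - u t w)) ---> l2norm Om (%w. u t w - u t w)) (at (t, y) within A \<times> {0..H})"
 by (simp add: continuous_within)
 thus ?thesis by (simp add: l2norm_def)
 qed
 have "((%z. (case z of (t, y) => low_mode L H j (u t) y) - low_mode L H j (u t) y) ---> 0) (at (t, y) within A \<times> {0..H})"
 proof (rule Lim_null_comparison)
 show "((%z. l2norm Om (%w. u (fst z) w - u t w) * sqrt H + l2norm Om (u t) * sqrt (abs (snd z - y))) ---> 0) (at (t, y) within A \<times> {0..H})"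
 proof -
 have "((%z. l2norm Om (%w. u (fst z) w - u t w) * sqrt H + l2norm Om (u t) * sqrt (abs (snd z - y))) \<longlongrightarrow>
 0 * sqrt H + l2norm Om (u t) * sqrt (abs (snd (t, y) - y))) (at (t, y) within A \<times> {0..H})"
 by (intro tendsto_intros fst)
 thus ?thesis by simp
 qed
 show "\<forall>\<^sub>F z in at (t, y) within A \<times> {0..H}. norm ((case z of (t, y) => low_mode L H j (u t) y) - low_mode L H j (u t) y) \<le>
 l2norm Om (%w. u (fst z) w - u t w) * sqrt H + l2norm Om (u t) * sqrt (abs (snd z - y))"
 proof (subst eventually_at_filter, intro always_eventually allI impI)
 fix z assume "z : A \<times> {0..H}"
 then obtain s y' where z: "z = (s, y')" "s : A" "y' : {0..H}" by auto
 have "norm (low_mode L H j (u s) y' - low_mode L H j (u t) y) \<le>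
 norm (low_mode L H j (u s) y' - low_mode L H j (u t) y') + norm (low_mode L H j (u t) y' - low_mode L H j (u t) y)"
 using norm_triangle_ineq[of "low_mode L H j (u s) y' - low_mode L H j (u t) y'" "low_mode L H j (u t) y' - low_mode L H j (u t) y"]
 by simp
 also have "... <= l2norm Om (%w. u s w - u t w) * sqrt H + l2norm Om (u t) * sqrt (abs (y' - y))"
 using low_mode_bound[OF L2_diff[OF u[OF z(2)] u[OF ty(2)]] z(3), of j]
 by (intro add_mono low_mode_Hoelder_abs u ty) (simp add: low_mode_diff u z ty)
 finally show "norm ((case z of (t, y) => low_mode L H j (u t) y) - low_mode L H j (u t) y) \<le>
 l2norm Om (%w. u (fst z) w - u t w) * sqrt H + l2norm Om (u t) * sqrt (abs (snd z - y))"
 by (simp add: z)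
 qed
 qed
 thus "((%(t, y). low_mode L H j (u t) y) ---> (case x of (t, y) => low_mode L H j (u t) y)) (at x within A \<times> {0..H})"
 by (simp add: ty LIM_zero_iff)
qed

lemma set_integrable_smooth_bounded:
 fixes w m :: "real \<times> real => complex"
 assumes w: "smooth w" and m: "m : msb borel" "!!z. z : Om ==> norm (m z) <= B"
 shows "sint ({0<..<L} \<times> {0<..<H}) (%z. w z * m z)"
 using L2_mult_integrable[OF L2_smooth[OF open_Omega bounded_Omega w] L2_Omega_bounded[OF m]]
 by (simp add: Omega_def)

lemma pr_md_smooth:
 assumes w: "smooth w" and m: "m : msb borel" "!!y. y : {0<..<H} ==> norm (m y) <= B"
 shows "pr L H w (md L j m) = (LBINT y:{0<..<H}. m y * slice_mode L j w y)"
 and "pr L H w (md L j m) = (LBINT x:{0<..<L}. phi L (- j) x * (LBINT y:{0<..<H}. w (x, y) * m y))"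
 and "sint {0<..<H} (%y. m y * slice_mode L j w y)"
proof -
 have i: "sint ({0<..<L} \<times> {0<..<H}) (%z. w z * md L j m z)"
 using m L by (intro set_integrable_smooth_bounded[where B="B / sqrt L"] w)
 (auto simp: norm_md Omega_def divide_right_mono)
 have 1: "(LBINT x:{0<..<L}. w (x, y) * md L j m (x, y)) = m y * slice_mode L j w y" for y
 by (simp add: md_def slice_mode_def mult_ac flip: set_integral_mult_right)
 have 2: "(LBINT y:{0<..<H}. w (x, y) * md L j m (x, y)) = phi L (- j) x * (LBINT y:{0<..<H}. w (x, y) * m y)" for x
 by (simp add: md_def mult_ac flip: set_integral_mult_right)
 show "pr L H w (md L j m) = (LBINT y:{0<..<H}. m y * slice_mode L j w y)"
 using set_integral_Times(2)[OF i] by (simp add: pr_def Omega_def 1)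
 show "pr L H w (md L j m) = (LBINT x:{0<..<L}. phi L (- j) x * (LBINT y:{0<..<H}. w (x, y) * m y))"
 using set_integral_Times(1)[OF i] by (simp add: pr_def Omega_def 2)
 show "sint {0<..<H} (%y. m y * slice_mode L j w y)"
 using set_integrable_Times_iterated(2)[OF i] by (simp add: 1)
qed

lemma slice_mode_smooth:
 assumes w: "smooth w" and y: "y : {0..H}"
 shows "slice_mode L j w y = slice_mode L j w 0 + low_mode L H j (pd (0, 1) w) y"
proof -
 have sp: "smooth (pd (0, 1) w)" by (intro smooth_pd w) (simp add: Basis_real_prod)
 have cs: "cts UNIV (%x. v (x, s))" "cts UNIV (%s. v (x, s))" if "smooth v" for v :: "real \<times> real => complex" and s x
 by (intro cont_comp[OF smooth_cont[OF that, of UNIV]] cints; simp)+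
 have inner: "(LBINT s:{0<..<H}. pd (0, 1) w (x, s) * (if s < y then 1 else 0)) = w (x, y) - w (x, 0)" for x
 proof -
 have "(LBINT s:{0<..<H}. pd (0, 1) w (x, s) * (if s < y then 1 else 0)) = (LBINT s:{0<..<y}. pd (0, 1) w (x, s))"
 unfolding set_int_def using y
 by (intro Bochner_Integration.integral_cong) (auto simp: indicator_def)
 also have "... = w (x, y) - w (x, 0)"
 using y by (intro set_integral_FTC has_vector_derivative_slice_y smooth_differentiable w cs sp) auto
 finally show ?thesis .
 qed
 have "low_mode L H j (pd (0, 1) w) y =
 (LBINT x:{0<..<L}. phi L (- j) x * (LBINT s:{0<..<H}. pd (0, 1) w (x, s) * (if s < y then 1 else 0)))"
 unfolding low_mode_def by (rule pr_md_smooth(2)[where B=1]) (auto simp: sp)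
 also have "... = (LBINT x:{0<..<L}. phi L (- j) x * (w (x, y) - w (x, 0)))" by (simp only: inner)
 also have "(LBINT x:{0<..<L}. phi L (- j) x * (w (x, y) - w (x, 0))) = slice_mode L j w y - slice_mode L j w 0"
 proof -
 have "sint {0<..<L} (%x. w (x, s) * phi L (- j) x)" for s
 using cs(1)[OF w, of s] continuous_phi
 by (intro set_integrable_subset[OF borel_integrable_atLeastAtMost'[of 0 L]] cints)
 (auto intro: cont_sub)
 thus ?thesis unfolding slice_mode_def
 by (subst set_integral_diff(2)[symmetric]) (auto simp: algebra_simps)
 qed
 finally show ?thesis by simp
qed

lemma pr_x_by_parts_smooth:
 fixes xh xh' et :: "real => complex"
 assumes w: "smooth w" and xi: "!!x. (xh hvd xh' x) (at x)" "cts UNIV xh'"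
 and eta: "cts UNIV et"
 shows "pr L H (pd (1, 0) w) (%z. xh (fst z) * et (snd z)) + pr L H w (%z. xh' (fst z) * et (snd z)) =
 xh L * (LBINT y:{0<..<H}. w (L, y) * et y) - xh 0 * (LBINT y:{0<..<H}. w (0, y) * et y)"
proof -
 have sp: "smooth (pd (1, 0) w)" by (intro smooth_pd w) (simp add: Basis_real_prod)
 have cxi: "cts UNIV xh"
 using xi(1) by (auto intro!: continuous_at_imp_continuous_on has_vector_derivative_continuous)
 have cs: "cts UNIV (%x. v (x, s))" "cts UNIV (%s. v (x, s))" if "smooth v" for v :: "real \<times> real => complex" and s x
 by (intro cont_comp[OF smooth_cont[OF that, of UNIV]] cints; simp)+
 have i: "sint ({0<..<L} \<times> {0<..<H}) (%z. v z * (x (fst z) * et (snd z)))"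
 if "smooth v" "cts UNIV x" for v and x :: "real => complex"
 proof -
 have "cts ({0..L} \<times> {0..H}) (%z. v z * (x (fst z) * et (snd z)))"
 by (intro cints smooth_cont that cont_comp[OF that(2)] cont_comp[OF eta]) auto
 hence "sint ({0..L} \<times> {0..H}) (%z. v z * (x (fst z) * et (snd z)))"
 unfolding set_integrable_def by (intro borel_integrable_compact compact_Times) auto
 moreover have "{0<..<L} \<times> {0<..<H} : sets lborel" using sets_Omega by (simp add: Omega_def)
 ultimately show ?thesis by (rule set_integrable_subset) auto
 qed
 have inner: "(LBINT x:{0<..<L}. pd (1, 0) w (x, y) * (xh x * et y) + w (x, y) * (xh' x * et y)) =
 xh L * (w (L, y) * et y) - xh 0 * (w (0, y) * et y)" for y
 proof -
 have "(LBINT x:{0<..<L}. (w (x, y) * xh' x + pd (1, 0) w (x, y) * xh x) * et y) = (w (L, y) * xh L) * et y - (w (0, y) * xh 0) * et y"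
 proof (rule set_integral_FTC)
 show "((%x. w (x, y) * xh x * et y) hvd (w (x, y) * xh' x + pd (1, 0) w (x, y) * xh x) * et y) (at x)" for x
 by (intro has_vector_derivative_mult_left has_vector_derivative_mult has_vector_derivative_slice_x smooth_differentiable w xi(1))
 show "cts UNIV (%x. (w (x, y) * xh' x + pd (1, 0) w (x, y) * xh x) * et y)"
 by (intro cints cs w sp xi(2) cxi)
 qed (use L in simp)
 thus ?thesis by (simp add: algebra_simps)
 qed
 have "pr L H (pd (1, 0) w) (%z. xh (fst z) * et (snd z)) + pr L H w (%z. xh' (fst z) * et (snd z)) =
 (LBINT z:{0<..<L} \<times> {0<..<H}. pd (1, 0) w z * (xh (fst z) * et (snd z)) + w z * (xh' (fst z) * et (snd z)))"
 unfolding pr_def Omega_def using i[OF sp cxi] i[OF w xi(2)] by simp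
 also have "... = (LBINT y:{0<..<H}. LBINT x:{0<..<L}. pd (1, 0) w (x, y) * (xh x * et y) + w (x, y) * (xh' x * et y))"
 using set_integral_Times(2)[OF set_integral_add(1)[OF i[OF sp cxi] i[OF w xi(2)]]] by simp
 also have "... = (LBINT y:{0<..<H}. xh L * (w (L, y) * et y) - xh 0 * (w (0, y) * et y))"
 by (simp only: inner)
 also have "(LBINT y:{0<..<H}. xh L * (w (L, y) * et y) - xh 0 * (w (0, y) * et y)) =
 xh L * (LBINT y:{0<..<H}. w (L, y) * et y) - xh 0 * (LBINT y:{0<..<H}. w (0, y) * et y)"
 proof -
 have "sint {0<..<H} (%y. w (x, y) * et y)" for x
 using cs(2)[OF w, of x] eta
 by (intro set_integrable_subset[OF borel_integrable_atLeastAtMost'[of 0 H]] cints)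
 (auto intro: cont_sub)
 thus ?thesis by simp
 qed
 finally show ?thesis .
qed

end

section \<open>Traces on the sides of the rectangle\<close>

lemma emeasure_Ioo_finite [simp]: "emeasure lborel {a<..<b::real} < top"
 using emeasure_bounded_finite[OF bounded_box[of a b]] by simp

lemma L2_interval_continuous:
 assumes f: "cts UNIV f"
 shows "L2 {a<..<b::real} f"
proof -
 have "compact (f ` {a..b})" by (intro compact_continuous_image cont_sub[OF f]) auto
 from compact_imp_bounded[OF this] obtain B where "ALL x:{a..b}. norm (f x) <= B" by (auto simp: bounded_iff)
 thus ?thesis using f
 by (intro l2norm_bounded[where B=B]) (auto intro: borel_cont)
qed

lemma L2_interval_imp_integrable:
 assumes "L2 {a<..<b::real} f"
 shows "sint {a<..<b} f"
 using L2_mult_integrable[OF assms L2_interval_continuous[of "%_. 1"]] by simp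

context rectangle
begin

definition smooth_approx :: "(real \<times> real => complex) => (nat => real \<times> real => complex) => bool" where
 "smooth_approx u w \<longleftrightarrow> (ALL n. smooth (w n)) & (%n. h1norm Om (%z. w n z - u z)) ----> 0"

abbreviation "dx u \<equiv> wderiv Om (1, 0) u"
abbreviation "dy u \<equiv> wderiv Om (0, 1) u"

lemma Basis_elems: "(1::real, 0::real) : Basis" "(0::real, 1::real) : Basis"
 by (auto simp: Basis_real_prod)

lemma L2_dx_dy: "H1 Om u ==> L2 Om (dx u)" "H1 Om u ==> L2 Om (dy u)"
 using H1_wderiv(2)[OF open_Omega _ Basis_elems(1)] H1_wderiv(2)[OF open_Omega _ Basis_elems(2)] by blast+

lemma H1_L2: "H1 Om u ==> L2 Om u"
 by (simp add: H1_def)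

lemma smooth_approxD:
 assumes "smooth_approx u w"
 shows "smooth (w n)" "L2 Om (w n)" "e : Basis ==> smooth (pd e (w n))" "e : Basis ==> L2 Om (pd e (w n))"
 using assms by (auto simp: smooth_approx_def intro!: L2_smooth open_Omega bounded_Omega smooth_pd)

lemma smooth_approx_l2:
 assumes u: "H1 Om u" and w: "smooth_approx u w"
 shows "(%n. l2norm Om (%z. w n z - u z)) ----> 0"
 and "e : Basis ==> (%n. l2norm Om (%z. pd e (w n) z - wderiv Om e u z)) ----> 0"
proof -
 have h: "(%n. h1norm Om (%z. w n z - u z)) ----> 0" using w by (simp add: smooth_approx_def)
 show "(%n. l2norm Om (%z. w n z - u z)) ----> 0"
 by (rule tendsto_sandwich[OF _ _ tendsto_const h]) (auto simp: l2norm_nonneg l2norm_le_h1norm)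
 assume e: "e : Basis"
 have "l2norm Om (%z. pd e (w n) z - wderiv Om e u z) <= h1norm Om (%z. w n z - u z)" for n
 proof (rule l2norm_wderiv_diff_le[OF open_Omega u _ _ e])
 have "Ck 1 (w n)" using smooth_approxD(1)[OF w] unfolding smooth_def by blast
 thus "weak_deriv Om e (w n) (pd e (w n))" using e by (rule weak_deriv_Ck1)
 qed (rule smooth_approxD(4)[OF w e])
 thus "(%n. l2norm Om (%z. pd e (w n) z - wderiv Om e u z)) ----> 0"
 by (intro tendsto_sandwich[OF _ _ tendsto_const h]) (auto simp: l2norm_nonneg)
qed

lemma smooth_approx_pr:
 assumes u: "H1 Om u" and w: "smooth_approx u w" and m: "L2 Om m"
 shows "(%n. pr L H (w n) m) ----> pr L H u m"
 and "e : Basis ==> (%n. pr L H (pd e (w n)) m) ----> pr L H (wderiv Om e u) m"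
proof -
 show "(%n. pr L H (w n) m) ----> pr L H u m"
 by (intro pr_tendsto always_eventually allI smooth_approxD(2)[OF w] m H1_L2 u smooth_approx_l2(1)[OF u w])
 assume e: "e : Basis"
 show "(%n. pr L H (pd e (w n)) m) ----> pr L H (wderiv Om e u) m"
 by (intro pr_tendsto always_eventually allI smooth_approxD(4)[OF w e] m H1_wderiv(2)[OF open_Omega u e] smooth_approx_l2(2)[OF u w e])
qed

lemma set_integrable_low_mode:
 assumes u: "L2 Om u" and m: "m : msb borel" "!!y. y : {0<..<H} ==> norm (m y) <= B"
 shows "sint {0<..<H} (%y. m y * low_mode L H j u y)"
proof -
 have "L2 {0<..<H} m" by (rule l2norm_bounded[OF _ _ m]) auto
 moreover have "L2 {0<..<H} (low_mode L H j u)"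
 by (rule l2norm_bounded[where B="l2norm Om u * sqrt H"])
 (auto intro!: borel_cont continuous_on_low_mode u low_mode_bound)
 ultimately show ?thesis by (rule L2_mult_integrable)
qed

lemma low_mode_integral_tendsto:
 assumes u: "H1 Om u" and w: "smooth_approx u w"
 and m: "m : msb borel" "!!y. y : {0<..<H} ==> norm (m y) <= B"
 shows "(%n. LBINT y:{0<..<H}. m y * low_mode L H j (pd (0, 1) (w n)) y) \<longlonglongrightarrow>
 (LBINT y:{0<..<H}. m y * low_mode L H j (dy u) y)"
proof -
 note wn = smooth_approxD(4)[OF w Basis_elems(2)]
 let ?e = "%n. l2norm Om (%z. pd (0, 1) (w n) z - dy u z)"
 have "(%n. (LBINT y:{0<..<H}. m y * low_mode L H j (pd (0, 1) (w n)) y) - (LBINT y:{0<..<H}. m y * low_mode L H j (dy u) y)) ----> 0"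
 proof (rule Lim_null_comparison)
 have "(%n. abs B * (?e n * sqrt H) * H) ----> abs B * (0 * sqrt H) * H"
 by (intro tendsto_intros smooth_approx_l2 u w Basis_elems)
 thus "(%n. abs B * (?e n * sqrt H) * H) ----> 0" by simp
 show "\<forall>\<^sub>F n in sequentially. norm ((LBINT y:{0<..<H}. m y * low_mode L H j (pd (0, 1) (w n)) y) - (LBINT y:{0<..<H}. m y * low_mode L H j (dy u) y))
 <= abs B * (?e n * sqrt H) * H"
 proof (intro always_eventually allI)
 fix n
 have i: "sint {0<..<H} (%y. m y * low_mode L H j (pd (0, 1) (w n)) y)"
 "sint {0<..<H} (%y. m y * low_mode L H j (dy u) y)"
 by (intro set_integrable_low_mode[OF _ m] wn L2_dx_dy u; simp)+
 have "norm ((LBINT y:{0<..<H}. m y * low_mode L H j (pd (0, 1) (w n)) y) - (LBINT y:{0<..<H}. m y * low_mode L H j (dy u) y)) =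
 norm (LBINT y:{0<..<H}. m y * low_mode L H j (pd (0, 1) (w n)) y - m y * low_mode L H j (dy u) y)"
 by (simp only: set_integral_diff(2)[OF i])
 also have "... <= (LBINT y:{0<..<H}. norm (m y * low_mode L H j (pd (0, 1) (w n)) y - m y * low_mode L H j (dy u) y))"
 by (rule set_integral_norm_bound[OF set_integral_diff(1)[OF i]])
 also have "... <= (LBINT y:{0<..<H}. abs B * (?e n * sqrt H))"
 proof (intro set_integral_mono)
 show "sint {0<..<H} (%y. norm (m y * low_mode L H j (pd (0, 1) (w n)) y - m y * low_mode L H j (dy u) y))"
 by (rule set_integrable_norm[OF set_integral_diff(1)[OF i]])
 show "sint {0<..<H} (%y. abs B * (?e n * sqrt H))"
 unfolding set_integrable_def by (intro integrable_scaleR_left integrable_real_indicator) auto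
 fix y assume y: "y : {0<..<H}"
 have "norm (low_mode L H j (pd (0, 1) (w n)) y - low_mode L H j (dy u) y) <= ?e n * sqrt H"
 using low_mode_bound[OF L2_diff[OF wn L2_dx_dy(2)[OF u]], of y j] y
 by (simp add: low_mode_diff wn L2_dx_dy u)
 hence "norm (m y) * norm (low_mode L H j (pd (0, 1) (w n)) y - low_mode L H j (dy u) y) <= abs B * (?e n * sqrt H)"
 using m(2)[OF y] by (intro mult_mono) auto
 thus "norm (m y * low_mode L H j (pd (0, 1) (w n)) y - m y * low_mode L H j (dy u) y) <= abs B * (?e n * sqrt H)"
 unfolding right_diff_distrib[symmetric] norm_mult .
 qed
 also have "... = abs B * (?e n * sqrt H) * H" using H by (simp add: set_int_def)
 finally show "norm ((LBINT y:{0<..<H}. m y * low_mode L H j (pd (0, 1) (w n)) y) - (LBINT y:{0<..<H}. m y * low_mode L H j (dy u) y))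
 <= abs B * (?e n * sqrt H) * H" .
 qed
 qed
 thus ?thesis by (simp add: LIM_zero_iff)
qed

text \<open>Fubini and the fundamental theorem in \<open>y\<close>. Every term other than
  \<open>slice_mode L j w 0\<close> is continuous with respect to the H1 norm, which makes the
  identity useful for traces.\<close>

lemma pr_md_slice_0:
 assumes w: "smooth w" and m: "m : msb borel" "!!y. y : {0<..<H} ==> norm (m y) <= B"
 shows "pr L H w (md L j m) = slice_mode L j w 0 * (LBINT y:{0<..<H}. m y) + (LBINT y:{0<..<H}. m y * low_mode L H j (pd (0, 1) w) y)"
proof -
 have lw: "L2 Om (pd (0, 1) w)" by (intro L2_smooth open_Omega bounded_Omega smooth_pd w Basis_elems)
 have im: "sint {0<..<H} m"
 by (intro L2_interval_imp_integrable l2norm_bounded[OF _ _ m]) auto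
 have "pr L H w (md L j m) = (LBINT y:{0<..<H}. m y * slice_mode L j w y)" by (rule pr_md_smooth(1)[OF w m])
 also have "... = (LBINT y:{0<..<H}. slice_mode L j w 0 * m y + m y * low_mode L H j (pd (0, 1) w) y)"
 proof (intro set_lebesgue_integral_cong ballI allI impI)
 fix y assume "y : {0<..<H}"
 thus "m y * slice_mode L j w y = slice_mode L j w 0 * m y + m y * low_mode L H j (pd (0, 1) w) y"
 by (subst slice_mode_smooth[OF w]) (auto simp: algebra_simps)
 qed simp
 also have "... = slice_mode L j w 0 * (LBINT y:{0<..<H}. m y) + (LBINT y:{0<..<H}. m y * low_mode L H j (pd (0, 1) w) y)"
 using im set_integrable_low_mode[OF lw m, of j] by simp
 finally show ?thesis .
qed

text \<open>The j-th coefficient of the trace at \<open>y = 0\<close>, found by solving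
  \<open>pr_md_slice_0\<close> with the constant weight 1. The formula does not mention an
  approximating sequence, so the sequences that define the traces on different sides all lead to the
  same value.\<close>

definition bottom_mode :: "int => (real \<times> real => complex) => complex" where
 "bottom_mode j u = (pr L H u (md L j (%_. 1)) - (LBINT y:{0<..<H}. low_mode L H j (dy u) y)) / H"

lemma slice_mode_0_tendsto:
 assumes u: "H1 Om u" and w: "smooth_approx u w"
 shows "(%n. slice_mode L j (w n) 0) ----> bottom_mode j u"
proof -
 have "slice_mode L j (w n) 0 = (pr L H (w n) (md L j (%_. 1)) - (LBINT y:{0<..<H}. 1 * low_mode L H j (pd (0, 1) (w n)) y)) / H" for n
 using pr_md_slice_0[OF smooth_approxD(1)[OF w], of "%_. 1" 1 n j] H
 by (simp add: set_int_def scaleR_conv_of_real)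
 moreover have "(%n. (pr L H (w n) (md L j (%_. 1)) - (LBINT y:{0<..<H}. 1 * low_mode L H j (pd (0, 1) (w n)) y)) / H)
 ----> (pr L H u (md L j (%_. 1)) - (LBINT y:{0<..<H}. 1 * low_mode L H j (dy u) y)) / H"
 using H by (intro tendsto_intros smooth_approx_pr low_mode_integral_tendsto[where B=1] u w L2_md[where B=1]) auto
 ultimately show ?thesis by (simp add: bottom_mode_def)
qed

lemma L2_smooth_slice: "smooth w ==> L2 {a<..<b} (%x. w (x, y))" "smooth w ==> L2 {a<..<b} (%y. w (x, y))"
 for w :: "real \<times> real => complex"
proof -
 assume w: "smooth w"
 show "L2 {a<..<b} (%x. w (x, y))" "L2 {a<..<b} (%y. w (x, y))"
 by (intro L2_interval_continuous cont_comp[OF smooth_cont[OF w, of UNIV]] cints; simp)+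
qed

lemma L2_phi: "L2 {0<..<L} (phi L j)"
 by (intro L2_interval_continuous continuous_phi)

lemma trace_pairing_tendsto:
 assumes S: "open S" "bounded S" and v: "!!n. L2 S (v n)" and g: "L2 S g" and m: "L2 S m"
 and lim: "(%n. l2norm S (%s. v n s - g s)) ----> 0"
 shows "(%n. LBINT s:S. v n s * m s) ----> (LBINT s:S. g s * m s)"
proof -
 have "(%n. (LBINT s:S. v n s * m s) - (LBINT s:S. g s * m s)) ----> 0"
 proof (rule Lim_null_comparison)
 show "(%n. l2norm S (%s. v n s - g s) * l2norm S m) ----> 0" using tendsto_mult_left_zero[OF lim] .
 have "(LBINT s:S. v n s * m s) - (LBINT s:S. g s * m s) = (LBINT s:S. (v n s - g s) * m s)" for n
 using L2_mult_integrable[OF v m] L2_mult_integrable[OF g m] by (simp add: left_diff_distrib)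
 thus "\<forall>\<^sub>F n in sequentially. norm ((LBINT s:S. v n s * m s) - (LBINT s:S. g s * m s)) <= l2norm S (%s. v n s - g s) * l2norm S m"
 using l2_Cauchy_Schwarz[OF L2_diff[OF v g] m] by simp
 qed
 thus ?thesis by (simp add: LIM_zero_iff)
qed

lemma V_H1: "V_space L H u ==> H1 Om u" by (simp add: V_space_def)

lemma V_bottom_mode:
 assumes "V_space L H u"
 shows "bottom_mode j u = 0"
proof -
 obtain w where w: "smooth_approx u w" and lim: "(%n. l2norm {0<..<L} (%s. w n (s, 0) - 0)) ----> 0"
 and g: "L2 {0<..<L} (%_. 0)"
 using assms by (auto simp: V_space_def is_trace_bot_def is_trace_def smooth_approx_def)
 have "(%n. slice_mode L j (w n) 0) ----> (LBINT x:{0<..<L}. 0 * phi L (- j) x)"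
 unfolding slice_mode_def
 by (rule trace_pairing_tendsto[OF _ _ _ g L2_phi lim]) (auto intro: L2_smooth_slice smooth_approxD[OF w])
 hence "(%n. slice_mode L j (w n) 0) ----> 0" by simp
 with slice_mode_0_tendsto[OF V_H1[OF assms] w] show ?thesis by (rule LIMSEQ_unique)
qed

text \<open>The smooth approximation in H1 comes with the trace on the bottom side.\<close>

lemma V_approx:
 assumes "V_space L H u"
 obtains w where "smooth_approx u w"
 using assms by (auto simp: V_space_def is_trace_bot_def is_trace_def smooth_approx_def)

text \<open>Since the bottom mode vanishes, the j-th mode of \<open>u\<close> is
  \<open>low_mode\<close> of its y-derivative; the identity expresses this against every bounded
  weight.\<close>

lemma V_pr_md:
 assumes V: "V_space L H u" and m: "m : msb borel" "!!y. y : {0<..<H} ==> norm (m y) <= B"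
 shows "pr L H u (md L j m) = (LBINT y:{0<..<H}. m y * low_mode L H j (dy u) y)"
proof -
 obtain w where w: "smooth_approx u w" by (rule V_approx[OF V])
 note u = V_H1[OF V]
 have "(%n. slice_mode L j (w n) 0 * (LBINT y:{0<..<H}. m y) + (LBINT y:{0<..<H}. m y * low_mode L H j (pd (0, 1) (w n)) y))
 ----> 0 * (LBINT y:{0<..<H}. m y) + (LBINT y:{0<..<H}. m y * low_mode L H j (dy u) y)"
 using slice_mode_0_tendsto[OF u w, of j] V_bottom_mode[OF V, of j]
 by (intro tendsto_intros low_mode_integral_tendsto[OF u w m]) auto
 moreover have "pr L H (w n) (md L j m) = slice_mode L j (w n) 0 * (LBINT y:{0<..<H}. m y) + (LBINT y:{0<..<H}. m y * low_mode L H j (pd (0, 1) (w n)) y)" for n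
 by (rule pr_md_slice_0[OF smooth_approxD(1)[OF w] m])
 ultimately have "(%n. pr L H (w n) (md L j m)) ----> (LBINT y:{0<..<H}. m y * low_mode L H j (dy u) y)"
 by (simp only: mult_zero_left add_0)
 moreover have "(%n. pr L H (w n) (md L j m)) ----> pr L H u (md L j m)"
 by (intro smooth_approx_pr u w L2_md[OF m])
 ultimately show ?thesis by (rule LIMSEQ_unique[symmetric])
qed

text \<open>The sequence defining the top trace converges in L2 on that side. By the fundamental
  theorem its modes there are those at the bottom, which tend to 0, plus \<open>low_mode\<close> of
  the y-derivative at \<open>H\<close>.\<close>

lemma top_trace_modes:
 assumes V: "V_space L H u" and g: "is_trace_top L H u g"
 shows "(LBINT x:{0<..<L}. g x * phi L (- j) x) = low_mode L H j (dy u) H"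
proof -
 obtain w where w: "smooth_approx u w" and lim: "(%n. l2norm {0<..<L} (%s. w n (s, H) - g s)) ----> 0"
 and gL: "L2 {0<..<L} g"
 using g by (auto simp: is_trace_top_def is_trace_def smooth_approx_def)
 note u = V_H1[OF V]
 have lim1: "(%n. slice_mode L j (w n) H) ----> (LBINT x:{0<..<L}. g x * phi L (- j) x)"
 unfolding slice_mode_def
 by (rule trace_pairing_tendsto[OF _ _ _ gL L2_phi lim]) (auto intro: L2_smooth_slice smooth_approxD[OF w])
 have lim2: "(%n. slice_mode L j (w n) 0 + low_mode L H j (pd (0, 1) (w n)) H) ----> 0 + low_mode L H j (dy u) H"
 using slice_mode_0_tendsto[OF u w, of j] V_bottom_mode[OF V, of j] unfolding low_mode_def
 by (intro tendsto_add smooth_approx_pr(2)[OF u w] L2_md_step Basis_elems) auto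
 have "slice_mode L j (w n) H = slice_mode L j (w n) 0 + low_mode L H j (pd (0, 1) (w n)) H" for n
 using H by (intro slice_mode_smooth smooth_approxD[OF w]) auto
 hence "(%n. slice_mode L j (w n) 0 + low_mode L H j (pd (0, 1) (w n)) H) ----> (LBINT x:{0<..<L}. g x * phi L (- j) x)"
 using lim1 by (simp only:)
 from LIMSEQ_unique[OF this lim2] show ?thesis by simp
qed

lemma L2_Omega_continuous:
 assumes "cts UNIV m"
 shows "L2 Om m"
proof -
 have "compact (m ` ({0..L} \<times> {0..H}))" by (intro compact_continuous_image cont_sub[OF assms] compact_Times) auto
 from compact_imp_bounded[OF this] obtain B where "ALL z:{0..L} \<times> {0..H}. norm (m z) <= B" by (auto simp: bounded_iff)
 thus ?thesis using assms
 by (intro L2_Omega_bounded[where B=B] borel_cont) (auto simp: Omega_def)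
qed

text \<open>Integration by parts in \<open>x\<close> against one Fourier mode leaves no boundary
  term for periodic functions. The obstacle is that the left and the right trace come with two
  different approximating sequences, whose boundary values cannot be compared directly.\<close>

lemma V_lateral:
 assumes V: "V_space L H u" and eta: "cts UNIV et"
 shows "pr L H (dx u) (md L j et) = \<i> * lam L j * pr L H u (md L j et)"
proof -
 note u = V_H1[OF V]
 obtain g wl wr where g: "L2 {0<..<H} g"
 and wl: "smooth_approx u wl" and liml: "(%n. l2norm {0<..<H} (%s. wl n (0, s) - g s)) ----> 0"
 and wr: "smooth_approx u wr" and limr: "(%n. l2norm {0<..<H} (%s. wr n (L, s) - g s)) ----> 0"
 using V by (auto simp: V_space_def is_trace_left_def is_trace_right_def is_trace_def smooth_approx_def)
 let ?t = "%xh z. xh (fst z) * et (snd z)"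
 have c: "L2 Om (?t xh)" if "cts UNIV xh" for xh :: "real => complex"
 by (intro L2_Omega_continuous cints cont_comp[OF that] cont_comp[OF eta]) auto
 have lim: "(%n. xh L * (LBINT y:{0<..<H}. w n (L, y) * et y) - xh 0 * (LBINT y:{0<..<H}. w n (0, y) * et y)) \<longlonglongrightarrow>
 pr L H (dx u) (?t xh) + pr L H u (?t xh')"
 if w: "smooth_approx u w" and xi: "!!x. (xh hvd xh' x) (at x)" "cts UNIV xh'" for w xh xh'
 proof -
 have cxi: "cts UNIV xh"
 using xi(1) by (auto intro!: continuous_at_imp_continuous_on has_vector_derivative_continuous)
 have "(%n. pr L H (pd (1, 0) (w n)) (?t xh) + pr L H (w n) (?t xh')) ----> pr L H (dx u) (?t xh) + pr L H u (?t xh')"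
 by (intro tendsto_add smooth_approx_pr u w Basis_elems c cxi xi)
 thus ?thesis by (simp add: pr_x_by_parts_smooth[OF smooth_approxD(1)[OF w] xi eta])
 qed
 have eH: "L2 {0<..<H} et" by (rule L2_interval_continuous[OF eta])
 let ?G = "LBINT y:{0<..<H}. g y * et y"
 have Gl: "(%n. LBINT y:{0<..<H}. wl n (0, y) * et y) ----> ?G"
 by (rule trace_pairing_tendsto[OF _ _ _ g eH liml]) (auto intro: L2_smooth_slice smooth_approxD[OF wl])
 have Gr: "(%n. LBINT y:{0<..<H}. wr n (L, y) * et y) ----> ?G"
 by (rule trace_pairing_tendsto[OF _ _ _ g eH limr]) (auto intro: L2_smooth_slice smooth_approxD[OF wr])
 \<comment> \<open>The weight \<open>x - L\<close> sees only the left side and is used with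
   \<open>wl\<close>, the weight \<open>x\<close> sees only the right side and is used with
   \<open>wr\<close>. Both lead to the common trace \<open>g\<close>; subtraction shows that the
   x-derivative has zero pairing with functions of \<open>y\<close> alone, and so the values of
   \<open>wl\<close> on the two sides become equal in the limit.\<close>
 have d1: "((%x. cor x - cor a) hvd 1) (at x)" for x a
 by (auto intro!: deqs has_vector_derivative_of_real simp: real_deriv_iff[symmetric])
 have "(%n. - (0 - L) * (LBINT y:{0<..<H}. wl n (0, y) * et y)) ----> - (0 - cor L) * ?G"
 by (intro tendsto_intros) (use Gl in auto)
 with lim[OF wl d1[of L]] have eq1: "cor L * ?G = pr L H (dx u) (?t (%x. of_real x - of_real L)) + pr L H u (?t (%_. 1))"
 by (intro LIMSEQ_unique[OF _ lim[OF wl d1[of L]]]) (auto intro: Gl tendsto_mult_left)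
 have eq2: "cor L * ?G = pr L H (dx u) (?t (%x. of_real x - of_real 0)) + pr L H u (?t (%_. 1))"
 by (intro LIMSEQ_unique[OF _ lim[OF wr d1[of 0]]]) (auto intro: Gr tendsto_mult_left)
 have "pr L H (dx u) (?t (%x. of_real x - of_real 0)) - pr L H (dx u) (?t (%x. of_real x - of_real L)) =
 pr L H (dx u) (%z. ?t (%x. of_real x - of_real 0) z - ?t (%x. of_real x - of_real L) z)"
 by (intro pr_diff_right[symmetric] L2_dx_dy u c cints)
 also have "... = pr L H (dx u) (%z. L * ?t (%_. 1) z)" by (simp add: algebra_simps)
 finally have x0: "pr L H (dx u) (?t (%_. 1)) = 0" using eq1 eq2 L by (simp add: pr_cmult_right)
 have "(%n. (LBINT y:{0<..<H}. wl n (L, y) * et y) - (LBINT y:{0<..<H}. wl n (0, y) * et y)) ----> 0"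
 using lim[OF wl, of "%_. 1" "%_. 0"] x0 by (simp add: pr_def)
 hence "(%n. phi L (- j) 0 * ((LBINT y:{0<..<H}. wl n (L, y) * et y) - (LBINT y:{0<..<H}. wl n (0, y) * et y))) ----> phi L (- j) 0 * 0"
 by (rule tendsto_mult_left)
 moreover have "(%n. phi L (- j) L * (LBINT y:{0<..<H}. wl n (L, y) * et y) - phi L (- j) 0 * (LBINT y:{0<..<H}. wl n (0, y) * et y)) \<longlonglongrightarrow>
 pr L H (dx u) (?t (phi L (- j))) + pr L H u (?t (%x. \<i> * lam L (- j) * phi L (- j) x))"
 by (intro lim[OF wl] phi_has_derivative cints continuous_phi)
 ultimately have "pr L H (dx u) (?t (phi L (- j))) + pr L H u (?t (%x. \<i> * lam L (- j) * phi L (- j) x)) = 0"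
 using L by (intro LIMSEQ_unique) (auto simp: phi_periodic right_diff_distrib)
 moreover have "pr L H u (?t (%x. \<i> * lam L (- j) * phi L (- j) x)) = \<i> * lam L (- j) * pr L H u (?t (phi L (- j)))"
 using pr_cmult_right[of u "\<i> * lam L (- j)" "?t (phi L (- j))"] by (simp add: mult.assoc)
 moreover have "md L j et = ?t (phi L (- j))" by (auto simp: md_def)
 moreover have "lam L (- j) = - lam L j" by (simp add: lam_def)
 ultimately show ?thesis by (simp add: add_eq_0_iff)
qed

lemma L2_mean:
 assumes f: "L2 Om f"
 shows "L2 {0<..<L} (%x. LBINT y:{0<..<H}. f (x, y))"
 and "l2norm {0<..<L} (%x. LBINT y:{0<..<H}. f (x, y)) <= sqrt H * l2norm Om f"
proof -
 let ?F = "%x. LBINT y:{0<..<H}. f (x, y)" and ?N = "%x. LBINT y:{0<..<H}. (norm (f (x, y)))^2"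
 have i: "sint ({0<..<L} \<times> {0<..<H}) f"
 using L2_mult_integrable[OF f L2_Omega_bounded[of "%_. 1" 1]] by (simp add: Omega_def)
 have i2: "sint ({0<..<L} \<times> {0<..<H}) (%z. (norm (f z))^2)"
 using f by (simp add: L2_def Omega_def)
 have iN: "sint {0<..<L} (%x. H * ?N x)" using set_integrable_Times_iterated(1)[OF i2] by simp
 have mF: "set_borel_measurable lborel {0<..<L} ?F"
 using set_integrable_Times_iterated(1)[OF i] by (auto simp: set_integrable_def set_meas_def)
 have ae: "AE x in lborel. x : {0<..<L} --> (norm (?F x))^2 <= H * ?N x"
 using set_integrable_Times_iterated(3)[OF i] set_integrable_Times_iterated(3)[OF i2]
 proof eventually_elim
 case (elim x)
 show ?case
 proof
 assume "x : {0<..<L}"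
 with elim have a: "L2 {0<..<H} (%y. f (x, y))"
 by (auto simp: L2_def set_integrable_def set_meas_def)
 have one: "L2 {0<..<H} (%_. 1)" by (rule L2_interval_continuous) auto
 have n1: "(l2norm {0<..<H} (%_. 1))^2 = H" using H by (simp add: l2norm_sq set_int_def)
 have "norm (?F x) <= l2norm {0<..<H} (%y. f (x, y)) * l2norm {0<..<H} (%_. 1)"
 using l2_Cauchy_Schwarz[OF a one] by simp
 hence "(norm (?F x))^2 <= (l2norm {0<..<H} (%y. f (x, y)) * l2norm {0<..<H} (%_. 1))^2" by (intro power_mono) auto
 thus "(norm (?F x))^2 <= H * ?N x" using n1 by (simp add: power_mult_distrib l2norm_sq mult.commute)
 qed
 qed
 have iF: "sint {0<..<L} (%x. (norm (?F x))^2)"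
 unfolding set_integrable_def
 proof (rule Bochner_Integration.integrable_bound)
 show "integrable lborel (%x. indicator {0<..<L} x *R (H * ?N x))" using iN by (simp add: set_integrable_def)
 have [measurable]: "(%x. indicator {0<..<L} x *R ?F x) : msb lborel" using mF by (simp add: set_meas_def)
 have "(%x. (norm (indicator {0<..<L} x *R ?F x))^2) : msb lborel" by measurable
 moreover have "(%x. (norm (indicator {0<..<L} x *R ?F x))^2) = (%x. indicator {0<..<L} x *R (norm (?F x))^2)"
 by (auto simp: indicator_def)
 ultimately show "(%x. indicator {0<..<L} x *R (norm (?F x))^2) : msb lborel" by simp
 show "AE x in lborel. norm (indicator {0<..<L} x *R (norm (?F x))^2) <= norm (indicator {0<..<L} x *R (H * ?N x))"
 using ae by eventually_elim (auto simp: indicator_def)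
 qed
 show "L2 {0<..<L} ?F" using mF iF by (simp add: L2_def)
 have "(l2norm {0<..<L} ?F)^2 <= (LBINT x:{0<..<L}. H * ?N x)"
 unfolding l2norm_sq by (intro set_integral_mono_AE iF iN) (use ae in auto)
 also have "... = H * (l2norm Om f)^2"
 using set_integral_Times(1)[OF i2] by (simp add: l2norm_sq Omega_def)
 finally have "l2norm {0<..<L} ?F <= sqrt (H * (l2norm Om f)^2)" by (rule real_le_rsqrt)
 thus "l2norm {0<..<L} ?F <= sqrt H * l2norm Om f" by (simp add: real_sqrt_mult l2norm_nonneg)
qed

lemma L2_snd_mult:
 assumes "L2 Om f"
 shows "L2 Om (%z. cor (snd z) * f z)" "l2norm Om (%z. cor (snd z) * f z) <= H * l2norm Om f"
proof -
 have [measurable]: "(%z. indicator Om z *R f z) : msb lborel"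
 using assms by (auto simp: set_meas_def L2_def)
 have [measurable]: "(%z::real \<times> real. cor (snd z)) : msb borel"
 by (intro borel_cont cints)
 have "(%z. cor (snd z) * (indicator Om z *R f z)) : msb lborel" by measurable
 hence m: "set_borel_measurable lborel Om (%z. cor (snd z) * f z)"
 by (simp add: set_meas_def)
 have le: "(norm (cor (snd z) * f z))^2 <= H^2 * (norm (f z))^2" if "z : Om" for z
 using that by (auto simp: Omega_def norm_mult power_mult_distrib intro!: mult_right_mono power_mono)
 have if2: "sint Om (%z. H^2 * (norm (f z))^2)" using assms by (simp add: L2_def)
 have i: "sint Om (%z. (norm (cor (snd z) * f z))^2)"
 unfolding set_integrable_def
 proof (rule Bochner_Integration.integrable_bound)
 show "integrable lborel (%z. indicator Om z *R (H^2 * (norm (f z))^2))" using if2 by (simp add: set_integrable_def)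
 have "(%z. (norm (cor (snd z) * (indicator Om z *R f z)))^2) : msb lborel" by measurable
 moreover have "(%z. (norm (cor (snd z) * (indicator Om z *R f z)))^2) = (%z. indicator Om z *R (norm (cor (snd z) * f z))^2)"
 by (auto simp: indicator_def)
 ultimately show "(%z. indicator Om z *R (norm (cor (snd z) * f z))^2) : msb lborel" by simp
 show "AE z in lborel. norm (indicator Om z *R (norm (cor (snd z) * f z))^2) <= norm (indicator Om z *R (H^2 * (norm (f z))^2))"
 using le by (intro AE_I2) (auto simp: indicator_def)
 qed
 show "L2 Om (%z. cor (snd z) * f z)" using m i by (simp add: L2_def)
 have "(l2norm Om (%z. cor (snd z) * f z))^2 <= (LBINT z:Om. H^2 * (norm (f z))^2)"
 unfolding l2norm_sq by (intro set_integral_mono i if2 le)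
 also have "... = (H * l2norm Om f)^2" by (simp add: l2norm_sq power_mult_distrib)
 finally show "l2norm Om (%z. cor (snd z) * f z) <= H * l2norm Om f"
 by (rule power2_le_imp_le) (use H in \<open>simp add: l2norm_nonneg\<close>)
qed

text \<open>The trace is explicit, by integrating \<open>\<partial>\<^sub>y (y u)\<close> over \<open>(0,H)\<close>.\<close>

lemma top_trace_exists:
 assumes u: "H1 Om u" and w: "smooth_approx u w"
 shows "EX g. is_trace_top L H u g"
proof -
 let ?f = "%z. u z + cor (snd z) * dy u z"
 let ?fn = "%n z. w n z + cor (snd z) * pd (0, 1) (w n) z"
 define g where "g x = inverse (cor H) * (LBINT y:{0<..<H}. ?f (x, y))" for x
 have lf: "L2 Om ?f" by (intro L2_add H1_L2 L2_snd_mult L2_dx_dy u)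
 have lfn: "L2 Om (?fn n)" for n by (intro L2_add smooth_approxD[OF w] L2_snd_mult Basis_elems)
 have gL: "L2 {0<..<L} g" unfolding g_def by (intro L2_cmult L2_mean lf)
 have wH: "w n (x, H) = inverse (cor H) * (LBINT y:{0<..<H}. ?fn n (x, y))" for n x
 proof -
 have "(LBINT y:{0<..<H}. y *R pd (0, 1) (w n) (x, y) + 1 *R w n (x, y)) = H *R w n (x, H) - 0 *R w n (x, 0)"
 proof (rule set_integral_FTC)
 show "((%y. y *R w n (x, y)) hvd y *R pd (0, 1) (w n) (x, y) + 1 *R w n (x, y)) (at y)" for y
 by (intro has_vector_derivative_scaleR has_vector_derivative_slice_y smooth_differentiable smooth_approxD[OF w] DERIV_ident)
 show "cts UNIV (%y. y *R pd (0, 1) (w n) (x, y) + 1 *R w n (x, y))"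
 by (intro cints cont_comp[OF smooth_cont[OF smooth_approxD(1)[OF w], of UNIV]]
 cont_comp[OF smooth_cont[OF smooth_approxD(3)[OF w Basis_elems(2)], of UNIV]]) auto
 qed (use H in simp)
 thus ?thesis using H by (simp add: scaleR_conv_of_real add.commute)
 qed
 have le: "l2norm {0<..<L} (%x. w n (x, H) - g x) <= (1 / H) * (sqrt H * (l2norm Om (%z. w n z - u z) + H * l2norm Om (%z. pd (0, 1) (w n) z - dy u z)))" for n
 proof -
 let ?d = "%z. (w n z - u z) + cor (snd z) * (pd (0, 1) (w n) z - dy u z)"
 have ld: "L2 Om ?d"
 by (intro L2_add L2_diff L2_snd_mult H1_L2 u L2_dx_dy smooth_approxD[OF w] Basis_elems)
 have si: "sint ({0<..<L} \<times> {0<..<H}) f" if "L2 Om f" for f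
 using L2_mult_integrable[OF that L2_Omega_bounded[of "%_. 1" 1]] by (simp add: Omega_def)
 have "AE x in lborel. x : {0<..<L} --> w n (x, H) - g x = inverse (cor H) * (LBINT y:{0<..<H}. ?d (x, y))"
 using set_integrable_Times_iterated(3)[OF si[OF lf]] set_integrable_Times_iterated(3)[OF si[OF lfn[of n]]]
 proof eventually_elim
 case (elim x)
 show ?case
 proof
 assume "x : {0<..<L}"
 with elim have "(LBINT y:{0<..<H}. ?fn n (x, y)) - (LBINT y:{0<..<H}. ?f (x, y)) = (LBINT y:{0<..<H}. ?fn n (x, y) - ?f (x, y))"
 by (intro set_integral_diff(2)[symmetric]) auto
 also have "... = (LBINT y:{0<..<H}. ?d (x, y))" by (simp add: algebra_simps)
 finally show "w n (x, H) - g x = inverse (cor H) * (LBINT y:{0<..<H}. ?d (x, y))"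
 unfolding wH g_def by (simp flip: right_diff_distrib)
 qed
 qed
 hence "l2norm {0<..<L} (%x. w n (x, H) - g x) = l2norm {0<..<L} (%x. inverse (cor H) * (LBINT y:{0<..<H}. ?d (x, y)))"
 using L2_diff[OF L2_smooth_slice(1)[OF smooth_approxD(1)[OF w], of 0 L n H] gL]
 by (intro L2_cong_AE(2) L2_cmult L2_mean ld) (auto simp: L2_def)
 also have "... = (1 / H) * l2norm {0<..<L} (%x. LBINT y:{0<..<H}. ?d (x, y))"
 using H by (subst L2_cmult(2)[OF L2_mean(1)[OF ld]]) (simp add: norm_inverse norm_divide inverse_eq_divide)
 also have "... <= (1 / H) * (sqrt H * l2norm Om ?d)"
 using H by (intro mult_left_mono L2_mean ld) auto
 also have "... <= (1 / H) * (sqrt H * (l2norm Om (%z. w n z - u z) + H * l2norm Om (%z. pd (0, 1) (w n) z - dy u z)))"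
 proof (intro mult_left_mono)
 have "l2norm Om ?d <= l2norm Om (%z. w n z - u z) + l2norm Om (%z. cor (snd z) * (pd (0, 1) (w n) z - dy u z))"
 by (intro l2norm_triangle L2_diff L2_snd_mult H1_L2 u L2_dx_dy smooth_approxD[OF w] Basis_elems)
 also have "l2norm Om (%z. cor (snd z) * (pd (0, 1) (w n) z - dy u z)) <= H * l2norm Om (%z. pd (0, 1) (w n) z - dy u z)"
 by (intro L2_snd_mult L2_diff L2_dx_dy u smooth_approxD[OF w] Basis_elems)
 finally show "l2norm Om ?d <= l2norm Om (%z. w n z - u z) + H * l2norm Om (%z. pd (0, 1) (w n) z - dy u z)" by simp
 qed (use H in auto)
 finally show ?thesis .
 qed
 have "(%n. (1 / H) * (sqrt H * (l2norm Om (%z. w n z - u z) + H * l2norm Om (%z. pd (0, 1) (w n) z - dy u z)))) \<longlonglongrightarrow>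
 (1 / H) * (sqrt H * (0 + H * 0))"
 by (intro tendsto_intros smooth_approx_l2 u w Basis_elems)
 hence lim0: "(%n. (1 / H) * (sqrt H * (l2norm Om (%z. w n z - u z) + H * l2norm Om (%z. pd (0, 1) (w n) z - dy u z)))) ----> 0"
 by simp
 have "(%n. l2norm {0<..<L} (%x. w n (x, H) - g x)) ----> 0"
 by (rule tendsto_sandwich[OF _ _ tendsto_const lim0]) (intro always_eventually allI l2norm_nonneg le)+
 hence "is_trace_top L H u g"
 using u gL w unfolding is_trace_top_def is_trace_def smooth_approx_def by blast
 thus ?thesis by blast
qed

lemma tr_top_is_trace:
 assumes "V_space L H u"
 shows "is_trace_top L H u (tr_top L H u)"
proof -
 obtain w where "smooth_approx u w" by (rule V_approx[OF assms])
 from top_trace_exists[OF V_H1[OF assms] this] show ?thesis unfolding tr_top_def by (rule someI_ex)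
qed

lemma tr_top_L2: "V_space L H u ==> L2 {0<..<L} (tr_top L H u)"
 using tr_top_is_trace by (auto simp: is_trace_top_def is_trace_def)

lemma tr_top_modes:
 "V_space L H u ==> (LBINT x:{0<..<L}. tr_top L H u x * phi L (- j) x) = low_mode L H j (dy u) H"
 by (intro top_trace_modes tr_top_is_trace)

text \<open>Through completeness an L2 trace is determined by its Fourier coefficients, so the
  choice made in \<open>tr_top\<close> does not matter.\<close>

lemma L2_AE_eq_if_modes_eq:
 assumes "L2 {0<..<L} f" "L2 {0<..<L} g"
 and "!!j. (LBINT x:{0<..<L}. f x * phi L (- j) x) = (LBINT x:{0<..<L}. g x * phi L (- j) x)"
 shows "AE x in lborel. x : {0<..<L} --> f x = g x"
proof -
 have "AE x in lborel. x : {0<..<L} --> f x - g x = 0"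
 proof (rule Fourier_complete[OF L])
 show "sint {0<..<L} (%x. f x - g x)"
 by (intro L2_interval_imp_integrable L2_diff assms)
 fix j
 show "(LBINT x:{0<..<L}. (f x - g x) * phi L j x) = 0"
 using assms(3)[of "- j"] L2_mult_integrable[OF assms(1) L2_phi] L2_mult_integrable[OF assms(2) L2_phi]
 by (simp add: left_diff_distrib)
 qed
 thus ?thesis by simp
qed

end

lemma has_vector_derivative_if_quotient:
 fixes f :: "real => 'b::real_normed_vector"
 assumes "((%s. norm ((f s - f t) /\<^sub>R (s - t) - D)) ---> 0) (at t within S)"
 shows "(f hvd D) (at t within S)"
 unfolding has_vector_derivative_def has_derivative_within'
proof (intro conjI allI impI)
 show "bounded_linear (%x. x *R D)" by (rule bounded_linear_scaleR_left)
 fix e :: real assume "e > 0"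
 from tendstoD[OF assms this]
 obtain d where d: "d > 0" "!!s. s : S ==> s ~= t ==> dist s t < d ==> norm ((f s - f t) /\<^sub>R (s - t) - D) < e"
 unfolding eventually_at by auto
 have "norm (f s - f t - (s - t) *R D) / norm (s - t) < e" if "s : S" "0 < norm (s - t)" "norm (s - t) < d" for s
 proof -
 have "(f s - f t) /\<^sub>R (s - t) - D = (f s - f t - (s - t) *R D) /\<^sub>R (s - t)"
 using that by (simp add: scaleR_diff_right)
 hence "norm (f s - f t - (s - t) *R D) / norm (s - t) = norm ((f s - f t) /\<^sub>R (s - t) - D)"
 by (simp add: divide_inverse_commute)
 thus ?thesis using d(2)[of s] that by (simp add: dist_real_def)
 qed
 thus "EX d>0. ALL x':S. 0 < norm (x' - t) & norm (x' - t) < d -->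
 norm (f x' - f t - (x' - t) *R D) / norm (x' - t) < e"
 using d(1) by blast
qed

lemma smooth_of_real:
 fixes f :: "'a::euclidean_space => real"
 shows "smooth f ==> smooth (%z. cor (f z))"
 unfolding smooth_def using Ck_bounded_linear[OF bounded_linear_of_real] by blast

lemma smooth_antiderivative_from_0:
 fixes f :: "real => complex"
 assumes "smooth f"
 obtains F where "smooth F" "F 0 = 0" "!!x. (F hvd f x) (at x)"
proof -
 have "EX F. ALL x::real. -\<infinity> < ereal x --> ereal x < \<infinity> --> (F hvd f x) (at x)"
 by (rule einterval_antiderivative) (use smooth_cont[OF assms, of UNIV] in \<open>auto simp: continuous_on_eq_continuous_at\<close>)
 then obtain F where F: "!!x. (F hvd f x) (at x)" by auto
 define G where "G x = F x - F 0" for x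
 have G: "(G hvd f x) (at x)" for x
 unfolding G_def by (auto intro!: deqs F)
 have "Ck n G" for n
 using assms unfolding smooth_def by (intro Ck_SucD[OF Ck_antiderivative[OF G]]) blast
 hence "smooth G" by (simp add: smooth_def)
 thus ?thesis using that[of G] G by (simp add: G_def)
qed

section \<open>Testing the boundary condition with single Fourier modes\<close>

context rectangle
begin

lemma smooth_md: "smooth et ==> smooth (md L j et)"
proof -
 assume "smooth et"
 from smooth_mult[OF smooth_affine[OF bounded_linear_fst smooth_phi, where d=0] smooth_affine[OF bounded_linear_snd this, where d=0]]
 have "smooth (%z. phi L (- j) (fst z) * et (snd z))" by (simp only: add_0_right)
 moreover have "md L j et = (%z. phi L (- j) (fst z) * et (snd z))" by (auto simp: md_def)
 ultimately show ?thesis by simp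
qed

text \<open>\<open>wderiv\<close> of the zero function is itself a chosen function, known to vanish
  only almost everywhere.\<close>

lemma h1norm_zero: "h1norm Om (%_. 0) = 0"
proof -
 have z: "smooth (%_::real \<times> real. 0::complex)" by (simp add: smooth_def Ck_const)
 have "l2norm Om (wderiv Om e (%_. 0 :: complex)) = 0" if e: "e : Basis" for e :: "real \<times> real"
 proof -
 have "pd e (%_::real \<times> real. 0::complex) z = 0" for z by (rule pd_eq) simp
 hence "AE z in lborel. z : Om --> wderiv Om e (%_. 0) z = (%_. 0 :: complex) z"
 using wderiv_smooth[OF open_Omega z e] by simp
 moreover have "L2 Om (%_. 0)" by (rule L2_smooth[OF open_Omega bounded_Omega z])
 moreover have "set_borel_measurable lborel Om (wderiv Om e (%_. 0 :: complex))"
 using H1_wderiv(2)[OF open_Omega H1_smooth[OF open_Omega bounded_Omega z] e] by (simp add: L2_def)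
 ultimately have "l2norm Om (wderiv Om e (%_. 0)) = l2norm Om (%_. 0)" by (intro L2_cong_AE(2))
 thus ?thesis by (simp add: l2norm_def)
 qed
 thus ?thesis by (simp add: h1norm_def l2norm_def)
qed

lemma is_trace_smooth:
 assumes v: "smooth v" and "L2 I (%s. v (ga s))"
 shows "is_trace L H ga I v (%s. v (ga s))"
 unfolding is_trace_def using assms H1_smooth[OF open_Omega bounded_Omega v]
 by (auto intro!: exI[of _ "%_. v"] simp: h1norm_zero l2norm_def)

lemma V_md:
 assumes "smooth et" "et 0 = 0"
 shows "V_space L H (md L j et)"
proof -
 note v = smooth_md[OF assms(1), of j]
 have "is_trace_left L H (md L j et) (%y. md L j et (0, y))"
 unfolding is_trace_left_def by (intro is_trace_smooth v L2_smooth_slice)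
 moreover have "is_trace_right L H (md L j et) (%y. md L j et (L, y))"
 unfolding is_trace_right_def by (intro is_trace_smooth v L2_smooth_slice)
 moreover have "(%y. md L j et (L, y)) = (%y. md L j et (0, y))" using phi_periodic[OF L] by (simp add: md_def)
 moreover have "is_trace_bot L H (md L j et) (%x. md L j et (x, 0))"
 unfolding is_trace_bot_def by (intro is_trace_smooth v L2_smooth_slice)
 moreover have "(%x. md L j et (x, 0)) = (%_. 0)" using assms(2) by (simp add: md_def)
 ultimately show ?thesis
 unfolding V_space_def using H1_smooth[OF open_Omega bounded_Omega v] by auto
qed

lemma pd_md:
 assumes eta: "smooth et" "!!y. (et hvd et' y) (at y)"
 shows "pd (1, 0) (md L j et) = (%z. - (\<i> * lam L j) * md L j et z)" "pd (0, 1) (md L j et) = md L j et'"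
proof -
 note d = smooth_differentiable[OF smooth_md[OF eta(1), of j]]
 have lm: "lam L (- j) = - lam L j" by (simp add: lam_def)
 show "pd (1, 0) (md L j et) = (%z. - (\<i> * lam L j) * md L j et z)"
 proof
 fix z :: "real \<times> real"
 obtain x y where z: "z = (x, y)" by (cases z)
 have "((%x. md L j et (x, y)) hvd (\<i> * lam L (- j) * phi L (- j) x) * et y) (at x)"
 unfolding md_def fst_conv snd_conv by (intro has_vector_derivative_mult_left phi_has_derivative)
 from vector_derivative_unique_at[OF has_vector_derivative_slice_x[OF d] this]
 show "pd (1, 0) (md L j et) z = - (\<i> * lam L j) * md L j et z" by (simp add: z md_def lm)
 qed
 show "pd (0, 1) (md L j et) = md L j et'"
 proof
 fix z :: "real \<times> real"
 obtain x y where z: "z = (x, y)" by (cases z)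
 have "((%y. md L j et (x, y)) hvd phi L (- j) x * et' y) (at y)"
 unfolding md_def fst_conv snd_conv by (intro has_vector_derivative_mult_right eta)
 from vector_derivative_unique_at[OF has_vector_derivative_slice_y[OF d] this]
 show "pd (0, 1) (md L j et) z = md L j et' z" by (simp add: z md_def)
 qed
qed

lemma L2_lapl:
 assumes "weak_lapl Om p g" "L2 Om g"
 shows "L2 Om (lapl Om p)"
 using lapl_AE_eq[OF open_Omega assms(1)]
 by (intro L2_cong_AE(1)[OF assms(2)] set_borel_measurable_loc_integrable open_Omega) (auto simp: weak_lapl_def)

lemma L2_md_continuous: "cts UNIV et ==> L2 Om (md L j et)"
proof -
 assume e: "cts UNIV et"
 have "cts UNIV (%z::real \<times> real. phi L (- j) (fst z))"
 by (rule cont_comp[OF continuous_phi[of UNIV] continuous_on_fst[OF continuous_on_id]]) simp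
 moreover have "cts UNIV (%z::real \<times> real. et (snd z))"
 by (rule cont_comp[OF e continuous_on_snd[OF continuous_on_id]]) simp
 ultimately show ?thesis
 unfolding md_def by (intro L2_Omega_continuous continuous_on_mult)
qed

text \<open>The x-derivative of the test function is \<open>- (i * lam L j)\<close> times the
  function, and \<open>V_lateral\<close> supplies the second factor \<open>i * lam L j\<close>;
  their product is \<open>(lam L j)^2\<close>.\<close>

lemma normal_pairing_md:
 assumes V: "V_space L H p" and n: "L2 Om (lapl Om p)"
 and eta: "smooth et" "!!y. (et hvd et' y) (at y)" "cts UNIV et'"
 shows "normal_pairing L H p (md L j et) =
 pr L H (lapl Om p) (md L j et) + (lam L j)^2 * pr L H p (md L j et) + pr L H (dy p) (md L j et')"
proof -
 note p = V_H1[OF V]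
 let ?v = "md L j et"
 note v = smooth_md[OF eta(1), of j]
 note vH = H1_smooth[OF open_Omega bounded_Omega v]
 have Lv: "L2 Om ?v" "L2 Om (md L j et')" using eta smooth_cont by (auto intro: L2_md_continuous)
 have i: "sint Om (%z. lapl Om p z * ?v z)" "sint Om (%z. dx p z * dx ?v z)"
 "sint Om (%z. dy p z * dy ?v z)"
 by (intro L2_mult_integrable n Lv L2_dx_dy p vH)+
 have "normal_pairing L H p ?v = (LBINT z:Om. lapl Om p z * ?v z + (dx p z * dx ?v z + dy p z * dy ?v z))"
 by (simp add: normal_pairing_def Basis_real_prod)
 also have "... = pr L H (lapl Om p) ?v + (pr L H (dx p) (dx ?v) + pr L H (dy p) (dy ?v))"
 unfolding pr_def using i by simp
 also have "pr L H (dx p) (dx ?v) = pr L H (dx p) (%z. - (\<i> * lam L j) * ?v z)"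
 using wderiv_smooth[OF open_Omega v Basis_elems(1)]
 by (intro pr_cong_AE L2_dx_dy p vH L2_cmult Lv) (auto simp: pd_md[OF eta(1,2)])
 also have "... = (lam L j)^2 * pr L H p ?v"
 by (subst pr_cmult_right) (simp add: V_lateral[OF V smooth_cont[OF eta(1)]] power2_eq_square mult_ac)
 also have "pr L H (dy p) (dy ?v) = pr L H (dy p) (md L j et')"
 using wderiv_smooth[OF open_Omega v Basis_elems(2)]
 by (intro pr_cong_AE L2_dx_dy p vH Lv) (auto simp: pd_md[OF eta(1,2)])
 finally show ?thesis by simp
qed

lemma tr_top_md:
 assumes "smooth et" "et 0 = 0"
 shows "AE x in lborel. x : {0<..<L} --> tr_top L H (md L j et) x = phi L (- j) x * et H"
proof -
 note v = smooth_md[OF assms(1), of j]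
 note V = V_md[OF assms, of j]
 have t: "is_trace_top L H (md L j et) (%x. md L j et (x, H))"
 unfolding is_trace_top_def by (intro is_trace_smooth v L2_smooth_slice)
 have "AE x in lborel. x : {0<..<L} --> tr_top L H (md L j et) x = md L j et (x, H)"
 using top_trace_modes[OF V t] tr_top_modes[OF V]
 by (intro L2_AE_eq_if_modes_eq tr_top_L2 V L2_smooth_slice v) simp
 thus ?thesis by (simp add: md_def)
qed

lemma boundary_term_md:
 assumes q: "V_space L H q" and eta: "smooth et" "et 0 = 0"
 shows "(LBINT x:{0<..<L}. tr_top L H q x * tr_top L H (md L j et) x) = low_mode L H j (dy q) H * et H"
proof -
 have "(LBINT x:{0<..<L}. tr_top L H q x * tr_top L H (md L j et) x) = (LBINT x:{0<..<L}. (tr_top L H q x * phi L (- j) x) * et H)"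
 unfolding set_int_def
 proof (rule integral_cong_AE)
 show "(%x. indicator {0<..<L} x *R (tr_top L H q x * tr_top L H (md L j et) x)) : msb lborel"
 using L2_mult_integrable[OF tr_top_L2[OF q] tr_top_L2[OF V_md[OF eta]]] by (auto simp: set_integrable_def)
 have "sint {0<..<L} (%x. tr_top L H q x * phi L (- j) x * et H)"
 using L2_mult_integrable[OF tr_top_L2[OF q] L2_phi] by simp
 thus "(%x. indicator {0<..<L} x *R (tr_top L H q x * phi L (- j) x * et H)) : msb lborel"
 by (auto simp: set_integrable_def)
 show "AE x in lborel. indicator {0<..<L} x *R (tr_top L H q x * tr_top L H (md L j et) x) =
 indicator {0<..<L} x *R (tr_top L H q x * phi L (- j) x * et H)"
 using tr_top_md[OF eta, of j] by eventually_elim (auto simp: indicator_def)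
 qed
 also have "... = low_mode L H j (dy q) H * et H" using tr_top_modes[OF q, of j] by simp
 finally show ?thesis .
qed

lemma pr_md_dominated:
 assumes u: "L2 Om u" and m: "!!n. m n : msb borel" "m' : msb borel"
 and B: "!!n y. y : {0<..<H} ==> norm (m n y) <= B"
 and lim: "!!y. y : {0<..<H} ==> (%n. m n y) ----> m' y"
 shows "(%n. pr L H u (md L j (m n))) ----> pr L H u (md L j m')"
 unfolding pr_def set_int_def
proof (rule integral_dominated_convergence[where w="%z. indicator Om z *R (norm (u z) * (B / sqrt L))"])
 have [measurable]: "(%z. indicator Om z *R u z) : msb lborel"
 using u by (auto simp: set_meas_def L2_def)
 have e: "indicator Om z *R (u z * m z) = (indicator Om z *R u z) * m z" for m z by simp
 note [measurable] = m md_measurable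
 show "(%z. indicator Om z *R (u z * md L j (m n) z)) : msb lborel" for n
 unfolding e by measurable
 show "(%z. indicator Om z *R (u z * md L j m' z)) : msb lborel" unfolding e by measurable
 have "sint Om (%z. norm (u z * 1))"
 by (intro set_integrable_norm L2_mult_integrable u L2_Omega_bounded[where B=1]) auto
 hence "integrable lborel (%z. (indicator Om z *R norm (u z)) * (B / sqrt L))"
 unfolding set_integrable_def by (intro integrable_mult_left) simp
 thus "integrable lborel (%z. indicator Om z *R (norm (u z) * (B / sqrt L)))"
 by (simp only: real_scaleR_def mult.assoc)
 show "AE z in lborel. (%n. indicator Om z *R (u z * md L j (m n) z)) ----> indicator Om z *R (u z * md L j m' z)"
 proof (rule AE_I2)
 fix z
 show "(%n. indicator Om z *R (u z * md L j (m n) z)) ----> indicator Om z *R (u z * md L j m' z)"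
 proof (cases "z : Om")
 case True
 hence "(%n. m n (snd z)) ----> m' (snd z)" by (intro lim) (auto simp: Omega_def)
 thus ?thesis unfolding md_def by (intro tendsto_intros)
 qed simp
 qed
 show "AE z in lborel. norm (indicator Om z *R (u z * md L j (m n) z)) <= indicator Om z *R (norm (u z) * (B / sqrt L))" for n
 proof (rule AE_I2)
 fix z
 show "norm (indicator Om z *R (u z * md L j (m n) z)) <= indicator Om z *R (norm (u z) * (B / sqrt L))"
 proof (cases "z : Om")
 case True
 hence "norm (m n (snd z)) / sqrt L <= B / sqrt L" using L by (intro divide_right_mono B) (auto simp: Omega_def)
 from mult_left_mono[OF this norm_ge_zero[of "u z"]] show ?thesis using True by (simp add: norm_mult norm_md)
 qed simp
 qed
qed

text \<open>Tested with \<open>phi L (- j) x * min s y\<close> as a function of the point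
  \<open>(x, s)\<close>, the weak condition in \<open>D_A\<close> becomes the twice integrated
  differential equation of the mode, together with its condition at \<open>H\<close>. The derivative
  of \<open>min s y\<close> in \<open>s\<close> is the indicator of \<open>s < y\<close>, the weight
  in \<open>low_mode\<close>.\<close>

lemma mode_identity:
 assumes DA: "D_A L H bt p q" and y: "y : {0..H}"
 shows "low_mode L H j (dy p) y = - pr L H (lapl Om p) (md L j (%s. of_real (min s y)))
 - (lam L j)^2 * pr L H p (md L j (%s. of_real (min s y))) - bt * low_mode L H j (dy q) H * y"
proof -
 have Vp: "V_space L H p" and Vq: "V_space L H q" using DA by (auto simp: D_A_def)
 have n: "L2 Om (lapl Om p)" using DA L2_lapl by (auto simp: D_A_def)
 \<comment> \<open>\<open>min s y\<close> is not smooth in \<open>s\<close>. Its derivative is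
   approximated by smooth steps and integrated from 0, which keeps the value 0 on the bottom
   side.\<close>
 define ps where "ps n s = cor (smstep (real (Suc n) * (y - s)))" for n s
 have sm: "smooth (ps n)" for n
 proof -
 have "smooth (%s. smstep ((- real (Suc n) * s) + real (Suc n) * y))"
 by (intro smooth_affine[OF _ smooth_smstep] bounded_linear_mult_right)
 thus ?thesis unfolding ps_def by (intro smooth_of_real) (simp add: right_diff_distrib del: of_nat_Suc)
 qed
 have "EX et. ALL n. smooth (et n) & et n 0 = 0 & (ALL x. (et n hvd ps n x) (at x))"
 using smooth_antiderivative_from_0[OF sm] by (intro choice) metis
 then obtain et where eta: "!!n. smooth (et n)" "!!n. et n 0 = 0" "!!n x. (et n hvd ps n x) (at x)"
 by blast
 have cps: "cts UNIV (ps n)" for n by (rule smooth_cont[OF sm])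
 have psm [measurable]: "ps n : msb borel" for n by (rule borel_cont[OF cps])
 have etm: "et n : msb borel" for n
 by (rule borel_cont[OF smooth_cont[OF eta(1)]])
 have ps1: "norm (ps n s) <= 1" for n s by (simp add: ps_def smstep_nonneg smstep_le_1)
 have pslim: "(%n. ps n s) ----> (if s < y then 1 else 0)" for s
 using tendsto_of_real[OF smstep_scaled_tendsto[of "y - s"]] unfolding ps_def by (auto simp del: of_nat_Suc)
 have eteq: "et n s = (LBINT r:{0<..<s}. ps n r)" if "0 <= s" for n s
 using set_integral_FTC[OF that eta(3) cps, of n] by (simp add: eta(2))
 have etH: "norm (et n s) <= H" if "s : {0..H}" for n s
 proof -
 have "norm (et n s) <= (LBINT r:{0<..<s}. norm (ps n r))"
 unfolding eteq[of s n, OF that[simplified, THEN conjunct1]]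
 by (intro set_integral_norm_bound L2_interval_imp_integrable L2_interval_continuous cps)
 also have "... <= (LBINT r:{0<..<s}. 1)"
 using ps1 by (intro set_integral_mono set_integrable_norm L2_interval_imp_integrable L2_interval_continuous cps)
 (auto simp: set_integrable_def)
 also have "... = s" using that by (simp add: set_int_def)
 finally show ?thesis using that by simp
 qed
 have etlim: "(%n. et n s) ----> cor (min s y)" if s: "s : {0..H}" for s
 proof -
 have "(%n. LBINT r:{0<..<s}. ps n r) ----> (LBINT r:{0<..<s}. if r < y then 1 else 0)"
 unfolding set_int_def
 proof (rule integral_dominated_convergence[where w="indicator {0<..<s}"])
 show "AE x in lborel. (%n. indicator {0<..<s} x *R ps n x) ----> indicator {0<..<s} x *R (if x < y then 1 else 0)"
 by (intro AE_I2 tendsto_intros pslim)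
 show "AE x in lborel. norm (indicator {0<..<s} x *R ps n x) <= indicator {0<..<s} x" for n
 using ps1 by (intro AE_I2) (auto simp: indicator_def)
 qed (auto intro!: integrable_real_indicator)
 also have "(LBINT r:{0<..<s}. if r < y then 1 else 0) = (LBINT r:{0<..<min s y}. 1 :: complex)"
 unfolding set_int_def by (intro Bochner_Integration.integral_cong) (auto simp: indicator_def)
 also have "... = cor (min s y)"
 using s y by (simp add: set_int_def scaleR_conv_of_real)
 finally show ?thesis using s by (simp add: eteq)
 qed
 have Vn: "V_space L H (md L j (et n))" for n by (rule V_md[OF eta(1,2)])
 have id: "pr L H (lapl Om p) (md L j (et n)) + (lam L j)^2 * pr L H p (md L j (et n)) + pr L H (dy p) (md L j (ps n))
 + bt * (low_mode L H j (dy q) H * et n H) = 0" for n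
 proof -
 have "normal_pairing L H p (md L j (et n)) + bt * (LBINT x:{0<..<L}. tr_top L H q x * tr_top L H (md L j (et n)) x) = 0"
 using DA Vn[of n] unfolding D_A_def by blast
 thus ?thesis
 unfolding boundary_term_md[OF Vq eta(1)[of n] eta(2)[of n]]
 normal_pairing_md[OF Vp n eta(1)[of n] eta(3)[of n] cps[of n]] .
 qed
 have "(%n. pr L H (lapl Om p) (md L j (et n)) + (lam L j)^2 * pr L H p (md L j (et n)) + pr L H (dy p) (md L j (ps n))
 + bt * (low_mode L H j (dy q) H * et n H)) \<longlonglongrightarrow>
 pr L H (lapl Om p) (md L j (%s. of_real (min s y))) + (lam L j)^2 * pr L H p (md L j (%s. of_real (min s y)))
 + pr L H (dy p) (md L j (%s. if s < y then 1 else 0)) + bt * (low_mode L H j (dy q) H * of_real (min H y))"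
 using H etH ps1
 by (intro tendsto_intros pr_md_dominated[where B=H] pr_md_dominated[where B=1] n H1_L2 V_H1 Vp L2_dx_dy etm psm etlim pslim)
 auto
 hence "pr L H (lapl Om p) (md L j (%s. of_real (min s y))) + (lam L j)^2 * pr L H p (md L j (%s. of_real (min s y)))
 + low_mode L H j (dy p) y + bt * (low_mode L H j (dy q) H * of_real (min H y)) = 0"
 unfolding id LIMSEQ_const_iff low_mode_def[of L H j "dy p", symmetric] by (rule sym)
 moreover have "min H y = y" using y by simp
 ultimately have "pr L H (lapl Om p) (md L j (%s. of_real (min s y))) + (lam L j)^2 * pr L H p (md L j (%s. of_real (min s y)))
 + low_mode L H j (dy p) y + bt * (low_mode L H j (dy q) H * y) = 0" by (simp only:)
 thus ?thesis by algebra
qed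

lemma pr_min_has_derivative:
 assumes u: "L2 Om u" and y: "y : {0..H}"
 shows "((%y. pr L H u (md L j (%s. of_real (min s y)))) hvd (low_mode L H j u H - low_mode L H j u y)) (at y within {0..H})"
proof (rule has_vector_derivative_if_quotient)
 have m: "(%s. cor (min s y)) : msb borel" for y by measurable
 have Lm: "L2 Om (md L j (%s. of_real (min s y)))" for y
 by (intro L2_md_continuous cints)
 show "((%y'. norm ((pr L H u (md L j (%s. of_real (min s y'))) - pr L H u (md L j (%s. of_real (min s y)))) /\<^sub>R (y' - y)
 - (low_mode L H j u H - low_mode L H j u y))) ---> 0) (at y within {0..H})"
 proof (rule Lim_null_comparison)
 have "((%y'. l2norm Om u * (1 * sqrt (abs (y' - y)))) ---> l2norm Om u * (1 * sqrt (abs (y - y)))) (at y within {0..H})"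
 by (intro tendsto_intros)
 thus "((%y'. l2norm Om u * (1 * sqrt (abs (y' - y)))) ---> 0) (at y within {0..H})" by simp
 show "\<forall>\<^sub>F y' in at y within {0..H}. norm (norm ((pr L H u (md L j (%s. of_real (min s y'))) - pr L H u (md L j (%s. of_real (min s y)))) /\<^sub>R (y' - y)
 - (low_mode L H j u H - low_mode L H j u y))) <= l2norm Om u * (1 * sqrt (abs (y' - y)))"
 unfolding eventually_at_filter
 proof (intro always_eventually allI impI)
 fix y' assume ne: "y' ~= y" and y': "y' : {0..H}"
 \<comment> \<open>The defect between the difference quotient of \<open>min s y\<close> in
   \<open>y\<close> and its limit, the indicator of \<open>s >= y\<close>. It is bounded by 1 and
   lives between \<open>y\<close> and \<open>y'\<close>, so its L2 norm is of order
   \<open>sqrt |y' - y|\<close>.\<close>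
 define r where "r s = cor ((min s y' - min s y) / (y' - y)) - ((if s < H then 1 else 0) - (if s < y then 1 else 0))" for s
 have rm: "r : msb borel" unfolding r_def by measurable
 have rb: "norm (r s) <= 1 * indicator {min y y'..max y y'} s" if s: "s : {0<..<H}" for s
 proof -
 have e: "r s = cor ((min s y' - min s y) / (y' - y) - (if s < y then 0 else 1))"
 using s by (simp add: r_def)
 have "abs ((min s y' - min s y) / (y' - y) - (if s < y then 0 else 1)) <= 1 * indicator {min y y'..max y y'} s"
 proof (cases "y < y'")
 case True
 then consider "s < y" | "y <= s" "s <= y'" | "y' < s" by linarith
 thus ?thesis
 proof cases
 case 2
 thus ?thesis using True by (simp add: indicator_def abs_le_iff field_simps)
 qed (use True in auto)
 next
 case False
 then consider "s < y'" | "y' <= s" "s < y" | "y <= s" using ne by linarith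
 thus ?thesis
 proof cases
 case 2
 thus ?thesis using False ne by (simp add: indicator_def abs_le_iff field_simps)
 next
 case 3
 hence "(min s y' - min s y) / (y' - y) = 1" using False ne by (simp add: field_simps)
 thus ?thesis using 3 by simp
 qed (use False ne in auto)
 qed
 thus ?thesis unfolding e norm_of_real .
 qed
 have "md L j r = (%z. inverse (of_real (y' - y)) * (md L j (%s. of_real (min s y')) z - md L j (%s. of_real (min s y)) z)
 - (md L j (%s. if s < H then 1 else 0) z - md L j (%s. if s < y then 1 else 0) z))"
 by (auto simp: md_def r_def divide_inverse algebra_simps)
 hence "pr L H u (md L j r) = inverse (of_real (y' - y)) * (pr L H u (md L j (%s. of_real (min s y'))) - pr L H u (md L j (%s. of_real (min s y))))
 - (low_mode L H j u H - low_mode L H j u y)"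
 unfolding low_mode_def
 by (simp only:) (simp only: pr_diff_right pr_cmult_right u Lm L2_diff L2_cmult L2_md_step)
 hence "norm ((pr L H u (md L j (%s. of_real (min s y'))) - pr L H u (md L j (%s. of_real (min s y)))) /\<^sub>R (y' - y)
 - (low_mode L H j u H - low_mode L H j u y)) = norm (pr L H u (md L j r))"
 by (simp add: scaleR_conv_of_real)
 also have "... <= l2norm Om u * l2norm Om (md L j r)"
 proof (intro pr_bound u L2_md[OF rm, where B=1])
 fix s assume "s : {0<..<H}"
 from rb[OF this] show "norm (r s) <= 1" by (rule order_trans) (simp add: indicator_def)
 qed
 also have "... <= l2norm Om u * (abs 1 * sqrt (max y y' - min y y'))"
 by (intro mult_left_mono l2norm_nonneg l2norm_md_strip rm rb) auto
 also have "max y y' - min y y' = abs (y' - y)" by auto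
 finally show "norm (norm ((pr L H u (md L j (%s. of_real (min s y'))) - pr L H u (md L j (%s. of_real (min s y)))) /\<^sub>R (y' - y)
 - (low_mode L H j u H - low_mode L H j u y))) <= l2norm Om u * (1 * sqrt (abs (y' - y)))" by simp
 qed
 qed
qed

text \<open>The y-derivative of the j-th mode of \<open>p\<close> at \<open>y\<close>: its value
  \<open>- bt\<close> times the mode of \<open>q\<close> at the top, minus the integral from
  \<open>y\<close> to \<open>H\<close> of the second derivative, which is the mode of the Laplacian
  plus \<open>(lam L j)^2\<close> times that of \<open>p\<close>. The Laplacian is only in L2, so it
  enters through \<open>low_mode\<close>.\<close>

definition flux_mode :: "real => int => (real \<times> real => complex) => (real \<times> real => complex) => real => complex" where
 "flux_mode bt j p q y = - bt * low_mode L H j (dy q) H - (low_mode L H j (lapl Om p) H - low_mode L H j (lapl Om p) y)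
 - (lam L j)^2 * (low_mode L H j p H - low_mode L H j p y)"

lemma low_mode_dy_has_derivative:
 assumes DA: "D_A L H bt p q" and y: "y : {0..H}"
 shows "(low_mode L H j (dy p) hvd flux_mode bt j p q y) (at y within {0..H})"
proof -
 have Vp: "V_space L H p" using DA by (auto simp: D_A_def)
 have n: "L2 Om (lapl Om p)" using DA L2_lapl by (auto simp: D_A_def)
 have d1: "((%y. - pr L H (lapl Om p) (md L j (%s. of_real (min s y)))) has_vector_derivative
 - (low_mode L H j (lapl Om p) H - low_mode L H j (lapl Om p) y)) (at y within {0..H})"
 by (intro has_vector_derivative_minus pr_min_has_derivative n y)
 have d2: "((%y. (lam L j)^2 * pr L H p (md L j (%s. of_real (min s y)))) has_vector_derivative
 (lam L j)^2 * (low_mode L H j p H - low_mode L H j p y)) (at y within {0..H})"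
 by (intro has_vector_derivative_mult_right pr_min_has_derivative H1_L2 V_H1 Vp y)
 have "((%y. cor y) hvd cor 1) (at y within {0..H})"
 by (rule has_vector_derivative_of_real) (simp add: DERIV_subset[OF DERIV_ident])
 hence d3: "((%y. bt * low_mode L H j (dy q) H * cor y) has_vector_derivative
 bt * low_mode L H j (dy q) H * cor 1) (at y within {0..H})"
 by (rule has_vector_derivative_mult_right)
 note has_vector_derivative_diff[OF has_vector_derivative_diff[OF d1 d2] d3]
 hence "(low_mode L H j (dy p) has_vector_derivative
 - (low_mode L H j (lapl Om p) H - low_mode L H j (lapl Om p) y) - (lam L j)^2 * (low_mode L H j p H - low_mode L H j p y)
 - bt * low_mode L H j (dy q) H * cor 1) (at y within {0..H})"
 by (rule has_vector_derivative_transform[OF y, rotated]) (rule mode_identity[OF DA])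
 thus ?thesis by (simp add: flux_mode_def algebra_simps)
qed

end

section \<open>Modes of acoustic solutions\<close>

text \<open>\<open>P\<close> is a mode of the pressure, \<open>a\<close> its time derivative,
  \<open>b\<close> its y-derivative; \<open>sg\<close> stands for \<open>c^-2\<close> and
  \<open>La\<close> for \<open>(lam L j)^2\<close>. The time derivative of \<open>a\<close> exists
  only in L2, so \<open>sg * a_t = b_y - La * P\<close> is stated integrated over intervals in
  \<open>y\<close>. The value type is general because modes are complex while the energy estimates
  concern their real and imaginary parts.\<close>

definition wave_mode :: "real => real => real => (real => real) => (real => real => 'a::euclidean_space) =>
 (real => real => 'a) => (real => real => 'a) => bool" where
 "wave_mode H bt La sg P a b \<longleftrightarrow>
 cts ({0..} \<times> {0..H}) (%(t, y). P t y) &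
 cts ({0..} \<times> {0..H}) (%(t, y). a t y) &
 cts ({0..} \<times> {0..H}) (%(t, y). b t y) &
 (ALL t>=0. P t 0 = 0 & b t H = - bt *R a t H) &
 (ALL t>=0. ALL y:{0..H}. ((%s. P s y) hvd a t y) (at t within {0..})) &
 (ALL t>=0. ALL y:{0..H}. (P t hvd b t y) (at y within {0..H})) &
 (ALL t>=0. ALL y1 y2. 0 <= y1 --> y1 <= y2 --> y2 <= H -->
 ((%s. integral {y1..y2} (%y. sg y *R a s y)) has_vector_derivative
 b t y2 - b t y1 - La *R integral {y1..y2} (P t)) (at t within {0..}))"

lemma weak_deriv_cong_AE:
 fixes u u' :: "'a::euclidean_space => complex"
 assumes w: "weak_deriv S e u g" and e: "e : Basis" and u': "loc_integrable S u'"
 and eq: "AE z in lborel. z : S --> u' z = u z"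
 shows "weak_deriv S e u' g"
 unfolding weak_deriv_def
proof (intro conjI allI impI)
 fix ph assume t: "test_fun S ph"
 have "sli S (%z. pd e ph z *R u' z) = sli S (%z. pd e ph z *R u z)"
 unfolding set_int_def
 proof (rule integral_cong_AE)
 show "(%z. indicator S z *R pd e ph z *R u' z) : msb lborel"
 using test_fun_integrable[OF test_fun_pd[OF t e] u'] unfolding set_integrable_def by (rule borel_measurable_integrable)
 show "(%z. indicator S z *R pd e ph z *R u z) : msb lborel"
 using test_fun_integrable[OF test_fun_pd[OF t e], of u] w unfolding set_integrable_def weak_deriv_def
 by (intro borel_measurable_integrable) auto
 show "AE z in lborel. indicator S z *R pd e ph z *R u' z = indicator S z *R pd e ph z *R u z"
 using eq by eventually_elim (auto simp: indicator_def)
 qed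
 thus "sli S (%z. pd e ph z *R u' z) = - sli S (%z. ph z *R g z)"
 using w t by (simp add: weak_deriv_def)
qed (use w u' in \<open>auto simp: weak_deriv_def\<close>)

lemma tendsto_0_if_le_on:
 fixes f g :: "real => real"
 assumes g: "(g ---> 0) (at t within S)" and le: "!!s. s : S ==> f s <= g s" and nn: "!!s. 0 <= f s"
 shows "(f ---> 0) (at t within S)"
 by (rule tendsto_sandwich[OF _ _ tendsto_const g]) (auto simp: eventually_at_filter le nn)

lemma integral_set_lebesgue_Ico:
 fixes f :: "real => 'a::euclidean_space"
 assumes "cts {a..b} f" "a <= b"
 shows "(LBINT y:{a..<b}. f y) = integral {a..b} f"
proof -
 have i: "sint {a..b} f" using assms by (intro borel_integrable_atLeastAtMost')
 have "(LBINT y:{a..<b}. f y) = (LBINT y:{a..b}. f y)"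
 unfolding set_int_def
 proof (rule integral_cong_AE)
 have "sint {a..<b} f" by (rule set_integrable_subset[OF i]) auto
 thus "(%x. indicator {a..<b} x *R f x) : msb lborel" by (auto simp: set_integrable_def)
 show "(%x. indicator {a..b} x *R f x) : msb lborel" using i by (auto simp: set_integrable_def)
 show "AE x in lborel. indicator {a..<b} x *R f x = indicator {a..b} x *R f x"
 using AE_lborel_singleton[of b] by eventually_elim (auto simp: indicator_def)
 qed
 thus ?thesis using set_borel_integral_eq_integral(2)[OF i] by simp
qed

context rectangle
begin

definition step_weight :: "(real => real) => real => real => real => complex" where
 "step_weight sg y1 y2 s = cor (indicator {y1..<y2} s * sg s)"

lemma step_weight:
 assumes s: "cts {0..H} sg" and y: "0 <= y1" "y1 <= y2" "y2 <= H"
 shows "step_weight sg y1 y2 : msb borel"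
 and "EX B. ALL s. norm (step_weight sg y1 y2 s) <= B"
proof -
 have "(%s. indicator {y1..<y2} s *R sg s) : msb borel"
 using y by (intro borel_measurable_continuous_on_indicator cont_sub[OF s]) auto
 hence "(%s. cor (indicator {y1..<y2} s *R sg s)) : msb borel" by measurable
 thus "step_weight sg y1 y2 : msb borel" by (simp add: step_weight_def[abs_def])
 obtain B where "ALL s:{0..H}. norm (sg s) <= B"
 using compact_imp_bounded[OF compact_continuous_image[OF s]] by (auto simp: bounded_iff)
 thus "EX B. ALL s. norm (step_weight sg y1 y2 s) <= B"
 using y by (intro exI[of _ "max 0 B"] allI) (auto simp: step_weight_def indicator_def le_max_iff_disj)
qed

lemma pr_step_weight:
 assumes V: "V_space L H u" and s: "cts {0..H} sg" and y: "0 <= y1" "y1 <= y2" "y2 <= H"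
 shows "pr L H u (md L j (step_weight sg y1 y2)) = integral {y1..y2} (%y. sg y *R low_mode L H j (dy u) y)"
proof -
 obtain B where B: "!!s. norm (step_weight sg y1 y2 s) <= B" using step_weight(2)[OF s y] by blast
 have "pr L H u (md L j (step_weight sg y1 y2)) = (LBINT y:{0<..<H}. step_weight sg y1 y2 y * low_mode L H j (dy u) y)"
 by (rule V_pr_md[OF V step_weight(1)[OF s y] B])
 also have "... = (LBINT y:{y1..<y2}. sg y *R low_mode L H j (dy u) y)"
 unfolding set_int_def
 proof (rule integral_cong_AE)
 have cl: "cts {0..H} (%y. sg y *R low_mode L H j (dy u) y)"
 by (intro cints s continuous_on_low_mode L2_dx_dy V_H1 V)
 have "sint {y1..<y2} (%y. sg y *R low_mode L H j (dy u) y)"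
 using y by (intro set_integrable_subset[OF borel_integrable_atLeastAtMost'[OF cl]]) auto
 thus "(%x. indicator {y1..<y2} x *R sg x *R low_mode L H j (dy u) x) : msb lborel"
 by (auto simp: set_integrable_def)
 show "(%x. indicator {0<..<H} x *R (step_weight sg y1 y2 x * low_mode L H j (dy u) x)) : msb lborel"
 using set_integrable_low_mode[OF L2_dx_dy(2)[OF V_H1[OF V]] step_weight(1)[OF s y] B, of j]
 by (auto simp: set_integrable_def)
 show "AE x in lborel. indicator {0<..<H} x *R (step_weight sg y1 y2 x * low_mode L H j (dy u) x) =
 indicator {y1..<y2} x *R sg x *R low_mode L H j (dy u) x"
 using AE_lborel_singleton[of 0]
 by eventually_elim (use y in \<open>auto simp: indicator_def step_weight_def scaleR_conv_of_real\<close>)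
 qed
 also have "... = integral {y1..y2} (%y. sg y *R low_mode L H j (dy u) y)"
 using y by (intro integral_set_lebesgue_Ico cints continuous_on_low_mode L2_dx_dy V_H1 V cont_sub[OF s]) auto
 finally show ?thesis .
qed

lemma pr_step_weight_1:
 assumes u: "L2 Om u" and y: "0 <= y1" "y1 <= y2" "y2 <= H"
 shows "pr L H u (md L j (step_weight (%_. 1) y1 y2)) = low_mode L H j u y2 - low_mode L H j u y1"
proof -
 have "md L j (step_weight (%_. 1) y1 y2) = (%z. md L j (%s. if s < y2 then 1 else 0) z - md L j (%s. if s < y1 then 1 else 0) z)"
 using y by (auto simp: md_def step_weight_def indicator_def)
 thus ?thesis unfolding low_mode_def by (simp add: pr_diff_right u L2_md_step)
qed

text \<open>Differentiability in time with respect to the L2 norm passes to every pairing by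
  Cauchy-Schwarz.\<close>

lemma quotient_mode_tendsto:
 assumes u: "!!s. s : S ==> L2 Om (u s)" and t: "t : S" and q: "L2 Om q" and m: "L2 Om m"
 and lim: "((%s. l2norm Om (%z. (u s z - u t z) / cor (s - t) - q z)) ---> 0) (at t within S)"
 shows "((%s. pr L H (u s) m) hvd pr L H q m) (at t within S)"
proof (rule has_vector_derivative_if_quotient, rule tendsto_0_if_le_on)
 show "((%s. l2norm Om (%z. (u s z - u t z) / cor (s - t) - q z) * l2norm Om m) ---> 0) (at t within S)"
 by (rule tendsto_mult_left_zero[OF lim])
 fix s assume s: "s : S"
 have "pr L H (%z. inverse (cor (s - t)) * (u s z - u t z) - q z) m =
 inverse (cor (s - t)) * (pr L H (u s) m - pr L H (u t) m) - pr L H q m"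
 by (simp only: pr_diff pr_cmult L2_diff L2_cmult u s t q m)
 hence "(pr L H (u s) m - pr L H (u t) m) /\<^sub>R (s - t) - pr L H q m =
 pr L H (%z. inverse (cor (s - t)) * (u s z - u t z) - q z) m"
 by (simp add: scaleR_conv_of_real)
 also have "norm ... <= l2norm Om (%z. inverse (cor (s - t)) * (u s z - u t z) - q z) * l2norm Om m"
 by (intro pr_bound L2_diff L2_cmult u s t q m)
 finally show "norm ((pr L H (u s) m - pr L H (u t) m) /\<^sub>R (s - t) - pr L H q m) \<le>
 l2norm Om (%z. (u s z - u t z) / cor (s - t) - q z) * l2norm Om m"
 by (simp add: divide_inverse mult.commute)
qed simp

text \<open>Convergence in the norms of the solution space carries over to the modes by
  Cauchy-Schwarz; the integrated equation comes from pairing the second time derivative with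
  \<open>c^-2\<close> on a strip.\<close>

lemma acoustic_wave_mode:
 assumes sol: "acoustic_solution L H bt c f0 f1 p pt" and c: "cts {0..H} c" "!!y. y : {0..H} ==> c y > 0"
 shows "wave_mode H bt ((lam L j)^2) (%y. 1 / (c y)^2) (%t. low_mode L H j (dy (p t))) (%t. low_mode L H j (dy (pt t)))
 (%t. flux_mode bt j (p t) (pt t))"
proof -
 have DA: "D_A L H bt (p t) (pt t)" if "t : {0..}" for t using sol that by (simp add: acoustic_solution_def)
 have V: "V_space L H (p t)" "V_space L H (pt t)" if "t : {0..}" for t using DA[OF that] by (auto simp: D_A_def)
 note H1 = V_H1[OF V(1)] V_H1[OF V(2)]
 have lap: "weak_lapl Om (p t) (lapl Om (p t))" "L2 Om (lapl Om (p t))" if "t : {0..}" for t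
 using DA[OF that] L2_lapl lapl_AE_eq(1)[OF open_Omega] by (auto simp: D_A_def)
 have Dlim: "((%s. D_A_norm L H (%z. p s z - p t z) (%z. pt s z - pt t z)) ---> 0) (at t within {0..})" if "t : {0..}" for t
 using sol that by (simp add: acoustic_solution_def)
 have lim_p: "((%s. l2norm Om (%z. p s z - p t z)) ---> 0) (at t within {0..})"
 and lim_dyp: "((%s. l2norm Om (%z. dy (p s) z - dy (p t) z)) ---> 0) (at t within {0..})"
 and lim_dypt: "((%s. l2norm Om (%z. dy (pt s) z - dy (pt t) z)) ---> 0) (at t within {0..})"
 and lim_lapl: "((%s. l2norm Om (%z. lapl Om (p s) z - lapl Om (p t) z)) ---> 0) (at t within {0..})"
 if t: "t : {0..}" for t
 proof -
 have h: "h1norm Om (%z. p s z - p t z) <= D_A_norm L H (%z. p s z - p t z) (%z. pt s z - pt t z)"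
 "h1norm Om (%z. pt s z - pt t z) <= D_A_norm L H (%z. p s z - p t z) (%z. pt s z - pt t z)"
 "l2norm Om (lapl Om (%z. p s z - p t z)) <= D_A_norm L H (%z. p s z - p t z) (%z. pt s z - pt t z)" for s
 by (simp_all add: D_A_norm_def h1norm_nonneg l2norm_nonneg add_increasing add_increasing2)
 show "((%s. l2norm Om (%z. p s z - p t z)) ---> 0) (at t within {0..})"
 by (rule tendsto_0_if_le_on[OF Dlim[OF t]]) (auto intro: order_trans[OF l2norm_le_h1norm(1)] h l2norm_nonneg)
 show "((%s. l2norm Om (%z. dy (p s) z - dy (p t) z)) ---> 0) (at t within {0..})"
 by (rule tendsto_0_if_le_on[OF Dlim[OF t]])
 (auto intro!: order_trans[OF l2norm_wderiv_diff_le] h l2norm_nonneg open_Omega H1 t H1_wderiv Basis_elems)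
 show "((%s. l2norm Om (%z. dy (pt s) z - dy (pt t) z)) ---> 0) (at t within {0..})"
 by (rule tendsto_0_if_le_on[OF Dlim[OF t]])
 (auto intro!: order_trans[OF l2norm_wderiv_diff_le] h l2norm_nonneg open_Omega H1 t H1_wderiv Basis_elems)
 show "((%s. l2norm Om (%z. lapl Om (p s) z - lapl Om (p t) z)) ---> 0) (at t within {0..})"
 proof (rule tendsto_0_if_le_on[OF Dlim[OF t]])
 fix s :: real assume s: "s : {0..}"
 note d = weak_lapl_diff[OF lap(1)[OF s] lap(1)[OF t]]
 have "l2norm Om (lapl Om (%z. p s z - p t z)) = l2norm Om (%z. lapl Om (p s) z - lapl Om (p t) z)"
 using lapl_AE_eq[OF open_Omega d]
 by (intro L2_cong_AE(2)[OF L2_diff[OF lap(2)[OF s] lap(2)[OF t]]] set_borel_measurable_loc_integrable open_Omega)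
 (auto simp: weak_lapl_def)
 thus "l2norm Om (%z. lapl Om (p s) z - lapl Om (p t) z) <= D_A_norm L H (%z. p s z - p t z) (%z. pt s z - pt t z)"
 using h(3)[of s] by simp
 qed (rule l2norm_nonneg)
 qed
 have cP: "cts ({0..} \<times> {0..H}) (%(t, y). low_mode L H j (dy (p t)) y)"
 by (intro continuous_on_low_mode_time L2_dx_dy H1 lim_dyp)
 have ca: "cts ({0..} \<times> {0..H}) (%(t, y). low_mode L H j (dy (pt t)) y)"
 by (intro continuous_on_low_mode_time L2_dx_dy H1 lim_dypt)
 have cn: "cts ({0..} \<times> {0..H}) (%(t, y). low_mode L H j (lapl Om (p t)) y)"
 by (intro continuous_on_low_mode_time lap lim_lapl)
 have cp: "cts ({0..} \<times> {0..H}) (%(t, y). low_mode L H j (p t) y)"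
 by (intro continuous_on_low_mode_time H1_L2 H1 lim_p)
 have atH: "cts ({0..} \<times> {0..H}) (%(t, y). f t H)"
 if "cts ({0..} \<times> {0..H}) (%(t, y). f t y)" for f :: "real => real => complex"
 proof -
 have "cts ({0..} \<times> {0..H}) (%z. (%(t, y). f t y) (fst z, H))"
 using H by (intro cont_comp[OF that] cints) auto
 thus ?thesis by (simp add: case_prod_beta')
 qed
 note cs = atH[OF ca] atH[OF cn] cn atH[OF cp] cp
 have "cts ({0..} \<times> {0..H}) (%z. - bt * low_mode L H j (dy (pt (fst z))) H
 - (low_mode L H j (lapl Om (p (fst z))) H - low_mode L H j (lapl Om (p (fst z))) (snd z))
 - (lam L j)^2 * (low_mode L H j (p (fst z)) H - low_mode L H j (p (fst z)) (snd z)))"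
 by (intro continuous_on_diff continuous_on_mult continuous_on_const cs[unfolded case_prod_beta'])
 hence cb: "cts ({0..} \<times> {0..H}) (%(t, y). flux_mode bt j (p t) (pt t) y)"
 by (simp add: flux_mode_def case_prod_beta')
 have dt: "((%s. low_mode L H j (dy (p s)) y) hvd low_mode L H j (dy (pt t)) y) (at t within {0..})"
 if t: "t : {0..}" for t y
 unfolding low_mode_def
 proof (rule quotient_mode_tendsto)
 have "((%s. h1norm Om (%z. (p s z - p t z) / cor (s - t) - pt t z)) ---> 0) (at t within {0..})"
 using sol t by (simp add: acoustic_solution_def time_deriv_def)
 thus "((%s. l2norm Om (%z. (dy (p s) z - dy (p t) z) / cor (s - t) - dy (pt t) z)) ---> 0) (at t within {0..})"
 proof (rule tendsto_0_if_le_on)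
 fix s :: real assume s: "s : {0..}"
 have w: "weak_deriv Om (0, 1) (%z. inverse (cor (s - t)) * (p s z - p t z))
 (%z. inverse (cor (s - t)) * (dy (p s) z - dy (p t) z))"
 by (intro weak_deriv_cmult weak_deriv_diff H1_wderiv open_Omega H1 s t Basis_elems)
 have "l2norm Om (%z. inverse (cor (s - t)) * (dy (p s) z - dy (p t) z) - dy (pt t) z)
 <= h1norm Om (%z. inverse (cor (s - t)) * (p s z - p t z) - pt t z)"
 by (intro l2norm_wderiv_diff_le w open_Omega H1 t Basis_elems L2_cmult L2_diff L2_dx_dy s)
 thus "l2norm Om (%z. (dy (p s) z - dy (p t) z) / cor (s - t) - dy (pt t) z)
 <= h1norm Om (%z. (p s z - p t z) / cor (s - t) - pt t z)"
 by (simp add: divide_inverse mult.commute)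
 qed (rule l2norm_nonneg)
 qed (use t in \<open>auto intro!: L2_dx_dy H1 L2_md_step\<close>)
 obtain ptt where ptt: "!!t. t >= 0 ==> L2 Om (ptt t)" "time_deriv (l2norm Om) pt ptt"
 "!!t. t >= 0 ==> AE z in lborel. z : Om --> ptt t z = cor ((c (snd z))^2) * lapl Om (p t) z"
 using sol unfolding acoustic_solution_def by blast
 have cs: "cts {0..H} (%y. 1 / (c y)^2)"
 using c by (intro cints) (auto simp: less_imp_neq[symmetric])
 have E: "((%s. integral {y1..y2} (%y. (1 / (c y)^2) *R low_mode L H j (dy (pt s)) y)) has_vector_derivative
 flux_mode bt j (p t) (pt t) y2 - flux_mode bt j (p t) (pt t) y1 - (lam L j)^2 *R integral {y1..y2} (low_mode L H j (dy (p t)))) (at t within {0..})"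
 if t: "t : {0..}" and y: "0 <= y1" "y1 <= y2" "y2 <= H" for t y1 y2
 proof -
 let ?m = "step_weight (%y. 1 / (c y)^2) y1 y2"
 obtain B where B: "!!s. norm (?m s) <= B" using step_weight(2)[OF cs y] by blast
 have Lm: "L2 Om (md L j ?m)" by (rule L2_md[OF step_weight(1)[OF cs y] B])
 obtain B' where B': "!!s. norm (step_weight (%_. 1) y1 y2 s) <= B'" using step_weight(2)[OF continuous_on_const y, of 1] by blast
 have Lm1: "L2 Om (md L j (step_weight (%_. 1) y1 y2))"
 by (rule L2_md[OF step_weight(1)[OF continuous_on_const y] B'])
 have "((%s. pr L H (pt s) (md L j ?m)) hvd pr L H (ptt t) (md L j ?m)) (at t within {0..})"
 proof (rule quotient_mode_tendsto[OF _ t _ Lm])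
 show "L2 Om (pt s)" if "s : {0..}" for s by (rule H1_L2[OF H1(2)[OF that]])
 show "L2 Om (ptt t)" using ptt(1) t by simp
 show "((%s. l2norm Om (%z. (pt s z - pt t z) / cor (s - t) - ptt t z)) ---> 0) (at t within {0..})"
 using ptt(2) t unfolding time_deriv_def by blast
 qed
 \<comment> \<open>The weight \<open>1 / c^2\<close> on the strip cancels the factor
   \<open>c^2\<close> in front of the Laplacian, so that no derivative of the speed appears.\<close>
 moreover have "pr L H (ptt t) (md L j ?m) = pr L H (lapl Om (p t)) (md L j (step_weight (%_. 1) y1 y2))"
 proof (rule pr_cong_AE)
 show "AE z in lborel. z : Om --> ptt t z * md L j ?m z = lapl Om (p t) z * md L j (step_weight (%_. 1) y1 y2) z"
 using ptt(3)[OF t[unfolded atLeast_iff]]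
 proof eventually_elim
 case (elim z)
 show ?case
 proof
 assume z: "z : Om"
 hence "c (snd z) ~= 0" using c(2)[of "snd z"] by (auto simp: Omega_def)
 thus "ptt t z * md L j ?m z = lapl Om (p t) z * md L j (step_weight (%_. 1) y1 y2) z"
 using elim z by (auto simp: md_def step_weight_def indicator_def field_simps)
 qed
 qed
 qed (use ptt t lap Lm Lm1 in auto)
 moreover have "... = flux_mode bt j (p t) (pt t) y2 - flux_mode bt j (p t) (pt t) y1 - (lam L j)^2 *R integral {y1..y2} (low_mode L H j (dy (p t)))"
 proof -
 have int: "integral {y1..y2} (low_mode L H j (dy (p t))) = low_mode L H j (p t) y2 - low_mode L H j (p t) y1"
 using pr_step_weight[OF V(1)[OF t] continuous_on_const y, of j 1] pr_step_weight_1[OF H1_L2[OF H1(1)[OF t]] y] by simp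
 show ?thesis
 unfolding int pr_step_weight_1[OF lap(2)[OF t] y] flux_mode_def
 by (simp add: scaleR_conv_of_real algebra_simps)
 qed
 ultimately have "((%s. pr L H (pt s) (md L j ?m)) has_vector_derivative
 flux_mode bt j (p t) (pt t) y2 - flux_mode bt j (p t) (pt t) y1 - (lam L j)^2 *R integral {y1..y2} (low_mode L H j (dy (p t)))) (at t within {0..})"
 by (simp only:)
 thus ?thesis
 by (rule has_vector_derivative_transform[OF t, rotated]) (rule pr_step_weight[OF V(2) cs y, symmetric])
 qed
 show ?thesis
 unfolding wave_mode_def
 proof (intro conjI allI impI ballI)
 fix t :: real assume "t >= 0"
 hence t: "t : {0..}" by simp
 show "flux_mode bt j (p t) (pt t) H = - bt *R low_mode L H j (dy (pt t)) H"
 by (simp add: flux_mode_def scaleR_conv_of_real)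
 fix y assume y: "y : {0..H}"
 show "(low_mode L H j (dy (p t)) hvd flux_mode bt j (p t) (pt t) y) (at y within {0..H})"
 by (rule low_mode_dy_has_derivative[OF DA[OF t] y])
 qed (use cP ca cb dt E in auto)
qed

text \<open>The data are known only almost everywhere, but both sides are continuous in
  \<open>y\<close>: their integrals over every \<open>(0,y2)\<close> agree and can be
  differentiated.\<close>

lemma initial_mode:
 assumes V: "V_space L H f" and r: "cts {0..H} r"
 and f: "AE y in lborel. y : {0<..<H} --> (LBINT x:{0<..<L}. f (x, y) * phi L (- j) x) = r y" and y: "y : {0..H}"
 shows "low_mode L H j (dy f) y = r y"
proof -
 let ?P = "low_mode L H j (dy f)"
 have eq: "integral {0..y2} ?P = integral {0..y2} r" if y2: "y2 : {0..H}" for y2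
 proof -
 have y': "0 <= (0::real)" "0 <= y2" "y2 <= H" using y2 by auto
 let ?m = "step_weight (%_. 1) 0 y2"
 obtain B where B: "!!s. norm (?m s) <= B" using step_weight(2)[OF continuous_on_const y', of 1] by blast
 note m = step_weight(1)[OF continuous_on_const y', of 1]
 have i: "sint ({0<..<L} \<times> {0<..<H}) (%z. f z * md L j ?m z)"
 using L2_mult_integrable[OF H1_L2[OF V_H1[OF V]] L2_md[OF m B]] by (simp add: Omega_def)
 have "integral {0..y2} ?P = pr L H f (md L j ?m)"
 using pr_step_weight[OF V continuous_on_const y', of j 1] by simp
 also have "... = (LBINT y:{0<..<H}. LBINT x:{0<..<L}. f (x, y) * md L j ?m (x, y))"
 using set_integral_Times(2)[OF i] by (simp add: pr_def Omega_def)
 also have "... = (LBINT y:{0..<y2}. r y)"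
 unfolding set_int_def[of _ "{0<..<H}"] set_int_def[of _ "{0..<y2}"]
 proof (rule integral_cong_AE)
 show "(%y. indicator {0<..<H} y *R (LBINT x:{0<..<L}. f (x, y) * md L j ?m (x, y))) : msb lborel"
 using set_integrable_Times_iterated(2)[OF i] by (auto simp: set_integrable_def)
 have "sint {0..<y2} r"
 using y' by (intro set_integrable_subset[OF borel_integrable_atLeastAtMost'[OF r]]) auto
 thus "(%y. indicator {0..<y2} y *R r y) : msb lborel" by (auto simp: set_integrable_def)
 show "AE y in lborel. indicator {0<..<H} y *R (LBINT x:{0<..<L}. f (x, y) * md L j ?m (x, y)) = indicator {0..<y2} y *R r y"
 using f AE_lborel_singleton[of 0]
 proof eventually_elim
 case (elim y)
 have "(LBINT x:{0<..<L}. f (x, y) * md L j ?m (x, y)) = (LBINT x:{0<..<L}. f (x, y) * phi L (- j) x) * ?m y"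
 by (simp add: md_def mult.assoc flip: set_integral_mult_left)
 thus ?case using elim y' by (auto simp: indicator_def step_weight_def)
 qed
 qed
 also have "... = integral {0..y2} r"
 using y' by (intro integral_set_lebesgue_Ico cont_sub[OF r]) auto
 finally show ?thesis .
 qed
 have cP: "cts {0..H} ?P" by (intro continuous_on_low_mode L2_dx_dy V_H1 V)
 have "((%u. integral {0..u} ?P) hvd ?P y) (at y within {0..H})"
 by (rule integral_has_vector_derivative[OF cP y])
 hence "((%u. integral {0..u} r) hvd ?P y) (at y within {0..H})"
 by (rule has_vector_derivative_transform[OF y, rotated]) (simp add: eq)
 moreover have "((%u. integral {0..u} r) hvd r y) (at y within {0..H})"
 by (rule integral_has_vector_derivative[OF r y])
 ultimately show ?thesis
 using vector_derivative_unique_within_closed_interval[of 0 H y] y H by (simp add: cbox_interval)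
qed

lemma trig_sum_mode:
 assumes K: "finite K"
 shows "(LBINT x:{0<..<L}. (\<Sum>k\<in>K. d k * phi L k x) * phi L (- j) x) = (if j : K then d j else 0)"
proof -
 have i: "sint {0<..<L} (%x. d k * (phi L k x * phi L (- j) x))" for k
 using L2_mult_integrable[OF L2_phi L2_phi] by simp
 have "(LBINT x:{0<..<L}. (\<Sum>k\<in>K. d k * phi L k x) * phi L (- j) x) = (LBINT x:{0<..<L}. (\<Sum>k\<in>K. d k * (phi L k x * phi L (- j) x)))"
 by (simp add: sum_distrib_right mult.assoc)
 also have "... = (\<Sum>k\<in>K. d k * (LBINT x:{0<..<L}. phi L k x * phi L (- j) x))"
 using i unfolding set_int_def set_integrable_def scaleR_sum_right
 by (subst Bochner_Integration.integral_sum) (auto simp flip: set_int_def)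
 also have "... = (\<Sum>k\<in>K. if k = j then d k else 0)" by (intro sum.cong) (simp_all add: integral_phi_phi[OF L])
 also have "... = (if j : K then d j else 0)" using K by simp
 finally show ?thesis .
qed

lemma tr_top_finite:
 assumes V: "V_space L H u" and K: "finite K" "!!j. j ~: K ==> low_mode L H j (dy u) H = 0"
 shows "AE x in lborel. x : {0<..<L} --> tr_top L H u x = (\<Sum>j\<in>K. low_mode L H j (dy u) H * phi L j x)"
proof (rule L2_AE_eq_if_modes_eq)
 show "L2 {0<..<L} (tr_top L H u)" by (rule tr_top_L2[OF V])
 show "L2 {0<..<L} (%x. \<Sum>j\<in>K. low_mode L H j (dy u) H * phi L j x)" by (intro L2_sum L2_cmult L2_phi)
 show "(LBINT x:{0<..<L}. tr_top L H u x * phi L (- l) x) =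
 (LBINT x:{0<..<L}. (\<Sum>j\<in>K. low_mode L H j (dy u) H * phi L j x) * phi L (- l) x)" for l
 using K(2)[of l] by (simp add: tr_top_modes[OF V] trig_sum_mode[OF K(1)])
qed

text \<open>With finitely many nonzero modes the trace agrees almost everywhere with a trigonometric
  polynomial. Thus its weak derivative exists, and \<open>dx_top\<close> is the termwise derivative
  rather than an arbitrary choice.\<close>

lemma dx_top_finite:
 assumes V: "V_space L H u" and K: "finite K" "!!j. j ~: K ==> low_mode L H j (dy u) H = 0"
 shows "loc_integrable {0<..<L} (dx_top L H u)"
 "AE x in lborel. x : {0<..<L} --> dx_top L H u x = (\<Sum>j\<in>K. \<i> * lam L j * low_mode L H j (dy u) H * phi L j x)"
proof -
 let ?S = "%x. \<Sum>j\<in>K. low_mode L H j (dy u) H * phi L j x" and ?D = "%x. \<Sum>j\<in>K. \<i> * lam L j * low_mode L H j (dy u) H * phi L j x"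
 have "(?S hvd (\<Sum>j\<in>K. low_mode L H j (dy u) H * (\<i> * lam L j * phi L j x))) (at x)" for x
 by (intro has_vector_derivative_sum has_vector_derivative_mult_right phi_has_derivative)
 hence d: "(?S hvd ?D x) (at x)" for x by (simp add: mult_ac)
 have "Ck 0 ?D" by (auto intro!: cints continuous_phi)
 from Ck_antiderivative[OF d this] have C: "Ck 1 ?S" by simp
 have pdS: "pd 1 ?S = ?D" using d by (intro ext pd_real_eq)
 have w: "weak_deriv {0<..<L} 1 ?S ?D" using weak_deriv_Ck1[OF C, of 1] pdS by simp
 have "weak_deriv {0<..<L} 1 (tr_top L H u) ?D"
 by (rule weak_deriv_cong_AE[OF w _ L2_imp_loc_integrable[OF tr_top_L2[OF V]] tr_top_finite[OF V K]]) simp_all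
 from wderiv_AE_eq[OF open_greaterThanLessThan this] show "loc_integrable {0<..<L} (dx_top L H u)"
 "AE x in lborel. x : {0<..<L} --> dx_top L H u x = ?D x"
 by (simp_all add: dx_top_def weak_deriv_def)
qed

lemma l2norm_trig_sum:
 assumes K: "finite K"
 shows "(l2norm {0<..<L} (%x. \<Sum>j\<in>K. d j * phi L j x))^2 = (\<Sum>j\<in>K. (norm (d j))^2)"
proof -
 let ?s = "%x. \<Sum>j\<in>K. d j * phi L j x"
 have i: "sint {0<..<L} (%x. d j * cnj (d l) * (phi L j x * phi L (- l) x))" for j l
 using L2_mult_integrable[OF L2_phi L2_phi] by simp
 have "cor ((l2norm {0<..<L} ?s)^2) = (LBINT x:{0<..<L}. cor ((norm (?s x))^2))"
 by (simp only: l2norm_sq set_integral_complex_of_real)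
 also have "... = (LBINT x:{0<..<L}. \<Sum>j\<in>K. \<Sum>l\<in>K. d j * cnj (d l) * (phi L j x * phi L (- l) x))"
 by (simp only: complex_norm_square cnj_sum complex_cnj_mult cnj_phi sum_product mult_ac)
 also have "... = (\<Sum>j\<in>K. \<Sum>l\<in>K. d j * cnj (d l) * (LBINT x:{0<..<L}. phi L j x * phi L (- l) x))"
 using i unfolding set_int_def set_integrable_def scaleR_sum_right
 by (simp add: Bochner_Integration.integral_sum Bochner_Integration.integrable_sum flip: mult_scaleR_right)
 also have "... = (\<Sum>j\<in>K. d j * cnj (d j))"
 using K by (simp add: integral_phi_phi[OF L] if_distrib[of "%x. _ * x"] cong: if_cong)
 also have "... = cor (\<Sum>j\<in>K. (norm (d j))^2)" by (simp only: of_real_sum complex_norm_square)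
 finally show ?thesis by (simp only: of_real_eq_iff)
qed

end

section \<open>The wave equation in one dimension\<close>

text \<open>\<open>U y = A + C * integral {y..b} F\<close> dominates \<open>F\<close> and has
  derivative \<open>- C * F\<close>, so \<open>exp (C * y) * U y\<close> is nondecreasing.\<close>

lemma Gronwall_backward:
 fixes F :: "real => real"
 assumes F: "cts {a..b} F" and C: "0 <= C"
 and le: "!!y. y : {a..b} ==> F y <= A + C * integral {y..b} F" and ab: "a <= b"
 shows "F a <= A * exp (C * (b - a))"
proof -
 define U where "U y = A + C * (integral {a..b} F - integral {a..y} F)" for y
 have split: "integral {a..b} F - integral {a..y} F = integral {y..b} F" if "y : {a..b}" for y
 using that by (subst hk_integral_combine[of a y b, symmetric])
 (auto intro: int_cont F)
 have dI: "((%y. integral {a..y} F) hrd F y) (at y within {a..b})" if "y : {a..b}" for y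
 using integral_has_vector_derivative[OF F that] by (simp add: real_deriv_iff)
 have dU: "((%y. exp (C * y) * U y) hrd exp (C * y) * C * (U y - F y)) (at y within {a..b})" if "y : {a..b}" for y
 unfolding U_def by (auto intro!: deqs dI that simp: algebra_simps)
 have "exp (C * a) * U a <= exp (C * b) * U b"
 proof (rule DERIV_nonneg_imp_increasing_open[OF ab])
 fix y assume y: "a < y" "y < b"
 hence "(at y within {a..b}) = at y" by (intro at_within_interior) auto
 hence "((%y. exp (C * y) * U y) hrd exp (C * y) * C * (U y - F y)) (at y)"
 using dU[of y] y by simp
 moreover have "0 <= exp (C * y) * C * (U y - F y)"
 using le[of y] y C by (simp add: U_def split)
 ultimately show "EX d. DERIV (%y. exp (C * y) * U y) y :> d & d >= 0" by blast
 next
 show "cts {a..b} (%y. exp (C * y) * U y)"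
 using dU by (intro DERIV_continuous_on) auto
 qed
 hence "U a <= exp (C * (b - a)) * A"
 by (simp add: U_def right_diff_distrib exp_diff field_simps)
 moreover have "F a <= U a" using le[of a] ab by (simp add: U_def)
 ultimately show ?thesis by (simp add: mult.commute)
qed

text \<open>Summation over a fine subdivision. The criterion serves functions that need not be
  differentiable, such as products with a weight that is only monotone.\<close>

lemma nondecreasing_if_local:
 fixes h :: "real => real"
 assumes ab: "a <= b"
 and loc: "!!e. e > 0 ==> EX d>0. ALL x y. a <= x --> x <= y --> y <= b --> y - x < d --> - e * (y - x) <= h y - h x"
 shows "h a <= h b"
proof -
 have "h a <= h b + e" if e: "e > 0" for e
 proof -
 define e' where "e' = e / (b - a + 1)"
 have e': "e' > 0" "e' * (b - a) <= e" using e ab by (auto simp: e'_def field_simps)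
 obtain d where d: "d > 0" "!!x y. a <= x ==> x <= y ==> y <= b ==> y - x < d ==> - e' * (y - x) <= h y - h x"
 using loc[OF e'(1)] by blast
 obtain n :: nat where n: "(b - a) / d < real n" using reals_Archimedean2 by blast
 hence n0: "0 < real n" using ab d(1) by (meson divide_nonneg_pos diff_ge_0_iff_ge le_less_trans)
 define x where "x i = a + real i * ((b - a) / real n)" for i
 have step: "- e' * ((b - a) / real n) <= h (x (Suc i)) - h (x i)" if i: "i < n" for i
 proof -
 have s: "x (Suc i) - x i = (b - a) / real n" by (simp add: x_def distrib_right del: times_divide_eq_right)
 have "(b - a) / real n < d" using n n0 d(1) by (simp add: field_simps)
 moreover have "real (Suc i) * ((b - a) / real n) <= real n * ((b - a) / real n)"
 using i ab n0 by (intro mult_right_mono) auto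
 hence "x (Suc i) <= b" using n0 by (simp add: x_def)
 moreover have "a <= x i" using ab n0 by (simp add: x_def)
 moreover have "x i <= x (Suc i)" using s ab n0 by (metis diff_ge_0_iff_ge divide_nonneg_pos)
 ultimately show ?thesis using d(2)[of "x i" "x (Suc i)"] s by simp
 qed
 have "- (e' * (b - a)) = (\<Sum>i<n. - e' * ((b - a) / real n))" using n0 by simp
 also have "... <= (\<Sum>i<n. h (x (Suc i)) - h (x i))" by (intro sum_mono step) simp
 also have "... = h (x n) - h (x 0)" by (rule sum_lessThan_telescope)
 also have "... = h b - h a" using n0 by (simp add: x_def)
 finally show ?thesis using e'(2) by linarith
 qed
 thus ?thesis by (rule field_le_epsilon)
qed

text \<open>Integration by parts in Stieltjes form: the discarded term is the integral of
  \<open>X\<close> with respect to the increasing function \<open>m\<close>, which is nonnegative.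
  Uniform continuity of \<open>m\<close> allows freezing it on short intervals.\<close>

lemma mono_product_ge:
 fixes m X X' :: "real => real"
 assumes m: "mono_on {a..b} m" "cts {a..b} m"
 and X: "!!y. y : {a..b} ==> (X hrd X' y) (at y within {a..b})" "cts {a..b} X'"
 and nn: "!!y. y : {a..b} ==> 0 <= X y" and ab: "a <= b"
 shows "integral {a..b} (%y. m y * X' y) <= m b * X b - m a * X a"
proof -
 have c: "cts {a..b} (%y. m y * X' y)" by (intro cints m X)
 define h where "h y = m y * X y - integral {a..y} (%y. m y * X' y)" for y
 obtain K where K: "ALL y:{a..b}. norm (X' y) <= K"
 using compact_imp_bounded[OF compact_continuous_image[OF X(2)]] by (auto simp: bounded_iff)
 have "h a <= h b"
 proof (rule nondecreasing_if_local[OF ab])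
 fix e :: real assume e: "e > 0"
 define e' where "e' = e / (abs K + 1)"
 have e': "e' > 0" "e' * abs K <= e" using e by (auto simp: e'_def field_simps)
 obtain d where d: "d > 0" "!!x y. x : {a..b} ==> y : {a..b} ==> dist y x < d ==> dist (m y) (m x) < e'"
 using compact_uniformly_continuous[OF m(2)] e'(1) unfolding uniformly_continuous_on_def by (metis compact_Icc)
 show "EX d>0. ALL x y. a <= x --> x <= y --> y <= b --> y - x < d --> - e * (y - x) <= h y - h x"
 proof (intro exI[of _ d] conjI allI impI d(1))
 fix x y assume xy: "a <= x" "x <= y" "y <= b" "y - x < d"
 have cx: "cts {x..y} (%y. m y * X' y)" "cts {x..y} X'" "cts {x..y} m"
 using c X(2) m(2) xy by (auto elim: cont_sub)
 have I: "integral {a..y} (%y. m y * X' y) = integral {a..x} (%y. m y * X' y) + integral {x..y} (%y. m y * X' y)"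
 using xy by (intro hk_integral_combine[symmetric] int_cont cont_sub[OF c]) auto
 have FTC: "(X' has_integral X y - X x) {x..y}"
 proof (rule fundamental_theorem_of_calculus)
 fix s assume "s : {x..y}"
 hence "(X hrd X' s) (at s within {x..y})"
 using xy by (intro DERIV_subset[OF X(1)]) auto
 thus "(X hvd X' s) (at s within {x..y})"
 by (simp add: real_deriv_iff)
 qed (use xy in simp)
 have "- e * (y - x) = integral {x..y} (%s. - e)" using xy by simp
 also have "... <= integral {x..y} (%s. m x * X' s - m s * X' s)"
 proof (intro integral_le int_cont cints cx)
 fix s assume s: "s : {x..y}"
 have "abs (m x - m s) <= e'" using d(2)[of s x] s xy by (auto simp: dist_real_def)
 hence "abs ((m x - m s) * X' s) <= e' * abs K"
 unfolding abs_mult using K s xy e' by (intro mult_mono) (auto intro: order_trans[OF _ abs_ge_self])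
 thus "- e <= m x * X' s - m s * X' s" using e' by (simp add: abs_le_iff algebra_simps)
 qed
 also have "... = m x * (X y - X x) - integral {x..y} (%s. m s * X' s)"
 using FTC by (subst hk_integral_diff)
 (auto intro!: int_cont cints cx simp: integral_unique)
 also have "... <= m x * (X y - X x) + (m y - m x) * X y - integral {x..y} (%s. m s * X' s)"
 using nn[of y] m(1) xy by (auto simp: mono_on_def)
 also have "... = h y - h x" unfolding h_def I by (simp add: algebra_simps)
 finally show "- e * (y - x) <= h y - h x" .
 qed
 qed
 thus ?thesis by (simp add: h_def)
qed

lemma integral_Cauchy_Schwarz_1:
 fixes f :: "real => real"
 assumes f: "cts {a..b} f" and ab: "a <= b"
 shows "(integral {a..b} f)^2 <= (b - a) * integral {a..b} (%x. (f x)^2)"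
proof (cases "a = b")
 case False
 \<comment> \<open>The mean of \<open>f\<close>; nonnegativity of the variance is the
   inequality.\<close>
 define c where "c = integral {a..b} f / (b - a)"
 have i: "f integrable_on {a..b}" "(%x. (f x)^2) integrable_on {a..b}"
 by (intro int_cont cints f)+
 have "0 <= integral {a..b} (%x. (f x - c)^2)"
 by (intro integral_nonneg int_cont cints f) auto
 also have "... = integral {a..b} (%x. ((f x)^2 - (2 * c) * f x) + c^2)"
 by (simp add: power2_diff algebra_simps)
 also have "... = integral {a..b} (%x. (f x)^2) - 2 * c * integral {a..b} f + c^2 * (b - a)"
 proof (rule integral_unique)
 have "((%x. c^2) has_integral (c^2 * (b - a))) {a..b}"
 using has_integral_const_real[of "c^2" a b] ab by (simp add: mult.commute)
 thus "((%x. (f x)^2 - 2 * c * f x + c^2) has_integral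
 integral {a..b} (%x. (f x)^2) - 2 * c * integral {a..b} f + c^2 * (b - a)) {a..b}"
 using i by (intro has_integral_add has_integral_diff has_integral_mult_right integrable_integral)
 qed
 also have "... = integral {a..b} (%x. (f x)^2) - (integral {a..b} f)^2 / (b - a)"
 proof -
 have "c^2 * (b - a) = c * integral {a..b} f" using False by (simp add: c_def power2_eq_square)
 moreover have "(integral {a..b} f)^2 / (b - a) = c * integral {a..b} f" by (simp add: c_def power2_eq_square)
 ultimately show ?thesis by simp
 qed
 finally show ?thesis using False ab by (simp add: pos_divide_le_eq mult.commute)
qed simp

definition cont2 :: "real => real => (real => real => real) => bool" where
 "cont2 T H f \<longleftrightarrow> cts ({0..T} \<times> {0..H}) (%z. f (fst z) (snd z))"

lemma cont2_t: "cont2 T H f ==> y : {0..H} ==> cts {0..T} (%t. f t y)"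
 and cont2_y: "cont2 T H f ==> t : {0..T} ==> cts {0..H} (f t)"
proof -
 assume f: "cont2 T H f"
 show "cts {0..T} (%t. f t y)" if "y : {0..H}"
 proof -
 have "cts {0..T} (%t. (%z. f (fst z) (snd z)) (t, y))"
 by (rule cont_comp[OF f[unfolded cont2_def]]) (use that in \<open>auto intro!: cints\<close>)
 thus ?thesis by simp
 qed
 show "cts {0..H} (f t)" if "t : {0..T}"
 proof -
 have "cts {0..H} (%y. (%z. f (fst z) (snd z)) (t, y))"
 by (rule cont_comp[OF f[unfolded cont2_def]]) (use that in \<open>auto intro!: cints\<close>)
 thus ?thesis by simp
 qed
qed

lemma cont2_arith:
 "cont2 T H f ==> cont2 T H g ==> cont2 T H (%t y. f t y + g t y)"
 "cont2 T H f ==> cont2 T H g ==> cont2 T H (%t y. f t y - g t y)"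
 "cont2 T H f ==> cont2 T H g ==> cont2 T H (%t y. f t y * g t y)"
 "cont2 T H f ==> cont2 T H (%t y. (f t y) ^ n)"
 "cont2 T H (%t y. c)"
 "cts {0..H} s ==> cont2 T H (%t y. s y)"
 "cts {0..T} r ==> cont2 T H (%t y. r t)"
 unfolding cont2_def
 by (intro cints; assumption | rule cont_comp, assumption, auto intro: cints)+

lemma cont2_leibniz_y:
 assumes d: "!!t y. t : {0..T} ==> y : {0..H} ==> ((%y. f t y) hrd f' t y) (at y within {0..H})"
 and f: "cont2 T H f" and f': "cont2 T H f'" and y: "y : {0..H}" and t: "0 <= t1" "t2 <= T"
 shows "((%y. integral {t1..t2} (%t. f t y)) hrd integral {t1..t2} (%t. f' t y)) (at y within {0..H})"
proof -
 have "((%y. integral (cbox t1 t2) (%t. f t y)) has_field_derivative integral (cbox t1 t2) (%t. f' t y)) (at y within {0..H})"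
 proof (rule leibniz_rule_field_derivative[where U="{0..H}"])
 show "((%y. f t y) has_field_derivative f' t y) (at y within {0..H})" if "y : {0..H}" "t : cbox t1 t2" for y t
 using that t by (intro d) auto
 show "(%t. f t y) integrable_on cbox t1 t2" if "y : {0..H}" for y
 using cont_sub[OF cont2_t[OF f that], of "{t1..t2}"] t by (auto intro: int_cont)
 have "cts ({0..H} \<times> {0..T}) (%(y, t). f' t y)"
 using continuous_on_swap_args[of "{0..T}" "{0..H}" f'] f' by (simp add: cont2_def case_prod_beta')
 thus "cts ({0..H} \<times> cbox t1 t2) (%(y, t). f' t y)"
 by (rule cont_sub) (use t in auto)
 qed (use y in auto)
 thus ?thesis by simp
qed

lemma cont2_leibniz_t:
 assumes d: "!!t y. t : {0..T} ==> y : {0..H} ==> ((%t. f t y) hrd f' t y) (at t within {0..T})"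
 and f: "cont2 T H f" and f': "cont2 T H f'" and t: "t : {0..T}" and y: "0 <= y1" "y2 <= H"
 shows "((%t. integral {y1..y2} (f t)) hrd integral {y1..y2} (f' t)) (at t within {0..T})"
proof -
 have "((%t. integral (cbox y1 y2) (f t)) has_field_derivative integral (cbox y1 y2) (f' t)) (at t within {0..T})"
 proof (rule leibniz_rule_field_derivative[where U="{0..T}"])
 show "((%t. f t y) has_field_derivative f' t y) (at t within {0..T})" if "t : {0..T}" "y : cbox y1 y2" for y t
 using that y by (intro d) auto
 show "f t integrable_on cbox y1 y2" if "t : {0..T}" for t
 using cont_sub[OF cont2_y[OF f that], of "{y1..y2}"] y by (auto intro: int_cont)
 show "cts ({0..T} \<times> cbox y1 y2) (%(t, y). f' t y)"
 using f' y by (auto simp: cont2_def case_prod_beta' elim: cont_sub)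
 qed (use t in auto)
 thus ?thesis by simp
qed

lemma cont2_swap:
 assumes f: "cont2 T H f" and t: "0 <= t1" "t2 <= T" and y: "0 <= y1" "y2 <= H"
 shows "integral {t1..t2} (%t. integral {y1..y2} (f t)) = integral {y1..y2} (%y. integral {t1..t2} (%t. f t y))"
proof -
 have "cbox (t1, y1) (t2, y2) <= {0..T} \<times> {0..H}" using t y by (auto simp: cbox_Pair_eq)
 hence "cts (cbox (t1, y1) (t2, y2)) (%(t, y). f t y)"
 using f by (auto simp: cont2_def case_prod_beta' elim: cont_sub)
 from integral_swap_continuous[OF this] show ?thesis by simp
qed

lemma cont2_integral_t:
 assumes f: "cont2 T H f"
 shows "cts {0..T} (%t. integral {0..H} (f t))"
proof -
 have "cts {0..T} (%t. integral (cbox 0 H) (f t))"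
 using f by (intro integral_continuous_on_param) (simp add: cont2_def case_prod_beta')
 thus ?thesis by simp
qed

lemma cont2_integral_y:
 assumes f: "cont2 T H f"
 shows "cts {0..H} (%y. integral {0..T} (%t. f t y))"
proof -
 have "cts {0..H} (%y. integral (cbox 0 T) (%t. f t y))"
 using f continuous_on_swap_args[of "{0..T}" "{0..H}" f]
 by (intro integral_continuous_on_param) (simp add: cont2_def case_prod_beta')
 thus ?thesis by simp
qed

lemma integral_from_has_derivative:
 fixes f :: "real => real"
 assumes f: "cts {0..H} f" and y: "y : {0..H}"
 shows "((%y. integral {y..H} f) hrd - f y) (at y within {0..H})"
proof -
 have split: "integral {0..H} f - integral {0..x} f = integral {x..H} f" if "x : {0..H}" for x
 using that by (subst hk_integral_combine[of 0 x H, symmetric])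
 (auto intro: int_cont f)
 have "((%y. integral {0..H} f - integral {0..y} f) hvd 0 - f y) (at y within {0..H})"
 by (intro has_vector_derivative_diff has_vector_derivative_const integral_has_vector_derivative[OF f y])
 hence "((%y. integral {y..H} f) hvd 0 - f y) (at y within {0..H})"
 by (rule has_vector_derivative_transform[OF y, rotated]) (simp add: split)
 thus ?thesis by (simp add: real_deriv_iff)
qed

text \<open>The substitution \<open>s = y + r (H - y)\<close> makes the range of integration constant.\<close>

lemma cont2_integral_from:
 assumes f: "cont2 T H f"
 shows "cont2 T H (%t y. integral {y..H} (f t))"
proof -
 have eq: "integral {y..H} (f t) = integral {0..1} (%r. (H - y) * f t (y + r * (H - y)))"
 if t: "t : {0..T}" and y: "y : {0..H}" for t y
 proof -
 note ct = cont2_y[OF f t]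
 have "((%r. - integral {y + r * (H - y)..H} (f t)) hrd (H - y) * f t (y + r * (H - y))) (at r within {0..1})"
 if r: "r : {0..1}" for r
 proof -
 have range: "y + r * (H - y) : {0..H}" if "r : {0..1}" for r
 using that y mult_left_le_one_le[of "H - y" r] by auto
 have "((%s. - integral {s..H} (f t)) hrd f t (y + r * (H - y))) (at (y + r * (H - y)) within (%r. y + r * (H - y)) ` {0..1})"
 using DERIV_minus[OF integral_from_has_derivative[OF ct range[OF r]]] range
 by (auto intro: DERIV_subset)
 moreover have "((%r. y + r * (H - y)) hrd (H - y)) (at r within {0..1})"
 by (auto intro!: deqs)
 ultimately show ?thesis
 using DERIV_image_chain[of "%s. - integral {s..H} (f t)" "f t (y + r * (H - y))" "%r. y + r * (H - y)" r "{0..1}" "H - y"]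
 by (simp add: o_def mult.commute)
 qed
 hence "((%r. (H - y) * f t (y + r * (H - y))) has_integral
 (- integral {y + 1 * (H - y)..H} (f t)) - (- integral {y + 0 * (H - y)..H} (f t))) {0..1}"
 by (intro fundamental_theorem_of_calculus) (auto simp: real_deriv_iff[symmetric])
 thus ?thesis by (intro integral_unique[symmetric]) simp
 qed
 have "cts (({0..T} \<times> {0..H}) \<times> {0..1}) (%z. (H - snd (fst z)) * f (fst (fst z)) (snd (fst z) + snd z * (H - snd (fst z))))"
 proof (intro cints)
 have "cts (({0..T} \<times> {0..H}) \<times> {0..1}) (%z. (%z. f (fst z) (snd z)) (fst (fst z), snd (fst z) + snd z * (H - snd (fst z))))"
 proof (rule cont_comp[OF f[unfolded cont2_def]])
 show "(%z. (fst (fst z), snd (fst z) + snd z * (H - snd (fst z)))) ` (({0..T} \<times> {0..H}) \<times> {0..1}) <= {0..T} \<times> {0..H}"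
 proof (rule image_subsetI)
 fix z :: "(real \<times> real) \<times> real" assume "z : ({0..T} \<times> {0..H}) \<times> {0..1}"
 hence "fst (fst z) : {0..T}" "snd (fst z) : {0..H}" "snd z : {0..1}" by auto
 thus "(fst (fst z), snd (fst z) + snd z * (H - snd (fst z))) : {0..T} \<times> {0..H}"
 using mult_left_le_one_le[of "H - snd (fst z)" "snd z"] by auto
 qed
 qed (intro cints)
 thus "cts (({0..T} \<times> {0..H}) \<times> {0..1}) (%z. f (fst (fst z)) (snd (fst z) + snd z * (H - snd (fst z))))" by simp
 qed
 hence "cts ({0..T} \<times> {0..H}) (%z. integral (cbox 0 1) (%r. (H - snd z) * f (fst z) (snd z + r * (H - snd z))))"
 by (intro integral_continuous_on_param) (simp add: case_prod_beta')
 thus ?thesis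
 unfolding cont2_def by (rule continuous_on_eq) (auto simp: eq)
qed

text \<open>\<open>al\<close> is the time derivative of \<open>a\<close>, and \<open>ga\<close> is
  the common value of \<open>a_y\<close> and \<open>b_t\<close>. The wave equation is read as
  \<open>b_y = sg * al + La * P\<close>, the form suited to integration in \<open>y\<close>.\<close>

locale classical_wave =
 fixes T H bt La :: real and sg :: "real => real" and P a b al ga :: "real => real => real"
 assumes T: "0 <= T" and H: "0 < H" and La: "0 <= La" and bt: "0 <= bt"
 and sg: "cts {0..H} sg" "!!y. y : {0..H} ==> 0 < sg y"
 and cont: "cont2 T H P" "cont2 T H a" "cont2 T H b" "cont2 T H al" "cont2 T H ga"
 and P_t: "!!t y. t : {0..T} ==> y : {0..H} ==> ((%t. P t y) hrd a t y) (at t within {0..T})"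
 and P_y: "!!t y. t : {0..T} ==> y : {0..H} ==> ((%y. P t y) hrd b t y) (at y within {0..H})"
 and a_t: "!!t y. t : {0..T} ==> y : {0..H} ==> ((%t. a t y) hrd al t y) (at t within {0..T})"
 and a_y: "!!t y. t : {0..T} ==> y : {0..H} ==> ((%y. a t y) hrd ga t y) (at y within {0..H})"
 and b_t: "!!t y. t : {0..T} ==> y : {0..H} ==> ((%t. b t y) hrd ga t y) (at t within {0..T})"
 and b_y: "!!t y. t : {0..T} ==> y : {0..H} ==> ((%y. b t y) hrd sg y * al t y + La * P t y) (at y within {0..H})"
 and bdry: "!!t. t : {0..T} ==> P t 0 = 0" "!!t. t : {0..T} ==> a t 0 = 0" "!!t. t : {0..T} ==> b t H = - bt * a t H"
begin

definition E :: "real => real" where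
 "E t = integral {0..H} (%y. sg y * (a t y)^2 + (b t y)^2 + La * (P t y)^2)"

lemma H0: "0 : {0..H}" "H : {0..H}" using H by auto

lemma energy_derivative:
 assumes t: "t : {0..T}"
 shows "(E hrd - 2 * bt * (a t H)^2) (at t within {0..T})"
proof -
 let ?e = "%t y. sg y * (a t y)^2 + (b t y)^2 + La * (P t y)^2"
 let ?f = "%t y. sg y * (2 * a t y * al t y) + 2 * b t y * ga t y + La * (2 * P t y * a t y)"
 have "(E hrd integral {0..H} (?f t)) (at t within {0..T})"
 unfolding E_def
 proof (rule cont2_leibniz_t)
 show "((%t. ?e t y) hrd ?f t y) (at t within {0..T})" if "t : {0..T}" "y : {0..H}" for t y
 by (auto intro!: deqs a_t b_t P_t that)
 qed (use t in \<open>auto intro!: cont2_arith cont sg\<close>)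
 \<comment> \<open>By the equation the integrand is the y-derivative of \<open>2 * a * b\<close>, so
   only the flux through the top side remains.\<close>
 moreover have "(?f t has_integral 2 * (a t H * b t H) - 2 * (a t 0 * b t 0)) {0..H}"
 proof (rule fundamental_theorem_of_calculus)
 fix y assume y: "y : {0..H}"
 have "((%y. 2 * (a t y * b t y)) hrd ?f t y) (at y within {0..H})"
 by (auto intro!: deqs a_y b_y t y simp: algebra_simps)
 thus "((%y. 2 * (a t y * b t y)) hvd ?f t y) (at y within {0..H})"
 by (simp add: real_deriv_iff)
 qed (use H in simp)
 ultimately show ?thesis using bdry t by (simp add: integral_unique power2_eq_square mult_ac)
qed

lemma energy_identity:
 assumes t: "t : {0..T}"
 shows "E T - E t = - 2 * bt * integral {t..T} (%t. (a t H)^2)"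
proof -
 have "((%t. - 2 * bt * (a t H)^2) has_integral E T - E t) {t..T}"
 proof (rule fundamental_theorem_of_calculus)
 fix s assume "s : {t..T}"
 hence "(E hrd - 2 * bt * (a s H)^2) (at s within {t..T})"
 using t by (intro DERIV_subset[OF energy_derivative]) auto
 thus "(E hvd - 2 * bt * (a s H)^2) (at s within {t..T})"
 by (simp add: real_deriv_iff)
 qed (use t in simp)
 hence "integral {t..T} (%t. - 2 * bt * (a t H)^2) = E T - E t" by (rule integral_unique)
 moreover have "integral {t..T} (%t. - 2 * bt * (a t H)^2) = - 2 * bt * integral {t..T} (%t. (a t H)^2)"
 by (rule integral_mult_right)
 ultimately show ?thesis by simp
qed

lemma energy_nonneg: "t : {0..T} ==> 0 <= E t"
 unfolding E_def using La sg(2)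
 by (intro integral_nonneg int_cont cont2_y[of T H "%t y. sg y * (a t y)^2 + (b t y)^2 + La * (P t y)^2"] cont2_arith cont sg)
 (auto intro!: add_nonneg_nonneg mult_nonneg_nonneg simp: less_imp_le)

lemma energy_antimono:
 assumes t: "t : {0..T}"
 shows "E T <= E t"
proof -
 have "0 <= integral {t..T} (%t. (a t H)^2)"
 using t by (intro integral_nonneg int_cont cints cont_sub[OF cont2_t[OF cont(2) H0(2)]]) auto
 hence "0 <= bt * integral {t..T} (%t. (a t H)^2)" using bt by (intro mult_nonneg_nonneg)
 thus ?thesis using energy_identity[OF t] by linarith
qed

definition A :: "real => real => real" where "A t y = integral {y..H} (a t)"
definition R :: "real => real => real" where "R t y = integral {y..H} (P t)"
text \<open>\<open>R_y = - P\<close> cancels the potential, so \<open>B_y = sg * al\<close>. The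
  potential reappears only in the time derivative of \<open>B\<close>, as the lower order term
  \<open>La * A\<close>, and \<open>B\<close> coincides with \<open>b\<close> at
  \<open>y = H\<close>.\<close>

definition B :: "real => real => real" where "B t y = b t y + La * R t y"

lemma cont_ARB: "cont2 T H A" "cont2 T H R" "cont2 T H B"
proof -
 show "cont2 T H A" "cont2 T H R" unfolding A_def[abs_def] R_def[abs_def] by (intro cont2_integral_from cont)+
 thus "cont2 T H B" unfolding B_def[abs_def] by (intro cont2_arith cont)
qed

lemma R_t:
 assumes "t : {0..T}" "y : {0..H}"
 shows "((%t. R t y) hrd A t y) (at t within {0..T})"
 unfolding R_def A_def using assms by (intro cont2_leibniz_t[OF P_t cont(1,2)]) auto

lemma R_y:
 assumes "t : {0..T}" "y : {0..H}"
 shows "((%y. R t y) hrd - P t y) (at y within {0..H})"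
 unfolding R_def using assms by (intro integral_from_has_derivative cont2_y[OF cont(1)])

lemma B_t:
 assumes "t : {0..T}" "y : {0..H}"
 shows "((%t. B t y) hrd ga t y + La * A t y) (at t within {0..T})"
 unfolding B_def by (auto intro!: deqs b_t R_t assms)

lemma B_y:
 assumes "t : {0..T}" "y : {0..H}"
 shows "((%y. B t y) hrd sg y * al t y) (at y within {0..H})"
 unfolding B_def by (auto intro!: deqs b_y R_y assms)

text \<open>\<open>B\<close> controls the energy because \<open>\<integral> b R = \<integral> P^2\<close>, by \<open>P t 0 = 0\<close> and \<open>R t H = 0\<close>.\<close>

lemma energy_le_B:
 assumes t: "t : {0..T}"
 shows "E t <= integral {0..H} (%y. sg y * (a t y)^2 + (B t y)^2)"
proof -
 have i: "f t integrable_on {0..H}" if "cont2 T H f" for f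
 by (intro int_cont cont2_y[OF that t])
 have "((%y. b t y * R t y - (P t y)^2) has_integral P t H * R t H - P t 0 * R t 0) {0..H}"
 proof (rule fundamental_theorem_of_calculus)
 fix y assume y: "y : {0..H}"
 have "((%y. P t y * R t y) hrd b t y * R t y - (P t y)^2) (at y within {0..H})"
 by (auto intro!: deqs P_y R_y t y simp: power2_eq_square algebra_simps)
 thus "((%y. P t y * R t y) hvd b t y * R t y - (P t y)^2) (at y within {0..H})"
 by (simp add: real_deriv_iff)
 qed (use H in simp)
 moreover have "R t H = 0" by (simp add: R_def)
 ultimately have z: "integral {0..H} (%y. b t y * R t y - (P t y)^2) = 0" using bdry(1)[OF t] by (simp add: integral_unique)
 have "E t = E t + 2 * La * integral {0..H} (%y. b t y * R t y - (P t y)^2)" using z by simp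
 also have "... = integral {0..H} (%y. (sg y * (a t y)^2 + (b t y)^2 + La * (P t y)^2) + 2 * La * (b t y * R t y - (P t y)^2))"
 unfolding E_def
 by (subst hk_integral_add) (auto intro!: i cont2_arith cont cont_ARB sg)
 also have "... <= integral {0..H} (%y. sg y * (a t y)^2 + (B t y)^2)"
 proof (intro integral_le)
 show "(%y. (sg y * (a t y)^2 + (b t y)^2 + La * (P t y)^2) + 2 * La * (b t y * R t y - (P t y)^2)) integrable_on {0..H}"
 "(%y. sg y * (a t y)^2 + (B t y)^2) integrable_on {0..H}"
 by (intro i cont2_arith cont cont_ARB sg)+
 fix y
 \<comment> \<open>After expanding \<open>B^2\<close>, adding the multiple of the vanishing integral
   has turned \<open>La * P^2\<close> into \<open>- La * P^2\<close>; together with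
   \<open>- (La * R)^2\<close> it has the favourable sign.\<close>
 have "0 <= La * (P t y)^2 + (La * R t y)^2" using La by simp
 thus "(sg y * (a t y)^2 + (b t y)^2 + La * (P t y)^2) + 2 * La * (b t y * R t y - (P t y)^2) <= sg y * (a t y)^2 + (B t y)^2"
 by (simp add: B_def power2_eq_square algebra_simps)
 qed
 finally show ?thesis .
qed

end

section \<open>Sideways energy estimate\<close>

lemma cont2_compose:
 assumes "cts UNIV f" "cont2 T H g"
 shows "cont2 T H (%t y. f (g t y))"
 unfolding cont2_def
 by (rule cont_comp[OF assms(1) assms(2)[unfolded cont2_def]]) simp

lemma cont2_integrable_t: "cont2 T H f ==> y : {0..H} ==> (%t. f t y) integrable_on {0..T}"
 by (intro int_cont cont2_t)

lemma cont2_integrable_y: "cont2 T H f ==> t : {0..T} ==> f t integrable_on {0..H}"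
 by (intro int_cont cont2_y)

text \<open>
 The variables \<open>t\<close> and \<open>y\<close> exchange their roles: the energy on the lines of constant \<open>y\<close>, cut off
 so that no flux enters through the ends of the time interval, is propagated from \<open>y = H\<close> downwards.
\<close>

locale sideways = classical_wave +
 fixes ta :: real and G rh rh' :: "real => real"
 assumes ta: "0 <= ta" "!!y. y : {0..H} ==> sg y <= ta^2"
 and G: "cts {0..H} G" "G H = 0"
 "mono_on {0..H} (%y. exp (- G y))" "mono_on {0..H} (%y. sg y * exp (- G y))"
 and rh: "!!x. (rh hrd rh' x) (at x)" "cts UNIV rh'" "!!x. 0 <= rh' x"
 "!!x. 0 <= rh x" "!!x. rh x <= 1" "!!x. x <= 0 ==> rh x = 0"
begin

text \<open>A cut-off to the time window from \<open>ta * (H - y)\<close> to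
  \<open>T - ta * (H - y)\<close>. Its boundary lines have slowness \<open>ta\<close>, which is at
  least \<open>sqrt (sg y)\<close>; the window loses the length \<open>2 * ta * H\<close> between
  \<open>y = H\<close> and \<open>y = 0\<close>.\<close>

definition w :: "real => real => real" where
 "w t y = rh (t - ta * (H - y)) * rh (T - ta * (H - y) - t)"
definition w_t :: "real => real => real" where
 "w_t t y = rh' (t - ta * (H - y)) * rh (T - ta * (H - y) - t) - rh (t - ta * (H - y)) * rh' (T - ta * (H - y) - t)"
definition w_y :: "real => real => real" where
 "w_y t y = ta * (rh' (t - ta * (H - y)) * rh (T - ta * (H - y) - t) + rh (t - ta * (H - y)) * rh' (T - ta * (H - y) - t))"

lemma cont_rh: "cts UNIV rh"
 using rh(1) by (intro DERIV_continuous_on) (auto intro: has_field_derivative_at_within)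

lemma rh_mono: "x <= y ==> rh x <= rh y"
 by (rule DERIV_nonneg_imp_nondecreasing) (use rh in auto)

lemma cont_w: "cont2 T H w" "cont2 T H w_t" "cont2 T H w_y"
proof -
 have l: "cont2 T H (%t y. t - ta * (H - y))" "cont2 T H (%t y. T - ta * (H - y) - t)"
 unfolding cont2_def by (intro cints)+
 note c = l[THEN cont2_compose[OF cont_rh]] l[THEN cont2_compose[OF rh(2)]]
 show "cont2 T H w" "cont2 T H w_t" "cont2 T H w_y"
 unfolding w_def[abs_def] w_t_def[abs_def] w_y_def[abs_def] by (intro cont2_arith c)+
qed

lemma w_derivs:
 "((%t. w t y) hrd w_t t y) (at t within S)"
 "((%y. w t y) hrd w_y t y) (at y within S)"
proof -
 have "((%t. rh (t - ta * (H - y))) hrd rh' (t - ta * (H - y)) * 1) (at t within S)"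
 "((%t. rh (T - ta * (H - y) - t)) hrd rh' (T - ta * (H - y) - t) * (-1)) (at t within S)"
 by (intro DERIV_chain2[OF rh(1)]; auto intro!: deqs)+
 from DERIV_mult[OF this] show "((%t. w t y) hrd w_t t y) (at t within S)"
 unfolding w_def w_t_def by (simp add: algebra_simps)
 have "((%y. rh (t - ta * (H - y))) hrd rh' (t - ta * (H - y)) * ta) (at y within S)"
 "((%y. rh (T - ta * (H - y) - t)) hrd rh' (T - ta * (H - y) - t) * ta) (at y within S)"
 by (intro DERIV_chain2[OF rh(1)]; auto intro!: deqs)+
 from DERIV_mult[OF this] show "((%y. w t y) hrd w_y t y) (at y within S)"
 unfolding w_def w_y_def by (simp add: algebra_simps)
qed

lemma w_nonneg: "0 <= w t y" unfolding w_def using rh by simp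

lemma w_mono: "y <= y' ==> w t y <= w t y'"
 unfolding w_def using ta by (intro mult_mono rh_mono rh) (auto intro: mult_left_mono)

text \<open>The lines bounding the window are at least as slow as the waves. This sign condition
  absorbs the term with \<open>w_t\<close> in \<open>flux_bound\<close>.\<close>

lemma w_t_le: "ta * abs (w_t t y) <= w_y t y"
 unfolding w_t_def w_y_def using ta rh by (intro mult_left_mono abs_triangle_ineq4[THEN order_trans]) auto

lemma w_ends: "y <= H ==> w 0 y = 0" "y <= H ==> w T y = 0"
 unfolding w_def using ta by (auto simp: rh(6))

definition X :: "real => real" where "X y = integral {0..T} (%t. w t y * (a t y)^2)"
definition Y :: "real => real" where "Y y = integral {0..T} (%t. w t y * (B t y)^2)"
definition X' :: "real => real" where "X' y = integral {0..T} (%t. w_y t y * (a t y)^2 + w t y * (2 * a t y * ga t y))"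
definition Y' :: "real => real" where "Y' y = integral {0..T} (%t. w_y t y * (B t y)^2 + w t y * (2 * B t y * (sg y * al t y)))"
text \<open>The windowed energy on the line of height \<open>y\<close>, weighted by
  \<open>exp (- G)\<close>, so that \<open>X\<close> and \<open>Y\<close> each carry a nondecreasing
  factor.\<close>

definition F :: "real => real" where "F y = sg y * exp (- G y) * X y + exp (- G y) * Y y"

lemma XY_nonneg: "y : {0..H} ==> 0 <= X y" "y : {0..H} ==> 0 <= Y y"
 unfolding X_def Y_def
 by (intro integral_nonneg cont2_integrable_t[of T H "%t y. w t y * (a t y)^2"]
 cont2_integrable_t[of T H "%t y. w t y * (B t y)^2"] cont2_arith cont_w cont cont_ARB;
 simp add: w_nonneg)+

lemma cont_XY: "cts {0..H} X" "cts {0..H} Y" "cts {0..H} X'" "cts {0..H} Y'"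
 unfolding X_def[abs_def] Y_def[abs_def] X'_def[abs_def] Y'_def[abs_def]
 by (intro cont2_integral_y cont2_arith cont_w cont cont_ARB sg)+

lemma XY_derivs:
 assumes y: "y : {0..H}"
 shows "(X hrd X' y) (at y within {0..H})" "(Y hrd Y' y) (at y within {0..H})"
proof -
 have "((%y. integral {0..T} (%t. w t y * (a t y)^2)) has_real_derivative
 integral {0..T} (%t. w_y t y * (a t y)^2 + w t y * (2 * a t y * ga t y))) (at y within {0..H})"
 proof (rule cont2_leibniz_y)
 fix t y assume ty: "t : {0..T}" "y : {0..H}"
 show "((%y. w t y * (a t y)^2) hrd w_y t y * (a t y)^2 + w t y * (2 * a t y * ga t y)) (at y within {0..H})"
 by (auto intro!: deqs w_derivs a_y ty)
 qed (use y in \<open>auto intro!: cont2_arith cont_w cont\<close>)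
 thus "(X hrd X' y) (at y within {0..H})" unfolding X_def[abs_def] X'_def .
 have "((%y. integral {0..T} (%t. w t y * (B t y)^2)) has_real_derivative
 integral {0..T} (%t. w_y t y * (B t y)^2 + w t y * (2 * B t y * (sg y * al t y)))) (at y within {0..H})"
 proof (rule cont2_leibniz_y)
 fix t y assume ty: "t : {0..T}" "y : {0..H}"
 show "((%y. w t y * (B t y)^2) hrd w_y t y * (B t y)^2 + w t y * (2 * B t y * (sg y * al t y))) (at y within {0..H})"
 by (auto intro!: deqs w_derivs B_y ty)
 qed (use y in \<open>auto intro!: cont2_arith cont_w cont cont_ARB sg\<close>)
 thus "(Y hrd Y' y) (at y within {0..H})" unfolding Y_def[abs_def] Y'_def .
qed

lemma F_ge: assumes y: "y : {0..H}" shows "sg y * exp (- G y) * X y <= F y" "0 <= F y"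
 using XY_nonneg[OF y] sg(2)[OF y] by (auto simp: F_def)

lemma cont_F: "cts {0..H} F"
 unfolding F_def[abs_def] by (intro cints cont_XY sg G)

text \<open>The time derivative of \<open>w * a * B\<close> integrates to 0, because
  \<open>w\<close> vanishes at both ends, so \<open>2 * sg\<close> times it may be subtracted. Then
  the mixed terms with \<open>al\<close> and \<open>ga\<close> cancel, the terms with derivatives of
  \<open>w\<close> combine to something nonnegative, and only
  \<open>- 2 * sg * La * w * a * A\<close> remains.\<close>

lemma flux_bound:
 assumes y: "y : {0..H}"
 shows "- La * sg y * (X y + H * integral {y..H} X) <= sg y * X' y + Y' y"
proof -
 have s: "0 < sg y" "sg y <= ta^2" using sg(2) ta(2) y by auto
 have i: "(%t. f t y) integrable_on {0..T}" if "cont2 T H f" for f by (rule cont2_integrable_t[OF that y])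
 let ?D = "%t y. w_t t y * (a t y * B t y) + w t y * (al t y * B t y + a t y * (ga t y + La * A t y))"
 have "((%t. ?D t y) has_integral w T y * (a T y * B T y) - w 0 y * (a 0 y * B 0 y)) {0..T}"
 proof (rule fundamental_theorem_of_calculus)
 fix t assume t: "t : {0..T}"
 have "((%t. w t y * (a t y * B t y)) hrd ?D t y) (at t within {0..T})"
 by (auto intro!: deqs w_derivs a_t B_t t y simp: algebra_simps)
 thus "((%t. w t y * (a t y * B t y)) hvd ?D t y) (at t within {0..T})"
 by (simp add: real_deriv_iff)
 qed (rule T)
 hence D0: "integral {0..T} (%t. ?D t y) = 0" using y by (simp add: integral_unique w_ends)
 have c: "cont2 T H (%t y. w_y t y * (a t y)^2 + w t y * (2 * a t y * ga t y))"
 "cont2 T H (%t y. w_y t y * (B t y)^2 + w t y * (2 * B t y * (sg y * al t y)))" "cont2 T H ?D"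
 "cont2 T H (%t y. w t y * (a t y)^2)" "cont2 T H (%t y. w t y * (A t y)^2)"
 by (intro cont2_arith cont_w cont cont_ARB sg)+
 have "sg y * X' y + Y' y = sg y * X' y + Y' y - 2 * sg y * integral {0..T} (%t. ?D t y)" using D0 by simp
 also have "... = integral {0..T} (%t. sg y * (w_y t y * (a t y)^2 + w t y * (2 * a t y * ga t y))
 + (w_y t y * (B t y)^2 + w t y * (2 * B t y * (sg y * al t y))) - 2 * sg y * ?D t y)"
 unfolding X'_def Y'_def
 by (rule integral_unique[symmetric], intro has_integral_diff has_integral_add has_integral_mult_right integrable_integral i c)
 also have "... >= integral {0..T} (%t. - La * sg y * (w t y * (a t y)^2 + w t y * (A t y)^2))"
 proof (intro integral_le)
 show "(%t. - La * sg y * (w t y * (a t y)^2 + w t y * (A t y)^2)) integrable_on {0..T}"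
 by (intro i cont2_arith cont_w cont cont_ARB sg)
 show "(%t. sg y * (w_y t y * (a t y)^2 + w t y * (2 * a t y * ga t y))
 + (w_y t y * (B t y)^2 + w t y * (2 * B t y * (sg y * al t y))) - 2 * sg y * ?D t y) integrable_on {0..T}"
 by (intro i cont2_arith cont_w cont cont_ARB sg)
 fix t
 \<comment> \<open>Since \<open>r <= ta\<close>, the product \<open>2 * sg * |a * B|\<close> is
   bounded by \<open>ta * (sg * a^2 + B^2)\<close>, with exactly the factor \<open>ta\<close> that
   \<open>w_t_le\<close> requires.\<close>
 define r where "r = sqrt (sg y)"
 have r: "r^2 = sg y" "0 <= r" "r <= ta" using s ta by (auto simp: r_def real_le_lsqrt)
 have "2 * sg y * abs (a t y * B t y) = r * (2 * (r * abs (a t y)) * abs (B t y))"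
 by (simp add: r(1)[symmetric] power2_eq_square abs_mult)
 also have "... <= r * ((r * abs (a t y))^2 + abs (B t y)^2)" by (intro mult_left_mono sum_squares_bound r)
 also have "... <= ta * ((r * abs (a t y))^2 + abs (B t y)^2)" by (intro mult_right_mono r) auto
 also have "... = ta * (sg y * (a t y)^2 + (B t y)^2)" by (simp add: power_mult_distrib r)
 finally have b1: "2 * sg y * abs (a t y * B t y) <= ta * (sg y * (a t y)^2 + (B t y)^2)" .
 have "2 * sg y * (w_t t y * (a t y * B t y)) <= abs (w_t t y) * (2 * sg y * abs (a t y * B t y))"
 using abs_ge_self[of "w_t t y * (a t y * B t y)"] s by (simp add: abs_mult mult_ac)
 also have "... <= abs (w_t t y) * (ta * (sg y * (a t y)^2 + (B t y)^2))" by (intro mult_left_mono b1) auto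
 also have "... = (ta * abs (w_t t y)) * (sg y * (a t y)^2 + (B t y)^2)" by simp
 also have "... <= w_y t y * (sg y * (a t y)^2 + (B t y)^2)"
 using s by (intro mult_right_mono w_t_le) auto
 finally have 1: "2 * sg y * (w_t t y * (a t y * B t y)) <= w_y t y * (sg y * (a t y)^2 + (B t y)^2)" .
 have "2 * (a t y * A t y) <= (a t y)^2 + (A t y)^2" using sum_squares_bound[of "a t y" "A t y"] by simp
 hence 2: "La * sg y * w t y * (2 * (a t y * A t y)) <= La * sg y * w t y * ((a t y)^2 + (A t y)^2)"
 using La s w_nonneg by (intro mult_left_mono) auto
 show "- La * sg y * (w t y * (a t y)^2 + w t y * (A t y)^2) <= sg y * (w_y t y * (a t y)^2 + w t y * (2 * a t y * ga t y))
 + (w_y t y * (B t y)^2 + w t y * (2 * B t y * (sg y * al t y))) - 2 * sg y * ?D t y"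
 using 1 2 by (simp add: algebra_simps)
 qed
 also have "integral {0..T} (%t. - La * sg y * (w t y * (a t y)^2 + w t y * (A t y)^2)) =
 - La * sg y * (X y + integral {0..T} (%t. w t y * (A t y)^2))"
 unfolding X_def by (rule integral_unique, intro has_integral_mult_right has_integral_add integrable_integral i c)
 finally have lower: "- La * sg y * (X y + integral {0..T} (%t. w t y * (A t y)^2)) <= sg y * X' y + Y' y" .
 \<comment> \<open>\<open>A\<close> integrates \<open>a\<close> over the heights above
   \<open>y\<close>, where the cut-off is larger: \<open>w t y\<close> may be replaced by
   \<open>w t s\<close> under the integral, and the term is bounded by the integral of
   \<open>X\<close>.\<close>
 have "integral {0..T} (%t. w t y * (A t y)^2) <= integral {0..T} (%t. H * integral {y..H} (%s. w t s * (a t s)^2))"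
 proof (rule integral_le)
 show "(%t. w t y * (A t y)^2) integrable_on {0..T}" by (rule i[OF c(5)])
 have "cont2 T H (%t y. H * integral {y..H} (%s. w t s * (a t s)^2))"
 by (intro cont2_arith cont2_integral_from[of T H "%t y. w t y * (a t y)^2"] c)
 thus "(%t. H * integral {y..H} (%s. w t s * (a t s)^2)) integrable_on {0..T}" by (rule i)
 fix t assume t: "t : {0..T}"
 have ca: "cts {y..H} (a t)" using y by (intro cont_sub[OF cont2_y[OF cont(2) t]]) auto
 have cw: "cts {y..H} (w t)" using y by (intro cont_sub[OF cont2_y[OF cont_w(1) t]]) auto
 have "(A t y)^2 <= (H - y) * integral {y..H} (%s. (a t s)^2)"
 unfolding A_def using y by (intro integral_Cauchy_Schwarz_1 ca) auto
 also have "... <= H * integral {y..H} (%s. (a t s)^2)"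
 using y by (intro mult_right_mono integral_nonneg int_cont cints ca) auto
 finally have "w t y * (A t y)^2 <= w t y * (H * integral {y..H} (%s. (a t s)^2))" by (intro mult_left_mono w_nonneg)
 also have "... = H * integral {y..H} (%s. w t y * (a t s)^2)" by simp
 also have "... <= H * integral {y..H} (%s. w t s * (a t s)^2)"
 using H by (intro mult_left_mono integral_le int_cont cints ca cw mult_right_mono w_mono) auto
 finally show "w t y * (A t y)^2 <= H * integral {y..H} (%s. w t s * (a t s)^2)" .
 qed
 also have "... = H * integral {y..H} X"
 unfolding X_def[abs_def] using y by (simp add: cont2_swap[OF c(4)])
 finally have "X y + integral {0..T} (%t. w t y * (A t y)^2) <= X y + H * integral {y..H} X" by simp
 hence "(La * sg y) * (X y + integral {0..T} (%t. w t y * (A t y)^2)) <= (La * sg y) * (X y + H * integral {y..H} X)"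
 using La s by (intro mult_left_mono) auto
 with lower show ?thesis by simp
qed

text \<open>The factor \<open>sg y * exp (- G y)\<close> moves under the integral over
  \<open>s >= y\<close> because it is nondecreasing; this closes the estimate in terms of
  \<open>F\<close> alone.\<close>

lemma weighted_flux_bound:
 assumes y: "y : {0..H}"
 shows "- La * (F y + H * integral {y..H} F) <= sg y * exp (- G y) * X' y + exp (- G y) * Y' y"
proof -
 have cX: "cts {y..H} X" "cts {y..H} F"
 using y by (auto intro: cont_sub[OF cont_XY(1)] cont_sub[OF cont_F])
 have "sg y * exp (- G y) * integral {y..H} X = integral {y..H} (%s. sg y * exp (- G y) * X s)" by simp
 also have "... <= integral {y..H} F"
 proof (intro integral_le int_cont cints cX)
 fix s assume s: "s : {y..H}"
 have "sg y * exp (- G y) * X s <= sg s * exp (- G s) * X s"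
 using G(4) s y XY_nonneg[of s] by (intro mult_right_mono) (auto simp: mono_on_def)
 also have "... <= F s" using F_ge(1)[of s] s y by simp
 finally show "sg y * exp (- G y) * X s <= F s" .
 qed
 finally have "sg y * exp (- G y) * X y + H * (sg y * exp (- G y) * integral {y..H} X) <= F y + H * integral {y..H} F"
 using F_ge(1)[OF y] H by (intro add_mono mult_left_mono) auto
 hence "La * (sg y * exp (- G y) * X y + H * (sg y * exp (- G y) * integral {y..H} X)) <= La * (F y + H * integral {y..H} F)"
 using La by (rule mult_left_mono)
 moreover have "exp (- G y) * (- La * sg y * (X y + H * integral {y..H} X)) <= exp (- G y) * (sg y * X' y + Y' y)"
 by (intro mult_left_mono flux_bound y) auto
 ultimately show ?thesis by (simp add: algebra_simps)
qed

text \<open>\<open>mono_product_ge\<close> replaces the differentiation of \<open>F\<close>, whose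
  weights are only monotone; the lower order term left by the potential is treated by Gronwall
  starting from \<open>H\<close>.\<close>

lemma F_Gronwall:
 assumes y: "y : {0..H}"
 shows "F y <= F H * exp (La * (1 + H^2) * (H - y))"
proof (rule Gronwall_backward)
 show "cts {y..H} F" using y by (auto intro: cont_sub[OF cont_F])
 show "0 <= La * (1 + H^2)" using La by simp
 show "y <= H" using y by simp
 fix z assume "z : {y..H}"
 hence z: "z : {0..H}" using y by auto
 let ?m1 = "%y. sg y * exp (- G y)" and ?m2 = "%y. exp (- G y)"
 have sub: "{z..H} <= {0..H}" using z by auto
 have cm: "cts {z..H} ?m1" "cts {z..H} ?m2"
 by (intro cints cont_sub[OF sg(1) sub] cont_sub[OF G(1) sub])+
 have 1: "integral {z..H} (%y. ?m1 y * X' y) <= ?m1 H * X H - ?m1 z * X z"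
 using z G(4) sub
 by (intro mono_product_ge cm DERIV_subset[OF XY_derivs(1)] cont_sub[OF cont_XY(3) sub] XY_nonneg)
 (auto intro: mono_on_subset)
 have 2: "integral {z..H} (%y. ?m2 y * Y' y) <= ?m2 H * Y H - ?m2 z * Y z"
 using z G(3) sub
 by (intro mono_product_ge cm DERIV_subset[OF XY_derivs(2)] cont_sub[OF cont_XY(4) sub] XY_nonneg)
 (auto intro: mono_on_subset)
 have ci: "cts {z..H} F" "cts {z..H} X'" "cts {z..H} Y'"
 by (intro cont_sub[OF cont_F sub] cont_sub[OF cont_XY(3) sub] cont_sub[OF cont_XY(4) sub])+
 have cI: "cts {z..H} (%y. integral {y..H} F)"
 by (rule cont_sub[OF _ sub], rule DERIV_continuous_on, rule integral_from_has_derivative[OF cont_F])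
 let ?I = "integral {z..H} F"
 have "- La * (1 + H^2) * ?I <= integral {z..H} (%y. - La * (F y + H * ?I))"
 proof -
 have I: "integral {z..H} (%y. - La * (F y + H * ?I)) = - La * (?I + H * ?I * (H - z))"
 using z ci by (subst integral_mult_right, subst hk_integral_add)
 (auto intro: int_cont)
 have I0: "0 <= ?I" using sub F_ge(2) by (intro integral_nonneg int_cont ci) auto
 have "H * ?I * (H - z) <= H * ?I * H" using I0 H z by (intro mult_left_mono) auto
 hence "La * (?I + H * ?I * (H - z)) <= La * (?I + H * ?I * H)" using La by (intro mult_left_mono) auto
 thus ?thesis unfolding I by (simp add: algebra_simps power2_eq_square)
 qed
 also have "... <= integral {z..H} (%y. - La * (F y + H * integral {y..H} F))"
 proof (intro integral_le int_cont cints ci cI)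
 fix s assume s: "s : {z..H}"
 have "integral {s..H} F <= ?I"
 using s sub F_ge(2) by (intro integral_subset_le int_cont ci cont_sub[OF ci(1)]) auto
 hence "La * (F s + H * integral {s..H} F) <= La * (F s + H * ?I)"
 using La H by (intro mult_left_mono add_left_mono) auto
 thus "- La * (F s + H * ?I) <= - La * (F s + H * integral {s..H} F)" by simp
 qed
 also have "... <= integral {z..H} (%y. ?m1 y * X' y + ?m2 y * Y' y)"
 using sub by (intro integral_le int_cont cints ci cI cm weighted_flux_bound) auto
 also have "... = integral {z..H} (%y. ?m1 y * X' y) + integral {z..H} (%y. ?m2 y * Y' y)"
 by (intro hk_integral_add int_cont cints ci cm)
 also have "... <= F H - F z" using 1 2 by (simp add: F_def)
 finally show "F z <= F H + La * (1 + H^2) * integral {z..H} F" by simp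
qed

text \<open>The cut-off is smallest at \<open>y = 0\<close>, so \<open>w t 0 <= w t y\<close> bounds
  the full energy at time \<open>t\<close> by windowed quantities, and \<open>E T\<close>, the
  smallest energy, can be averaged over the window. At the top \<open>B = - bt * a\<close>, which
  produces the factor \<open>sg H + bt^2\<close>.\<close>

lemma windowed_energy:
 "E T * integral {0..T} (%t. rh (t - ta * H) * rh (T - ta * H - t)) \<le>
 H * exp (G 0) * exp (La * (1 + H^2) * H) * (sg H + bt^2) * integral {0..T} (%t. (a t H)^2)"
proof -
 let ?K = "exp (La * (1 + H^2) * H)" and ?V = "integral {0..T} (%t. (a t H)^2)"
 have w0: "rh (t - ta * H) * rh (T - ta * H - t) = w t 0" for t by (simp add: w_def)
 have c: "cont2 T H (%t y. sg y * (a t y)^2 + (B t y)^2)" "cont2 T H (%t y. w t y * (sg y * (a t y)^2 + (B t y)^2))"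
 "cont2 T H (%t y. w t y * (a t y)^2)" "cont2 T H (%t y. w t y * (B t y)^2)"
 by (intro cont2_arith cont_w cont cont_ARB sg)+
 have cw0: "cts {0..T} (%t. w t 0)" by (rule cont2_t[OF cont_w(1) H0(1)])
 have e0: "0 <= sg y * (a t y)^2 + (B t y)^2" if "y : {0..H}" for t y using sg(2)[OF that] by simp
 have FH: "F H <= (sg H + bt^2) * ?V"
 proof -
 have BH: "B t H = - bt * a t H" if "t : {0..T}" for t using bdry(3)[OF that] by (simp add: B_def R_def)
 have ia: "(%t. (a t H)^2) integrable_on {0..T}"
 by (intro int_cont cints cont2_t[OF cont(2) H0(2)])
 have "w t H * (a t H)^2 <= (a t H)^2" for t
 using rh by (intro mult_left_le_one_le) (auto simp: w_def mult_le_one)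
 hence x: "X H <= ?V" unfolding X_def by (intro integral_le ia cont2_integrable_t[OF c(3) H0(2)])
 have "Y H = integral {0..T} (%t. bt^2 * (w t H * (a t H)^2))"
 unfolding Y_def by (intro hk_integral_cong) (simp add: BH power_mult_distrib)
 also have "... = bt^2 * X H" by (simp add: X_def)
 finally have "F H = (sg H + bt^2) * X H" using G(2) by (simp add: F_def algebra_simps)
 thus ?thesis using x sg(2)[OF H0(2)] by (simp add: mult_left_mono)
 qed
 have "E T * integral {0..T} (%t. w t 0) = integral {0..T} (%t. w t 0 * E T)" by (simp add: mult.commute)
 also have "... <= integral {0..T} (%t. integral {0..H} (%y. w t y * (sg y * (a t y)^2 + (B t y)^2)))"
 proof (intro integral_le)
 show "(%t. w t 0 * E T) integrable_on {0..T}" by (intro int_cont cints cw0)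
 show "(%t. integral {0..H} (%y. w t y * (sg y * (a t y)^2 + (B t y)^2))) integrable_on {0..T}"
 by (intro int_cont cont2_integral_t c)
 fix t assume t: "t : {0..T}"
 have "w t 0 * E T <= w t 0 * integral {0..H} (%y. sg y * (a t y)^2 + (B t y)^2)"
 using energy_antimono[OF t] energy_le_B[OF t] by (intro mult_left_mono w_nonneg) linarith
 also have "... = integral {0..H} (%y. w t 0 * (sg y * (a t y)^2 + (B t y)^2))" by simp
 also have "... <= integral {0..H} (%y. w t y * (sg y * (a t y)^2 + (B t y)^2))"
 proof (intro integral_le cont2_integrable_y[OF c(2) t])
 show "(%y. w t 0 * (sg y * (a t y)^2 + (B t y)^2)) integrable_on {0..H}"
 by (intro int_cont continuous_on_mult continuous_on_const cont2_y[OF c(1) t])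
 fix y assume "y : {0..H}"
 thus "w t 0 * (sg y * (a t y)^2 + (B t y)^2) <= w t y * (sg y * (a t y)^2 + (B t y)^2)"
 by (intro mult_right_mono e0 w_mono) auto
 qed
 finally show "w t 0 * E T <= integral {0..H} (%y. w t y * (sg y * (a t y)^2 + (B t y)^2))" .
 qed
 also have "... = integral {0..H} (%y. integral {0..T} (%t. w t y * (sg y * (a t y)^2 + (B t y)^2)))"
 by (rule cont2_swap[OF c(2)]) auto
 also have "... = integral {0..H} (%y. exp (G y) * F y)"
 proof (intro hk_integral_cong)
 fix y assume y: "y : {0..H}"
 have "integral {0..T} (%t. w t y * (sg y * (a t y)^2 + (B t y)^2)) =
 integral {0..T} (%t. sg y * (w t y * (a t y)^2) + w t y * (B t y)^2)" by (simp add: algebra_simps)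
 also have "... = sg y * X y + Y y"
 unfolding X_def Y_def
 by (rule integral_unique, intro has_integral_add has_integral_mult_right integrable_integral cont2_integrable_t[OF c(3) y] cont2_integrable_t[OF c(4) y])
 also have "... = exp (G y) * F y" by (simp add: F_def exp_minus field_simps)
 finally show "integral {0..T} (%t. w t y * (sg y * (a t y)^2 + (B t y)^2)) = exp (G y) * F y" .
 qed
 also have "... <= integral {0..H} (%y. exp (G 0) * (?K * F H))"
 proof (intro integral_le int_cont cints G cont_F)
 fix y assume y: "y : {0..H}"
 have "exp (- G 0) <= exp (- G y)" using G(3) H0(1) y unfolding mono_on_def by auto
 hence g: "exp (G y) <= exp (G 0)" by simp
 have "F y <= F H * exp (La * (1 + H^2) * (H - y))" by (rule F_Gronwall[OF y])
 also have "... <= F H * ?K" using F_ge(2)[OF H0(2)] y La by (intro mult_left_mono) (auto intro!: mult_left_mono)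
 finally have "F y <= ?K * F H" by (simp add: mult.commute)
 thus "exp (G y) * F y <= exp (G 0) * (?K * F H)" using F_ge(2)[OF y] by (intro mult_mono g) auto
 qed
 also have "... = H * exp (G 0) * ?K * F H" using H by simp
 also have "... <= H * exp (G 0) * ?K * ((sg H + bt^2) * ?V)" using H by (intro mult_left_mono FH) auto
 finally show ?thesis unfolding w0 by (simp add: mult.assoc)
qed

end

section \<open>Observability of one mode\<close>

lemma has_real_derivative_transform:
 fixes f g :: "real => real"
 assumes "x : s" "!!x. x : s ==> g x = f x" "(f hrd f') (at x within s)"
 shows "(g hrd f') (at x within s)"
 using has_vector_derivative_transform[of x s g f f'] assms by (simp add: real_deriv_iff)

lemma cont2_subset: "cont2 S H f ==> T <= S ==> cont2 T H f"
 unfolding cont2_def by (erule cont_sub) auto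

lemma cont2_shift:
 assumes "cont2 (T + h) H f" "0 <= h"
 shows "cont2 T H (%t y. f (t + h) y)"
proof -
 have "cts ({0..T} \<times> {0..H}) (%z. (%z. f (fst z) (snd z)) (fst z + h, snd z))"
 by (rule cont_comp[OF assms(1)[unfolded cont2_def]])
 (use assms(2) in \<open>auto intro!: cints\<close>)
 thus ?thesis by (simp add: cont2_def)
qed

lemma cont2_transpose: "cont2 T H f ==> cont2 H T (%y t. f t y)"
 using continuous_on_swap_args[of "{0..T}" "{0..H}" f] by (simp add: cont2_def case_prod_beta')

text \<open>Steklov averages in time turn a mild solution into a classical one.\<close>

definition av :: "real => (real => real => real) => real => real => real" where
 "av h f t y = integral {t..t + h} (%s. f s y) / h"

lemma av_eq:
 assumes f: "cont2 (T + h) H f" and h: "0 < h" and t: "t : {0..T}" and y: "y : {0..H}"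
 shows "av h f t y = (integral {t..T + h} (%s. f s y) - integral {t + h..T + h} (%s. f s y)) / h"
proof -
 have "cts {t..T + h} (%s. f s y)" by (rule cont_sub[OF cont2_t[OF f y]]) (use t in auto)
 hence "integral {t..t + h} (%s. f s y) + integral {t + h..T + h} (%s. f s y) = integral {t..T + h} (%s. f s y)"
 using t h by (intro hk_integral_combine int_cont) auto
 thus ?thesis by (simp add: av_def)
qed

lemma cont2_av:
 assumes f: "cont2 (T + h) H f" and h: "0 < h"
 shows "cont2 T H (av h f)"
proof -
 have "cont2 H (T + h) (%y t. integral {t..T + h} (%s. f s y))"
 by (rule cont2_integral_from[OF cont2_transpose[OF f]])
 from cont2_transpose[OF this] have I: "cont2 (T + h) H (%t y. integral {t..T + h} (%s. f s y))" .
 have "cont2 T H (%t y. (integral {t..T + h} (%s. f s y) - integral {t + h..T + h} (%s. f s y)) * (1 / h))"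
 using h by (intro cont2_arith cont2_subset[OF I] cont2_shift[OF I]) auto
 hence "cont2 T H (%t y. (integral {t..T + h} (%s. f s y) - integral {t + h..T + h} (%s. f s y)) / h)" by simp
 thus ?thesis unfolding cont2_def by (rule continuous_on_eq) (auto simp: av_eq[OF f h])
qed

lemma shift_has_derivative:
 fixes f :: "real => real"
 assumes f: "!!x. x : {0..T + h} ==> (f hrd f' x) (at x within {0..T + h})" and t: "t : {0..T}" and h: "0 <= h"
 shows "((%t. f (t + h)) hrd f' (t + h)) (at t within {0..T})"
proof -
 have "(f hrd f' (t + h)) (at (t + h) within (%t. t + h) ` {0..T})"
 by (rule DERIV_subset[OF f]) (use t h in auto)
 moreover have "((%t. t + h) hrd 1) (at t within {0..T})" by (auto intro!: deqs)
 ultimately show ?thesis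
 using DERIV_image_chain[of f "f' (t + h)" "%t. t + h" t "{0..T}" 1] by (simp add: o_def)
qed

lemma av_t:
 assumes f: "cont2 (T + h) H f" and h: "0 < h" and t: "t : {0..T}" and y: "y : {0..H}"
 shows "((%t. av h f t y) hrd (f (t + h) y - f t y) / h) (at t within {0..T})"
proof -
 note d = integral_from_has_derivative[OF cont2_t[OF f y]]
 have 1: "((%t. integral {t..T + h} (%s. f s y)) hrd - f t y) (at t within {0..T})"
 by (rule DERIV_subset[OF d]) (use t h in auto)
 have 2: "((%t. integral {t + h..T + h} (%s. f s y)) hrd - f (t + h) y) (at t within {0..T})"
 by (rule shift_has_derivative[OF d t]) (use h in auto)
 have "((%t. (integral {t..T + h} (%s. f s y) - integral {t + h..T + h} (%s. f s y)) / h) has_real_derivative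
 (- f t y - - f (t + h) y) / h) (at t within {0..T})"
 by (intro DERIV_cdivide DERIV_diff 1 2)
 hence "((%t. av h f t y) hrd (- f t y - - f (t + h) y) / h) (at t within {0..T})"
 by (rule has_real_derivative_transform[OF t, rotated]) (rule av_eq[OF f h _ y])
 thus ?thesis by simp
qed

lemma av_y:
 assumes f: "cont2 (T + h) H f" and f': "cont2 (T + h) H f'"
 and d: "!!t y. t : {0..T + h} ==> y : {0..H} ==> ((%y. f t y) hrd f' t y) (at y within {0..H})"
 and h: "0 < h" and t: "t : {0..T}" and y: "y : {0..H}"
 shows "((%y. av h f t y) hrd av h f' t y) (at y within {0..H})"
 unfolding av_def using t h by (intro DERIV_cdivide cont2_leibniz_y[OF d f f' y]) auto

lemma av_deriv_eq:
 assumes f: "!!t. t : {0..T + h} ==> ((%t. f t y) hrd f' t y) (at t within {0..T + h})"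
 and h: "0 < h" and t: "t : {0..T}"
 shows "av h f' t y = (f (t + h) y - f t y) / h"
proof -
 have "((%t. f' t y) has_integral f (t + h) y - f t y) {t..t + h}"
 proof (rule fundamental_theorem_of_calculus)
 fix s assume "s : {t..t + h}"
 hence "((%t. f t y) hrd f' s y) (at s within {t..t + h})"
 using t by (intro DERIV_subset[OF f]) auto
 thus "((%t. f t y) hvd f' s y) (at s within {t..t + h})"
 by (simp add: real_deriv_iff)
 qed (use h in simp)
 thus ?thesis by (simp add: av_def integral_unique)
qed

lemma av_tendsto:
 assumes f: "cont2 (T + 1) H f" and t: "t : {0..T}" and y: "y : {0..H}"
 shows "(%n. av (1 / real (Suc n)) f t y) ----> f t y"
proof -
 have c: "cts {t..t + 1} (%s. f s y)" by (rule cont_sub[OF cont2_t[OF f y]]) (use t in auto)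
 have "((%x. integral {t..x} (%s. f s y)) hrd f t y) (at t within {t..t + 1})"
 using integral_has_vector_derivative[OF c, of t] by (simp add: real_deriv_iff)
 hence "((%x. integral {t..x} (%s. f s y) / (x - t)) ---> f t y) (at t within {t..t + 1})"
 by (simp add: has_field_derivative_iff)
 moreover have "filterlim (%n. t + 1 / real (Suc n)) (at t within {t..t + 1}) sequentially"
 unfolding filterlim_at
 proof (intro conjI always_eventually allI)
 have "(%n. t + inverse (real (Suc n))) ----> t + 0" by (intro tendsto_intros LIMSEQ_inverse_real_of_nat)
 thus "(%n. t + 1 / real (Suc n)) ----> t" by (simp add: inverse_eq_divide del: of_nat_Suc)
 qed auto
 ultimately have "(%n. integral {t..t + 1 / real (Suc n)} (%s. f s y) / (t + 1 / real (Suc n) - t)) ----> f t y"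
 by (rule filterlim_compose)
 thus ?thesis by (simp add: av_def del: of_nat_Suc)
qed

lemma av_bound:
 assumes f: "cont2 (T + 1) H f"
 obtains M where "!!n t y. t : {0..T} ==> y : {0..H} ==> abs (av (1 / real (Suc n)) f t y) <= M"
proof -
 have "compact ((%z. f (fst z) (snd z)) ` ({0..T + 1} \<times> {0..H}))"
 using f unfolding cont2_def by (intro compact_continuous_image compact_Times) auto
 from compact_imp_bounded[OF this] obtain M where M: "ALL z:{0..T + 1} \<times> {0..H}. norm (f (fst z) (snd z)) <= M"
 by (auto simp: bounded_iff)
 show ?thesis
 proof
 fix n t y assume t: "t : {0..T}" and y: "y : {0..H}"
 define h where "h = 1 / real (Suc n)"
 have h: "0 < h" "h <= 1" by (auto simp: h_def)
 have c: "cts {t..t + h} (%s. f s y)" by (rule cont_sub[OF cont2_t[OF f y]]) (use t h in auto)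
 have "norm (integral {t..t + h} (%s. f s y)) <= M * (t + h - t)"
 using M t y h by (intro integral_bound c) auto
 thus "abs (av (1 / real (Suc n)) f t y) <= M"
 using h unfolding h_def[symmetric] av_def by (simp add: abs_divide divide_le_eq)
 qed
qed

lemma integral_dominated_bounded:
 fixes f :: "nat => real => real"
 assumes "!!n. f n integrable_on {a..b}" "!!n x. x : {a..b} ==> abs (f n x) <= M"
 and "!!x. x : {a..b} ==> (%n. f n x) ----> g x"
 shows "(%n. integral {a..b} (f n)) ----> integral {a..b} g"
 using assms by (intro dominated_convergence(2)[where h="%_. M"]) auto

locale wave_data =
 fixes H bt La :: real and sg :: "real => real" and P a b :: "real => real => real"
 assumes wave: "wave_mode H bt La sg P a b" and H: "0 < H" and La: "0 <= La" and bt: "0 < bt"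
 and sg: "cts {0..H} sg" "!!y. y : {0..H} ==> 0 < sg y"
begin

lemma cont: "cont2 T H P" "cont2 T H a" "cont2 T H b"
proof -
 have "cts ({0..} \<times> {0..H}) (%(t, y). P t y)" "cts ({0..} \<times> {0..H}) (%(t, y). a t y)"
 "cts ({0..} \<times> {0..H}) (%(t, y). b t y)"
 using wave unfolding wave_mode_def by - (elim conjE, assumption)+
 thus "cont2 T H P" "cont2 T H a" "cont2 T H b"
 unfolding cont2_def case_prod_beta' by (auto intro: cont_sub)
qed

lemma P_t:
 assumes "t : {0..T}" "y : {0..H}"
 shows "((%t. P t y) hrd a t y) (at t within {0..T})"
proof -
 have "ALL t>=0. ALL y:{0..H}. ((%s. P s y) hvd a t y) (at t within {0..})"
 using wave unfolding wave_mode_def by (elim conjE)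
 hence "((%s. P s y) hvd a t y) (at t within {0..})" using assms by simp
 thus ?thesis unfolding real_deriv_iff
 by (rule has_vector_derivative_within_subset) auto
qed

lemma P_y:
 assumes "0 <= t" "y : {0..H}"
 shows "((%y. P t y) hrd b t y) (at y within {0..H})"
proof -
 have "ALL t>=0. ALL y:{0..H}. (P t hvd b t y) (at y within {0..H})"
 using wave unfolding wave_mode_def by (elim conjE)
 thus ?thesis using assms by (simp add: real_deriv_iff)
qed

lemma bdry:
 assumes "0 <= t"
 shows "P t 0 = 0" "b t H = - bt * a t H"
proof -
 have "ALL t>=0. P t 0 = 0 & b t H = - bt *R a t H"
 using wave unfolding wave_mode_def by (elim conjE)
 thus "P t 0 = 0" "b t H = - bt * a t H" using assms by simp_all
qed

text \<open>Integrating the mild equation over \<open>[t, t + h]\<close> turns the time derivative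
  of the momentum into a difference quotient, which exists pointwise. Exchanging the integrations
  exhibits the averaged flux as an integral in \<open>y\<close>, hence as differentiable.\<close>

lemma balance:
 assumes t: "t : {0..T}" and h: "0 < h" and y: "y : {0..H}"
 shows "av h b t y = av h b t 0 + integral {0..y} (%y. sg y * ((a (t + h) y - a t y) / h) + La * av h P t y)"
proof -
 let ?I = "%s. integral {0..y} (%y. sg y * a s y)"
 have sub: "{t..t + h} <= {0..T + h}" using t by auto
 have cb: "cts {t..t + h} (%s. b s z)" if "z : {0..H}" for z
 by (rule cont_sub[OF cont2_t[OF cont(3) that] sub])
 have cP: "cts {t..t + h} (%s. integral {0..y} (P s))"
 proof -
 have "cont2 (T + h) y P" using cont(1)[of "T + h"] y by (auto simp: cont2_def elim: cont_sub)
 from cont_sub[OF cont2_integral_t[OF this] sub] show ?thesis .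
 qed
 have "((%s. b s y - b s 0 - La * integral {0..y} (P s)) has_integral ?I (t + h) - ?I t) {t..t + h}"
 proof (rule fundamental_theorem_of_calculus)
 fix s assume s: "s : {t..t + h}"
 hence "(?I hvd b s y - b s 0 - La * integral {0..y} (P s)) (at s within {0..})"
 using wave t y unfolding wave_mode_def by auto
 thus "(?I hvd b s y - b s 0 - La * integral {0..y} (P s)) (at s within {t..t + h})"
 by (rule has_vector_derivative_within_subset) (use t in auto)
 qed (use h in simp)
 moreover have "((%s. b s y - b s 0 - La * integral {0..y} (P s)) has_integral
 h * av h b t y - h * av h b t 0 - La * integral {t..t + h} (%s. integral {0..y} (P s))) {t..t + h}"
 using h y H unfolding av_def
 by (intro has_integral_diff has_integral_mult_right)
 (auto intro!: integrable_integral int_cont cb cP)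
 ultimately have eq: "?I (t + h) - ?I t = h * av h b t y - h * av h b t 0 - La * integral {t..t + h} (%s. integral {0..y} (P s))"
 by (rule has_integral_unique)
 have "integral {t..t + h} (%s. integral {0..y} (P s)) = integral {0..y} (%y. integral {t..t + h} (%s. P s y))"
 by (rule cont2_swap[OF cont(1)[of "T + h"]]) (use t y in auto)
 also have "... = h * integral {0..y} (av h P t)" using h by (simp add: av_def[abs_def])
 finally have sw: "integral {t..t + h} (%s. integral {0..y} (P s)) = h * integral {0..y} (av h P t)" .
 have sy: "{0..y} <= {0..H}" using y by auto
 have ca: "cts {0..y} (a s)" if "0 <= s" for s
 by (rule cont_sub[OF cont2_y[OF cont(2)[of s]] sy]) (use that in auto)
 have cs: "cts {0..y} sg" by (rule cont_sub[OF sg(1) sy])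
 have cav: "cts {0..y} (av h P t)" by (rule cont_sub[OF cont2_y[OF cont2_av[OF cont(1) h] t] sy])
 have "integral {0..y} (%y. sg y * ((a (t + h) y - a t y) / h) + La * av h P t y) =
 integral {0..y} (%y. (1 / h) * (sg y * a (t + h) y - sg y * a t y) + La * av h P t y)"
 by (simp add: field_simps)
 also have "... = (1 / h) * (?I (t + h) - ?I t) + La * integral {0..y} (av h P t)"
 using t h by (intro integral_unique has_integral_add has_integral_diff has_integral_mult_right integrable_integral
 int_cont cints ca cs cav) auto
 also have "... = av h b t y - av h b t 0" using h unfolding eq sw by (simp add: field_simps)
 finally show ?thesis by simp
qed

lemma classical_average:
 assumes h: "0 < h" and T: "0 <= T"
 shows "classical_wave T H bt La sg (av h P) (av h a) (av h b) (%t y. (a (t + h) y - a t y) / h) (%t y. (b (t + h) y - b t y) / h)"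
proof
 \<comment> \<open>The average of \<open>a\<close> is the difference quotient of \<open>P\<close>.
   Thus it gains a y-derivative, the difference quotient of \<open>b\<close>, which is also the time
   derivative of the average of \<open>b\<close>.\<close>
 have av_a: "av h a t y = (P (t + h) y - P t y) / h" if "t : {0..T}" "y : {0..H}" for t y
 using that by (intro av_deriv_eq[OF _ h]) (auto intro: P_t)
 have q: "cont2 T H (%t y. (f (t + h) y - f t y) / h)" if "!!S. cont2 S H f" for f
 using cont2_arith(3)[OF cont2_arith(2)[OF cont2_shift[OF that] that] cont2_arith(5), of h T "1 / h"] h by simp
 show "0 <= T" "0 < H" "0 <= La" "0 <= bt" using T H La bt by auto
 show "cts {0..H} sg" "!!y. y : {0..H} ==> 0 < sg y" by (rule sg)+
 show "cont2 T H (av h P)" "cont2 T H (av h a)" "cont2 T H (av h b)" by (intro cont2_av cont h)+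
 show "cont2 T H (%t y. (a (t + h) y - a t y) / h)" "cont2 T H (%t y. (b (t + h) y - b t y) / h)"
 by (intro q cont)+
 fix t y assume t: "t : {0..T}" and y: "y : {0..H}"
 show "((%t. av h P t y) hrd av h a t y) (at t within {0..T})"
 using av_t[OF cont(1) h t y] by (simp add: av_a[OF t y])
 show "((%y. av h P t y) hrd av h b t y) (at y within {0..H})"
 by (rule av_y[OF cont(1) cont(3) _ h t y]) (auto intro: P_y)
 show "((%t. av h a t y) hrd (a (t + h) y - a t y) / h) (at t within {0..T})"
 by (rule av_t[OF cont(2) h t y])
 show "((%y. av h a t y) hrd (b (t + h) y - b t y) / h) (at y within {0..H})"
 proof -
 have "((%y. (P (t + h) y - P t y) / h) hrd (b (t + h) y - b t y) / h) (at y within {0..H})"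
 using t h by (intro DERIV_cdivide DERIV_diff P_y y) auto
 thus ?thesis by (rule has_real_derivative_transform[OF y, rotated]) (rule av_a[OF t])
 qed
 show "((%t. av h b t y) hrd (b (t + h) y - b t y) / h) (at t within {0..T})"
 by (rule av_t[OF cont(3) h t y])
 show "((%y. av h b t y) hrd sg y * ((a (t + h) y - a t y) / h) + La * av h P t y) (at y within {0..H})"
 proof -
 have "cts {0..H} (%y. sg y * ((a (t + h) y - a t y) / h) + La * av h P t y)"
 using h t by (intro cints sg cont2_y[OF cont2_av[OF cont(1) h] t] cont2_y[OF cont(2)[of "T + h"]]) auto
 from integral_has_vector_derivative[OF this y]
 have "((%y. integral {0..y} (%y. sg y * ((a (t + h) y - a t y) / h) + La * av h P t y)) has_real_derivative
 sg y * ((a (t + h) y - a t y) / h) + La * av h P t y) (at y within {0..H})"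
 by (simp add: real_deriv_iff)
 hence "((%y. av h b t 0 + integral {0..y} (%y. sg y * ((a (t + h) y - a t y) / h) + La * av h P t y)) has_real_derivative
 0 + (sg y * ((a (t + h) y - a t y) / h) + La * av h P t y)) (at y within {0..H})"
 by (intro DERIV_add DERIV_const)
 hence "((%y. av h b t y) hrd 0 + (sg y * ((a (t + h) y - a t y) / h) + La * av h P t y)) (at y within {0..H})"
 by (rule has_real_derivative_transform[OF y, rotated]) (rule balance[OF t h])
 thus ?thesis by simp
 qed
next
 fix t assume t: "t : {0..T}"
 have z: "av h f t y = c * av h g t y" if "!!s. 0 <= s ==> f s y = c * g s y" for f g c y
 proof -
 have "integral {t..t + h} (%s. f s y) = integral {t..t + h} (%s. c * g s y)"
 using t that by (intro hk_integral_cong) auto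
 thus ?thesis by (simp add: av_def)
 qed
 show "av h P t 0 = 0" using z[of P 0 0 P] by (simp add: bdry)
 have "av h a t 0 = (P (t + h) 0 - P t 0) / h"
 using t H by (intro av_deriv_eq[OF _ h]) (auto intro: P_t)
 thus "av h a t 0 = 0" using t h by (simp add: bdry)
 show "av h b t H = - bt * av h a t H" by (rule z) (rule bdry)
qed

definition E0 :: real where
 "E0 = integral {0..H} (%y. sg y * (a 0 y)^2 + (b 0 y)^2 + La * (P 0 y)^2)"

lemma average_limits:
 assumes T: "0 <= T"
 shows "(%n. integral {0..T} (%t. (av (1 / real (Suc n)) a t H)^2)) ----> integral {0..T} (%t. (a t H)^2)"
 and "(%n. integral {0..H} (%y. sg y * (av (1 / real (Suc n)) a 0 y)^2 + (av (1 / real (Suc n)) b 0 y)^2 +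
 La * (av (1 / real (Suc n)) P 0 y)^2)) ----> E0"
proof -
 have n: "0 < 1 / real (Suc n)" for n by simp
 have HH: "H : {0..H}" "0 : {0..T}" using H T by auto
 obtain Ma where Ma: "!!n t y. t : {0..T} ==> y : {0..H} ==> abs (av (1 / real (Suc n)) a t y) <= Ma" using av_bound[OF cont(2)] by blast
 obtain Mb where Mb: "!!n t y. t : {0..T} ==> y : {0..H} ==> abs (av (1 / real (Suc n)) b t y) <= Mb" using av_bound[OF cont(3)] by blast
 obtain MP where MP: "!!n t y. t : {0..T} ==> y : {0..H} ==> abs (av (1 / real (Suc n)) P t y) <= MP" using av_bound[OF cont(1)] by blast
 obtain Ms where Ms: "ALL y:{0..H}. norm (sg y) <= Ms"
 using compact_imp_bounded[OF compact_continuous_image[OF sg(1)]] by (auto simp: bounded_iff)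
 have sq: "x^2 <= M^2" if "abs x <= M" for x M :: real using that by (metis abs_ge_zero abs_le_square_iff abs_of_nonneg order_trans)
 show "(%n. integral {0..T} (%t. (av (1 / real (Suc n)) a t H)^2)) ----> integral {0..T} (%t. (a t H)^2)"
 proof (rule integral_dominated_bounded[where M="Ma^2"])
 show "(%t. (av (1 / real (Suc n)) a t H)^2) integrable_on {0..T}" for n
 by (intro int_cont cints cont2_t[OF cont2_av[OF cont(2) n] HH(1)])
 show "abs ((av (1 / real (Suc n)) a x H)^2) <= Ma^2" if "x : {0..T}" for n x
 using sq[OF Ma[OF that HH(1)]] by simp
 show "(%n. (av (1 / real (Suc n)) a x H)^2) ----> (a x H)^2" if "x : {0..T}" for x
 by (intro tendsto_intros av_tendsto[OF cont(2) that HH(1)])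
 qed
 show "(%n. integral {0..H} (%y. sg y * (av (1 / real (Suc n)) a 0 y)^2 + (av (1 / real (Suc n)) b 0 y)^2 +
 La * (av (1 / real (Suc n)) P 0 y)^2)) ----> E0"
 unfolding E0_def
 proof (rule integral_dominated_bounded[where M="Ms * Ma^2 + Mb^2 + La * MP^2"])
 show "(%y. sg y * (av (1 / real (Suc n)) a 0 y)^2 + (av (1 / real (Suc n)) b 0 y)^2 +
 La * (av (1 / real (Suc n)) P 0 y)^2) integrable_on {0..H}" for n
 by (intro int_cont cints sg cont2_y[OF cont2_av[OF cont(1) n] HH(2)]
 cont2_y[OF cont2_av[OF cont(2) n] HH(2)] cont2_y[OF cont2_av[OF cont(3) n] HH(2)])
 fix n y assume y: "y : {0..H}"
 show "abs (sg y * (av (1 / real (Suc n)) a 0 y)^2 + (av (1 / real (Suc n)) b 0 y)^2 + La * (av (1 / real (Suc n)) P 0 y)^2)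
 <= Ms * Ma^2 + Mb^2 + La * MP^2"
 proof -
 have s: "0 <= sg y" "sg y <= Ms" using sg(2)[OF y] bspec[OF Ms y] by (simp_all add: less_imp_le)
 have "sg y * (av (1 / real (Suc n)) a 0 y)^2 + (av (1 / real (Suc n)) b 0 y)^2 + La * (av (1 / real (Suc n)) P 0 y)^2
 <= Ms * Ma^2 + Mb^2 + La * MP^2"
 using s La by (intro add_mono mult_mono mult_left_mono sq Ma Mb MP HH y) auto
 moreover have "0 <= sg y * (av (1 / real (Suc n)) a 0 y)^2 + (av (1 / real (Suc n)) b 0 y)^2 + La * (av (1 / real (Suc n)) P 0 y)^2"
 using s La by simp
 ultimately show ?thesis by simp
 qed
 next
 fix y assume y: "y : {0..H}"
 show "(%n. sg y * (av (1 / real (Suc n)) a 0 y)^2 + (av (1 / real (Suc n)) b 0 y)^2 + La * (av (1 / real (Suc n)) P 0 y)^2)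
 ----> sg y * (a 0 y)^2 + (b 0 y)^2 + La * (P 0 y)^2"
 by (intro tendsto_intros av_tendsto[OF cont(1) HH(2) y] av_tendsto[OF cont(2) HH(2) y] av_tendsto[OF cont(3) HH(2) y])
 qed
qed

lemma boundary_flux_le:
 assumes T: "0 <= T"
 shows "2 * bt * integral {0..T} (%t. (a t H)^2) <= E0"
proof -
 have le: "2 * bt * integral {0..T} (%t. (av (1 / real (Suc n)) a t H)^2) \<le>
 integral {0..H} (%y. sg y * (av (1 / real (Suc n)) a 0 y)^2 + (av (1 / real (Suc n)) b 0 y)^2 + La * (av (1 / real (Suc n)) P 0 y)^2)" for n
 proof -
 interpret C: classical_wave T H bt La sg "av (1 / real (Suc n)) P" "av (1 / real (Suc n)) a" "av (1 / real (Suc n)) b"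
 "%t y. (a (t + 1 / real (Suc n)) y - a t y) / (1 / real (Suc n))" "%t y. (b (t + 1 / real (Suc n)) y - b t y) / (1 / real (Suc n))"
 by (rule classical_average[OF _ T]) simp
 have TT: "T : {0..T}" using T by simp
 have "0 <= C.E T" using TT by (rule C.energy_nonneg)
 moreover have "C.E T - C.E 0 = - 2 * bt * integral {0..T} (%t. (av (1 / real (Suc n)) a t H)^2)"
 by (rule C.energy_identity) (use T in simp)
 ultimately have "2 * bt * integral {0..T} (%t. (av (1 / real (Suc n)) a t H)^2) <= C.E 0" by linarith
 thus ?thesis unfolding C.E_def .
 qed
 show ?thesis
 by (rule LIMSEQ_le[OF tendsto_mult_left[OF average_limits(1)[OF T]] average_limits(2)[OF T]]) (use le in auto)
qed

text \<open>With vanishing data the energy is 0, and the energy identity leaves no flux through the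
  top; integrating \<open>a\<close> in time gives \<open>P\<close>. Applied to modes absent from the
  initial data, it shows that they leave no trace on the top side.\<close>

lemma zero_if_zero_data:
 assumes z: "!!y. y : {0..H} ==> P 0 y = 0" "!!y. y : {0..H} ==> a 0 y = 0" and t: "0 <= t"
 shows "a t H = 0" "P t H = 0"
proof -
 have HH: "H : {0..H}" using H by simp
 have "b 0 y = 0" if y: "y : {0..H}" for y
 proof -
 have "((%y. P 0 y) hrd 0) (at y within {0..H})"
 by (rule has_real_derivative_transform[OF y _ DERIV_const[of 0]]) (simp add: z)
 hence "((%y. P 0 y) hvd 0) (at y within cbox 0 H)" by (simp add: real_deriv_iff)
 moreover have "((%y. P 0 y) hvd b 0 y) (at y within cbox 0 H)"
 using P_y[of 0 y] y by (simp add: real_deriv_iff)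
 ultimately show ?thesis using vector_derivative_unique_within_closed_interval[of 0 H y] y H by simp
 qed
 hence "E0 = integral {0..H} (%y. 0)" unfolding E0_def by (intro hk_integral_cong) (simp add: z)
 hence E0: "E0 = 0" by simp
 have a0: "a s H = 0" if s: "0 <= s" for s
 proof (cases "s = 0")
 case False
 have c: "cts {0..s} (%t. (a t H)^2)" by (intro cints cont2_t[OF cont(2) HH])
 have "0 <= integral {0..s} (%t. (a t H)^2)" by (intro integral_nonneg int_cont c) auto
 moreover have "integral {0..s} (%t. (a t H)^2) <= 0"
 using boundary_flux_le[OF s] bt E0 by (simp add: mult_le_0_iff)
 ultimately have "((%t. (a t H)^2) has_integral 0) (cbox 0 s)"
 using integrable_integral[OF int_cont[OF c]] by simp
 hence "(a s H)^2 = 0"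
 by (rule has_integral_0_cbox_imp_0[rotated 2]) (use s False c in \<open>auto simp: box_ne_empty\<close>)
 thus ?thesis by simp
 qed (use z H in auto)
 show "a t H = 0" by (rule a0[OF t])
 have "((%s. a s H) has_integral P t H - P 0 H) {0..t}"
 proof (rule fundamental_theorem_of_calculus[OF t])
 fix s assume "s : {0..t}"
 thus "((%s. P s H) hvd a s H) (at s within {0..t})"
 using P_t[of s t H] HH by (simp add: real_deriv_iff)
 qed
 moreover have "((%s. a s H) has_integral 0) {0..t}"
 by (rule has_integral_is_0) (simp add: a0)
 ultimately have "P t H - P 0 H = 0" by (rule has_integral_unique)
 thus "P t H = 0" using z(1)[OF HH] by simp
qed

text \<open>The initial energy is \<open>E T\<close> plus what is lost through the top side, and
  \<open>windowed_energy\<close> bounds \<open>E T\<close>. Sharpening the cut-offs turns the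
  integral of the window at \<open>y = 0\<close> into its length \<open>T - 2 * ta * H\<close>, the
  denominator of the estimate.\<close>

lemma observability:
 assumes ta: "0 <= ta" "!!y. y : {0..H} ==> sg y <= ta^2" and T: "2 * ta * H < T"
 and G: "cts {0..H} G" "G H = 0" "mono_on {0..H} (%y. exp (- G y))" "mono_on {0..H} (%y. sg y * exp (- G y))"
 shows "E0 <= (H * exp (G 0) * exp (La * (1 + H^2) * H) * (sg H + bt^2) / (T - 2 * ta * H) + 2 * bt) * integral {0..T} (%t. (a t H)^2)"
proof -
 define C where "C = H * exp (G 0) * exp (La * (1 + H^2) * H) * (sg H + bt^2)"
 have T0: "0 <= T" using T ta H by (smt (verit) mult_nonneg_nonneg)
 define rh where "rh m x = smstep (real (Suc m) * x)" for m x
 have "EX rh'. (ALL x. (smstep hrd rh' x) (at x)) & cts UNIV rh' & (ALL x. 0 <= rh' x)"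
 proof (intro exI[of _ "smstep_p [:0, 0, 1:]"] conjI allI)
 have s1: "smstep = smstep_p 1" by (auto simp: smstep_p_def smstep_def)
 have "(smstep_p 1 hrd smstep_p ([:0, 0, 1:] * (1 - pderiv 1)) x) (at x)" for x by (rule smstep_p_deriv)
 thus "(smstep hrd smstep_p [:0, 0, 1:] x) (at x)" for x unfolding s1 by simp
 show "cts UNIV (smstep_p [:0, 0, 1:])"
 by (rule DERIV_continuous_on) (rule has_field_derivative_at_within[OF smstep_p_deriv])
 show "0 <= smstep_p [:0, 0, 1:] x" for x by (simp add: smstep_p_def)
 qed
 then obtain r' where r': "!!x. (smstep hrd r' x) (at x)" "cts UNIV r'" "!!x. 0 <= r' x" by blast
 have cr: "cts UNIV (rh m)" for m unfolding rh_def
 by (intro cont_comp[OF smooth_cont[OF smooth_smstep, of UNIV]] cints) simp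
 have main: "integral {0..H} (%y. sg y * (av h a 0 y)^2 + (av h b 0 y)^2 + La * (av h P 0 y)^2) \<le>
 (C / (T - 2 * ta * H) + 2 * bt) * integral {0..T} (%t. (av h a t H)^2)" if h: "0 < h" for h
 proof -
 interpret C: classical_wave T H bt La sg "av h P" "av h a" "av h b" "%t y. (a (t + h) y - a t y) / h" "%t y. (b (t + h) y - b t y) / h"
 by (rule classical_average[OF h T0])
 let ?V = "integral {0..T} (%t. (av h a t H)^2)"
 have win: "C.E T * integral {0..T} (%t. rh m (t - ta * H) * rh m (T - ta * H - t)) <= C * ?V" for m
 proof -
 interpret S: sideways T H bt La sg "av h P" "av h a" "av h b" "%t y. (a (t + h) y - a t y) / h" "%t y. (b (t + h) y - b t y) / h"
 ta G "rh m" "%x. real (Suc m) * r' (real (Suc m) * x)"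
 proof
 show "(rh m hrd real (Suc m) * r' (real (Suc m) * x)) (at x)" for x
 proof -
 have "((%x. real (Suc m) * x) hrd real (Suc m)) (at x)" by (auto intro!: deqs)
 from DERIV_chain2[OF r'(1) this] show ?thesis unfolding rh_def[abs_def] by (simp only: mult.commute)
 qed
 show "cts UNIV (%x. real (Suc m) * r' (real (Suc m) * x))"
 by (intro cints cont_comp[OF r'(2)]) auto
 qed (use ta G r' in \<open>auto simp: rh_def smstep_nonneg smstep_le_1 smstep_eq_0 mult_nonneg_nonpos simp del: of_nat_Suc\<close>)
 show ?thesis using S.windowed_energy by (simp add: C_def)
 qed
 have "(%m. integral {0..T} (%t. rh m (t - ta * H) * rh m (T - ta * H - t))) \<longlonglongrightarrow>
 integral {0..T} (%t. (if t - ta * H > 0 then 1 else 0) * (if T - ta * H - t > 0 then 1 else 0))"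
 proof (rule integral_dominated_bounded[where M=1])
 show "(%t. rh m (t - ta * H) * rh m (T - ta * H - t)) integrable_on {0..T}" for m
 by (intro int_cont cints cont_comp[OF cr]) auto
 show "abs (rh m (x - ta * H) * rh m (T - ta * H - x)) <= 1" for m x
 unfolding rh_def abs_mult by (intro mult_le_one) (auto simp: smstep_nonneg smstep_le_1)
 show "(%m. rh m (x - ta * H) * rh m (T - ta * H - x)) ----> (if x - ta * H > 0 then 1 else 0) * (if T - ta * H - x > 0 then 1 else 0)" for x
 unfolding rh_def by (intro tendsto_mult smstep_scaled_tendsto)
 qed
 also have "integral {0..T} (%t. (if t - ta * H > 0 then 1 else 0) * (if T - ta * H - t > 0 then 1 else 0)) = T - 2 * ta * H"
 proof (rule integral_unique)
 have "((%_. 1::real) has_integral (T - ta * H - ta * H)) {ta * H..T - ta * H}"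
 proof -
 have "ta * H <= T - ta * H" using T by linarith
 thus ?thesis using has_integral_const_real[of "1::real" "ta * H" "T - ta * H"] by simp
 qed
 hence "((%t. if t : {ta * H..T - ta * H} then 1 else 0::real) has_integral (T - ta * H - ta * H)) {0..T}"
 using ta H by (subst has_integral_restrict) auto
 thus "((%t. (if t - ta * H > 0 then 1 else 0) * (if T - ta * H - t > 0 then 1 else 0)) has_integral T - 2 * ta * H) {0..T}"
 by (rule has_integral_spike_finite[of "{ta * H, T - ta * H}", rotated 2, THEN has_integral_eq_rhs]) auto
 qed
 finally have "(%m. C.E T * integral {0..T} (%t. rh m (t - ta * H) * rh m (T - ta * H - t))) ----> C.E T * (T - 2 * ta * H)"
 by (rule tendsto_mult_left)
 from LIMSEQ_le_const2[OF this] win have "C.E T * (T - 2 * ta * H) <= C * ?V" by blast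
 hence "C.E T <= C * ?V / (T - 2 * ta * H)" using T by (simp add: pos_le_divide_eq)
 moreover have "C.E T - C.E 0 = - 2 * bt * ?V" using T0 by (intro C.energy_identity) auto
 ultimately show ?thesis by (simp add: C.E_def algebra_simps)
 qed
 have "E0 <= (C / (T - 2 * ta * H) + 2 * bt) * integral {0..T} (%t. (a t H)^2)"
 by (rule LIMSEQ_le[OF average_limits(2)[OF T0] tendsto_mult_left[OF average_limits(1)[OF T0]]]) (use main in auto)
 thus ?thesis by (simp only: C_def)
qed

end

section \<open>The sound speed\<close>

text \<open>Bounded Borel functions on the line are integrable over every compact interval in both
  the Lebesgue and the Henstock-Kurzweil sense, and the class is stable under sums and
  products.\<close>

definition bm :: "(real => real) => bool" where
 "bm w \<longleftrightarrow> w : msb borel & (EX K. ALL x. abs (w x) <= K)"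

lemma bm_add:
 assumes "bm f" "bm g"
 shows "bm (%x. f x + g x)"
proof -
 obtain A B where "!!x. abs (f x) <= A" "!!x. abs (g x) <= B" using assms by (auto simp: bm_def)
 hence "abs (f x + g x) <= A + B" for x by (meson abs_triangle_ineq add_mono order_trans)
 moreover have "(%x. f x + g x) : msb borel"
 using assms by (intro borel_measurable_add) (simp_all add: bm_def)
 ultimately show ?thesis unfolding bm_def by blast
qed

lemma bm_mult:
 assumes "bm f" "bm g"
 shows "bm (%x. f x * g x)"
proof -
 obtain A B where "!!x. abs (f x) <= A" "!!x. abs (g x) <= B" using assms by (auto simp: bm_def)
 hence "abs (f x * g x) <= A * B" for x
 unfolding abs_mult by (meson abs_ge_zero mult_mono order_trans)
 moreover have "(%x. f x * g x) : msb borel"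
 using assms by (intro borel_measurable_times) (simp_all add: bm_def)
 ultimately show ?thesis unfolding bm_def by blast
qed

lemma bm_const: "bm (%x. k)" by (auto simp: bm_def)

lemma bm_abs: "bm f ==> bm (%x. abs (f x))" by (auto simp: bm_def)

lemma bm_set_integrable:
 assumes "bm w"
 shows "sint {y..z} w"
proof -
 obtain K where K: "!!x. abs (w x) <= K" and [measurable]: "w : msb borel" using assms by (auto simp: bm_def)
 have "sint {y..z} (%_. K)"
 by (intro borel_integrable_compact[folded set_integrable_def]) auto
 moreover have "abs (w x) <= abs K" for x using order_trans[OF K abs_ge_self] .
 ultimately show ?thesis
 by (intro set_integrable_bound[of lborel "{y..z}" "%_. K" w]) (auto simp: set_meas_def)
qed

lemma bm_integrable: "bm w ==> w integrable_on {y..z}"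
 using set_borel_integral_eq_integral(1)[OF bm_set_integrable] .

lemma bm_LBINT: "bm w ==> (LBINT x:{y..z}. w x) = integral {y..z} w"
 using set_borel_integral_eq_integral(2)[OF bm_set_integrable] .

lemma bm_LBINT_open:
 assumes w: "bm w"
 shows "(LBINT x:{y<..<z}. w x) = integral {y..z} w"
proof -
 have [measurable]: "w : msb borel" using w by (simp add: bm_def)
 have "AE x in lborel. x ~= y" "AE x in lborel. x ~= z" by (rule AE_lborel_singleton)+
 hence "AE x in lborel. indicat_real {y<..<z} x *R w x = indicat_real {y..z} x *R w x"
 by eventually_elim (auto simp: indicator_def)
 hence "(LBINT x:{y<..<z}. w x) = (LBINT x:{y..z}. w x)"
 unfolding set_int_def by (intro integral_cong_AE) auto
 thus ?thesis using bm_LBINT[OF w] by simp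
qed

text \<open>\<open>w\<close> is a bounded density of \<open>f\<close> on \<open>[a,b]\<close>, so
  \<open>f\<close> is Lipschitz there. Product and chain rules are proved in this integrated form
  because derivatives are available only almost everywhere.\<close>

definition ac_rep :: "real => real => (real => real) => (real => real) => bool" where
 "ac_rep a b f w \<longleftrightarrow> bm w & (ALL y z. a <= y --> y <= z --> z <= b --> f z - f y = integral {y..z} w)"

lemma ac_repD: "ac_rep a b f w ==> a <= y ==> y <= z ==> z <= b ==> f z - f y = integral {y..z} w"
 by (simp add: ac_rep_def)

lemma integral_abs_le:
 fixes w :: "real => real"
 assumes "w integrable_on {y..z}" "y <= z" "!!x. x : {y..z} ==> abs (w x) <= K"
 shows "abs (integral {y..z} w) <= K * (z - y)"
proof -
 have "norm (integral {y..z} w) <= integral {y..z} (%_. K)"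
 by (rule integral_norm_bound_integral) (use assms in auto)
 thus ?thesis using assms(2) by (simp add: mult.commute)
qed

lemma ac_rep_Lipschitz:
 assumes "ac_rep a b f w"
 obtains K where "0 <= K" "!!x. abs (w x) <= K" "!!y z. y : {a..b} ==> z : {a..b} ==> abs (f z - f y) <= K * abs (z - y)"
proof -
 have w: "bm w" using assms by (simp add: ac_rep_def)
 then obtain K where K: "!!x. abs (w x) <= K" by (auto simp: bm_def)
 have le: "abs (f z - f y) <= K * (z - y)" if "a <= y" "y <= z" "z <= b" for y z
 using integral_abs_le[OF bm_integrable[OF w] that(2) K] ac_repD[OF assms that] by simp
 show ?thesis
 proof (rule that[of K])
 show "0 <= K" using order_trans[OF abs_ge_zero K[of 0]] .
 show "abs (f z - f y) <= K * abs (z - y)" if "y : {a..b}" "z : {a..b}" for y z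
 proof (cases "y <= z")
 case True thus ?thesis using le[of y z] that by simp
 next
 case False thus ?thesis using le[of z y] that by (simp add: abs_minus_commute)
 qed
 qed (rule K)
qed

text \<open>On short intervals a quadratic bound on increments lies below every linear one, so
  \<open>nondecreasing_if_local\<close> applies to \<open>F\<close> and to
  \<open>- F\<close>.\<close>

lemma const_if_quadratic:
 fixes F :: "real => real"
 assumes ab: "a <= b" and q: "!!y z. a <= y ==> y <= z ==> z <= b ==> abs (F z - F y) <= K * (z - y)^2"
 shows "F b = F a"
proof -
 have loc: "EX d>0. ALL y z. a <= y --> y <= z --> z <= b --> z - y < d --> abs (F z - F y) <= e * (z - y)" if e: "e > 0" for e
 proof (intro exI[of _ "e / (abs K + 1)"] conjI allI impI)
 fix y z assume yz: "a <= y" "y <= z" "z <= b" "z - y < e / (abs K + 1)"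
 have "(abs K + 1) * (z - y) <= e" using yz(4) by (simp add: pos_less_divide_eq mult.commute)
 hence "(abs K + 1) * (z - y) * (z - y) <= e * (z - y)" using yz by (intro mult_right_mono) auto
 moreover have "K * (z - y)^2 <= (abs K + 1) * (z - y)^2" by (intro mult_right_mono) auto
 ultimately show "abs (F z - F y) <= e * (z - y)" using q[OF yz(1-3)] by (simp add: power2_eq_square mult.assoc)
 qed (use e in simp)
 have "F a <= F b"
 proof (rule nondecreasing_if_local[OF ab])
 fix e :: real assume "0 < e"
 from loc[OF this] obtain d where "d > 0" "!!y z. a <= y ==> y <= z ==> z <= b ==> z - y < d ==> abs (F z - F y) <= e * (z - y)" by blast
 thus "EX d>0. ALL x y. a <= x --> x <= y --> y <= b --> y - x < d --> - e * (y - x) <= F y - F x"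
 by (intro exI[of _ d]) (simp add: abs_le_iff minus_le_iff)
 qed
 moreover have "- F a <= - F b"
 proof (rule nondecreasing_if_local[OF ab])
 fix e :: real assume "0 < e"
 from loc[OF this] obtain d where "d > 0" "!!y z. a <= y ==> y <= z ==> z <= b ==> z - y < d ==> abs (F z - F y) <= e * (z - y)" by blast
 thus "EX d>0. ALL x y. a <= x --> x <= y --> y <= b --> y - x < d --> - e * (y - x) <= - F y - - F x"
 by (intro exI[of _ d]) (simp add: abs_le_iff minus_le_iff)
 qed
 ultimately show ?thesis by simp
qed

text \<open>The difference between \<open>f * g\<close> and the integral of the expected density has
  increments of second order, as both factors are Lipschitz; hence it is constant.\<close>

lemma ac_product:
 assumes f: "bm f" "ac_rep a b f v" and g: "bm g" "ac_rep a b g w" and ab: "a <= b"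
 shows "f b * g b - f a * g a = integral {a..b} (%x. v x * g x + f x * w x)"
proof -
 have v: "bm v" and w: "bm w" using f g by (auto simp: ac_rep_def)
 obtain A where A: "0 <= A" "!!x. abs (v x) <= A" "!!y z. y : {a..b} ==> z : {a..b} ==> abs (f z - f y) <= A * abs (z - y)"
 using ac_rep_Lipschitz[OF f(2)] by blast
 obtain B where B: "0 <= B" "!!x. abs (w x) <= B" "!!y z. y : {a..b} ==> z : {a..b} ==> abs (g z - g y) <= B * abs (z - y)"
 using ac_rep_Lipschitz[OF g(2)] by blast
 define h where "h x = v x * g x + f x * w x" for x
 have h: "bm h" unfolding h_def by (intro bm_add bm_mult v w f g)
 define D where "D z = f z * g z - integral {a..z} h" for z
 have "D b = D a"
 proof (rule const_if_quadratic[OF ab, where K="2 * A * B"])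
 fix y z assume yz: "a <= y" "y <= z" "z <= b"
 have "integral {a..y} h + integral {y..z} h = integral {a..z} h"
 by (rule hk_integral_combine) (use yz in \<open>auto intro: bm_integrable h\<close>)
 hence "D z - D y = (f z - f y) * g z + f y * (g z - g y) - integral {y..z} h"
 by (simp add: D_def algebra_simps)
 also have "... = integral {y..z} v * g z + f y * integral {y..z} w - integral {y..z} h"
 using ac_repD[OF f(2) yz] ac_repD[OF g(2) yz] by simp
 also have "... = integral {y..z} (%s. v s * g z + f y * w s - h s)"
 by (subst hk_integral_diff)
 (auto intro!: bm_integrable bm_add bm_mult v w h bm_const simp: hk_integral_add bm_integrable v w bm_mult bm_const)
 finally have eq: "D z - D y = integral {y..z} (%s. v s * g z + f y * w s - h s)" .
 have "abs (integral {y..z} (%s. v s * g z + f y * w s - h s)) <= (2 * A * B * (z - y)) * (z - y)"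
 proof (rule integral_abs_le[OF _ yz(2)])
 show "(%s. v s * g z + f y * w s - h s) integrable_on {y..z}"
 by (intro hk_integrable_diff bm_integrable bm_add bm_mult v w h bm_const)
 fix s assume s: "s : {y..z}"
 have "v s * g z + f y * w s - h s = v s * (g z - g s) + (f y - f s) * w s" by (simp add: h_def algebra_simps)
 also have "abs (...) <= abs (v s) * abs (g z - g s) + abs (f y - f s) * abs (w s)" by (metis abs_mult abs_triangle_ineq)
 also have "... <= A * (B * (z - y)) + (A * (z - y)) * B"
 proof (intro add_mono mult_mono A(2) B(2))
 have "B * abs (z - s) <= B * (z - y)" "A * abs (y - s) <= A * (z - y)" using s A B by (intro mult_left_mono; simp)+
 thus "abs (g z - g s) <= B * (z - y)" "abs (f y - f s) <= A * (z - y)"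
 using A(3)[of s y] B(3)[of s z] s yz by auto
 qed (use A B yz in auto)
 finally show "abs (v s * g z + f y * w s - h s) <= 2 * A * B * (z - y)" by (simp add: algebra_simps)
 qed
 thus "abs (D z - D y) <= 2 * A * B * (z - y)^2" unfolding eq by (simp add: power2_eq_square mult.assoc)
 qed
 thus ?thesis by (simp add: D_def h_def[abs_def])
qed

lemma mvt_between:
 fixes Ph :: "real => real"
 assumes d: "!!x. m <= x ==> (Ph hrd Ph' x) (at x)" and uv: "m <= u" "m <= v"
 obtains xh where "m <= xh" "abs (xh - u) <= abs (v - u)" "Ph v - Ph u = Ph' xh * (v - u)"
proof -
 consider "u < v" | "u = v" | "v < u" by linarith
 thus ?thesis
 proof cases
 case 1
 then obtain xh where "u < xh" "xh < v" "Ph v - Ph u = (v - u) * Ph' xh" using MVT2[of u v Ph Ph'] d uv by auto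
 thus ?thesis using uv by (intro that[of xh]) auto
 next
 case 2
 thus ?thesis using uv by (intro that[of u]) auto
 next
 case 3
 then obtain xh where "v < xh" "xh < u" "Ph u - Ph v = (u - v) * Ph' xh" using MVT2[of v u Ph Ph'] d uv by auto
 thus ?thesis using uv by (intro that[of xh]) (auto simp: algebra_simps)
 qed
qed

text \<open>As for products: the mean value \<open>Ph' xh\<close> differs from
  \<open>Ph' (f s)\<close> by the order of the interval length, because \<open>f\<close> and
  \<open>Ph'\<close> are Lipschitz.\<close>

lemma ac_chain:
 assumes f: "ac_rep a b f w" and m: "!!x. m <= f x"
 and d: "!!x. m <= x ==> (Ph hrd Ph' x) (at x)"
 and L: "!!x y. m <= x ==> m <= y ==> abs (Ph' x - Ph' y) <= B * abs (x - y)" and B: "0 <= B"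
 and h: "bm (%x. Ph' (f x))"
 shows "ac_rep a b (%x. Ph (f x)) (%x. Ph' (f x) * w x)"
proof -
 have w: "bm w" using f by (auto simp: ac_rep_def)
 obtain A where A: "0 <= A" "!!x. abs (w x) <= A" "!!y z. y : {a..b} ==> z : {a..b} ==> abs (f z - f y) <= A * abs (z - y)"
 using ac_rep_Lipschitz[OF f] by blast
 define h' where "h' x = Ph' (f x) * w x" for x
 have h': "bm h'" unfolding h'_def by (intro bm_mult w h)
 have main: "Ph (f b') - Ph (f a') = integral {a'..b'} h'" if ab: "a <= a'" "a' <= b'" "b' <= b" for a' b'
 proof -
 define D where "D z = Ph (f z) - integral {a'..z} h'" for z
 have "D b' = D a'"
 proof (rule const_if_quadratic[OF ab(2), where K="2 * A * A * B"])
 fix y z assume yz: "a' <= y" "y <= z" "z <= b'"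
 have yz': "a <= y" "z <= b" using yz ab by auto
 obtain xh where xh: "m <= xh" "abs (xh - f y) <= abs (f z - f y)" "Ph (f z) - Ph (f y) = Ph' xh * (f z - f y)"
 using mvt_between[of m Ph Ph', OF d m m] by blast
 have "integral {a'..y} h' + integral {y..z} h' = integral {a'..z} h'"
 by (rule hk_integral_combine) (use yz in \<open>auto intro: bm_integrable h'\<close>)
 hence "D z - D y = Ph' xh * integral {y..z} w - integral {y..z} h'"
 using xh(3) ac_repD[OF f yz'(1) yz(2) yz'(2)] by (simp add: D_def algebra_simps)
 also have "... = integral {y..z} (%s. Ph' xh * w s - h' s)"
 by (subst hk_integral_diff)
 (auto intro!: bm_integrable bm_mult w h' bm_const)
 finally have eq: "D z - D y = integral {y..z} (%s. Ph' xh * w s - h' s)" .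
 have "abs (integral {y..z} (%s. Ph' xh * w s - h' s)) <= (2 * A * A * B * (z - y)) * (z - y)"
 proof (rule integral_abs_le[OF _ yz(2)])
 show "(%s. Ph' xh * w s - h' s) integrable_on {y..z}"
 by (intro hk_integrable_diff bm_integrable bm_mult w h' bm_const)
 fix s assume s: "s : {y..z}"
 have "A * abs (z - y) <= A * (z - y)" "A * abs (s - y) <= A * (z - y)" using s A by (intro mult_left_mono; simp)+
 moreover have "y : {a..b}" "z : {a..b}" "s : {a..b}" using s yz yz' by auto
 ultimately have fl: "abs (f z - f y) <= A * (z - y)" "abs (f s - f y) <= A * (z - y)"
 using A(3)[of y z] A(3)[of y s] by auto
 have "abs (xh - f s) <= 2 * (A * (z - y))" using xh(2) fl by linarith
 hence "B * abs (xh - f s) <= B * (2 * (A * (z - y)))" using B by (rule mult_left_mono)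
 with L[OF xh(1) m] have "abs (Ph' xh - Ph' (f s)) <= B * (2 * (A * (z - y)))" by (meson order_trans)
 hence "abs (Ph' xh - Ph' (f s)) * abs (w s) <= (B * (2 * (A * (z - y)))) * A"
 using A(2) by (intro mult_mono) (use A B yz in auto)
 moreover have "Ph' xh * w s - h' s = (Ph' xh - Ph' (f s)) * w s" by (simp add: h'_def algebra_simps)
 ultimately show "abs (Ph' xh * w s - h' s) <= 2 * A * A * B * (z - y)" by (simp add: abs_mult mult_ac)
 qed
 thus "abs (D z - D y) <= 2 * A * A * B * (z - y)^2" unfolding eq by (simp add: power2_eq_square mult.assoc)
 qed
 thus ?thesis by (simp add: D_def)
 qed
 show ?thesis unfolding ac_rep_def using h' main by (auto simp: h'_def[abs_def])
qed

text \<open>The points violating the closed condition form an open set; being negligible, it is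
  empty.\<close>

lemma AE_imp_all_open:
 fixes f :: "real => 'b::topological_space"
 assumes S: "open S" and f: "cts S f" and C: "closed C"
 and ae: "AE x in lborel. x : S --> f x : C" and x: "x : S"
 shows "f x : C"
proof -
 define N where "N = f -` (- C) \<inter> S"
 have "open N" using f C S unfolding N_def by (simp add: continuous_on_open_vimage open_Compl)
 moreover have "negligible N"
 proof -
 from ae obtain A where A: "{x : space lborel. \<not> (x : S --> f x : C)} <= A" "emeasure lborel A = 0" "A : sets lborel"
 by (rule AE_E)
 hence "A : null_sets lebesgue" by (auto intro!: null_sets_completionI simp: null_sets_def)
 hence "negligible A" by (simp add: negligible_iff_null_sets)
 thus ?thesis by (rule negligible_subset) (use A(1) in \<open>auto simp: N_def\<close>)
 qed
 ultimately have "N = {}" using open_not_negligible by blast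
 thus ?thesis using x by (auto simp: N_def)
qed

lemma Linf_AE:
 assumes u: "Linf S u" and S: "S : sets borel"
 shows "AE x in lborel. x : S --> abs (u x) <= real_of_ereal (Linf_norm S u)"
proof -
 have "AE x in restrict_space lborel S. ereal (abs (u x)) <= Linf_norm S u" unfolding Linf_norm_def by (rule esssup_AE)
 hence "AE x in lborel. x : S --> ereal (abs (u x)) <= Linf_norm S u"
 using S by (simp add: AE_restrict_space_iff)
 thus ?thesis
 proof eventually_elim
 case (elim x)
 have "Linf_norm S u < \<infinity>" using u by (simp add: Linf_def)
 thus ?case using elim by (cases "Linf_norm S u") auto
 qed
qed

section \<open>Continuous functions with a bounded weak derivative\<close>

lemma test_fun_antiderivative:
 fixes H :: real
 assumes ps: "test_fun {0<..<H} ps" and H: "0 < H" and z: "(LBINT x:{0<..<H}. ps x) = 0"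
 obtains ph where "test_fun {0<..<H} ph" "pd 1 ph = ps"
proof -
 obtain K where K: "compact K" "K <= {0<..<H}" "!!x. x ~: K ==> ps x = 0" and sm: "smooth ps"
 using ps by (auto simp: test_fun_def)
 obtain l r where lr: "0 < l" "l <= r" "r < H" "K <= {l..r}"
 proof (cases "K = {}")
 case True thus ?thesis using H by (intro that[of "H/2" "H/2"]) auto
 next
 case False
 obtain l where l: "l : K" "ALL x:K. l <= x" using compact_attains_inf[OF K(1) False] by blast
 obtain r where r: "r : K" "ALL x:K. x <= r" using compact_attains_sup[OF K(1) False] by blast
 show ?thesis using l r K(2) by (intro that[of l r]) auto
 qed
 have "smooth (%x. cor (ps x))" using sm by (rule smooth_of_real)
 then obtain F where F: "smooth F" "F 0 = 0" "!!x. (F hvd cor (ps x)) (at x)"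
 by (rule smooth_antiderivative_from_0) blast
 define ph where "ph x = Re (F x)" for x
 have d: "(ph hvd ps x) (at x)" for x
 using bounded_linear.has_vector_derivative[OF bounded_linear_Re F(3)] by (simp add: ph_def[abs_def])
 have smF: "smooth ph" using F(1) unfolding smooth_def ph_def[abs_def] by (auto intro: Ck_bounded_linear[OF bounded_linear_Re])
 have "(LBINT x:{0<..<H}. cor (ps x)) = F H - F 0"
 by (rule set_integral_FTC[OF _ F(3)]) (use H in \<open>auto intro!: cints smooth_cont sm\<close>)
 moreover have "(LBINT x:{0<..<H}. cor (ps x)) = 0"
 using z by (simp add: set_int_def of_real_mult[symmetric] scaleR_conv_of_real del: of_real_mult)
 ultimately have FH: "F H = 0" using F(2) by simp
 have const: "ph x = ph y" if "!!z. z : {x..y} ==> ps z = 0" "x <= y" for x y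
 proof -
 have "(ps has_integral ph y - ph x) {x..y}"
 by (rule fundamental_theorem_of_calculus[OF that(2)]) (use d in \<open>auto intro: has_vector_derivative_at_within\<close>)
 moreover have "(ps has_integral 0) {x..y}" by (rule has_integral_is_0) (use that in auto)
 ultimately have "ph y - ph x = 0" by (rule has_integral_unique)
 thus ?thesis by simp
 qed
 have psi0: "ps x = 0" if "x < l \<or> r < x" for x using K(3) lr(4) that by fastforce
 have out: "ph x = 0" if x: "x ~: {l..r}" for x
 proof -
 have z0: "ph 0 = 0" "ph H = 0" using F(2) FH by (auto simp: ph_def)
 consider "x < l" "x <= 0" | "x < l" "0 < x" | "r < x" "x <= H" | "r < x" "H < x" using x by fastforce
 thus ?thesis
 proof cases
 case 1 thus ?thesis using const[of x 0] z0 lr psi0 by auto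
 next
 case 2 thus ?thesis using const[of 0 x] z0 lr psi0 by auto
 next
 case 3 thus ?thesis using const[of x H] z0 lr psi0 by auto
 next
 case 4 thus ?thesis using const[of H x] z0 lr psi0 by auto
 qed
 qed
 show ?thesis
 proof (rule that[of ph])
 show "test_fun {0<..<H} ph" unfolding test_fun_def
 by (intro conjI smF exI[of _ "{l..r}"]) (use out lr in auto)
 show "pd 1 ph = ps" by (rule ext) (rule pd_real_eq[OF d])
 qed
qed

lemma test_fun_nonzero_mean:
 fixes H :: real
 assumes H: "0 < H"
 obtains ps where "test_fun {0<..<H} ps" "(LBINT x:{0<..<H}. ps x) ~= 0"
proof -
 have "EX ps. test_fun {0<..<H} ps & (LBINT x:{0<..<H}. ps x) ~= 0"
 proof (rule ccontr)
 assume n: "\<not> ?thesis"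
 have "AE z in lborel. z : {0<..<H} --> (%_. 1::real) z = 0"
 by (rule fundamental_lemma) (use n in \<open>auto intro!: loc_integrable_continuous\<close>)
 hence "(1::real) : {0}"
 by (intro AE_imp_all_open[of "{0<..<H}" "%_. 1" "{0}" "H/2"]) (use H in auto)
 thus False by simp
 qed
 thus ?thesis using that by blast
qed

text \<open>The lemma of du Bois-Reymond. A multiple of a fixed test function \<open>ps\<close> with
  nonzero mean corrects \<open>et\<close> to mean 0; the result is the derivative of a test
  function, against which \<open>F\<close> integrates to 0.\<close>

lemma const_if_weak_deriv_0:
 fixes F :: "real => real"
 assumes F: "cts UNIV F" and H: "0 < H"
 and z: "!!ph. test_fun {0<..<H} ph ==> (LBINT x:{0<..<H}. pd 1 ph x * F x) = 0"
 obtains k where "!!x. x : {0..H} ==> F x = k"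
proof -
 obtain ps where ps: "test_fun {0<..<H} ps" "(LBINT x:{0<..<H}. ps x) ~= 0" by (rule test_fun_nonzero_mean[OF H])
 note li = loc_integrable_continuous[OF F] loc_integrable_continuous[of "%_. 1::real", OF continuous_on_const]
 define k where "k = (LBINT x:{0<..<H}. ps x * F x) / (LBINT x:{0<..<H}. ps x)"
 have "AE x in lborel. x : {0<..<H} --> F x = k"
 proof (rule AE_eq_if_test_integrals_eq)
 fix et assume et: "test_fun {0<..<H} et"
 define I where "I f = (LBINT x:{0<..<H}. f x)" for f :: "real => real"
 note s1 = test_fun_integrable[OF et li(1)] test_fun_integrable[OF ps(1) li(1)] test_fun_integrable[OF et li(2)] test_fun_integrable[OF ps(1) li(2)]
 have s: "sint {0<..<H} (%x. et x * F x)" "sint {0<..<H} (%x. ps x * F x)"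
 "sint {0<..<H} et" "sint {0<..<H} ps" using s1 by simp_all
 define ze where "ze x = et x * I ps - ps x * I et" for x
 have "test_fun {0<..<H} ze"
 proof -
 obtain K1 where K1: "compact K1" "K1 <= {0<..<H}" "!!x. x ~: K1 ==> et x = 0" "smooth et" using et by (auto simp: test_fun_def)
 obtain K2 where K2: "compact K2" "K2 <= {0<..<H}" "!!x. x ~: K2 ==> ps x = 0" "smooth ps" using ps by (auto simp: test_fun_def)
 have "Ck n (%x. et x * I ps + ps x * (- I et))" for n
 by (intro Ck_add Ck_mult Ck_const K1(4)[unfolded smooth_def, rule_format] K2(4)[unfolded smooth_def, rule_format])
 hence "smooth ze" by (simp add: ze_def[abs_def] smooth_def)
 thus ?thesis unfolding test_fun_def
 by (intro conjI exI[of _ "K1 \<union> K2"]) (use K1 K2 in \<open>auto simp: ze_def\<close>)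
 qed
 moreover have "(LBINT x:{0<..<H}. ze x) = 0" unfolding ze_def
 by (subst set_integral_diff) (use s in \<open>auto simp: I_def mult.commute\<close>)
 ultimately obtain ph where ph: "test_fun {0<..<H} ph" "pd 1 ph = ze" by (rule test_fun_antiderivative[OF _ H])
 have "0 = (LBINT x:{0<..<H}. ze x * F x)" using z[OF ph(1)] by (simp add: ph(2))
 also have "... = (LBINT x:{0<..<H}. I ps * (et x * F x) - I et * (ps x * F x))"
 unfolding ze_def by (simp add: algebra_simps)
 also have "... = I ps * (LBINT x:{0<..<H}. et x * F x) - I et * (LBINT x:{0<..<H}. ps x * F x)"
 by (subst set_integral_diff) (use s in auto)
 finally have "(LBINT x:{0<..<H}. et x * F x) = I et * k" using ps(2) by (simp add: k_def I_def field_simps)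
 thus "(LBINT x:{0<..<H}. et x *R F x) = (LBINT x:{0<..<H}. et x *R k)" by (simp add: I_def)
 qed (auto intro!: loc_integrable_continuous F)
 hence op: "F x = k" if "x : {0<..<H}" for x
 using AE_imp_all_open[of "{0<..<H}" F "{k}" x] cont_sub[OF F] that by auto
 show ?thesis
 proof (rule that[of k])
 fix x assume "x : {0..H}"
 hence "x : closure {0<..<H}" using H by (simp add: closure_greaterThanLessThan)
 thus "F x = k"
 by (rule continuous_constant_on_closure[where S="{0<..<H}", rotated 2]) (use op cont_sub[OF F] in auto)
 qed
qed


lemma test_fun_ac:
 assumes "test_fun {0<..<H} ph"
 shows "bm ph" "ac_rep 0 H ph (pd 1 ph)" "ph 0 = 0" "ph H = 0"
proof -
 have bm: "bm et" if "test_fun {0<..<H} et" for et :: "real => real"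
 proof -
 obtain K where K: "compact K" "!!x. x ~: K ==> et x = 0" "smooth et" using \<open>test_fun _ et\<close> by (auto simp: test_fun_def)
 obtain B where B: "ALL x:K. norm (et x) <= B"
 using compact_imp_bounded[OF compact_continuous_image[OF smooth_cont[OF K(3)] K(1)]] by (auto simp: bounded_iff)
 have "abs (et x) <= max B 0" for x using B K(2)[of x] by (cases "x : K") auto
 moreover have "et : msb borel" by (rule borel_cont[OF smooth_cont[OF K(3)]])
 ultimately show ?thesis unfolding bm_def by blast
 qed
 show "bm ph" by (rule bm[OF assms])
 have "bm (pd 1 ph)" by (rule bm[OF test_fun_pd[OF assms]]) simp
 moreover have "ph z - ph y = integral {y..z} (pd 1 ph)" if "y <= z" for y z
 proof -
 have "(pd 1 ph has_integral ph z - ph y) {y..z}"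
 proof (rule fundamental_theorem_of_calculus[OF that])
 fix x
 have "ph differentiable (at x)" using assms by (auto simp: test_fun_def smooth_differentiable)
 then obtain d where d: "(ph hvd d) (at x)" using vector_derivative_works by blast
 thus "(ph hvd pd 1 ph x) (at x within {y..z})"
 using pd_real_eq[OF d] by (simp add: has_vector_derivative_at_within)
 qed
 thus ?thesis by (simp add: integral_unique)
 qed
 ultimately show "ac_rep 0 H ph (pd 1 ph)" by (simp add: ac_rep_def)
 show "ph 0 = 0" "ph H = 0" using assms by (auto simp: test_fun_def)
qed

lemma ac_by_parts:
 assumes f: "bm f" "ac_rep 0 H f w" and H: "0 <= H" and ph: "test_fun {0<..<H} ph"
 shows "(LBINT x:{0<..<H}. pd 1 ph x * f x) = - (LBINT x:{0<..<H}. ph x * w x)"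
proof -
 have w: "bm w" and p: "bm (pd 1 ph)" using f test_fun_ac(2)[OF ph] by (auto simp: ac_rep_def)
 note t = test_fun_ac[OF ph]
 have "0 = integral {0..H} (%x. pd 1 ph x * f x + ph x * w x)"
 using ac_product[OF t(1,2) f H] t(3,4) by simp
 also have "... = integral {0..H} (%x. pd 1 ph x * f x) + integral {0..H} (%x. ph x * w x)"
 by (intro hk_integral_add bm_integrable bm_mult p f t w)
 also have "... = (LBINT x:{0<..<H}. pd 1 ph x * f x) + (LBINT x:{0<..<H}. ph x * w x)"
 by (intro arg_cong2[where f="(+)"] bm_LBINT_open[symmetric] bm_mult p f t w)
 finally show ?thesis by simp
qed

lemma bm_loc_integrable:
 assumes "bm w" "S <= {0..H}"
 shows "loc_integrable S w"
 unfolding loc_integrable_def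
proof (intro allI impI)
 fix K assume K: "compact K & K <= S"
 show "sint K w"
 by (rule set_integrable_subset[OF bm_set_integrable[OF assms(1), of 0 H]]) (use K assms(2) in \<open>auto intro: borel_compact\<close>)
qed

lemma weak_deriv_ac:
 assumes f: "bm f" "ac_rep 0 H f w" and H: "0 <= H" and eq: "!!x. x : {0<..<H} ==> h x = f x"
 shows "weak_deriv {0<..<H} 1 h w"
proof -
 have w: "bm w" using f by (auto simp: ac_rep_def)
 have "loc_integrable {0<..<H} f" "loc_integrable {0<..<H} w" using f(1) w by (auto intro!: bm_loc_integrable[of _ _ H])
 moreover have "loc_integrable {0<..<H} h = loc_integrable {0<..<H} f"
 unfolding loc_integrable_def by (intro all_cong set_integrable_cong) (auto simp: eq subset_iff)
 moreover have "(LBINT x:{0<..<H}. pd 1 ph x *R h x) = (LBINT x:{0<..<H}. pd 1 ph x * f x)" for ph :: "real => real"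
 by (intro set_lebesgue_integral_cong) (auto simp: eq)
 ultimately show ?thesis unfolding weak_deriv_def using ac_by_parts[OF f H] by simp
qed

lemma bounded_version:
 assumes g: "Linf S g" and S: "S : sets borel"
 obtains w where "bm w" "AE x in lborel. x : S --> w x = g x"
proof -
 define K where "K = real_of_ereal (Linf_norm S g)"
 define h where "h x = indicat_real S x * g x" for x
 define w where "w x = (if (abs (h x)) <= K then h x else 0)" for x
 have [measurable]: "h : msb borel"
 using g by (simp add: Linf_def set_meas_def h_def[abs_def])
 have "abs (w x) <= abs K" for x by (simp add: w_def)
 moreover have "w : msb borel" unfolding w_def[abs_def] by measurable
 ultimately have "bm w" unfolding bm_def by blast
 moreover have "AE x in lborel. x : S --> w x = g x"
 using Linf_AE[OF g S] by eventually_elim (auto simp: w_def h_def K_def)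
 ultimately show ?thesis by (rule that)
qed

text \<open>Extends functions from \<open>[0,H]\<close> to the line by their end values, since
  \<open>bm\<close> asks for boundedness everywhere.\<close>

definition clamp1 :: "real => real => real" where "clamp1 H x = max 0 (min H x)"

lemma clamp1: "x : {0..H} ==> clamp1 H x = x" "0 <= H ==> clamp1 H x : {0..H}" "cts A (clamp1 H)"
 unfolding clamp1_def by (auto intro!: cints)

lemma continuous_clamp1: "cts {0..H} h ==> 0 <= H ==> cts UNIV (%x. h (clamp1 H x))"
 by (rule cont_comp[OF _ clamp1(3)]) (use clamp1(2) in auto)

lemma bm_clamp1:
 assumes "cts {0..H} h" "0 <= H"
 shows "bm (%x. h (clamp1 H x))"
proof -
 obtain B where B: "ALL x:{0..H}. norm (h x) <= B"
 using compact_imp_bounded[OF compact_continuous_image[OF assms(1)]] by (auto simp: bounded_iff)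
 have "abs (h (clamp1 H x)) <= B" for x using B clamp1(2)[OF assms(2), of x] by auto
 moreover have "(%x. h (clamp1 H x)) : msb borel"
 by (rule borel_cont[OF continuous_clamp1[OF assms]])
 ultimately show ?thesis unfolding bm_def by blast
qed

lemma ac_rep_indefinite:
 assumes w: "bm w" and H: "0 <= H"
 shows "cts {0..H} (%x. integral {0..x} w)" "ac_rep 0 H (%x. integral {0..clamp1 H x} w) w"
proof -
 show "cts {0..H} (%x. integral {0..x} w)" by (rule indefinite_integral_continuous_1[OF bm_integrable[OF w]])
 have "integral {0..z} w - integral {0..y} w = integral {y..z} w" if "0 <= y" "y <= z" for y z
 using hk_integral_combine[of 0 y z w] that bm_integrable[OF w] by simp
 thus "ac_rep 0 H (%x. integral {0..clamp1 H x} w) w"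
 unfolding ac_rep_def using w by (auto simp: clamp1)
qed

text \<open>The difference of \<open>c\<close> and the indefinite integral of a bounded version of
  its weak derivative has weak derivative 0 and is therefore constant.\<close>

lemma ac_rep_if_weak_deriv:
 assumes c: "cts {0..H} c" and H: "0 < H" and g: "weak_deriv {0<..<H} 1 c g" "Linf {0<..<H} g"
 obtains w where "ac_rep 0 H (%x. c (clamp1 H x)) w"
proof -
 have H0: "0 <= H" using H by simp
 obtain w where w: "bm w" "AE x in lborel. x : {0<..<H} --> w x = g x"
 by (rule bounded_version[OF g(2)]) auto
 define W where "W x = integral {0..x} w" for x
 note W = ac_rep_indefinite[OF w(1) H0, folded W_def]
 define F where "F x = c (clamp1 H x) - W (clamp1 H x)" for x
 have cF: "cts UNIV F" unfolding F_def by (intro cints continuous_clamp1 c W H0)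
 obtain k where k: "!!x. x : {0..H} ==> F x = k"
 proof (rule const_if_weak_deriv_0[OF cF H])
 fix ph assume ph: "test_fun {0<..<H} ph"
 have p: "bm (pd 1 ph)" using test_fun_ac(2)[OF ph] by (auto simp: ac_rep_def)
 have 1: "(LBINT x:{0<..<H}. pd 1 ph x * c (clamp1 H x)) = (LBINT x:{0<..<H}. pd 1 ph x *R c x)"
 by (intro set_lebesgue_integral_cong) (auto simp: clamp1)
 have 2: "(LBINT x:{0<..<H}. pd 1 ph x *R c x) = - (LBINT x:{0<..<H}. ph x *R g x)" using g(1) ph by (simp add: weak_deriv_def)
 have gm: "set_borel_measurable lborel {0<..<H} g" using g(2) by (simp add: Linf_def)
 have [measurable]: "ph : msb borel" "w : msb borel" using test_fun_ac(1)[OF ph] w(1) by (auto simp: bm_def)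
 have 3: "(LBINT x:{0<..<H}. ph x *R g x) = (LBINT x:{0<..<H}. ph x * w x)"
 unfolding set_int_def
 proof (rule integral_cong_AE)
 have "(%x. ph x * (indicat_real {0<..<H} x *R g x)) : msb lborel"
 using gm unfolding set_meas_def by measurable
 thus "(%x. indicat_real {0<..<H} x *R ph x *R g x) : msb lborel" by (simp add: mult.left_commute)
 show "AE x in lborel. indicat_real {0<..<H} x *R ph x *R g x = indicat_real {0<..<H} x *R (ph x * w x)"
 using w(2) by eventually_elim (auto simp: indicator_def)
 qed measurable
 have 4: "(LBINT x:{0<..<H}. pd 1 ph x * W (clamp1 H x)) = - (LBINT x:{0<..<H}. ph x * w x)"
 by (rule ac_by_parts[OF bm_clamp1[OF W(1) H0] _ H0 ph]) (use W(2) in \<open>simp add: W_def\<close>)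
 have s: "sint {0<..<H} (%x. pd 1 ph x * c (clamp1 H x))" "sint {0<..<H} (%x. pd 1 ph x * W (clamp1 H x))"
 by (rule set_integrable_subset[OF bm_set_integrable[of _ 0 H]], auto intro!: bm_mult p bm_clamp1 c W H0)+
 show "(LBINT x:{0<..<H}. pd 1 ph x * F x) = 0"
 unfolding F_def right_diff_distrib using s 1 2 3 4 by (subst set_integral_diff) auto
 qed blast
 have "ac_rep 0 H (%x. c (clamp1 H x)) w"
 unfolding ac_rep_def
 proof (intro conjI w(1) allI impI)
 fix y z assume yz: "0 <= y" "y <= z" "z <= H"
 hence "W z - W y = integral {y..z} w" using ac_repD[OF ac_rep_indefinite(2)[OF w(1) H0] yz] by (simp add: W_def clamp1)
 moreover have "y : {0..H}" "z : {0..H}" using yz by auto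
 moreover from this have "F y = F z" using k by simp
 ultimately show "c (clamp1 H z) - c (clamp1 H y) = integral {y..z} w" by (simp add: F_def clamp1(1))
 qed
 thus ?thesis by (rule that)
qed

text \<open>\<open>G y\<close> is the total variation of \<open>ln (c^-2)\<close> over
  \<open>[y,H]\<close>, written with the density \<open>c^2 * |(c^-2)'|\<close>. It compensates
  every decrease of \<open>ln (c^-2)\<close>, so \<open>c^-2 * exp (- G)\<close> is nondecreasing,
  and \<open>exp (G 0)\<close> is the exponential factor of \<open>C_M\<close>.\<close>

lemma sound_speed:
 assumes W: "W1inf H c" and H: "0 < H" and pos: "ALL y:{0<..<H}. 0 < c y"
 and Li: "Linf {0<..<H} (%y. 1 / (c y)^2)"
 obtains G where "cts {0..H} c" "!!y. y : {0..H} ==> 0 < c y" "0 <= theta H c"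
 "!!y. y : {0..H} ==> 1 / (c y)^2 <= (theta H c)^2" "cts {0..H} G" "G H = 0"
 "mono_on {0..H} (%y. exp (- G y))" "mono_on {0..H} (%y. 1 / (c y)^2 * exp (- G y))"
 "C_M H bt c = H * exp (G 0) * (1 / (c H)^2 + bt^2)"
proof -
 have H0: "0 <= H" using H by simp
 have c: "cts {0..H} c" using W by (simp add: W1inf_def)
 define r where "r = real_of_ereal (Linf_norm {0<..<H} (%y. 1 / (c y)^2))"
 have co: "cts {0<..<H} c" by (rule cont_sub[OF c]) auto
 have r1: "1 / (c y)^2 <= r" if y: "y : {0<..<H}" for y
 proof -
 have "1 / (c y)^2 : {..r}"
 proof (rule AE_imp_all_open[OF _ _ _ _ y])
 show "cts {0<..<H} (%y. 1 / (c y)^2)" using pos by (intro cints co) auto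
 show "AE x in lborel. x : {0<..<H} --> 1 / (c x)^2 : {..r}"
 using Linf_AE[OF Li] unfolding r_def by simp
 qed auto
 thus ?thesis by simp
 qed
 have r0: "0 < r"
 proof -
 have "H / 2 : {0<..<H}" using H by simp
 hence "0 < 1 / (c (H/2))^2" using pos by (simp add: less_imp_neq[symmetric])
 thus ?thesis using r1[OF \<open>H/2 : _\<close>] by linarith
 qed
 have th: "0 <= theta H c" "(theta H c)^2 = r" using r0 by (auto simp: theta_def r_def)
 have cl: "closure {0<..<H} = {0..H}" using H by (simp add: closure_greaterThanLessThan)
 \<comment> \<open>The hypotheses concern the open interval; the essential bound on
   \<open>c^-2\<close> keeps \<open>c\<close> away from 0 at the end points as well.\<close>
 have cge: "0 <= c y" "1 <= r * (c y)^2" if y: "y : {0..H}" for y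
 proof -
 show "0 <= c y" by (rule continuous_ge_on_closure[of "{0<..<H}" c]) (use c y pos in \<open>auto simp: cl less_imp_le\<close>)
 show "1 <= r * (c y)^2"
 proof (rule continuous_ge_on_closure[of "{0<..<H}" "%y. r * (c y)^2"])
 show "1 <= r * (c x)^2" if "x : {0<..<H}" for x
 using r1[OF that] pos that by (simp add: divide_le_eq split: if_splits) force
 qed (use c y in \<open>auto simp: cl intro!: cints\<close>)
 qed
 have cpos: "0 < c y" if "y : {0..H}" for y using cge[OF that] by (cases "c y = 0") auto
 have s_le: "1 / (c y)^2 <= (theta H c)^2" if "y : {0..H}" for y
 using cge[OF that] cpos[OF that] th by (simp add: divide_le_eq)
 define m where "m = 1 / sqrt r"
 have m0: "0 < m" using r0 by (simp add: m_def)
 have cm: "m <= c y" if "y : {0..H}" for y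
 proof (rule power2_le_imp_le)
 show "m^2 <= (c y)^2" using cge(2)[OF that] r0 by (simp add: m_def power_divide divide_le_eq mult.commute)
 qed (use cge[OF that] in simp)
 obtain g where g: "weak_deriv {0<..<H} 1 c g" "Linf {0<..<H} g" using W by (auto simp: W1inf_def)
 obtain w where w: "ac_rep 0 H (%x. c (clamp1 H x)) w" by (rule ac_rep_if_weak_deriv[OF c H g])
 define d where "d x = c (clamp1 H x)" for x
 note w = w[folded d_def[abs_def]]
 have bw: "bm w" using w by (simp add: ac_rep_def)
 have dm: "m <= d x" for x unfolding d_def by (rule cm[OF clamp1(2)[OF H0]])
 have d0: "0 < d x" for x using dm[of x] m0 by linarith
 have deq: "d x = c x" if "x : {0..H}" for x using that by (simp add: d_def clamp1)
 have bmd: "bm (%x. h (d x))" if "cts {m..} h" for h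
 proof -
 have "cts {0..H} (%x. h (c x))" by (rule cont_comp[OF that c]) (use cm in auto)
 from bm_clamp1[OF this H0] show ?thesis by (simp add: d_def)
 qed
 define s where "s x = - 2 / (d x)^3 * w x" for x
 have "ac_rep 0 H (%x. (%v. 1 / v^2) (d x)) (%x. (%v. - 2 / v^3) (d x) * w x)"
 proof (rule ac_chain[OF w dm, where B="6 / m^4"])
 show "((%v. 1 / v^2) hrd - 2 / x^3) (at x)" if "m <= x" for x
 using that m0 by (auto intro!: deqs simp: field_simps power2_eq_square power3_eq_cube)
 show "abs (- 2 / x^3 - - 2 / y^3) <= 6 / m^4 * abs (x - y)" if xy: "m <= x" "m <= y" for x y
 proof -
 have "((%v. - 2 / v^3) hrd 6 / x^4) (at x)" if "m <= x" for x
 using that m0 by (auto intro!: deqs simp: field_simps power3_eq_cube power4_eq_xxxx)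
 then obtain xh where "m <= xh" "- 2 / x^3 - - 2 / y^3 = 6 / xh^4 * (x - y)"
 using mvt_between[of m "%v. - 2 / v^3" "%x. 6 / x^4" y x] xy by metis
 moreover have "6 / xh^4 <= 6 / m^4" using \<open>m <= xh\<close> m0 by (intro divide_left_mono power_mono) auto
 moreover have "0 <= 6 / xh^4" by simp
 ultimately show ?thesis by (simp only: abs_mult abs_of_nonneg) (rule mult_right_mono, simp_all)
 qed
 show "bm (%x. - 2 / (d x)^3)" by (rule bmd) (use m0 in \<open>auto intro!: cints\<close>)
 qed (use m0 in auto)
 hence sr: "ac_rep 0 H (%x. 1 / (d x)^2) s" by (simp add: s_def[abs_def])
 \<comment> \<open>The logarithm of \<open>c^-2\<close> is treated besides \<open>c^-2\<close>
   itself: the absolute value of its density is \<open>ga\<close>, so that the comparison with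
   \<open>G\<close> is additive.\<close>
 have lr: "ac_rep 0 H (%x. (%v. - 2 * ln v) (d x)) (%x. (%v. - 2 / v) (d x) * w x)"
 proof (rule ac_chain[OF w dm, where B="2 / m^2"])
 show "((%v. - 2 * ln v) hrd - 2 / x) (at x)" if "m <= x" for x
 using that m0 by (auto intro!: deqs simp: field_simps)
 show "abs (- 2 / x - - 2 / y) <= 2 / m^2 * abs (x - y)" if xy: "m <= x" "m <= y" for x y
 proof -
 have "((%v. - 2 / v) hrd 2 / x^2) (at x)" if "m <= x" for x
 using that m0 by (auto intro!: deqs simp: field_simps power2_eq_square)
 then obtain xh where "m <= xh" "- 2 / x - - 2 / y = 2 / xh^2 * (x - y)"
 using mvt_between[of m "%v. - 2 / v" "%x. 2 / x^2" y x] xy by metis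
 moreover have "2 / xh^2 <= 2 / m^2" using \<open>m <= xh\<close> m0 by (intro divide_left_mono power_mono) auto
 moreover have "0 <= 2 / xh^2" by simp
 ultimately show ?thesis by (simp only: abs_mult abs_of_nonneg) (rule mult_right_mono, simp_all)
 qed
 show "bm (%x. - 2 / d x)" by (rule bmd) (use m0 in \<open>auto intro!: cints\<close>)
 qed (use m0 in auto)
 have bs: "bm s" using sr by (simp add: ac_rep_def)
 define ga where "ga x = (d x)^2 * abs (s x)" for x
 have bga: "bm ga" unfolding ga_def
 by (intro bm_mult bm_abs bs bmd[of "%v. v^2"]) (auto intro!: cints)
 have ga_eq: "ga x = abs (- 2 / d x * w x)" for x
 using d0[of x] by (simp add: ga_def s_def abs_mult power2_eq_square power3_eq_cube)
 define G where "G y = integral {y..H} ga" for y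
 have G_diff: "G y - G z = integral {y..z} ga" if "0 <= y" "y <= z" "z <= H" for y z
 using hk_integral_combine[of y z H ga] that bm_integrable[OF bga] by (simp add: G_def)
 have ga0: "0 <= ga x" for x by (simp add: ga_def)
 have wd: "weak_deriv {0<..<H} 1 (%y. 1 / (c y)^2) s"
 by (rule weak_deriv_ac[OF _ sr H0]) (auto simp: deq intro!: bmd cints dest: less_le_trans[OF m0])
 note wde = wderiv_AE_eq[OF open_greaterThanLessThan wd]
 define q where "q = wderiv {0<..<H} 1 (%y. 1 / (c y)^2)"
 have "(LBINT x:{0<..<H}. (c x)^2 * abs (q x)) = (LBINT x:{0<..<H}. ga x)"
 unfolding set_int_def
 proof (rule integral_cong_AE)
 have [measurable]: "ga : msb borel" using bga by (simp add: bm_def)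
 have [measurable]: "d : msb borel" using bmd[of "%x. x"] by (simp add: bm_def)
 have "loc_integrable {0<..<H} q" using wde(1) by (simp add: weak_deriv_def q_def)
 hence qm: "(%x. indicat_real {0<..<H} x *R q x) : msb borel"
 using set_borel_measurable_loc_integrable[of "{0<..<H}" q] by (simp add: set_meas_def)
 have "(%x. indicat_real {0<..<H} x *R ((c x)^2 * abs (q x))) = (%x. (d x)^2 * abs (indicat_real {0<..<H} x *R q x))"
 by (auto simp: fun_eq_iff indicator_def deq)
 moreover have "(%x. (d x)^2 * abs (indicat_real {0<..<H} x *R q x)) : msb borel"
 by (intro borel_measurable_times borel_measurable_abs borel_measurable_power qm) measurable
 ultimately show "(%x. indicat_real {0<..<H} x *R ((c x)^2 * abs (q x))) : msb lborel" by simp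
 show "AE x in lborel. indicat_real {0<..<H} x *R ((c x)^2 * abs (q x)) = indicat_real {0<..<H} x *R ga x"
 using wde(2) by eventually_elim (auto simp: indicator_def ga_def deq q_def)
 show "(%x. indicat_real {0<..<H} x *R ga x) : msb lborel" by measurable
 qed
 hence CM: "C_M H bt c = H * exp (G 0) * (1 / (c H)^2 + bt^2)"
 unfolding C_M_def q_def[symmetric] G_def using bm_LBINT_open[OF bga, of 0 H] by simp
 show ?thesis
 proof (rule that[of G, OF c cpos th(1) s_le _ _ _ _ CM])
 have "cts {0..H} (%y. G 0 - integral {0..y} ga)"
 by (intro cints ac_rep_indefinite(1)[OF bga H0])
 thus "cts {0..H} G"
 by (rule continuous_on_eq) (use G_diff[of 0] in fastforce)
 show "G H = 0" by (simp add: G_def)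
 have Gm: "G z <= G y" if "0 <= y" "y <= z" "z <= H" for y z
 proof -
 have "0 <= integral {y..z} ga" by (intro integral_nonneg bm_integrable bga ga0)
 thus ?thesis using G_diff[OF that] by simp
 qed
 thus "mono_on {0..H} (%y. exp (- G y))" by (auto simp: mono_on_def)
 show "mono_on {0..H} (%y. 1 / (c y)^2 * exp (- G y))"
 proof (rule mono_onI)
 fix y z assume yz: "y : {0..H}" "z : {0..H}" "y <= z"
 have "- integral {y..z} ga <= integral {y..z} (%x. - 2 / d x * w x)"
 proof -
 have "integral {y..z} (%x. - ga x) <= integral {y..z} (%x. - 2 / d x * w x)"
 proof (rule integral_le)
 show "(%x. - 2 / d x * w x) integrable_on {y..z}" using lr by (intro bm_integrable) (simp add: ac_rep_def)
 show "(%x. - ga x) integrable_on {y..z}" using bm_integrable[OF bga] by (rule hk_integrable_neg)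
 show "- ga x <= - 2 / d x * w x" for x unfolding ga_eq by linarith
 qed
 thus ?thesis by simp
 qed
 hence "- 2 * ln (c y) - G y <= - 2 * ln (c z) - G z"
 using ac_repD[OF lr, of y z] G_diff[of y z] yz by (simp add: deq)
 hence le: "exp (- 2 * ln (c y) - G y) <= exp (- 2 * ln (c z) - G z)" by simp
 have "exp (- 2 * ln (c x) - G x) = 1 / (c x)^2 * exp (- G x)" if "x : {0..H}" for x
 proof -
 have "exp (- 2 * ln (c x)) = inverse (exp (ln (c x)) * exp (ln (c x)))"
 by (simp add: exp_minus[symmetric] exp_add[symmetric] exp_diff)
 also have "... = 1 / (c x)^2" using cpos[OF that] by (simp add: power2_eq_square divide_inverse)
 finally show ?thesis by (simp add: exp_diff exp_minus divide_inverse)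
 qed
 note e = this
 show "1 / (c y)^2 * exp (- G y) <= 1 / (c z)^2 * exp (- G z)"
 using le by (simp only: e[OF yz(1)] e[OF yz(2)])
 qed
 qed
qed

section \<open>The optical problem\<close>

lemma C3_bounds:
 assumes f: "Cn_on H 3 f" "Cn_norm H 3 f <= M" and H: "0 < H" and y: "y : {0..H}"
 shows "(f hrd dI H f y) (at y within {0..H})"
 "(dI H f hrd dI H (dI H f) y) (at y within {0..H})"
 "abs (f y) <= M" "abs (dI H f y) <= M" "abs (dI H (dI H f) y) <= M"
proof -
 have d: "((dI H ^^ j) f hrd (dI H ^^ Suc j) f y) (at y within {0..H})" if "j < 3" "y : {0..H}" for j y
 proof -
 have "((dI H ^^ j) f) differentiable (at y within {0..H})" using f(1) that by (simp add: Cn_on_def)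
 thus ?thesis
 by (simp add: vector_derivative_works dI_def real_deriv_iff)
 qed
 show "(f hrd dI H f y) (at y within {0..H})" using d[of 0] y by simp
 show "(dI H f hrd dI H (dI H f) y) (at y within {0..H})" using d[of 1] y by simp
 have c: "cts {0..H} ((dI H ^^ j) f)" if "j <= 3" for j
 proof (cases "j = 3")
 case True thus ?thesis using f(1) by (simp add: Cn_on_def)
 next
 case False
 thus ?thesis using that by (intro DERIV_continuous_on[OF d]) auto
 qed
 have up: "abs ((dI H ^^ j) f x) <= sup_norm H ((dI H ^^ j) f)" if "j <= 3" "x : {0..H}" for j x
 unfolding sup_norm_def
 proof (rule cSUP_upper[OF that(2)])
 have "compact ((%y. abs ((dI H ^^ j) f y)) ` {0..H})"
 by (intro compact_continuous_image cints c that(1)) simp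
 thus "bdd_above ((%y. abs ((dI H ^^ j) f y)) ` {0..H})" by (rule bounded_imp_bdd_above[OF compact_imp_bounded])
 qed
 have nn: "0 <= sup_norm H ((dI H ^^ j) f)" if "j <= 3" for j
 using order_trans[OF abs_ge_zero up[OF that y]] .
 have le: "abs ((dI H ^^ j) f y) <= M" if "j <= 3" for j
 proof -
 have "sup_norm H ((dI H ^^ j) f) <= (\<Sum>j\<le>3. sup_norm H ((dI H ^^ j) f))"
 by (rule member_le_sum) (use that nn in auto)
 thus ?thesis using up[OF that y] f(2) by (simp add: Cn_norm_def)
 qed
 show "abs (f y) <= M" "abs (dI H f y) <= M" "abs (dI H (dI H f) y) <= M"
 using le[of 0] le[of 1] le[of 2] by (simp_all add: numeral_2_eq_2)
qed

lemma abs_diff_le_if_deriv_le: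
 fixes f F :: "real => real"
 assumes ab: "a <= b" and f: "!!x. x : {a..b} ==> (f hrd f' x) (at x within {a..b})"
 and F: "!!x. x : {a..b} ==> (F hrd F' x) (at x within {a..b})"
 and le: "!!x. x : {a..b} ==> abs (f' x) <= F' x"
 shows "abs (f b - f a) <= F b - F a"
proof -
 have i: "(f' has_integral f b - f a) {a..b}" "(F' has_integral F b - F a) {a..b}"
 by (rule fundamental_theorem_of_calculus[OF ab]; use f F in \<open>simp add: real_deriv_iff\<close>)+
 have "f b - f a <= F b - F a" by (rule has_integral_le[OF i]) (use le in \<open>force simp: abs_le_iff\<close>)
 moreover have "- (f b - f a) <= F b - F a"
 by (rule has_integral_le[OF has_integral_neg[OF i(1)] i(2)]) (use le in \<open>force simp: abs_le_iff\<close>)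
 ultimately show ?thesis by simp
qed

lemma nondecreasing_if_deriv_nonneg:
 fixes f :: "real => real"
 assumes "a <= b" "!!x. x : {a..b} ==> (f hrd f' x) (at x within {a..b})"
 and "!!x. x : {a..b} ==> 0 <= f' x"
 shows "f a <= f b"
proof -
 have "(f' has_integral f b - f a) {a..b}"
 by (rule fundamental_theorem_of_calculus[OF assms(1)]) (use assms(2) in \<open>simp add: real_deriv_iff\<close>)
 hence "0 <= f b - f a" by (rule has_integral_nonneg) (rule assms(3))
 thus ?thesis by simp
qed

text \<open>The optical equation holds only in the open interval. The flux \<open>D * u'\<close> is
  an indefinite integral there, hence extends to \<open>[0,H]\<close>, and \<open>u\<close> is then
  the integral of \<open>g / D\<close>, with one-sided derivatives at the ends.\<close>

lemma optical_extension:
 assumes D: "cts {0..H} D" "!!y. y : {0..H} ==> 0 < D y" and mu: "cts {0..H} mu"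
 and u: "optical_solution L H D mu k u" and H: "0 < H"
 obtains g where "!!y. y : {0..H} ==> (u hrd g y / D y) (at y within {0..H})"
 "!!y. y : {0..H} ==> (g hrd (mu y + (lam L k)^2 * D y) * u y) (at y within {0..H})"
proof -
 define q where "q y = mu y + (lam L k)^2 * D y" for y
 have cu: "cts {0..H} u" and u0: "u 0 = 0" using u by (auto simp: optical_solution_def)
 have du: "(u hrd deriv u y) (at y)" if "y : {0<..<H}" for y
 using u that by (auto simp: optical_solution_def DERIV_deriv_iff_real_differentiable)
 have dg: "((%s. D s * deriv u s) hrd q y * u y) (at y)" if "y : {0<..<H}" for y
 proof -
 have "((%s. D s * deriv u s) hrd deriv (%s. D s * deriv u s) y) (at y)"
 using u that by (auto simp: optical_solution_def DERIV_deriv_iff_real_differentiable)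
 moreover have "deriv (%s. D s * deriv u s) y = q y * u y"
 using u that by (auto simp: optical_solution_def q_def)
 ultimately show ?thesis by simp
 qed
 have cq: "cts {0..H} (%y. q y * u y)" unfolding q_def by (intro cints D mu cu)
 define I where "I y = integral {0..y} (%y. q y * u y)" for y
 have dI: "(I hrd q y * u y) (at y within {0..H})" if "y : {0..H}" for y
 unfolding I_def using integral_has_real_derivative[OF cq that] by simp
 have "((%s. D s * deriv u s - I s) hrd 0) (at y within {0<..<H})" if y: "y : {0<..<H}" for y
 proof -
 have "((%s. D s * deriv u s - I s) hrd q y * u y - q y * u y) (at y within {0<..<H})"
 by (intro DERIV_diff has_field_derivative_at_within[OF dg[OF y]] DERIV_subset[OF dI]) (use y in auto)
 thus ?thesis by simp
 qed
 then obtain k' where k': "!!y. y : {0<..<H} ==> D y * deriv u y - I y = k'"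
 using has_field_derivative_zero_constant[of "{0<..<H}" "%s. D s * deriv u s - I s"] by auto
 define g where "g y = I y + k'" for y
 have gd: "(g hrd q y * u y) (at y within {0..H})" if "y : {0..H}" for y
 unfolding g_def by (auto intro!: deqs dI[OF that])
 have cg: "cts {0..H} (%y. g y / D y)"
 using D(2) by (intro cints D DERIV_continuous_on[OF gd]) (auto simp: less_imp_neq[symmetric])
 define V where "V y = integral {0..y} (%y. g y / D y)" for y
 have dV: "(V hrd g y / D y) (at y within {0..H})" if "y : {0..H}" for y
 unfolding V_def using integral_has_real_derivative[OF cg that] by simp
 have uV: "u y = V y" if y: "y : {0..H}" for y
 proof -
 have "(%y. u y - V y) y = (%y. u y - V y) 0"
 proof (rule DERIV_isconst2[OF H])
 show "cts {0..H} (%y. u y - V y)" by (intro cints cu DERIV_continuous_on[OF dV])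
 fix x assume x: "0 < x" "x < H"
 hence xx: "x : {0<..<H}" "x : {0..H}" by auto
 have "(V hrd g x / D x) (at x)"
 using dV[OF xx(2)] x by (simp add: at_within_Icc_at)
 moreover have "g x / D x = deriv u x" using k'[OF xx(1)] D(2)[OF xx(2)] by (simp add: g_def field_simps)
 ultimately show "((%y. u y - V y) hrd 0) (at x)" using DERIV_diff[OF du[OF xx(1)], of V "deriv u x"] by simp
 qed (use y in auto)
 thus ?thesis using u0 by (simp add: V_def)
 qed
 show ?thesis
 proof (rule that[of g])
 show "(u hrd g y / D y) (at y within {0..H})" if "y : {0..H}" for y
 by (rule has_real_derivative_transform[OF that uV dV[OF that]])
 show "(g hrd (mu y + (lam L k)^2 * D y) * u y) (at y within {0..H})" if "y : {0..H}" for y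
 using gd[OF that] by (simp add: q_def)
 qed
qed

text \<open>\<open>u * g\<close> is nondecreasing and vanishes at 0, so \<open>g^2\<close> is
  nondecreasing too, and \<open>|g|\<close> is at least \<open>|g 0|\<close>, which an energy
  estimate started at \<open>H\<close> bounds below. Thus \<open>g\<close> has no zero, and its sign
  is positive because \<open>u\<close> rises from 0 to 1.\<close>

lemma optical_bounds:
 fixes u g D q :: "real => real"
 assumes H: "0 < H" and D0: "0 < D0" and D': "ALL y:{0..H}. D0 <= D y & D y <= M"
 and q': "ALL y:{0..H}. 0 <= q y & q y <= B"
 and u'': "ALL y:{0..H}. (u hrd g y / D y) (at y within {0..H})"
 and g'': "ALL y:{0..H}. (g hrd q y * u y) (at y within {0..H})"
 and bc: "u 0 = 0" "u H = 1" and y: "y : {0..H}"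
 shows "exp (- (1 / D0 + B) * H / 2) <= g y" "g y <= M / H + B * H"
 "exp (- (1 / D0 + B) * H / 2) / M * y <= u y" "u y <= (M / H + B * H) / D0 * y" "0 <= u y" "u y <= 1"
proof -
 note D = D'[rule_format] and q = q'[rule_format] and u' = u''[rule_format] and g' = g''[rule_format]
 define C where "C = 1 / D0 + B"
 define c where "c = exp (- C * H / 2)"
 have c0: "0 < c" by (simp add: c_def)
 have Dpos: "0 < D y" if "y : {0..H}" for y using D[OF that] D0 by linarith
 have M0: "0 < M" using D[OF y] D0 by linarith
 have sub: "(f hrd d) (at x within {a..b})"
 if "(f hrd d) (at x within {0..H})" "0 <= a" "b <= H" for f d x a b
 using that(2,3) by (intro DERIV_subset[OF that(1)]) auto
 have ug: "0 <= u y * g y" if y: "y : {0..H}" for y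
 proof -
 have "u 0 * g 0 <= u y * g y"
 proof (rule nondecreasing_if_deriv_nonneg[where f="%y. u y * g y" and f'="%y. (g y)^2 / D y + q y * (u y)^2"])
 fix x assume x: "x : {0..y}"
 hence x': "x : {0..H}" using y by auto
 have "((%y. u y * g y) hrd g x / D x * g x + q x * u x * u x) (at x within {0..y})"
 by (rule sub[OF DERIV_mult[OF u'[OF x'] g'[OF x']]]) (use y in auto)
 thus "((%y. u y * g y) hrd (g x)^2 / D x + q x * (u x)^2) (at x within {0..y})"
 by (simp add: power2_eq_square mult.assoc)
 show "0 <= (g x)^2 / D x + q x * (u x)^2" using Dpos[OF x'] q[OF x'] by (intro add_nonneg_nonneg) auto
 qed (use y in auto)
 thus ?thesis using bc by simp
 qed
 have g2: "(g 0)^2 <= (g y)^2" if y: "y : {0..H}" for y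
 proof (rule nondecreasing_if_deriv_nonneg[where f="%y. (g y)^2" and f'="%y. 2 * (q y * (u y * g y))"])
 fix x assume x: "x : {0..y}"
 hence x': "x : {0..H}" using y by auto
 have "((%y. (g y)^2) hrd 2 * (q x * (u x * g x))) (at x within {0..H})"
 by (auto intro!: deqs g'[OF x'])
 thus "((%y. (g y)^2) hrd 2 * (q x * (u x * g x))) (at x within {0..y})"
 by (rule sub) (use y in auto)
 show "0 <= 2 * (q x * (u x * g x))" using q[OF x'] ug[OF x'] by auto
 qed (use y in auto)
 \<comment> \<open>Gronwall for \<open>u^2 + g^2\<close>, which grows at most at the rate
   \<open>C\<close>. As \<open>u H = 1\<close> and \<open>u 0 = 0\<close>, the value
   \<open>(g 0)^2\<close> cannot be smaller than \<open>exp (- C * H)\<close>.\<close>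
 have N: "- exp (- C * 0) * ((u 0)^2 + (g 0)^2) <= - exp (- C * H) * ((u H)^2 + (g H)^2)"
 proof (rule nondecreasing_if_deriv_nonneg[where f="%y. - exp (- C * y) * ((u y)^2 + (g y)^2)"
 and f'="%y. exp (- C * y) * (C * ((u y)^2 + (g y)^2) - 2 * (u y * g y) * (1 / D y + q y))"])
 fix x assume x: "x : {0..H}"
 show "((%y. - exp (- C * y) * ((u y)^2 + (g y)^2)) has_real_derivative
 exp (- C * x) * (C * ((u x)^2 + (g x)^2) - 2 * (u x * g x) * (1 / D x + q x))) (at x within {0..H})"
 by (auto intro!: deqs u'[OF x] g'[OF x] simp: algebra_simps)
 have "1 / D x <= 1 / D0" using D[OF x] D0 by (intro divide_left_mono) auto
 hence "1 / D x + q x <= C" using q[OF x] by (simp add: C_def)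
 moreover have "2 * (u x * g x) <= (u x)^2 + (g x)^2" using sum_squares_bound[of "u x" "g x"] by simp
 ultimately have "2 * (u x * g x) * (1 / D x + q x) <= ((u x)^2 + (g x)^2) * C"
 by (intro mult_mono) (use Dpos[OF x] q[OF x] in auto)
 thus "0 <= exp (- C * x) * (C * ((u x)^2 + (g x)^2) - 2 * (u x * g x) * (1 / D x + q x))"
 by (simp add: mult.commute)
 qed (use H in auto)
 have "exp (- C * H) <= exp (- C * H) * (1 + (g H)^2)" by simp
 also have "... <= (g 0)^2" using N bc by simp
 finally have "exp (- C * H) <= (g 0)^2" .
 moreover have "c^2 = exp (- C * H)" by (simp add: c_def power2_eq_square exp_add[symmetric])
 ultimately have "c^2 <= (g 0)^2" by simp
 hence cg: "c <= abs (g y)" if "y : {0..H}" for y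
 using order_trans[OF _ g2[OF that]] c0 by (metis abs_ge_zero power2_abs power2_le_imp_le)
 have contg: "cts {0..H} g" by (rule DERIV_continuous_on[OF g'])
 have gpos: "0 < g y" if y: "y : {0..H}" for y
 proof (rule ccontr)
 assume n: "\<not> 0 < g y"
 have neg: "g x < 0" if x: "x : {0..H}" for x
 proof (rule ccontr)
 assume n2: "\<not> g x < 0"
 have "connected (g ` {0..H})" by (rule connected_continuous_image[OF contg]) simp
 hence "0 : g ` {0..H}" using n n2 x y by (auto simp: connected_iff_interval)
 then obtain z where "z : {0..H}" "g z = 0" by auto
 thus False using cg[of z] c0 by simp
 qed
 have "- u 0 <= - u H"
 proof (rule nondecreasing_if_deriv_nonneg[where f="%y. - u y" and f'="%y. - (g y / D y)"])
 fix x assume x: "x : {0..H}"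
 show "((%y. - u y) hrd - (g x / D x)) (at x within {0..H})" by (rule DERIV_minus[OF u'[OF x]])
 show "0 <= - (g x / D x)" using neg[OF x] Dpos[OF x] by (simp add: divide_le_0_iff)
 qed (use H in auto)
 thus False using bc by simp
 qed
 have umono: "u a <= u b" if "0 <= a" "a <= b" "b <= H" for a b
 proof (rule nondecreasing_if_deriv_nonneg[OF that(2) sub[OF u']])
 show "0 <= g x / D x" if "x : {a..b}" for x using gpos[of x] Dpos[of x] that \<open>0 <= a\<close> \<open>b <= H\<close> by auto
 qed (use that in auto)
 have u0: "0 <= u y" and u1: "u y <= 1" if "y : {0..H}" for y using umono[of 0 y] umono[of y H] that bc by auto
 show "exp (- (1 / D0 + B) * H / 2) <= g y" using cg[OF y] gpos[OF y] by (simp add: c_def C_def)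
 show "0 <= u y" "u y <= 1" using u0 u1 y by auto
 have g0_le: "g 0 <= g x" if "x : {0..H}" for x
 using g2[OF that] gpos[OF that] by (auto intro: power2_le_imp_le less_imp_le)
 have lin: "a * y <= u y" if a: "!!x. x : {0..H} ==> a <= g x / D x" and y: "y : {0..H}" for a y
 proof -
 have "u 0 - a * 0 <= u y - a * y"
 proof (rule nondecreasing_if_deriv_nonneg[where f="%y. u y - a * y" and f'="%y. g y / D y - a"])
 fix x assume x: "x : {0..y}"
 hence x': "x : {0..H}" using y by auto
 show "((%y. u y - a * y) hrd g x / D x - a) (at x within {0..y})"
 by (auto intro!: deqs sub[OF u'[OF x']]) (use y in auto)
 show "0 <= g x / D x - a" using a[OF x'] by simp
 qed (use y in auto)
 thus ?thesis using bc by simp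
 qed
 have gup: "g y <= M / H + B * H" if y: "y : {0..H}" for y
 proof -
 have "g 0 / M * H <= u H"
 proof (rule lin)
 fix x assume x: "x : {0..H}"
 show "g 0 / M <= g x / D x"
 using g0_le[OF x] gpos[OF x] D[OF x] Dpos[OF x] by (intro frac_le) auto
 qed (use H in auto)
 hence "g 0 <= M / H" using bc H M0 by (simp add: field_simps)
 moreover have "B * 0 - g 0 <= B * y - g y"
 proof (rule nondecreasing_if_deriv_nonneg[where f="%y. B * y - g y" and f'="%y. B - q y * u y"])
 fix x assume x: "x : {0..y}"
 hence x': "x : {0..H}" using y by auto
 show "((%y. B * y - g y) hrd B - q x * u x) (at x within {0..y})"
 by (auto intro!: deqs sub[OF g'[OF x']]) (use y in auto)
 have "q x * u x <= B * 1" using q[OF x'] u0[OF x'] u1[OF x'] by (intro mult_mono) auto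
 thus "0 <= B - q x * u x" by simp
 qed (use y in auto)
 moreover have "B * y <= B * H" using y q[OF y] by (intro mult_left_mono) auto
 ultimately show ?thesis by simp
 qed
 show "g y <= M / H + B * H" by (rule gup[OF y])
 have "c / M * y <= u y"
 proof (rule lin[OF _ y])
 fix x assume x: "x : {0..H}"
 show "c / M <= g x / D x"
 using cg[OF x] gpos[OF x] D[OF x] Dpos[OF x] c0 by (intro frac_le) auto
 qed
 thus "exp (- (1 / D0 + B) * H / 2) / M * y <= u y" by (simp add: c_def C_def)
 define Ga where "Ga = M / H + B * H"
 have "Ga / D0 * 0 - u 0 <= Ga / D0 * y - u y"
 proof (rule nondecreasing_if_deriv_nonneg[where f="%y. Ga / D0 * y - u y" and f'="%y. Ga / D0 - g y / D y"])
 fix x assume x: "x : {0..y}"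
 hence x': "x : {0..H}" using y by auto
 show "((%y. Ga / D0 * y - u y) hrd Ga / D0 - g x / D x) (at x within {0..y})"
 by (auto intro!: deqs sub[OF u'[OF x']]) (use y D0 in auto)
 have "g x / D x <= Ga / D0" using gup[OF x'] gpos[OF x'] D[OF x'] D0 by (intro frac_le) (auto simp: Ga_def)
 thus "0 <= Ga / D0 - g x / D x" by simp
 qed (use y in auto)
 thus "u y <= (M / H + B * H) / D0 * y" using bc D0 by (simp add: Ga_def)
qed

text \<open>What the stability analysis uses of one optical mode: \<open>u\<close>, its flux
  \<open>g = D * u'\<close> and the derivative \<open>h'\<close> of the internal datum
  \<open>mu * u\<close>, with all bounds expressed by one constant \<open>K\<close>. The bound
  \<open>y / K <= u y\<close> records that \<open>u\<close> vanishes only linearly at 0; the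
  Lipschitz bound on \<open>h'\<close> serves the interpolation.\<close>

definition mode_data :: "real => real => real => (real => real) => (real => real) => (real => real) =>
 (real => real) => (real => real) => (real => real) => bool" where
 "mode_data H K La D mu mu1 u g h' \<longleftrightarrow> cts {0..H} D &
 (ALL y:{0..H}. (u hrd g y / D y) (at y within {0..H})) &
 (ALL y:{0..H}. (g hrd (mu y + La * D y) * u y) (at y within {0..H})) &
 (ALL y:{0..H}. ((%y. mu y * u y) hrd h' y) (at y within {0..H})) &
 (ALL y:{0..H}. 1 / K <= D y & D y <= K & 1 / K <= mu y & mu y <= K) &
 (ALL y:{0..H}. y / K <= u y & u y <= K * y & abs (g y) <= K & abs (h' y) <= K) &
 (ALL x:{0..H}. ALL y:{0..H}. abs (h' x - h' y) <= K * abs (x - y)) &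
 u H = 1 & (ALL y:{0..H}. h' y = mu1 y * u y + mu y * (g y / D y))"

lemma mode_data_mono:
 assumes m: "mode_data H K La D mu mu1 u g h'" and K: "0 < K" "K <= K'"
 shows "mode_data H K' La D mu mu1 u g h'"
proof -
 have 1: "1 / K' <= 1 / K" using K by (intro divide_left_mono) auto
 have 2: "y / K' <= y / K" "K * y <= K' * y" if "0 <= y" for y
 using that K by (auto intro!: divide_left_mono mult_right_mono)
 have 3: "K * abs (x - y) <= K' * abs (x - y)" for x y using K by (intro mult_right_mono) auto
 have a: "1 / K' <= D y & D y <= K' & 1 / K' <= mu y & mu y <= K'" if "y : {0..H}" for y
 proof -
 have "1 / K <= D y & D y <= K & 1 / K <= mu y & mu y <= K" using m that unfolding mode_data_def by blast
 thus ?thesis using 1 K by linarith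
 qed
 have b: "y / K' <= u y & u y <= K' * y & abs (g y) <= K' & abs (h' y) <= K'" if "y : {0..H}" for y
 proof -
 have "y / K <= u y & u y <= K * y & abs (g y) <= K & abs (h' y) <= K" using m that unfolding mode_data_def by blast
 thus ?thesis using 2[of y] K that by auto
 qed
 have c: "abs (h' x - h' y) <= K' * abs (x - y)" if "x : {0..H}" "y : {0..H}" for x y
 proof -
 have "abs (h' x - h' y) <= K * abs (x - y)" using m that unfolding mode_data_def by blast
 thus ?thesis using 3[of x y] by linarith
 qed
 show ?thesis using m a b c unfolding mode_data_def by blast
qed

text \<open>The Lipschitz constant of \<open>h'\<close> comes from a bound on its derivative, which
  contains second derivatives of \<open>mu\<close> and first derivatives of \<open>D\<close>; the C3
  norms control both. \<open>K\<close> is a sum that exceeds each of the bounds.\<close>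

lemma optical_mode_data:
 assumes H: "0 < H" and D0: "0 < D0" and mu0: "0 < mu0" and M: "0 < M"
 obtains K where "1 <= K"
 "!!D mu u. (D, mu) : O_M H D0 mu0 M ==> optical_solution L H D mu k u ==>
 EX g h'. mode_data H K ((lam L k)^2) D mu (dI H mu) u g h'"
proof -
 define La where "La = (lam L k)^2"
 have La: "0 <= La" by (simp add: La_def)
 define B where "B = M + La * M"
 define c where "c = exp (- (1 / D0 + B) * H / 2)"
 define G where "G = M / H + B * H"
 define h1 where "h1 = M + M * (G / D0)"
 define h2 where "h2 = M + M * (G / D0) + (M * (G / D0) + M * (B / D0 + G * M / (D0 * D0)))"
 define K where "K = 1 + M / c + G / D0 + G + M + 1 / D0 + 1 / mu0 + h1 + h2"
 have c0: "0 < c" by (simp add: c_def)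
 have nn: "0 <= B" "0 <= G" "0 <= G / D0" "0 <= M / c" "0 <= 1 / D0" "0 <= 1 / mu0" "0 <= h1" "0 <= h2"
 using H D0 mu0 M La c0 by (auto simp: B_def G_def h1_def h2_def intro!: add_nonneg_nonneg mult_nonneg_nonneg divide_nonneg_nonneg)
 have K1: "1 <= K" using nn M by (simp add: K_def)
 have K: "M / c <= K" "G / D0 <= K" "G <= K" "M <= K" "1 / D0 <= K" "1 / mu0 <= K" "h1 <= K" "h2 <= K"
 using nn M unfolding K_def by linarith+
 have inv: "1 / K <= x" if "1 / x <= K" "0 < x" for x
 using that K1 by (simp add: field_simps)
 have main: "EX g h'. mode_data H K La D mu (dI H mu) u g h'"
 if OM: "(D, mu) : O_M H D0 mu0 M" and u: "optical_solution L H D mu k u" for D mu u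
 proof -
 define D1 D2 mu1 mu2 where "D1 = dI H D" and "D2 = dI H (dI H D)" and "mu1 = dI H mu" and "mu2 = dI H (dI H mu)"
 have CD: "Cn_on H 3 D" "Cn_norm H 3 D <= M" and Cmu: "Cn_on H 3 mu" "Cn_norm H 3 mu <= M"
 and low: "!!y. y : {0..H} ==> D0 < D y" "!!y. y : {0..H} ==> mu0 < mu y"
 using OM by (auto simp: O_M_def)
 note bD = C3_bounds[OF CD H, folded D1_def D2_def]
 note bmu = C3_bounds[OF Cmu H, folded mu1_def mu2_def]
 have Dp: "0 < D y" and mup: "0 < mu y" if "y : {0..H}" for y using low(1)[OF that] low(2)[OF that] D0 mu0 by linarith+
 obtain g where u': "!!y. y : {0..H} ==> (u hrd g y / D y) (at y within {0..H})"
 and g': "!!y. y : {0..H} ==> (g hrd (mu y + La * D y) * u y) (at y within {0..H})"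
 using optical_extension[OF DERIV_continuous_on[OF bD(1)] Dp DERIV_continuous_on[OF bmu(1)] u H] unfolding La_def by blast
 have bc: "u 0 = 0" "u H = 1" using u by (auto simp: optical_solution_def)
 have DM: "D0 <= D y & D y <= M" if "y : {0..H}" for y using low(1)[OF that] bD(3)[OF that] by auto
 have muM: "mu0 <= mu y & mu y <= M" if "y : {0..H}" for y using low(2)[OF that] bmu(3)[OF that] by auto
 have qB: "0 <= mu y + La * D y & mu y + La * D y <= B" if "y : {0..H}" for y
 using DM[OF that] muM[OF that] mup[OF that] Dp[OF that] La unfolding B_def by (auto intro!: add_mono mult_left_mono)
 have "ALL y:{0..H}. D0 <= D y & D y <= M" "ALL y:{0..H}. 0 <= mu y + La * D y & mu y + La * D y <= B"
 "ALL y:{0..H}. (u hrd g y / D y) (at y within {0..H})"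
 "ALL y:{0..H}. (g hrd (mu y + La * D y) * u y) (at y within {0..H})"
 using DM qB u' g' by blast+
 note ob = optical_bounds[OF H D0 this bc, folded c_def G_def]
 define h' where "h' y = mu1 y * u y + mu y * (g y / D y)" for y
 define h'' where "h'' y = (mu2 y * u y + mu1 y * (g y / D y)) + (mu1 y * (g y / D y) + mu y * ((mu y + La * D y) * u y / D y - g y * D1 y / (D y * D y)))" for y
 have dh: "((%y. mu y * u y) hrd h' y) (at y within {0..H})" if y: "y : {0..H}" for y
 using DERIV_mult[OF bmu(1)[OF y] u'[OF y]] by (simp add: h'_def mult.commute add.commute)
 have dgD: "((%y. g y / D y) hrd (mu y + La * D y) * u y / D y - g y * D1 y / (D y * D y)) (at y within {0..H})"
 if y: "y : {0..H}" for y
 proof -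
 have "((%y. g y / D y) hrd ((mu y + La * D y) * u y * D y - g y * D1 y) / (D y * D y)) (at y within {0..H})"
 by (rule DERIV_divide[OF g'[OF y] bD(1)[OF y]]) (use Dp[OF y] in simp)
 moreover have "((mu y + La * D y) * u y * D y - g y * D1 y) / (D y * D y) = (mu y + La * D y) * u y / D y - g y * D1 y / (D y * D y)"
 using Dp[OF y] by (simp add: diff_divide_distrib)
 ultimately show ?thesis by simp
 qed
 have dh': "(h' hrd h'' y) (at y within {0..H})" if y: "y : {0..H}" for y
 using DERIV_add[OF DERIV_mult[OF bmu(2)[OF y] u'[OF y]] DERIV_mult[OF bmu(1)[OF y] dgD[OF y]]]
 unfolding h'_def[abs_def] h''_def by (simp only: mult.commute add.commute)
 have gD: "abs (g y / D y) <= G / D0" if y: "y : {0..H}" for y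
 unfolding abs_divide using ob(1,2)[OF y] c0 DM[OF y] D0 by (intro frac_le) auto
 have h'b: "abs (h' y) <= h1" if y: "y : {0..H}" for y
 proof -
 have "abs (h' y) <= abs (mu1 y) * abs (u y) + abs (mu y) * abs (g y / D y)" unfolding h'_def by (metis abs_mult abs_triangle_ineq)
 also have "... <= M * 1 + M * (G / D0)"
 using bmu(3,4)[OF y] ob(5,6)[OF y] gD[OF y] M by (intro add_mono mult_mono) auto
 finally show ?thesis by (simp add: h1_def)
 qed
 have h''b: "abs (h'' y) <= h2" if y: "y : {0..H}" for y
 proof -
 have 1: "abs (mu2 y * u y) <= M * 1" unfolding abs_mult using bmu(5)[OF y] ob(5,6)[OF y] M by (intro mult_mono) auto
 have 2: "abs (mu1 y * (g y / D y)) <= M * (G / D0)" unfolding abs_mult using bmu(4)[OF y] gD[OF y] M by (intro mult_mono) auto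
 have 3: "abs ((mu y + La * D y) * u y / D y) <= B / D0"
 proof -
 have "(mu y + La * D y) * u y <= B * 1" using qB[OF y] ob(5,6)[OF y] by (intro mult_mono) auto
 thus ?thesis unfolding abs_divide using qB[OF y] ob(5)[OF y] DM[OF y] D0 by (intro frac_le) auto
 qed
 have 4: "abs (g y * D1 y / (D y * D y)) <= G * M / (D0 * D0)"
 unfolding abs_divide abs_mult using ob(1,2)[OF y] c0 bD(4)[OF y] DM[OF y] D0 nn M
 by (intro frac_le mult_mono) auto
 have 5: "abs ((mu y + La * D y) * u y / D y - g y * D1 y / (D y * D y)) <= B / D0 + G * M / (D0 * D0)"
 using 3 4 by linarith
 have 6: "abs (mu y * ((mu y + La * D y) * u y / D y - g y * D1 y / (D y * D y))) <= M * (B / D0 + G * M / (D0 * D0))"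
 unfolding abs_mult[of "mu y"] using bmu(3)[OF y] 5 M by (intro mult_mono) auto
 have tri: "abs (a + b + (b + d)) <= A + B + (B + E)" if "abs a <= A" "abs b <= B" "abs d <= E" for a b d A B E :: real
 using that by linarith
 show ?thesis unfolding h''_def h2_def using tri[OF 1[unfolded mult_1_right] 2 6] .
 qed
 have Lip: "abs (h' x - h' y) <= K * abs (x - y)" if xy: "x : {0..H}" "y : {0..H}" for x y
 proof -
 have le: "abs (h' b - h' a) <= K * (b - a)" if ab: "a : {0..H}" "b : {0..H}" "a <= b" for a b
 proof -
 have "abs (h' b - h' a) <= h2 * b - h2 * a"
 proof (rule abs_diff_le_if_deriv_le[OF ab(3), where f'=h'' and F'="%_. h2"])
 fix x assume x: "x : {a..b}"
 show "(h' hrd h'' x) (at x within {a..b})" by (rule DERIV_subset[OF dh']) (use x ab in auto)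
 show "((%x. h2 * x) hrd h2) (at x within {a..b})" by (auto intro!: deqs)
 show "abs (h'' x) <= h2" by (rule h''b) (use x ab in auto)
 qed
 also have "... <= K * (b - a)" unfolding right_diff_distrib[symmetric] using ab K by (intro mult_right_mono) auto
 finally show ?thesis .
 qed
 show ?thesis using le[of x y] le[of y x] xy by (cases "x <= y") (auto simp: abs_minus_commute)
 qed
 have Dmu: "1 / K <= D y & D y <= K & 1 / K <= mu y & mu y <= K" if y: "y : {0..H}" for y
 proof -
 have "1 / D y <= 1 / D0" "1 / mu y <= 1 / mu0" using DM[OF y] muM[OF y] Dp[OF y] mup[OF y] D0 mu0 by (auto intro!: divide_left_mono)
 hence "1 / D y <= K" "1 / mu y <= K" using K by linarith+
 thus ?thesis using inv Dp[OF y] mup[OF y] DM[OF y] muM[OF y] K(4) by (meson order_trans)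
 qed
 have ug: "y / K <= u y & u y <= K * y & abs (g y) <= K & abs (h' y) <= K" if y: "y : {0..H}" for y
 proof (intro conjI)
 have "1 / K <= c / M" using K(1) c0 M K1 by (simp add: field_simps)
 hence "1 / K * y <= c / M * y" using y by (intro mult_right_mono) auto
 thus "y / K <= u y" using ob(3)[OF y] by simp
 have "G / D0 * y <= K * y" using y K by (intro mult_right_mono) auto
 thus "u y <= K * y" using ob(4)[OF y] by simp
 show "abs (g y) <= K" using ob(1,2)[OF y] c0 K by linarith
 show "abs (h' y) <= K" using h'b[OF y] K by linarith
 qed
 have "cts {0..H} D" by (rule DERIV_continuous_on[OF bD(1)])
 hence "mode_data H K La D mu mu1 u g h'" unfolding mode_data_def using u' g' dh Dmu ug Lip bc h'_def by blast
 thus ?thesis unfolding mu1_def by blast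
 qed
 show ?thesis using that[OF K1 main[unfolded La_def]] by blast
qed

section \<open>Stability of the coefficients\<close>

lemma abs_mult_diff_le: "abs (a * b - a' * b') <= abs (a - a') * abs b + abs a' * abs (b - b')" for a b :: real
proof -
 have "a * b - a' * b' = (a - a') * b + a' * (b - b')" by (simp add: algebra_simps)
 thus ?thesis by (metis abs_mult abs_triangle_ineq)
qed

lemma abs_mult_diff_bound:
 fixes a b :: real
 assumes "abs (a - a') <= p" "abs b <= q" "abs a' <= r" "abs (b - b') <= s"
 shows "abs (a * b - a' * b') <= p * q + r * s"
proof -
 have "0 <= p" "0 <= r" using assms(1,3) abs_ge_zero order_trans by blast+
 hence "abs (a - a') * abs b <= p * q" "abs a' * abs (b - b') <= r * s"
 using assms by (auto intro!: mult_mono)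
 thus ?thesis using abs_mult_diff_le[of a b a' b'] by linarith
qed

lemma abs_diff_diff_le: "abs (a - b) <= p ==> abs (c - d) <= p ==> abs ((a - c) - (b - d)) <= 2 * p" for a :: real
 by linarith

lemma abs_divide_diff_le:
 fixes a b :: real
 assumes "0 < b" "0 < b'"
 shows "abs (a / b - a' / b') <= abs (a - a') / b + abs a' * abs (b - b') / (b * b')"
proof -
 have "a / b - a' / b' = (a - a') / b + a' * (b' - b) / (b * b')" using assms by (simp add: field_simps)
 moreover have "abs ((a - a') / b) = abs (a - a') / b" "abs (a' * (b' - b) / (b * b')) = abs a' * abs (b - b') / (b * b')"
 using assms by (simp_all add: abs_mult abs_minus_commute)
 ultimately show ?thesis by (metis abs_triangle_ineq)
qed

lemma abs_ln_diff_le: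
 fixes a b :: real
 assumes "0 < m" "m <= a" "m <= b"
 shows "abs (ln a - ln b) <= abs (a - b) / m"
proof -
 have le: "ln x - ln y <= abs (x - y) / m" if "m <= x" "m <= y" for x y
 proof -
 have "ln x - ln y <= (x - y) / y" by (rule ln_diff_le) (use that assms in auto)
 also have "... <= abs (x - y) / y" using that assms by (intro divide_right_mono) auto
 also have "... <= abs (x - y) / m" using that assms by (intro divide_left_mono) auto
 finally show ?thesis .
 qed
 show ?thesis using le[of a b] le[of b a] assms by (simp add: abs_le_iff abs_minus_commute)
qed

lemma abs_diff_le_ln:
 fixes a b :: real
 assumes "0 < a" "0 < b" "a <= m" "b <= m"
 shows "abs (a - b) <= m * abs (ln a - ln b)"
proof -
 have le: "x - y <= m * (ln x - ln y)" if "0 < y" "y <= x" "x <= m" for x y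
 proof -
 have "ln y - ln x <= (y - x) / x" by (rule ln_diff_le) (use that in auto)
 hence "x - y <= x * (ln x - ln y)" using that by (simp add: field_simps)
 also have "... <= m * (ln x - ln y)" using that by (intro mult_right_mono) auto
 finally show ?thesis .
 qed
 show ?thesis
 proof (cases "b <= a")
 case True
 hence "ln b <= ln a" using assms by simp
 thus ?thesis using le[of b a] assms True by simp
 next
 case False
 hence "ln a <= ln b" using assms by simp
 thus ?thesis using le[of a b] assms False by (simp add: abs_minus_commute)
 qed
qed

text \<open>Two modes in one medium. Here \<open>k1\<close> and \<open>k2\<close> are the
  derivatives of the internal data \<open>mu * u1\<close> and \<open>mu * u2\<close>, not mode
  numbers; the frequencies enter as \<open>La1 < La2\<close>.\<close>

locale media =
 fixes H K La1 La2 :: real and D mu mu1 u1 g1 k1 u2 g2 k2 :: "real => real"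
 assumes H: "0 < H" and K: "1 <= K" and La1: "0 <= La1" and La12: "La1 < La2"
 and m1: "mode_data H K La1 D mu mu1 u1 g1 k1" and m2: "mode_data H K La2 D mu mu1 u2 g2 k2"
begin

lemma derivs:
 assumes "y : {0..H}"
 shows "(u1 hrd g1 y / D y) (at y within {0..H})" "(u2 hrd g2 y / D y) (at y within {0..H})"
 "(g1 hrd (mu y + La1 * D y) * u1 y) (at y within {0..H})"
 "(g2 hrd (mu y + La2 * D y) * u2 y) (at y within {0..H})"
 "((%y. mu y * u1 y) hrd k1 y) (at y within {0..H})"
 "((%y. mu y * u2 y) hrd k2 y) (at y within {0..H})"
 using m1 m2 assms unfolding mode_data_def by blast+

lemma D_continuous: "cts {0..H} D" using m1 unfolding mode_data_def by blast

lemma bounds: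
 assumes "y : {0..H}"
 shows "1 / K <= D y" "D y <= K" "1 / K <= mu y" "mu y <= K"
 "y / K <= u1 y" "u1 y <= K * y" "y / K <= u2 y" "u2 y <= K * y"
 "abs (g1 y) <= K" "abs (k1 y) <= K" "abs (g2 y) <= K" "abs (k2 y) <= K" "0 < D y" "0 < mu y" "0 <= u1 y" "0 <= u2 y"
proof -
 show b: "1 / K <= D y" "D y <= K" "1 / K <= mu y" "mu y <= K"
 "y / K <= u1 y" "u1 y <= K * y" "y / K <= u2 y" "u2 y <= K * y"
 "abs (g1 y) <= K" "abs (k1 y) <= K" "abs (g2 y) <= K" "abs (k2 y) <= K"
 using m1 m2 assms unfolding mode_data_def by blast+
 have "0 < 1 / K" "0 <= y / K" using K assms by auto
 thus "0 < D y" "0 < mu y" "0 <= u1 y" "0 <= u2 y" using b by linarith+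
qed

lemma u_pos:
 assumes "0 < y" "y <= H"
 shows "0 < u1 y" "0 < u2 y"
proof -
 have "0 < y / K" using assms K by simp
 thus "0 < u1 y" "0 < u2 y" using bounds(5,7)[of y] assms by auto
qed

lemma k_eq: "y : {0..H} ==> k1 y = mu1 y * u1 y + mu y * (g1 y / D y)" "y : {0..H} ==> k2 y = mu1 y * u2 y + mu y * (g2 y / D y)"
 and u_H: "u1 H = 1" "u2 H = 1"
 using m1 m2 unfolding mode_data_def by blast+

definition h1 where "h1 y = mu y * u1 y"
definition h2 where "h2 y = mu y * u2 y"
text \<open>
 \<open>J\<close> is the Wronskian of the two optical modes. Its logarithmic derivative and its value at \<open>H\<close>
 only involve the internal data \<open>h1\<close>, \<open>h2\<close>, and so does \<open>W\<close>; hence the data determine \<open>R\<close>.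
\<close>

definition J where "J y = u1 y * g2 y - u2 y * g1 y"
definition R where "R y = (mu y)^2 / D y"
definition W where "W y = h1 y * k2 y - h2 y * k1 y"
definition Q where "Q y = D y * (u1 y)^2"

lemma W_eq: "y : {0..H} ==> W y = R y * J y"
 using bounds(13)[of y] by (simp add: W_def h1_def h2_def k_eq R_def J_def power2_eq_square field_simps)

lemma h_bounds:
 assumes y: "y : {0..H}"
 shows "abs (h1 y) <= K^2 * y" "abs (h2 y) <= K^2 * y" "0 <= h1 y"
proof -
 have "mu y * u1 y <= K * (K * y)" "mu y * u2 y <= K * (K * y)"
 using bounds(4,6,8,14,15,16)[OF y] K by (rule_tac mult_mono; simp)+
 moreover have "0 <= mu y * u1 y" "0 <= mu y * u2 y" using bounds[OF y] by auto
 ultimately show "abs (h1 y) <= K^2 * y" "abs (h2 y) <= K^2 * y" "0 <= h1 y"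
 by (auto simp: h1_def h2_def power2_eq_square mult.assoc)
qed

lemma R_bounds:
 assumes y: "y : {0..H}"
 shows "1 / K^3 <= R y" "R y <= K^3" "0 < R y"
proof -
 have K': "0 <= 1 / K" using K by simp
 have "(1 / K)^2 <= (mu y)^2" "(mu y)^2 <= K^2"
 by (rule power_mono[OF bounds(3)[OF y] K'], rule power_mono[OF bounds(4)[OF y] less_imp_le[OF bounds(14)[OF y]]])
 hence "(1 / K)^2 / K <= R y" "R y <= K^2 / (1 / K)" unfolding R_def
 using bounds(1,2,13)[OF y] K by (rule_tac frac_le; simp)+
 thus "1 / K^3 <= R y" "R y <= K^3" by (simp_all add: power2_eq_square power3_eq_cube mult.assoc)
 show "0 < R y" using bounds[OF y] by (simp add: R_def)
qed

lemma Q_bounds: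
 assumes y: "y : {0..H}"
 shows "y^2 / K^3 <= Q y" "Q y <= K^3 * y^2"
proof -
 have yK: "0 <= y / K" using y K by simp
 have "(y / K)^2 <= (u1 y)^2" "(u1 y)^2 <= (K * y)^2"
 by (rule power_mono[OF bounds(5)[OF y] yK], rule power_mono[OF bounds(6)[OF y] bounds(15)[OF y]])
 hence "1 / K * (y / K)^2 <= Q y" "Q y <= K * (K * y)^2" unfolding Q_def
 using bounds(1,2,13)[OF y] K by (rule_tac mult_mono; simp)+
 thus "y^2 / K^3 <= Q y" "Q y <= K^3 * y^2" by (simp_all add: power2_eq_square power3_eq_cube mult_ac)
qed

lemma J_derivative:
 assumes y: "y : {0..H}"
 shows "(J hrd (La2 - La1) * (D y * (u1 y * u2 y))) (at y within {0..H})"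
proof -
 note d = derivs[OF y]
 have "(J hrd (g1 y / D y * g2 y + (mu y + La2 * D y) * u2 y * u1 y) - (g2 y / D y * g1 y + (mu y + La1 * D y) * u1 y * u2 y)) (at y within {0..H})"
 unfolding J_def[abs_def] by (intro DERIV_diff DERIV_mult d)
 moreover have "(g1 y / D y * g2 y + (mu y + La2 * D y) * u2 y * u1 y) - (g2 y / D y * g1 y + (mu y + La1 * D y) * u1 y * u2 y)
 = (La2 - La1) * (D y * (u1 y * u2 y))" by (simp add: algebra_simps)
 ultimately show ?thesis by simp
qed

text \<open>\<open>J\<close> vanishes at 0, and its derivative is at least a multiple of
  \<open>y^2\<close> because both modes are bounded below linearly. This cubic rate fixes all later
  powers of \<open>y\<close>.\<close>

lemma J_ge:
 assumes y: "y : {0..H}"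
 shows "(La2 - La1) * y^3 / (3 * K^3) <= J y"
proof -
 have z: "u1 0 = 0" "u2 0 = 0" using bounds[of 0] H by auto
 define c where "c = (La2 - La1) / (3 * K^3)"
 have "J 0 - c * 0^3 <= J y - c * y^3"
 proof (rule nondecreasing_if_deriv_nonneg[where f="%y. J y - c * y^3"
 and f'="%y. (La2 - La1) * (D y * (u1 y * u2 y)) - c * (3 * y^2)"])
 fix x assume x: "x : {0..y}"
 hence x': "x : {0..H}" using y by auto
 have "((%y. c * y^3) hrd c * (3 * x^2)) (at x within {0..y})"
 by (auto intro!: deqs)
 moreover have "(J hrd (La2 - La1) * (D x * (u1 x * u2 x))) (at x within {0..y})"
 by (rule DERIV_subset[OF J_derivative[OF x']]) (use y in auto)
 ultimately show "((%y. J y - c * y^3) has_real_derivative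
 (La2 - La1) * (D x * (u1 x * u2 x)) - c * (3 * x^2)) (at x within {0..y})"
 by (rule DERIV_diff[rotated])
 have nn: "0 <= x / K" "0 <= 1 / K" using K x by auto
 have "1 / K * (x / K * (x / K)) <= D x * (u1 x * u2 x)"
 by (rule mult_mono[OF bounds(1)[OF x'] mult_mono[OF bounds(5)[OF x'] bounds(7)[OF x'] bounds(15)[OF x'] nn(1)]])
 (use bounds(13)[OF x'] nn in simp_all)
 hence "(La2 - La1) * (1 / K * (x / K * (x / K))) <= (La2 - La1) * (D x * (u1 x * u2 x))"
 using La12 by (intro mult_left_mono) auto
 moreover have "c * (3 * x^2) = (La2 - La1) * (1 / K * (x / K * (x / K)))"
 by (simp add: c_def power2_eq_square power3_eq_cube)
 ultimately show "0 <= (La2 - La1) * (D x * (u1 x * u2 x)) - c * (3 * x^2)"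
 by linarith
 qed (use y in auto)
 thus ?thesis using z by (simp add: J_def c_def)
qed

lemma J_pos:
 assumes "0 < y" "y <= H"
 shows "0 < J y"
proof -
 have "0 < (La2 - La1) * y^3 / (3 * K^3)" using assms La12 K by simp
 thus ?thesis using J_ge[of y] assms by auto
qed

text \<open>The constant in the lower bound \<open>w * y^3\<close> for \<open>W\<close>: the lower
  bound \<open>1 / K^3\<close> of \<open>R\<close> times the constant of
  \<open>J_ge\<close>.\<close>

definition w where "w = (La2 - La1) / (3 * K^6)"

lemma w_pos: "0 < w" using La12 K by (simp add: w_def)

lemma W_ge:
 assumes y: "y : {0..H}"
 shows "w * y^3 <= W y"
proof -
 have "1 / K^3 * ((La2 - La1) * y^3 / (3 * K^3)) <= R y * J y"
 by (rule mult_mono[OF R_bounds(1)[OF y] J_ge[OF y]]) (use R_bounds(3)[OF y] La12 K y in simp_all)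
 moreover have "1 / K^3 * ((La2 - La1) * y^3 / (3 * K^3)) = w * y^3"
 by (simp add: w_def power_add[symmetric, of K 3 3])
 ultimately show ?thesis using W_eq[OF y] by simp
qed

lemma W_pos:
 assumes "0 < y" "y <= H"
 shows "0 < W y"
proof -
 have "0 < w * y^3" using assms w_pos by simp
 thus ?thesis using W_ge[of y] assms by auto
qed

lemma ln_J_derivative:
 assumes y: "0 < y" "y <= H"
 shows "((%y. ln (J y)) hrd (La2 - La1) * (h1 y * h2 y / W y)) (at y within {0..H})"
proof -
 have y': "y : {0..H}" using y by auto
 have "((%y. ln (J y)) hrd 1 / J y * ((La2 - La1) * (D y * (u1 y * u2 y)))) (at y within {0..H})"
 using DERIV_chain2[of ln "1 / J y" J y "(La2 - La1) * (D y * (u1 y * u2 y))" "{0..H}", OF _ J_derivative[OF y']] J_pos[OF y]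
 by (simp add: DERIV_ln_divide)
 moreover have "1 / J y * ((La2 - La1) * (D y * (u1 y * u2 y))) = (La2 - La1) * (h1 y * h2 y / W y)"
 unfolding W_eq[OF y'] using bounds(13,14)[OF y'] J_pos[OF y] by (simp add: h1_def h2_def R_def power2_eq_square)
 ultimately show ?thesis by simp
qed

text \<open>\<open>Q\<close> is the coefficient of the linear system for \<open>1 / u1\<close> and
  \<open>g1\<close>: \<open>(1 / u1)' = - g1 / Q\<close>, and \<open>D * u1 = Q * (1 / u1)\<close>
  in the equation of \<open>g1\<close>. The identity expresses it by \<open>h1\<close> and
  \<open>R\<close>.\<close>

lemma Q_eq: "y : {0..H} ==> Q y = (h1 y)^2 / R y"
 using bounds(13,14)[of y] by (simp add: Q_def h1_def R_def power_mult_distrib)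

lemma z_bounds: "0 < y ==> y <= H ==> 1 / u1 y <= K / y"
proof -
 assume y: "0 < y" "y <= H"
 have "y / K <= u1 y" "0 < y / K" using bounds(5)[of y] y K by auto
 hence "1 / u1 y <= 1 / (y / K)" by (intro frac_le) auto
 thus ?thesis by simp
qed

lemma z_derivative:
 assumes y: "0 < y" "y <= H"
 shows "((%y. 1 / u1 y) hrd - (g1 y / Q y)) (at y within {0..H})"
proof -
 have y': "y : {0..H}" using y by auto
 have u: "u1 y ~= 0" using u_pos[OF y] by simp
 have "((%y. 1 / u1 y) hrd (0 * u1 y - 1 * (g1 y / D y)) / (u1 y * u1 y)) (at y within {0..H})"
 by (rule DERIV_divide[OF DERIV_const derivs(1)[OF y'] u])
 thus ?thesis by (simp add: Q_def power2_eq_square)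
qed

end

section \<open>Comparison of two media\<close>

locale media_pair = A: media H K La1 La2 D mu mu1 u1 g1 k1 u2 g2 k2 + B: media H K La1 La2 D' mu' mu1' u1' g1' k1' u2' g2' k2'
 for H K La1 La2 :: real and D mu mu1 u1 g1 k1 u2 g2 k2 D' mu' mu1' u1' g1' k1' u2' g2' k2' :: "real => real" +
 fixes dl :: real
 assumes dl: "!!y. y : {0..H} ==> abs (k1 y - k1' y) <= dl" "!!y. y : {0..H} ==> abs (k2 y - k2' y) <= dl"
 and top: "D H = D' H" "mu1 H = mu1' H"
begin

lemmas HK = A.H A.K

lemma dl0: "0 <= dl" using dl(1)[of H] HK by auto

text \<open>\<open>dl\<close> bounds the differences of the derivatives and all data vanish at 0, so
  the differences of the data gain a factor \<open>y\<close>.\<close>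

lemma Deh:
 assumes y: "y : {0..H}"
 shows "abs (A.h1 y - B.h1 y) <= dl * y" "abs (A.h2 y - B.h2 y) <= dl * y"
proof -
 have z: "u1 0 = 0" "u2 0 = 0" "u1' 0 = 0" "u2' 0 = 0" using A.bounds(6,8,15,16)[of 0] B.bounds(6,8,15,16)[of 0] HK by auto
 have "abs ((A.h1 y - B.h1 y) - (A.h1 0 - B.h1 0)) <= dl * y - dl * 0"
 proof (rule abs_diff_le_if_deriv_le[where f="%y. A.h1 y - B.h1 y" and F="%y. dl * y" and f'="%y. k1 y - k1' y" and F'="%y. dl"])
 fix x assume x: "x : {0..y}"
 hence x': "x : {0..H}" using y by auto
 show "((%y. A.h1 y - B.h1 y) hrd k1 x - k1' x) (at x within {0..y})"
 unfolding A.h1_def B.h1_def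
 by (rule DERIV_subset[OF DERIV_diff[OF A.derivs(5)[OF x'] B.derivs(5)[OF x']]]) (use y in auto)
 show "((%y. dl * y) hrd dl) (at x within {0..y})" by (auto intro!: deqs)
 show "abs (k1 x - k1' x) <= dl" by (rule dl[OF x'])
 qed (use y in auto)
 thus "abs (A.h1 y - B.h1 y) <= dl * y" using z by (simp add: A.h1_def B.h1_def)
 have "abs ((A.h2 y - B.h2 y) - (A.h2 0 - B.h2 0)) <= dl * y - dl * 0"
 proof (rule abs_diff_le_if_deriv_le[where f="%y. A.h2 y - B.h2 y" and F="%y. dl * y" and f'="%y. k2 y - k2' y" and F'="%y. dl"])
 fix x assume x: "x : {0..y}"
 hence x': "x : {0..H}" using y by auto
 show "((%y. A.h2 y - B.h2 y) hrd k2 x - k2' x) (at x within {0..y})"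
 unfolding A.h2_def B.h2_def
 by (rule DERIV_subset[OF DERIV_diff[OF A.derivs(6)[OF x'] B.derivs(6)[OF x']]]) (use y in auto)
 show "((%y. dl * y) hrd dl) (at x within {0..y})" by (auto intro!: deqs)
 show "abs (k2 x - k2' x) <= dl" by (rule dl[OF x'])
 qed (use y in auto)
 thus "abs (A.h2 y - B.h2 y) <= dl * y" using z by (simp add: A.h2_def B.h2_def)
qed

lemma KK: "K <= K^2" using HK self_le_power[of K 2] by simp

lemma DeW:
 assumes y: "y : {0..H}"
 shows "abs (A.W y - B.W y) <= 4 * K^2 * (dl * y)"
proof -
 have Ky: "dl * y * K <= dl * y * K^2" using KK dl0 y by (intro mult_left_mono) auto
 have "abs (A.h1 y * k2 y - B.h1 y * k2' y) <= dl * y * K + K^2 * y * dl"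
 by (rule abs_mult_diff_bound[OF Deh(1)[OF y] A.bounds(12)[OF y] B.h_bounds(1)[OF y] dl(2)[OF y]])
 moreover have "abs (A.h2 y * k1 y - B.h2 y * k1' y) <= dl * y * K + K^2 * y * dl"
 by (rule abs_mult_diff_bound[OF Deh(2)[OF y] A.bounds(10)[OF y] B.h_bounds(2)[OF y] dl(1)[OF y]])
 ultimately have "abs (A.W y - B.W y) <= 2 * (dl * y * K + K^2 * y * dl)" unfolding A.W_def B.W_def by (rule abs_diff_diff_le)
 also have "... <= 2 * (dl * y * K^2 + K^2 * y * dl)" using Ky by simp
 finally show ?thesis by (simp add: mult_ac)
qed

definition cF where "cF = (La2 - La1) * (2 * K^2 * H^2 / A.w + 4 * K^6 / A.w^2)"

text \<open>The two sides are the logarithmic derivatives of the two Wronskians. With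
  \<open>W\<close> of size at least \<open>y^3\<close>, a change of \<open>W\<close> by
  \<open>dl * y\<close> and \<open>h1 * h2\<close> of order \<open>y^2\<close>, the worst term has
  the power \<open>y^-3\<close>.\<close>

lemma DeF:
 assumes y: "0 < y" "y <= H"
 shows "abs ((La2 - La1) * (A.h1 y * A.h2 y / A.W y) - (La2 - La1) * (B.h1 y * B.h2 y / B.W y)) <= cF * dl / y^3"
proof -
 have y': "y : {0..H}" using y by auto
 note w = A.w_pos
 have W: "A.w * y^3 <= A.W y" "A.w * y^3 <= B.W y" using A.W_ge[OF y'] B.W_ge[OF y'] by auto
 have w3: "0 < A.w * y^3" using w y by simp
 have hh: "abs (A.h1 y * A.h2 y - B.h1 y * B.h2 y) <= dl * y * (K^2 * y) + K^2 * y * (dl * y)"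
 by (rule abs_mult_diff_bound[OF Deh(1)[OF y'] A.h_bounds(2)[OF y'] B.h_bounds(1)[OF y'] Deh(2)[OF y']])
 have h2: "abs (B.h1 y * B.h2 y) <= K^2 * y * (K^2 * y)"
 unfolding abs_mult by (rule mult_mono[OF B.h_bounds(1,2)[OF y']]) (use y in simp_all)
 have "abs (A.h1 y * A.h2 y / A.W y - B.h1 y * B.h2 y / B.W y) \<le>
 abs (A.h1 y * A.h2 y - B.h1 y * B.h2 y) / A.W y + abs (B.h1 y * B.h2 y) * abs (A.W y - B.W y) / (A.W y * B.W y)"
 by (rule abs_divide_diff_le) (use W w3 in auto)
 also have "... <= (dl * y * (K^2 * y) + K^2 * y * (dl * y)) / (A.w * y^3) +
 (K^2 * y * (K^2 * y)) * (4 * K^2 * (dl * y)) / (A.w * y^3 * (A.w * y^3))"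
 by (intro add_mono frac_le mult_mono hh h2 DeW y' W) (use w3 W y dl0 in \<open>auto intro!: mult_nonneg_nonneg add_nonneg_nonneg\<close>)
 also have "... = (2 * K^2 * y^2 / A.w + 4 * K^6 / A.w^2) * dl / y^3"
 using y w by (simp add: field_simps power2_eq_square eval_nat_numeral)
 also have "... <= (2 * K^2 * H^2 / A.w + 4 * K^6 / A.w^2) * dl / y^3"
 using y w dl0 by (intro divide_right_mono mult_right_mono add_right_mono mult_left_mono power_mono) auto
 finally have "(La2 - La1) * abs (A.h1 y * A.h2 y / A.W y - B.h1 y * B.h2 y / B.W y) \<le>
 (La2 - La1) * ((2 * K^2 * H^2 / A.w + 4 * K^6 / A.w^2) * dl / y^3)" using A.La12 by (intro mult_left_mono) auto
 thus ?thesis using A.La12 unfolding right_diff_distrib[symmetric] abs_mult cF_def by (simp add: mult.assoc)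
qed

lemma cF_nonneg: "0 <= cF" using A.La12 A.w_pos by (auto simp: cF_def intro!: mult_nonneg_nonneg add_nonneg_nonneg)

lemma DelnW:
 assumes y: "0 < y" "y <= H"
 shows "abs (ln (A.W y) - ln (B.W y)) <= 4 * K^2 / A.w * dl / y^2"
proof -
 have y': "y : {0..H}" using y by auto
 have w3: "0 < A.w * y^3" using A.w_pos y by simp
 have "abs (ln (A.W y) - ln (B.W y)) <= abs (A.W y - B.W y) / (A.w * y^3)"
 by (rule abs_ln_diff_le[OF w3]) (use A.W_ge[OF y'] B.W_ge[OF y'] in auto)
 also have "... <= 4 * K^2 * (dl * y) / (A.w * y^3)" using DeW[OF y'] w3 by (intro divide_right_mono) auto
 also have "... = 4 * K^2 / A.w * dl / y^2" using y A.w_pos by (simp add: field_simps power2_eq_square power3_eq_cube)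
 finally show ?thesis .
qed

definition cJ where "cJ = 4 * K^2 / A.w + 2 * K * H^3"

text \<open>At the top \<open>u1\<close> is 1, so \<open>h1 H\<close> is \<open>mu H\<close>, and
  \<open>D H\<close> is common to both media; \<open>W = R * J\<close> then expresses
  \<open>J H\<close> by data.\<close>

lemma DelnJ_top: "abs (ln (A.J H) - ln (B.J H)) <= cJ * dl / H^2"
proof -
 have H': "H : {0..H}" using HK by auto
 have HH: "0 < H" "H <= H" using HK by auto
 have eqA: "A.J H = A.W H * D H / (A.h1 H)^2" using A.W_eq[OF H'] A.bounds(13,14)[OF H']
 by (simp add: A.R_def A.h1_def A.u_H power2_eq_square)
 have eqB: "B.J H = B.W H * D H / (B.h1 H)^2" using B.W_eq[OF H'] B.bounds(13,14)[OF H']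
 by (simp add: B.R_def B.h1_def B.u_H power2_eq_square top)
 have p: "1 / K <= A.h1 H" "1 / K <= B.h1 H" "0 < A.h1 H" "0 < B.h1 H"
 using A.bounds(3,14)[OF H'] B.bounds(3,14)[OF H'] by (auto simp: A.h1_def B.h1_def A.u_H B.u_H)
 have Dp: "0 < D H" using A.bounds(13)[OF H'] .
 have tri: "abs a <= p + 2 * q" if "a = b - 2 * c" "abs b <= p" "abs c <= q" for a b c p q :: real using that by linarith
 have "ln (A.J H) - ln (B.J H) = (ln (A.W H) - ln (B.W H)) - 2 * (ln (A.h1 H) - ln (B.h1 H))"
 unfolding eqA eqB using p Dp A.W_pos[OF HH] B.W_pos[OF HH] by (simp add: ln_div ln_mult ln_realpow algebra_simps)
 moreover have "abs (ln (A.h1 H) - ln (B.h1 H)) <= K * H * dl"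
 proof -
 have "abs (ln (A.h1 H) - ln (B.h1 H)) <= abs (A.h1 H - B.h1 H) / (1 / K)"
 by (rule abs_ln_diff_le) (use p HK in auto)
 also have "... <= (dl * H) / (1 / K)" using Deh[OF H'] HK by (intro divide_right_mono) auto
 finally show ?thesis by (simp add: mult_ac)
 qed
 ultimately have "abs (ln (A.J H) - ln (B.J H)) <= 4 * K^2 / A.w * dl / H^2 + 2 * (K * H * dl)"
 using tri[OF _ DelnW[OF HH]] by blast
 also have "... = cJ * dl / H^2" using HK by (simp add: cJ_def field_simps power2_eq_square power3_eq_cube)
 finally show ?thesis .
qed

text \<open>Integrating the \<open>y^-3\<close> bound from the top downwards gives
  \<open>y^-2\<close>, which also dominates the error at \<open>H\<close>.\<close>

lemma DelnJ:
 assumes y: "0 < y" "y <= H"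
 shows "abs (ln (A.J y) - ln (B.J y)) <= (cJ + cF) * dl / y^2"
proof -
 have tri: "abs b <= j + f" if "abs (a - b) <= p - q" "p <= 0" "- q <= f" "i <= j" "abs a <= i" for a b f i j p q :: real using that by linarith
 have cJ0: "0 <= cJ" using HK A.w_pos by (auto simp: cJ_def)
 have "abs ((ln (A.J H) - ln (B.J H)) - (ln (A.J y) - ln (B.J y))) <= - (cF * dl / 2) / H^2 - - (cF * dl / 2) / y^2"
 proof (rule abs_diff_le_if_deriv_le[where f="%y. ln (A.J y) - ln (B.J y)" and F="%y. - (cF * dl / 2) / y^2"
 and f'="%y. (La2 - La1) * (A.h1 y * A.h2 y / A.W y) - (La2 - La1) * (B.h1 y * B.h2 y / B.W y)" and F'="%y. cF * dl / y^3"])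
 fix x assume x: "x : {y..H}"
 hence x': "0 < x" "x <= H" using y by auto
 show "((%y. ln (A.J y) - ln (B.J y)) has_real_derivative
 (La2 - La1) * (A.h1 x * A.h2 x / A.W x) - (La2 - La1) * (B.h1 x * B.h2 x / B.W x)) (at x within {y..H})"
 by (rule DERIV_subset[OF DERIV_diff[OF A.ln_J_derivative[OF x'] B.ln_J_derivative[OF x']]]) (use y in auto)
 show "((%y. - (cF * dl / 2) / y^2) hrd cF * dl / x^3) (at x within {y..H})"
 using x' by (auto intro!: deqs simp: field_simps power2_eq_square power3_eq_cube)
 show "abs ((La2 - La1) * (A.h1 x * A.h2 x / A.W x) - (La2 - La1) * (B.h1 x * B.h2 x / B.W x)) <= cF * dl / x^3"
 by (rule DeF[OF x'])
 qed (use y in auto)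
 moreover have "- (cF * dl / 2) / H^2 <= 0" using cF_nonneg dl0 by simp
 moreover have "- (- (cF * dl / 2) / y^2) <= cF * dl / y^2"
 unfolding minus_divide_left minus_minus using cF_nonneg dl0 by (intro divide_right_mono) auto
 moreover have "cJ * dl / H^2 <= cJ * dl / y^2" using cJ0 dl0 y by (intro divide_left_mono power_mono mult_nonneg_nonneg) auto
 ultimately have "abs (ln (A.J y) - ln (B.J y)) <= cJ * dl / y^2 + cF * dl / y^2" using DelnJ_top tri by blast
 thus ?thesis by (simp add: algebra_simps add_divide_distrib)
qed

definition cR where "cR = K^3 * (4 * K^2 / A.w + (cJ + cF))"

lemma DeR:
 assumes y: "0 < y" "y <= H"
 shows "abs (A.R y - B.R y) <= cR * dl / y^2"
proof -
 have y': "y : {0..H}" using y by auto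
 have eq: "ln (A.R y) = ln (A.W y) - ln (A.J y)" "ln (B.R y) = ln (B.W y) - ln (B.J y)"
 using A.W_eq[OF y'] B.W_eq[OF y'] A.J_pos[OF y] B.J_pos[OF y] A.R_bounds(3)[OF y'] B.R_bounds(3)[OF y'] by (simp_all add: ln_mult)
 have "abs (A.R y - B.R y) <= K^3 * abs (ln (A.R y) - ln (B.R y))"
 by (rule abs_diff_le_ln) (use A.R_bounds[OF y'] B.R_bounds[OF y'] in auto)
 also have "abs (ln (A.R y) - ln (B.R y)) <= 4 * K^2 / A.w * dl / y^2 + (cJ + cF) * dl / y^2"
 unfolding eq using DelnW[OF y] DelnJ[OF y] by linarith
 finally have "abs (A.R y - B.R y) <= K^3 * (4 * K^2 / A.w * dl / y^2 + (cJ + cF) * dl / y^2)" using HK by simp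
 also have "... = cR * dl / y^2" by (simp add: cR_def algebra_simps add_divide_distrib)
 finally show ?thesis .
qed

lemma cR_nonneg: "0 <= cR"
 using HK A.w_pos cF_nonneg by (auto simp: cR_def cJ_def intro!: mult_nonneg_nonneg add_nonneg_nonneg)

definition cQ where "cQ = 2 * K^5 * H^2 + K^10 * cR"

text \<open>In \<open>Q = h1^2 / R\<close> the factor \<open>h1^2\<close> of order
  \<open>y^2\<close> compensates the loss \<open>y^-2\<close> of \<open>R\<close>, so the
  coefficient of the linear system is controlled uniformly up to 0.\<close>

lemma DeQ:
 assumes y: "0 < y" "y <= H"
 shows "abs (A.Q y - B.Q y) <= cQ * dl"
proof -
 have y': "y : {0..H}" using y by auto
 have K0: "0 < K" using HK by simp
 have RA: "0 < 1 / K^3" "1 / K^3 <= A.R y" "1 / K^3 <= B.R y" using K0 A.R_bounds(1)[OF y'] B.R_bounds(1)[OF y'] by auto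
 have Rp: "0 < A.R y" "0 < B.R y" using A.R_bounds(3)[OF y'] B.R_bounds(3)[OF y'] by auto
 have sq: "abs ((A.h1 y)^2 - (B.h1 y)^2) <= dl * y * (K^2 * y) + K^2 * y * (dl * y)"
 unfolding power2_eq_square[of "A.h1 y"] power2_eq_square[of "B.h1 y"]
 by (rule abs_mult_diff_bound[OF Deh(1)[OF y'] A.h_bounds(1)[OF y'] B.h_bounds(1)[OF y'] Deh(1)[OF y']])
 have h2: "abs ((B.h1 y)^2) <= (K^2 * y)^2"
 using power_mono[OF B.h_bounds(1)[OF y'] abs_ge_zero, of 2] by simp
 have nn: "0 <= dl * y * (K^2 * y) + K^2 * y * (dl * y)" "0 <= (K^2 * y)^2 * (cR * dl / y^2)"
 using dl0 y cR_nonneg by (auto intro!: add_nonneg_nonneg mult_nonneg_nonneg)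
 have RR: "1 / K^3 * (1 / K^3) <= A.R y * B.R y" by (rule mult_mono[OF RA(2,3)]) (use RA Rp in simp_all)
 have "abs (A.Q y - B.Q y) <= abs ((A.h1 y)^2 - (B.h1 y)^2) / A.R y + abs ((B.h1 y)^2) * abs (A.R y - B.R y) / (A.R y * B.R y)"
 unfolding A.Q_eq[OF y'] B.Q_eq[OF y'] by (rule abs_divide_diff_le[OF Rp])
 also have "... <= (dl * y * (K^2 * y) + K^2 * y * (dl * y)) / (1 / K^3) + (K^2 * y)^2 * (cR * dl / y^2) / (1 / K^3 * (1 / K^3))"
 proof (rule add_mono)
 show "abs ((A.h1 y)^2 - (B.h1 y)^2) / A.R y <= (dl * y * (K^2 * y) + K^2 * y * (dl * y)) / (1 / K^3)"
 by (rule frac_le[OF nn(1) sq RA(1,2)])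
 have "abs ((B.h1 y)^2) * abs (A.R y - B.R y) <= (K^2 * y)^2 * (cR * dl / y^2)"
 by (rule mult_mono[OF h2 DeR[OF y]]) simp_all
 thus "abs ((B.h1 y)^2) * abs (A.R y - B.R y) / (A.R y * B.R y) <= (K^2 * y)^2 * (cR * dl / y^2) / (1 / K^3 * (1 / K^3))"
 by (rule frac_le[OF nn(2) _ _ RR]) (use RA in simp)
 qed
 also have "... = (2 * K^5 * y^2 + K^10 * cR) * dl"
 using y by (simp add: field_simps power2_eq_square eval_nat_numeral)
 also have "... <= cQ * dl"
 unfolding cQ_def using y K0 dl0 by (intro mult_right_mono add_right_mono mult_left_mono power_mono) auto
 finally show ?thesis .
qed

lemma cQ_nonneg: "0 <= cQ" using HK cR_nonneg by (auto simp: cQ_def)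

definition c3 where "c3 = K^2 + K^6 * H"

text \<open>At the top \<open>k1 H = mu1 H + h1 H * g1 H / D H\<close>, so the flux there is
  determined by the data together with \<open>D H\<close> and \<open>mu1 H\<close>, which the media
  share.\<close>

lemma Deg_top: "abs (g1 H - g1' H) <= c3 * dl"
proof -
 have H': "H : {0..H}" using HK by auto
 have K0: "0 < K" using HK by simp
 have hp: "1 / K <= A.h1 H" "1 / K <= B.h1 H" "0 < 1 / K"
 using A.bounds(3)[OF H'] B.bounds(3)[OF H'] K0 by (auto simp: A.h1_def B.h1_def A.u_H B.u_H)
 have hp': "0 < A.h1 H" "0 < B.h1 H" using hp by linarith+
 have eqA: "g1 H = D H * ((k1 H - mu1 H) / A.h1 H)" using A.k_eq(1)[OF H'] A.bounds(13,14)[OF H']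
 by (simp add: A.h1_def A.u_H)
 have eqB: "g1' H = D H * ((k1' H - mu1 H) / B.h1 H)" using B.k_eq(1)[OF H'] B.bounds(13,14)[OF H']
 by (simp add: B.h1_def B.u_H top)
 have b3: "abs (k1' H - mu1 H) <= K * (K / (1 / K))"
 proof -
 have "k1' H - mu1 H = mu' H * (g1' H / D' H)" using B.k_eq(1)[OF H'] by (simp add: B.u_H top)
 moreover have "abs (g1' H / D' H) <= K / (1 / K)"
 proof -
 have "abs (g1' H) / abs (D' H) <= K / (1 / K)"
 by (rule frac_le) (use B.bounds(1,9,13)[OF H'] K0 in simp_all)
 thus ?thesis by simp
 qed
 moreover have "abs (mu' H) <= K" using B.bounds(4,14)[OF H'] by simp
 ultimately show ?thesis unfolding abs_mult using K0 by (simp only: abs_mult) (rule mult_mono, simp_all)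
 qed
 have "abs ((k1 H - mu1 H) / A.h1 H - (k1' H - mu1 H) / B.h1 H) \<le>
 abs ((k1 H - mu1 H) - (k1' H - mu1 H)) / A.h1 H + abs (k1' H - mu1 H) * abs (A.h1 H - B.h1 H) / (A.h1 H * B.h1 H)"
 by (rule abs_divide_diff_le[OF hp'])
 also have "... <= dl / (1 / K) + (K * (K / (1 / K))) * (dl * H) / (1 / K * (1 / K))"
 proof (rule add_mono)
 show "abs ((k1 H - mu1 H) - (k1' H - mu1 H)) / A.h1 H <= dl / (1 / K)"
 by (rule frac_le) (use dl(1)[OF H'] dl0 hp in simp_all)
 have "abs (k1' H - mu1 H) * abs (A.h1 H - B.h1 H) <= (K * (K / (1 / K))) * (dl * H)"
 by (rule mult_mono[OF b3 Deh(1)[OF H']]) (use K0 in simp_all)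
 moreover have "1 / K * (1 / K) <= A.h1 H * B.h1 H" by (rule mult_mono[OF hp(1,2)]) (use hp hp' in simp_all)
 ultimately show "abs (k1' H - mu1 H) * abs (A.h1 H - B.h1 H) / (A.h1 H * B.h1 H) <= (K * (K / (1 / K))) * (dl * H) / (1 / K * (1 / K))"
 by (intro frac_le) (use K0 dl0 HK in simp_all)
 qed
 also have "... = (K + K^5 * H) * dl" using K0 by (simp add: field_simps eval_nat_numeral)
 finally have le: "abs ((k1 H - mu1 H) / A.h1 H - (k1' H - mu1 H) / B.h1 H) <= (K + K^5 * H) * dl" .
 have "abs (g1 H - g1' H) = D H * abs ((k1 H - mu1 H) / A.h1 H - (k1' H - mu1 H) / B.h1 H)"
 unfolding eqA eqB right_diff_distrib[symmetric] abs_mult using A.bounds(13)[OF H'] by simp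
 also have "... <= K * ((K + K^5 * H) * dl)"
 by (rule mult_mono[OF A.bounds(2)[OF H'] le]) (use K0 in simp_all)
 finally show ?thesis by (simp add: c3_def algebra_simps eval_nat_numeral)
qed

text \<open>
 The difference of \<open>1 / u1\<close> blows up at \<open>0\<close> and is therefore weighted by \<open>Q\<close>, which is of size \<open>y^2\<close>.
\<close>

definition S where "S y = A.Q y * abs (1 / u1 y - 1 / u1' y) + abs (g1 y - g1' y)"

definition c1 where "c1 = K^10 * cQ"
definition c2 where "c2 = H^3 + La1 * (K * H * cQ)"
definition cS where "cS = (c1 + (c3 * H + c2)) * exp ((K^6 + La1) * H)"

lemma c_nonneg: "0 <= c1" "0 <= c2" "0 <= c3" "0 <= cS"
proof -
 show "0 <= c1" "0 <= c2" "0 <= c3" using HK cQ_nonneg A.La1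
 by (auto simp: c1_def c2_def c3_def intro!: add_nonneg_nonneg mult_nonneg_nonneg)
 thus "0 <= cS" unfolding cS_def using HK by (auto intro!: add_nonneg_nonneg mult_nonneg_nonneg)
qed

lemma S_parts: "y : {0..H} ==> A.Q y * abs (1 / u1 y - 1 / u1' y) <= S y" "y : {0..H} ==> abs (g1 y - g1' y) <= S y" "y : {0..H} ==> 0 <= S y"
 using A.bounds(13)[of y] by (auto simp: S_def A.Q_def)

lemma S_continuous: "0 < a ==> cts {a..H} S"
proof -
 assume a: "0 < a"
 have sub: "cts {a..H} f" if "!!y. y : {0..H} ==> (f hrd f' y) (at y within {0..H})" for f f'
 by (rule cont_sub[OF DERIV_continuous_on[OF that]]) (use a in auto)
 have "cts {a..H} (%y. g1 y - g1' y)"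
 by (intro continuous_on_diff sub[OF A.derivs(3)] sub[OF B.derivs(3)])
 moreover have z: "cts {a..H} (%y. 1 / u1 y - 1 / u1' y)"
 proof (intro continuous_on_diff continuous_on_divide continuous_on_const)
 show "cts {a..H} u1" "cts {a..H} u1'" by (rule sub[OF A.derivs(1)], simp, rule sub[OF B.derivs(1)], simp)
 show "ALL x:{a..H}. u1 x ~= 0"
 proof
 fix x assume "x : {a..H}"
 thus "u1 x ~= 0" using A.u_pos(1)[of x] a by auto
 qed
 show "ALL x:{a..H}. u1' x ~= 0"
 proof
 fix x assume "x : {a..H}"
 thus "u1' x ~= 0" using B.u_pos(1)[of x] a by auto
 qed
 qed
 moreover have "cts {a..H} A.Q" unfolding A.Q_def[abs_def]
 by (intro continuous_on_mult continuous_on_power sub[OF A.derivs(1)] cont_sub[OF A.D_continuous]) (use a in auto)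
 ultimately show ?thesis unfolding S_def[abs_def] by (intro continuous_on_add continuous_on_mult continuous_on_rabs)
qed

text \<open>\<open>Q\<close> is comparable to \<open>y^2\<close>, so \<open>Q y <= K^6 * Q s\<close>
  for \<open>y <= s\<close>: the weight can be frozen at the lower end \<open>y\<close> of the range
  of integration.\<close>

lemma Dez_derivative_le:
 assumes s: "0 < s" "s <= H" and y: "0 < y" "y <= s"
 shows "abs (g1 s / A.Q s - g1' s / B.Q s) <= (K^6 * S s + c1 * dl / s^2) / A.Q y"
proof -
 have s': "s : {0..H}" and y': "y : {0..H}" using s y by auto
 have K0: "0 < K" using HK by simp
 have Qp: "0 < A.Q s" "0 < B.Q s" "0 < A.Q y"
 using A.bounds(13)[OF s'] B.bounds(13)[OF s'] A.bounds(13)[OF y'] A.u_pos(1)[OF s] B.u_pos(1)[OF s] A.u_pos(1)[of y] y s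
 by (auto simp: A.Q_def B.Q_def)
 have QQ: "A.Q y <= K^6 * A.Q s"
 proof -
 have "A.Q y <= K^3 * y^2" by (rule A.Q_bounds(2)[OF y'])
 also have "... <= K^3 * s^2" using K0 y by (intro mult_left_mono power_mono) auto
 also have "... = K^6 * (s^2 / K^3)" using K0 by (simp add: field_simps eval_nat_numeral)
 also have "... <= K^6 * A.Q s" using A.Q_bounds(1)[OF s'] K0 by (intro mult_left_mono) auto
 finally show ?thesis .
 qed
 have s2: "0 < s^2 / K^3" using s K0 by simp
 have t: "abs (g1' s) * abs (A.Q s - B.Q s) / B.Q s <= K * (cQ * dl) / (s^2 / K^3)"
 by (rule frac_le[OF _ mult_mono[OF B.bounds(9)[OF s'] DeQ[OF s]] s2 B.Q_bounds(1)[OF s']]) (use K0 cQ_nonneg dl0 in simp_all)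
 have "abs (g1 s / A.Q s - g1' s / B.Q s) <= abs (g1 s - g1' s) / A.Q s + abs (g1' s) * abs (A.Q s - B.Q s) / (A.Q s * B.Q s)"
 by (rule abs_divide_diff_le[OF Qp(1,2)])
 also have "... = (abs (g1 s - g1' s) + abs (g1' s) * abs (A.Q s - B.Q s) / B.Q s) / A.Q s"
 using Qp by (simp add: add_divide_distrib)
 also have "... <= (S s + K * (cQ * dl) / (s^2 / K^3)) / A.Q s"
 by (rule divide_right_mono[OF add_mono[OF S_parts(2)[OF s'] t] less_imp_le[OF Qp(1)]])
 also have "... = (K^6 * (S s + K * (cQ * dl) / (s^2 / K^3))) / (K^6 * A.Q s)" using K0 by simp
 also have "... <= (K^6 * (S s + K * (cQ * dl) / (s^2 / K^3))) / A.Q y"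
 by (rule divide_left_mono[OF QQ]) (use Qp K0 S_parts(3)[OF s'] cQ_nonneg dl0 in \<open>auto intro!: mult_nonneg_nonneg add_nonneg_nonneg\<close>)
 also have "K^6 * (S s + K * (cQ * dl) / (s^2 / K^3)) = K^6 * S s + c1 * dl / s^2"
 using K0 s by (simp add: c1_def field_simps eval_nat_numeral)
 finally show ?thesis .
qed

text \<open>\<open>D * u1 = Q * (1 / u1)\<close> writes the difference through quantities already
  under control. The change of \<open>Q\<close> is multiplied by \<open>1 / u1'\<close>, of order
  \<open>1 / s\<close>; this is weakened to \<open>s^-2\<close> to match the source in the other
  equation.\<close>

lemma Deg_derivative_le:
 assumes s: "0 < s" "s <= H"
 shows "abs ((mu s + La1 * D s) * u1 s - (mu' s + La1 * D' s) * u1' s) <= La1 * S s + c2 * dl / s^2"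
proof -
 have s': "s : {0..H}" using s by auto
 have K0: "0 < K" using HK by simp
 have up: "0 < u1 s" "0 < u1' s" using A.u_pos(1)[OF s] B.u_pos(1)[OF s] by auto
 have "D s * u1 s - D' s * u1' s = A.Q s * (1 / u1 s) - B.Q s * (1 / u1' s)"
 using up by (simp add: A.Q_def B.Q_def power2_eq_square)
 also have "... = A.Q s * (1 / u1 s - 1 / u1' s) + (A.Q s - B.Q s) * (1 / u1' s)" by (simp add: algebra_simps)
 finally have eq: "D s * u1 s - D' s * u1' s = A.Q s * (1 / u1 s - 1 / u1' s) + (A.Q s - B.Q s) * (1 / u1' s)" .
 have Qn: "0 <= A.Q s" using A.bounds(13)[OF s'] by (simp add: A.Q_def)
 have a: "abs (A.Q s * (1 / u1 s - 1 / u1' s)) <= S s" using S_parts(1)[OF s'] Qn by (simp add: abs_mult)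
 have b: "abs ((A.Q s - B.Q s) * (1 / u1' s)) <= cQ * dl * (K / s)"
 unfolding abs_mult by (rule mult_mono[OF DeQ[OF s]]) (use B.z_bounds[OF s] up cQ_nonneg dl0 in simp_all)
 have "abs (D s * u1 s - D' s * u1' s) <= S s + cQ * dl * (K / s)" unfolding eq using a b by (rule order_trans[OF abs_triangle_ineq add_mono])
 hence "La1 * abs (D s * u1 s - D' s * u1' s) <= La1 * (S s + cQ * dl * (K / s))" using A.La1 by (rule mult_left_mono)
 moreover have "abs (A.h1 s - B.h1 s) <= dl * s" by (rule Deh(1)[OF s'])
 moreover have "(mu s + La1 * D s) * u1 s - (mu' s + La1 * D' s) * u1' s = (A.h1 s - B.h1 s) + La1 * (D s * u1 s - D' s * u1' s)"
 by (simp add: A.h1_def B.h1_def algebra_simps)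
 moreover have "abs ((A.h1 s - B.h1 s) + La1 * (D s * u1 s - D' s * u1' s)) <= abs (A.h1 s - B.h1 s) + La1 * abs (D s * u1 s - D' s * u1' s)"
 using abs_triangle_ineq[of "A.h1 s - B.h1 s" "La1 * (D s * u1 s - D' s * u1' s)"] A.La1 by (simp add: abs_mult)
 ultimately have "abs ((mu s + La1 * D s) * u1 s - (mu' s + La1 * D' s) * u1' s) <= dl * s + La1 * (S s + cQ * dl * (K / s))" by linarith
 also have "... = La1 * S s + (s^3 + La1 * (K * s * cQ)) * dl / s^2"
 using s by (simp add: field_simps eval_nat_numeral)
 also have "... <= La1 * S s + c2 * dl / s^2"
 unfolding c2_def using s K0 cQ_nonneg dl0 A.La1
 by (intro add_left_mono divide_right_mono mult_right_mono add_mono mult_left_mono power_mono) auto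
 finally show ?thesis .
qed

text \<open>Both equations are integrated from \<open>H\<close>, where \<open>1 / u1\<close> equals
  1 in both media and \<open>Deg_top\<close> bounds the flux difference. The sources of order
  \<open>s^-2\<close> integrate to at most \<open>1 / y0\<close>, and Gronwall closes the estimate
  on \<open>[y0,H]\<close>.\<close>

lemma S_bound:
 assumes y0: "0 < y0" "y0 <= H"
 shows "S y0 <= cS * dl / y0"
proof -
 have K0: "0 < K" using HK by simp
 define P where "P y = integral {y0..y} S" for y
 note cont = S_continuous[OF y0(1)]
 have dP: "(P hrd S s) (at s within {y0..H})" if "s : {y0..H}" for s
 unfolding P_def using integral_has_real_derivative[OF cont that] .
 have PH: "P H - P y = integral {y..H} S" if "y : {y0..H}" for y
 unfolding P_def using hk_integral_combine[of y0 y H S] that int_cont[OF cont] by simp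
 have le: "S y <= (c1 + (c3 * H + c2)) * dl / y0 + (K^6 + La1) * integral {y..H} S" if y: "y : {y0..H}" for y
 proof -
 have y': "0 < y" "y <= H" "y : {0..H}" using y y0 by auto
 have H': "H : {0..H}" using HK by auto
 have Qp: "0 < A.Q y" using A.bounds(13)[OF y'(3)] A.u_pos(1)[OF y'(1,2)] by (simp add: A.Q_def)
 have sub: "(f hrd d) (at s within {y..H})" if "(f hrd d) (at s within T)" "{y..H} <= T" for f d s T
 by (rule DERIV_subset[OF that])
 have inv: "((%s. - (c / s)) hrd c / s^2) (at s within {y..H})" if "0 < s" for c s
 using that by (auto intro!: deqs simp: power2_eq_square)
 have yy: "1 / y - 1 / H <= 1 / y0"
 proof -
 have "1 / y <= 1 / y0" using y y0 by (auto intro!: divide_left_mono)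
 moreover have "0 <= 1 / H" using HK by simp
 ultimately show ?thesis by linarith
 qed
 have z: "abs ((1 / u1 H - 1 / u1' H) - (1 / u1 y - 1 / u1' y)) \<le>
 (K^6 * P H + - (c1 * dl / H)) / A.Q y - (K^6 * P y + - (c1 * dl / y)) / A.Q y"
 proof (rule abs_diff_le_if_deriv_le[where f="%s. 1 / u1 s - 1 / u1' s" and F="%s. (K^6 * P s + - (c1 * dl / s)) / A.Q y"
 and f'="%s. - (g1 s / A.Q s) - - (g1' s / B.Q s)" and F'="%s. (K^6 * S s + c1 * dl / s^2) / A.Q y"])
 fix s assume s: "s : {y..H}"
 hence s': "0 < s" "s <= H" using y' by auto
 show "((%s. 1 / u1 s - 1 / u1' s) hrd - (g1 s / A.Q s) - - (g1' s / B.Q s)) (at s within {y..H})"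
 by (rule sub[OF DERIV_diff[OF A.z_derivative[OF s'] B.z_derivative[OF s']]]) (use y' in auto)
 show "((%s. (K^6 * P s + - (c1 * dl / s)) / A.Q y) hrd (K^6 * S s + c1 * dl / s^2) / A.Q y) (at s within {y..H})"
 by (intro DERIV_cdivide DERIV_add DERIV_cmult inv s' sub[OF dP]) (use s y in auto)
 have "abs (g1 s / A.Q s - g1' s / B.Q s) <= (K^6 * S s + c1 * dl / s^2) / A.Q y"
 by (rule Dez_derivative_le[OF s' y'(1)]) (use s in simp)
 thus "abs (- (g1 s / A.Q s) - - (g1' s / B.Q s)) <= (K^6 * S s + c1 * dl / s^2) / A.Q y"
 by (simp add: abs_minus_commute)
 qed (use y' in simp)
 have gen: "q * (a / q - b / q) = a - b" if "0 < q" for a b q :: real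
 unfolding diff_divide_distrib[symmetric] using that by simp
 have "A.Q y * abs (1 / u1 y - 1 / u1' y) <= A.Q y * ((K^6 * P H + - (c1 * dl / H)) / A.Q y - (K^6 * P y + - (c1 * dl / y)) / A.Q y)"
 using z Qp by (intro mult_left_mono) (simp_all add: A.u_H B.u_H abs_minus_commute)
 also have "... = K^6 * (P H - P y) + c1 * dl * (1 / y - 1 / H)"
 unfolding gen[OF Qp] by (simp add: algebra_simps)
 also have "... <= K^6 * (P H - P y) + c1 * dl * (1 / y0)"
 using c_nonneg dl0 by (intro add_left_mono mult_left_mono yy) auto
 finally have 1: "A.Q y * abs (1 / u1 y - 1 / u1' y) <= K^6 * (P H - P y) + c1 * dl * (1 / y0)" .
 have g: "abs ((g1 H - g1' H) - (g1 y - g1' y)) <= (La1 * P H + - (c2 * dl / H)) - (La1 * P y + - (c2 * dl / y))"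
 proof (rule abs_diff_le_if_deriv_le[where f="%s. g1 s - g1' s" and F="%s. La1 * P s + - (c2 * dl / s)"
 and f'="%s. (mu s + La1 * D s) * u1 s - (mu' s + La1 * D' s) * u1' s" and F'="%s. La1 * S s + c2 * dl / s^2"])
 fix s assume s: "s : {y..H}"
 hence s': "0 < s" "s <= H" "s : {0..H}" using y' by auto
 show "((%s. g1 s - g1' s) hrd (mu s + La1 * D s) * u1 s - (mu' s + La1 * D' s) * u1' s) (at s within {y..H})"
 by (rule sub[OF DERIV_diff[OF A.derivs(3)[OF s'(3)] B.derivs(3)[OF s'(3)]]]) (use y' in auto)
 show "((%s. La1 * P s + - (c2 * dl / s)) hrd La1 * S s + c2 * dl / s^2) (at s within {y..H})"
 by (intro DERIV_add DERIV_cmult inv s' sub[OF dP]) (use s y in auto)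
 show "abs ((mu s + La1 * D s) * u1 s - (mu' s + La1 * D' s) * u1' s) <= La1 * S s + c2 * dl / s^2"
 by (rule Deg_derivative_le[OF s'(1,2)])
 qed (use y' in simp)
 have "(La1 * P H + - (c2 * dl / H)) - (La1 * P y + - (c2 * dl / y)) = La1 * (P H - P y) + c2 * dl * (1 / y - 1 / H)"
 by (simp add: algebra_simps)
 also have "... <= La1 * (P H - P y) + c2 * dl * (1 / y0)"
 using c_nonneg dl0 by (intro add_left_mono mult_left_mono yy) auto
 finally have g': "abs ((g1 H - g1' H) - (g1 y - g1' y)) <= La1 * (P H - P y) + c2 * dl * (1 / y0)" using g by linarith
 \<comment> \<open>The contribution of the top is enlarged by \<open>H / y0 >= 1\<close> so as to
   have the same form as the sources.\<close>
 have "c3 * dl <= c3 * dl * (H * (1 / y0))"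
 proof -
 have "1 <= H * (1 / y0)" using y0 by simp
 from mult_left_mono[OF this, of "c3 * dl"] show ?thesis using c_nonneg dl0 by simp
 qed
 hence gH: "abs (g1 H - g1' H) <= c3 * dl * (H * (1 / y0))" using Deg_top by linarith
 have tri: "abs b <= p + q" if "abs (a - b) <= p" "abs a <= q" for a b p q :: real using that by linarith
 have 2: "abs (g1 y - g1' y) <= (La1 * (P H - P y) + c2 * dl * (1 / y0)) + c3 * dl * (H * (1 / y0))" by (rule tri[OF g' gH])
 have "S y <= K^6 * (P H - P y) + c1 * dl * (1 / y0) + ((La1 * (P H - P y) + c2 * dl * (1 / y0)) + c3 * dl * (H * (1 / y0)))"
 unfolding S_def using 1 2 by (rule add_mono)
 also have "... = (c1 + (c3 * H + c2)) * dl / y0 + (K^6 + La1) * (P H - P y)"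
 by (simp add: algebra_simps add_divide_distrib)
 finally show ?thesis using PH[OF y] by simp
 qed
 have "S y0 <= (c1 + (c3 * H + c2)) * dl / y0 * exp ((K^6 + La1) * (H - y0))"
 by (rule Gronwall_backward[OF cont _ le]) (use y0 K0 A.La1 in auto)
 also have "... <= (c1 + (c3 * H + c2)) * dl / y0 * exp ((K^6 + La1) * H)"
 using y0 K0 A.La1 c_nonneg dl0 HK by (intro mult_left_mono) (auto intro!: divide_nonneg_nonneg mult_nonneg_nonneg add_nonneg_nonneg mult_left_mono)
 also have "... = cS * dl / y0" by (simp add: cS_def)
 finally show ?thesis .
qed

definition cmu where "cmu = K * H^2 + K^5 * cS"
definition cD where "cD = 2 * K * cS + K^2 * cQ"

text \<open>\<open>mu = h1 * (1 / u1)\<close> and \<open>D = Q * (1 / u1)^2\<close>. The difference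
  of \<open>1 / u1\<close>, bounded by \<open>S / Q\<close>, is of order \<open>y^-3\<close>, and
  \<open>h1\<close> returns one factor \<open>y\<close>. For \<open>D\<close> the factor
  \<open>Q\<close> stays inside \<open>S\<close>, of order \<open>1 / y\<close>, and the sum of the
  reciprocals costs another \<open>1 / y\<close>.\<close>

lemma stability:
 assumes y: "0 < y" "y <= H"
 shows "abs (mu y - mu' y) <= cmu * dl / y^2" "abs (D y - D' y) <= cD * dl / y^2"
proof -
 have y': "y : {0..H}" using y by auto
 have K0: "0 < K" using HK by simp
 have up: "0 < u1 y" "0 < u1' y" using A.u_pos(1)[OF y] B.u_pos(1)[OF y] by auto
 have z: "abs (1 / u1 y) <= K / y" "abs (1 / u1' y) <= K / y" using A.z_bounds[OF y] B.z_bounds[OF y] up by simp_all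
 have Qp: "0 < A.Q y" using A.bounds(13)[OF y'] up by (simp add: A.Q_def)
 have yq: "0 < y^2 / K^3" using y K0 by simp
 have SQ: "A.Q y * abs (1 / u1 y - 1 / u1' y) <= cS * dl / y" using S_parts(1)[OF y'] S_bound[OF y] by linarith
 hence "abs (1 / u1 y - 1 / u1' y) <= cS * dl / y / A.Q y"
 by (subst pos_le_divide_eq[OF Qp]) (simp add: mult.commute)
 also have "... <= cS * dl / y / (y^2 / K^3)"
 by (rule frac_le[OF _ order_refl yq A.Q_bounds(1)[OF y']]) (use c_nonneg dl0 y in simp)
 finally have dz: "abs (1 / u1 y - 1 / u1' y) <= cS * dl / y / (y^2 / K^3)" .
 have "mu y = A.h1 y * (1 / u1 y)" "mu' y = B.h1 y * (1 / u1' y)" using up by (simp_all add: A.h1_def B.h1_def)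
 hence "abs (mu y - mu' y) <= dl * y * (K / y) + K^2 * y * (cS * dl / y / (y^2 / K^3))"
 using abs_mult_diff_bound[OF Deh(1)[OF y'] z(1) B.h_bounds(1)[OF y'] dz] by simp
 also have "... = (K * y^2 + K^5 * cS) * dl / y^2" using y K0 by (simp add: field_simps eval_nat_numeral)
 also have "... <= cmu * dl / y^2"
 unfolding cmu_def using y K0 dl0 by (intro divide_right_mono mult_right_mono add_right_mono mult_left_mono power_mono) auto
 finally show "abs (mu y - mu' y) <= cmu * dl / y^2" .
 have eq: "D y - D' y = A.Q y * (1 / u1 y - 1 / u1' y) * (1 / u1 y + 1 / u1' y) + (A.Q y - B.Q y) * (1 / u1' y)^2"
 using up by (simp add: A.Q_def B.Q_def field_simps power2_eq_square)
 have 1: "abs (A.Q y * (1 / u1 y - 1 / u1' y) * (1 / u1 y + 1 / u1' y)) <= cS * dl / y * (K / y + K / y)"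
 proof -
 have "abs (A.Q y * (1 / u1 y - 1 / u1' y)) <= cS * dl / y" using SQ Qp by (simp add: abs_mult)
 moreover have "abs (1 / u1 y + 1 / u1' y) <= K / y + K / y" using z by linarith
 ultimately show ?thesis unfolding abs_mult[of _ "1 / u1 y + 1 / u1' y"] by (rule mult_mono) (use c_nonneg dl0 y in simp_all)
 qed
 have 2: "abs ((A.Q y - B.Q y) * (1 / u1' y)^2) <= cQ * dl * (K / y)^2"
 proof -
 have "(1 / u1' y)^2 <= (K / y)^2" using power_mono[OF z(2) abs_ge_zero, of 2] by (simp only: power2_abs)
 thus ?thesis unfolding abs_mult abs_power2 by (rule mult_mono[OF DeQ[OF y]]) (use cQ_nonneg dl0 in simp_all)
 qed
 have "abs (D y - D' y) <= cS * dl / y * (K / y + K / y) + cQ * dl * (K / y)^2"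
 unfolding eq by (rule order_trans[OF abs_triangle_ineq add_mono[OF 1 2]])
 also have "... = cD * dl / y^2" using y by (simp add: cD_def field_simps power2_eq_square)
 finally show "abs (D y - D' y) <= cD * dl / y^2" .
qed

end

section \<open>The stability estimate\<close>

text \<open>
 A Lipschitz function exceeds half of its maximum on an interval whose length is proportional to the
 maximum. This is the source of the exponent \<open>1/4\<close>.
\<close>

lemma fourth_power_le_energy:
 fixes f :: "real => real"
 assumes H: "0 < H" and B: "0 < B" and b: "!!y. y : {0..H} ==> abs (f y) <= B"
 and Lip: "!!x y. x : {0..H} ==> y : {0..H} ==> abs (f x - f y) <= B * abs (x - y)"
 and f: "cts {0..H} f" and y: "y : {0..H}"
 shows "abs (f y)^4 <= 8 * B^2 / min 1 H * integral {0..H} (%x. (f x)^2)"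
proof -
 define m where "m = abs (f y)"
 \<comment> \<open>On an interval of this length around \<open>y\<close> the Lipschitz bound keeps
   \<open>|f| >= m / 2\<close>. The factor \<open>min 1 H\<close> gives \<open>l <= H / 2\<close>,
   so the interval fits into \<open>[0,H]\<close> on one side of \<open>y\<close>.\<close>
 define l where "l = m * (min 1 H / (2 * B))"
 have m: "0 <= m" "m <= B" using b[OF y] by (auto simp: m_def)
 have l0: "0 <= l" using m H B by (simp add: l_def)
 have lB: "B * l <= m / 2"
 proof -
 have "B * l = m * min 1 H / 2" using B by (simp add: l_def)
 also have "... <= m * 1 / 2" using m by (intro divide_right_mono mult_left_mono) auto
 finally show ?thesis by simp
 qed
 have lH: "l <= H / 2"
 proof -
 have "l <= B * (min 1 H / (2 * B))" unfolding l_def using m H B by (intro mult_right_mono) auto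
 also have "... = min 1 H / 2" using B by simp
 finally show ?thesis by simp
 qed
 obtain a where a: "0 <= a" "a + l <= H" "y : {a..a + l}"
 proof (cases "y <= H / 2")
 case True thus ?thesis using l0 lH y by (intro that[of y]) auto
 next
 case False thus ?thesis using l0 lH y by (intro that[of "y - l"]) auto
 qed
 have sub: "{a..a + l} <= {0..H}" using a by auto
 have c2: "cts {0..H} (%x. (f x)^2)" by (intro cints f)
 have "(m / 2)^2 * l = integral {a..a + l} (%x. (m / 2)^2)" using l0 by simp
 also have "... <= integral {a..a + l} (%x. (f x)^2)"
 proof (rule integral_le)
 show "(%x. (f x)^2) integrable_on {a..a + l}" by (rule int_cont[OF cont_sub[OF c2 sub]])
 fix x assume x: "x : {a..a + l}"
 have "B * abs (y - x) <= B * l" using x a B by (intro mult_left_mono) auto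
 hence "abs (f y - f x) <= m / 2" using Lip[of y x] x sub y lB by fastforce
 hence "m / 2 <= abs (f x)" unfolding m_def by linarith
 hence "(m / 2)^2 <= abs (f x)^2" using m by (intro power_mono) auto
 thus "(m / 2)^2 <= (f x)^2" by simp
 qed (rule integrable_const_ivl)
 also have "... <= integral {0..H} (%x. (f x)^2)"
 by (rule integral_subset_le[OF sub]) (auto intro!: int_cont c2 cont_sub[OF c2 sub])
 finally have le: "(m / 2)^2 * l <= integral {0..H} (%x. (f x)^2)" .
 \<comment> \<open>The integral bound is cubic in \<open>m\<close>; a further factor
   \<open>m <= B\<close> produces the fourth power.\<close>
 have "m^4 <= B * m^3"
 using mult_right_mono[OF m(2), of "m^3"] m(1) by (simp add: power4_eq_xxxx power3_eq_cube)
 also have "... = 8 * B^2 / min 1 H * ((m / 2)^2 * l)"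
 proof -
 have "min 1 H ~= 0" "B ~= 0" using H B by auto
 thus ?thesis by (simp add: l_def field_simps power2_eq_square power3_eq_cube)
 qed
 also have "... <= 8 * B^2 / min 1 H * integral {0..H} (%x. (f x)^2)"
 using le H by (intro mult_left_mono) auto
 finally show ?thesis by (simp add: m_def)
qed

section \<open>The weight \<open>u_m\<close>\<close>

lemma sinh_mult_le:
 fixes x t :: real
 assumes "0 <= x" "0 <= t" "t <= 1"
 shows "sinh (t * x) <= t * sinh x"
proof -
 have "t * sinh 0 - sinh (t * 0) <= t * sinh x - sinh (t * x)"
 proof (rule nondecreasing_if_deriv_nonneg[where f="%x. t * sinh x - sinh (t * x)" and f'="%x. t * cosh x - cosh (t * x) * t"])
 fix s assume s: "s : {0..x}"
 show "((%x. t * sinh x - sinh (t * x)) hrd t * cosh s - cosh (t * s) * t) (at s within {0..x})"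
 by (auto intro!: deqs)
 have "t * s <= 1 * s" using s assms by (intro mult_right_mono) auto
 hence "cosh (t * s) <= cosh s" using s assms by (simp add: cosh_real_nonneg_le_iff)
 thus "0 <= t * cosh s - cosh (t * s) * t" using assms by (simp add: mult.commute mult_left_mono)
 qed (use assms in auto)
 thus ?thesis by simp
qed

text \<open>For \<open>s > 0\<close> this is convexity of \<open>sinh\<close>, and the quotient is
  even in \<open>s\<close>; at \<open>s = 0\<close> it is \<open>0 / 0 = 0\<close>. Negative
  \<open>s\<close> occurs when \<open>kappa_m\<close> is negative, because \<open>sqrt\<close> of a
  negative real is a negative real.\<close>

lemma abs_sinh_quotient_le:
 fixes s :: real
 assumes H: "0 < H" and y: "0 <= y" "y <= H"
 shows "abs (sinh (s * y) / sinh (s * H)) <= y / H"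
proof -
 have pos: "abs (sinh (s * y) / sinh (s * H)) <= y / H" if s: "0 < s" for s
 proof -
 have "sinh (y / H * (s * H)) <= y / H * sinh (s * H)" by (rule sinh_mult_le) (use s y H in auto)
 hence "sinh (s * y) <= y / H * sinh (s * H)" using H by (simp add: mult.commute)
 moreover have "0 < sinh (s * H)" "0 <= sinh (s * y)" using s y H by auto
 ultimately show ?thesis by (simp add: divide_le_eq)
 qed
 consider "0 < s" | "s = 0" | "s < 0" by linarith
 thus ?thesis
 proof cases
 case 3
 thus ?thesis using pos[of "- s"] by simp
 qed (use pos y H in auto)
qed

lemma u_m_bound:
 assumes H: "0 < H" and y: "y : {0..H}" and D: "0 < D0" "D0 <= D y" "0 <= D H" "D H <= M"
 shows "(u_m L H D mu k y)^2 <= M / D0 * (y / H)^2"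
proof -
 define q where "q = sinh (sqrt (kappa_m L H D mu k) * y) / sinh (sqrt (kappa_m L H D mu k) * H)"
 have "abs q <= y / H" unfolding q_def by (rule abs_sinh_quotient_le) (use H y in auto)
 hence q: "q^2 <= (y / H)^2" using power_mono[OF _ abs_ge_zero, of q "y / H" 2] by simp
 have "(u_m L H D mu k y)^2 = D H / D y * q^2"
 using D by (simp add: u_m_def q_def power_mult_distrib power_divide)
 also have "... <= M / D0 * (y / H)^2" using D q by (intro mult_mono frac_le) auto
 finally show ?thesis .
qed

lemma inverse_square_continuous_pos:
 fixes c :: "real => real"
 assumes "cts S c" "!!y. y : S ==> 0 < c y"
 shows "cts S (%y. 1 / (c y)^2)" "!!y. y : S ==> 0 < 1 / (c y)^2"
proof -
 have "ALL y:S. (c y)^2 ~= 0" using assms(2) by force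
 thus "cts S (%y. 1 / (c y)^2)" by (intro continuous_on_divide continuous_on_const continuous_on_power assms(1))
 show "0 < 1 / (c y)^2" if "y : S" for y using assms(2)[OF that] by simp
qed

text \<open>\<open>h\<close> is the real or the imaginary part: the energy estimates are for real
  modes. The difference of two solutions with the same speed solves the same equation.\<close>

lemma wave_mode_linear_diff:
 fixes P P' :: "real => real => complex" and h :: "complex => real"
 assumes w: "wave_mode H bt La sg P a b" and w': "wave_mode H bt La sg P' a' b'" and h: "bounded_linear h"
 and sg: "cts {0..H} sg"
 shows "wave_mode H bt La sg (%t y. h (P t y - P' t y)) (%t y. h (a t y - a' t y)) (%t y. h (b t y - b' t y))"
proof -
 interpret h: bounded_linear h by (rule h)
 let ?S = "{0..} \<times> {0..H}"
 have c: "cts ?S (%(t, y). P t y)" "cts ?S (%(t, y). a t y)" "cts ?S (%(t, y). b t y)"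
 and z: "ALL t>=0. P t 0 = 0 & b t H = - bt *R a t H"
 and dt: "ALL t>=0. ALL y:{0..H}. ((%s. P s y) hvd a t y) (at t within {0..})"
 and dy: "ALL t>=0. ALL y:{0..H}. (P t hvd b t y) (at y within {0..H})"
 and bal: "ALL t>=0. ALL y1 y2. 0 <= y1 --> y1 <= y2 --> y2 <= H -->
 ((%s. integral {y1..y2} (%y. sg y *R a s y)) has_vector_derivative
 b t y2 - b t y1 - La *R integral {y1..y2} (P t)) (at t within {0..})"
 using w unfolding wave_mode_def by blast+
 have c': "cts ?S (%(t, y). P' t y)" "cts ?S (%(t, y). a' t y)" "cts ?S (%(t, y). b' t y)"
 and z': "ALL t>=0. P' t 0 = 0 & b' t H = - bt *R a' t H"
 and dt': "ALL t>=0. ALL y:{0..H}. ((%s. P' s y) hvd a' t y) (at t within {0..})"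
 and dy': "ALL t>=0. ALL y:{0..H}. (P' t hvd b' t y) (at y within {0..H})"
 and bal': "ALL t>=0. ALL y1 y2. 0 <= y1 --> y1 <= y2 --> y2 <= H -->
 ((%s. integral {y1..y2} (%y. sg y *R a' s y)) has_vector_derivative
 b' t y2 - b' t y1 - La *R integral {y1..y2} (P' t)) (at t within {0..})"
 using w' unfolding wave_mode_def by blast+
 have cd: "cts ?S (%(t, y). h (f t y - f' t y))"
 if "cts ?S (%(t, y). f t y)" "cts ?S (%(t, y). f' t y)" for f f' :: "real => real => complex"
 using h.continuous_on[OF continuous_on_diff[OF that]] by (simp add: case_prod_beta')
 have slice: "cts {0..H} (f t)" if "cts ?S (%(t, y). f t y)" "0 <= t" for f :: "real => real => complex" and t
 proof -
 have "cts {0..H} (%y. (%(t, y). f t y) (t, y))"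
 by (rule cont_comp[OF that(1) continuous_on_Pair[OF continuous_on_const continuous_on_id]]) (use that(2) in auto)
 thus ?thesis by simp
 qed
 have int: "integral {y1..y2} (%y. h (f y - f' y)) = h (integral {y1..y2} f - integral {y1..y2} f')"
 if "cts {0..H} f" "cts {0..H} f'" "0 <= y1" "y2 <= H" for f f' :: "real => complex" and y1 y2
 proof -
 have i: "f integrable_on {y1..y2}" "f' integrable_on {y1..y2}"
 using that by (auto intro!: int_cont intro: cont_sub)
 have "integral {y1..y2} (h \<circ> (%y. f y - f' y)) = h (integral {y1..y2} (%y. f y - f' y))"
 by (rule integral_linear[OF hk_integrable_diff[OF i] h])
 thus ?thesis using hk_integral_diff[OF i] by (simp add: o_def)
 qed
 have b1: "ALL t>=0. h (P t 0 - P' t 0) = 0 & h (b t H - b' t H) = - bt *R h (a t H - a' t H)"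
 proof (intro allI impI conjI)
 fix t :: real assume t: "0 <= t"
 show "h (P t 0 - P' t 0) = 0" using z z' t by (simp add: h.zero)
 have "b t H - b' t H = - bt *R (a t H - a' t H)" using z z' t by (simp add: algebra_simps)
 thus "h (b t H - b' t H) = - bt *R h (a t H - a' t H)" by (simp only: h.scaleR)
 qed
 have b2: "ALL t>=0. ALL y:{0..H}. ((%s. h (P s y - P' s y)) hvd h (a t y - a' t y)) (at t within {0..})"
 using dt dt' by (auto intro!: h.has_vector_derivative has_vector_derivative_diff)
 have b3: "ALL t>=0. ALL y:{0..H}. ((%y. h (P t y - P' t y)) hvd h (b t y - b' t y)) (at y within {0..H})"
 using dy dy' by (auto intro!: h.has_vector_derivative has_vector_derivative_diff)
 have b4: "((%s. integral {y1..y2} (%y. sg y *R h (a s y - a' s y))) has_vector_derivative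
 h (b t y2 - b' t y2) - h (b t y1 - b' t y1) - La *R integral {y1..y2} (%y. h (P t y - P' t y))) (at t within {0..})"
 if t: "0 <= t" and y: "0 <= y1" "y1 <= y2" "y2 <= H" for t y1 y2
 proof -
 have D1: "((%s. h (integral {y1..y2} (%y. sg y *R a s y) - integral {y1..y2} (%y. sg y *R a' s y))) has_vector_derivative
 h ((b t y2 - b t y1 - La *R integral {y1..y2} (P t)) - (b' t y2 - b' t y1 - La *R integral {y1..y2} (P' t)))) (at t within {0..})"
 using bal bal' t y by (intro h.has_vector_derivative has_vector_derivative_diff) auto
 have D2: "h ((b t y2 - b t y1 - La *R integral {y1..y2} (P t)) - (b' t y2 - b' t y1 - La *R integral {y1..y2} (P' t))) =
 h (b t y2 - b' t y2) - h (b t y1 - b' t y1) - La *R integral {y1..y2} (%y. h (P t y - P' t y))"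
 unfolding int[OF slice[OF c(1) t] slice[OF c'(1) t] y(1,3)] by (simp only: h.diff h.scaleR) (simp add: algebra_simps)
 have eq: "integral {y1..y2} (%y. sg y *R h (a s y - a' s y)) =
 h (integral {y1..y2} (%y. sg y *R a s y) - integral {y1..y2} (%y. sg y *R a' s y))" if s: "s : {0..}" for s
 proof -
 have s0: "0 <= s" using s by simp
 have "integral {y1..y2} (%y. h (sg y *R a s y - sg y *R a' s y)) =
 h (integral {y1..y2} (%y. sg y *R a s y) - integral {y1..y2} (%y. sg y *R a' s y))"
 by (rule int[OF _ _ y(1,3)]) (intro continuous_on_scaleR sg slice[OF c(2) s0] slice[OF c'(2) s0])+
 thus ?thesis by (simp only: scaleR_diff_right[symmetric] h.scaleR)
 qed
 show ?thesis by (rule has_vector_derivative_transform[OF _ eq D1[unfolded D2]]) (use t in auto)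
 qed
 show ?thesis unfolding wave_mode_def using cd[OF c(1) c'(1)] cd[OF c(2) c'(2)] cd[OF c(3) c'(3)] b1 b2 b3 b4 by blast
qed

section \<open>From the boundary misfit to the internal data\<close>

context rectangle
begin

lemma finite_initial_mode:
 assumes V: "V_space L H f" and K: "finite K"
 and f: "AE z in lborel. z : Om --> f z = (\<Sum>k\<in>K. r k (snd z) * phi L k (fst z))"
 and q: "cts {0..H} q" "!!y. y : {0..H} ==> (if j : K then r j y else 0) = q y" and y: "y : {0..H}"
 shows "low_mode L H j (dy f) y = q y"
proof (rule initial_mode[OF V q(1) _ y])
 have fm: "(%z. indicator Om z *R f z) : msb borel"
 using H1_L2[OF V_H1[OF V]] by (simp add: L2_def set_meas_def)
 show "AE y in lborel. y : {0<..<H} --> (LBINT x:{0<..<L}. f (x, y) * phi L (- j) x) = q y"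
 using AE_lborel_pair[OF f]
 proof eventually_elim
 case (elim y)
 show ?case
 proof
 assume y: "y : {0<..<H}"
 have mx: "(%x. indicator Om (x, y) *R f (x, y)) : msb borel"
 by (rule measurable_compose[OF _ fm]) (intro borel_cont cints)
 have "(LBINT x:{0<..<L}. f (x, y) * phi L (- j) x) = (LBINT x:{0<..<L}. (\<Sum>k\<in>K. r k y * phi L k x) * phi L (- j) x)"
 unfolding set_int_def
 proof (rule integral_cong_AE)
 have "(%x. (indicator Om (x, y) *R f (x, y)) * phi L (- j) x) : msb borel"
 by (intro borel_measurable_times mx measurable_phi)
 moreover have "(%x. (indicator Om (x, y) *R f (x, y)) * phi L (- j) x) = (%x. indicator {0<..<L} x *R (f (x, y) * phi L (- j) x))"
 using y by (auto simp: fun_eq_iff indicator_def Omega_def)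
 ultimately show "(%x. indicator {0<..<L} x *R (f (x, y) * phi L (- j) x)) : msb lborel" by simp
 show "AE x in lborel. indicator {0<..<L} x *R (f (x, y) * phi L (- j) x) =
 indicator {0<..<L} x *R ((\<Sum>k\<in>K. r k y * phi L k x) * phi L (- j) x)"
 using elim by eventually_elim (use y in \<open>auto simp: indicator_def Omega_def\<close>)
 qed measurable
 thus "(LBINT x:{0<..<L}. f (x, y) * phi L (- j) x) = q y"
 using trig_sum_mode[OF K, of "%k. r k y" j] q(2)[of y] y by simp
 qed
 qed
qed

lemma trig_sum_l2_diff:
 assumes K: "finite K"
 and u: "set_borel_measurable lborel {0<..<L} u" "AE x in lborel. x : {0<..<L} --> u x = (\<Sum>j\<in>K. d j * phi L j x)"
 and v: "set_borel_measurable lborel {0<..<L} v" "AE x in lborel. x : {0<..<L} --> v x = (\<Sum>j\<in>K. e j * phi L j x)"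
 shows "(l2norm {0<..<L} (%x. u x - v x))^2 = (\<Sum>j\<in>K. (norm (d j - e j))^2)"
proof -
 have "l2norm {0<..<L} (%x. u x - v x) = l2norm {0<..<L} (%x. \<Sum>j\<in>K. (d j - e j) * phi L j x)"
 proof (rule L2_cong_AE(2))
 show "L2 {0<..<L} (%x. \<Sum>j\<in>K. (d j - e j) * phi L j x)" by (intro L2_sum L2_cmult L2_phi)
 show "set_borel_measurable lborel {0<..<L} (%x. u x - v x)"
 using borel_measurable_diff[OF u(1)[unfolded set_meas_def] v(1)[unfolded set_meas_def]]
 by (simp only: set_meas_def scaleR_diff_right)
 show "AE x in lborel. x : {0<..<L} --> u x - v x = (\<Sum>j\<in>K. (d j - e j) * phi L j x)"
 using u(2) v(2) by eventually_elim (auto simp: sum_subtractf left_diff_distrib)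
 qed
 thus ?thesis using l2norm_trig_sum[OF K, of "%j. d j - e j"] by simp
qed

lemma wave_mode_continuous_t:
 fixes P a b :: "real => real => 'a::euclidean_space"
 assumes w: "wave_mode H bt La sg P a b" and y: "y : {0..H}"
 shows "cts {0..} (%t. P t y)" "cts {0..} (%t. a t y)"
proof -
 have "cts ({0..} \<times> {0..H}) (%(t, y). P t y)" "cts ({0..} \<times> {0..H}) (%(t, y). a t y)"
 using w unfolding wave_mode_def by blast+
 note c = this
 have t: "cts {0..} (%t. f t y)" if "cts ({0..} \<times> {0..H}) (%(t, y). f t y)" for f :: "real => real => 'a"
 proof -
 have "cts {0..} (%t. (%(t, y). f t y) (t, y))"
 by (rule cont_comp[OF that continuous_on_Pair[OF continuous_on_id continuous_on_const]]) (use y in auto)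
 thus ?thesis by simp
 qed
 show "cts {0..} (%t. P t y)" "cts {0..} (%t. a t y)" using t[OF c(1)] t[OF c(2)] .
qed

text \<open>The initial speed has finitely many modes and the initial pressure only the mode
  \<open>k\<close>. Every other mode starts from zero data and leaves no trace at the top, so the
  boundary traces are trigonometric polynomials.\<close>

lemma acoustic_modes:
 assumes ap: "acoustic_pressure L H bt c k mu u p pt" and c: "cts {0..H} c" "!!y. y : {0..H} ==> c y > 0"
 and bt: "0 < bt" and h: "cts {0..H} (%y. mu y * u y)"
 obtains N :: nat and f0 f1 where "acoustic_solution L H bt c f0 f1 p pt"
 "ALL j t. j ~: {- int N..int N} \<union> {k} --> 0 <= t -->
 low_mode L H j (dy (p t)) H = 0 & low_mode L H j (dy (pt t)) H = 0"
 "ALL y:{0..H}. low_mode L H k (dy (p 0)) y = cor (mu y * u y)"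
proof -
 define f0 where "f0 = (%z. cor (mu (snd z) * u (snd z)) * phi L k (fst z))"
 obtain f1 where ff: "finite_fourier L H f1" and sol: "acoustic_solution L H bt c f0 f1 p pt"
 using ap by (auto simp: acoustic_pressure_def f0_def)
 obtain N fk where fk: "AE z in lborel. z : Om --> f1 z = (\<Sum>k=-int N..int N. fk k (snd z) * phi L k (fst z))"
 using ff by (auto simp: finite_fourier_def)
 have V: "V_space L H (p t)" "V_space L H (pt t)" if "0 <= t" for t
 using sol that by (auto simp: acoustic_solution_def D_A_def)
 have AE0: "AE z in lborel. z : Om --> p 0 z = f0 z" "AE z in lborel. z : Om --> pt 0 z = f1 z"
 using sol by (simp_all add: acoustic_solution_def)
 have P0: "low_mode L H j (dy (p 0)) y = (if j = k then cor (mu y * u y) else 0)" if y: "y : {0..H}" for j y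
 proof (rule finite_initial_mode[where K="{k}" and r="%_ y. cor (mu y * u y)"])
 show "AE z in lborel. z : Om --> p 0 z = (\<Sum>k\<in>{k}. cor (mu (snd z) * u (snd z)) * phi L k (fst z))"
 using AE0(1) by (simp add: f0_def)
 show "cts {0..H} (%y. if j = k then cor (mu y * u y) else 0)"
 proof (cases "j = k")
 case True
 have "cts {0..H} (%y. cor (mu y * u y))" by (rule continuous_on_of_real[OF h])
 thus ?thesis using True by simp
 qed simp
 qed (use V y in auto)
 have a0: "low_mode L H j (dy (pt 0)) y = 0" if j: "j ~: {- int N..int N}" and y: "y : {0..H}" for j y
 proof (rule finite_initial_mode[where K="{- int N..int N}" and r=fk])
 show "AE z in lborel. z : Om --> pt 0 z = (\<Sum>k=- int N..int N. fk k (snd z) * phi L k (fst z))"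
 using AE0(2) fk by eventually_elim auto
 qed (use V y j in auto)
 define sg where "sg y = 1 / (c y)^2" for y
 have sg: "cts {0..H} sg" "!!y. y : {0..H} ==> 0 < sg y"
 using inverse_square_continuous_pos[OF c] by (simp_all add: sg_def[abs_def])
 note w = acoustic_wave_mode[OF sol c, folded sg_def[abs_def]]
 \<comment> \<open>The zero solution, for comparison: the real and imaginary parts of a single mode
   are then an instance of \<open>wave_mode_linear_diff\<close>.\<close>
 have w0: "wave_mode H bt La sg (%_ _. 0 :: complex) (%_ _. 0) (%_ _. 0)" for La
 by (simp add: wave_mode_def case_prod_beta')
 have zero: "h (low_mode L H j (dy (p t)) H) = 0 & h (low_mode L H j (dy (pt t)) H) = 0"
 if j: "j ~: {- int N..int N} \<union> {k}" and t: "0 <= t" and hl: "bounded_linear h" for j t and h :: "complex => real"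
 proof -
 interpret h: bounded_linear h by (rule hl)
 interpret wave_data H bt "(lam L j)^2" sg "%t y. h (low_mode L H j (dy (p t)) y - 0)" "%t y. h (low_mode L H j (dy (pt t)) y - 0)"
 "%t y. h (flux_mode bt j (p t) (pt t) y - 0)"
 by unfold_locales (use wave_mode_linear_diff[OF w w0 hl sg(1)] H bt sg in auto)
 have "h (low_mode L H j (dy (pt t)) H - 0) = 0" "h (low_mode L H j (dy (p t)) H - 0) = 0"
 by (rule zero_if_zero_data; use P0 a0 j t h.zero in auto)+
 thus ?thesis by simp
 qed
 have z: "low_mode L H j (dy (p t)) H = 0" "low_mode L H j (dy (pt t)) H = 0"
 if "j ~: {- int N..int N} \<union> {k}" "0 <= t" for j t
 using zero[OF that bounded_linear_Re] zero[OF that bounded_linear_Im] by (auto simp: complex_eq_iff)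
 show ?thesis by (rule that[OF sol]) (use z P0 in auto)
qed

text \<open>By Parseval on the top side the integrand of the misfit is a sum of nonnegative
  contributions of the modes; only the time derivative of the mode \<open>k\<close> is kept.\<close>

lemma boundary_misfit_ge:
 assumes sol: "acoustic_solution L H bt c f0 f1 p pt" "acoustic_solution L H bt c f0' f1' p' pt'"
 and c: "cts {0..H} c" "!!y. y : {0..H} ==> c y > 0"
 and K: "finite K" "k : K"
 and z: "!!j t. j ~: K ==> 0 <= t ==> low_mode L H j (dy (p t)) H = 0" "!!j t. j ~: K ==> 0 <= t ==> low_mode L H j (dy (pt t)) H = 0"
 "!!j t. j ~: K ==> 0 <= t ==> low_mode L H j (dy (p' t)) H = 0" "!!j t. j ~: K ==> 0 <= t ==> low_mode L H j (dy (pt' t)) H = 0"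
 and w: "0 <= C_M H bt c / (T - 2 * theta H c * H) + bt" and T: "0 <= T"
 shows "(C_M H bt c / (T - 2 * theta H c * H) + bt) *
 integral {0..T} (%t. (norm (low_mode L H k (dy (pt t)) H - low_mode L H k (dy (pt' t)) H))^2) <= boundary_misfit L H bt c T p pt p' pt'"
proof -
 define w where "w = C_M H bt c / (T - 2 * theta H c * H) + bt"
 define A where "A j t = low_mode L H j (dy (pt t)) H - low_mode L H j (dy (pt' t)) H" for j t
 define B where "B j t = \<i> * lam L j * low_mode L H j (dy (p t)) H - \<i> * lam L j * low_mode L H j (dy (p' t)) H" for j t
 have HH: "H : {0..H}" using H by simp
 have V: "V_space L H (p t)" "V_space L H (pt t)" "V_space L H (p' t)" "V_space L H (pt' t)" if "0 <= t" for t
 using sol that by (auto simp: acoustic_solution_def D_A_def)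
 note wt = wave_mode_continuous_t[OF acoustic_wave_mode[OF sol(1) c] HH] wave_mode_continuous_t[OF acoustic_wave_mode[OF sol(2) c] HH]
 have cA: "cts {0..} (A j)" for j unfolding A_def by (intro continuous_on_diff wt)
 have cB: "cts {0..} (B j)" for j
 unfolding B_def by (intro continuous_on_diff continuous_on_mult continuous_on_const wt)
 have cont: "cts {0..T} (A j)" "cts {0..T} (B j)" for j
 by (rule cont_sub[OF cA], simp, rule cont_sub[OF cB], simp)
 have tm: "set_borel_measurable lborel {0<..<L} (tr_top L H v)" if "V_space L H v" for v
 using tr_top_L2[OF that] by (simp add: L2_def)
 have dm: "set_borel_measurable lborel {0<..<L} (dx_top L H v)" if "V_space L H v" "!!j. j ~: K ==> low_mode L H j (dy v) H = 0" for v
 by (rule set_borel_measurable_loc_integrable[OF open_greaterThanLessThan dx_top_finite(1)[OF that(1) K(1) that(2)]])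
 have tr: "(l2norm {0<..<L} (%x. tr_top L H (pt t) x - tr_top L H (pt' t) x))^2 = (\<Sum>j\<in>K. (norm (A j t))^2)" if t: "0 <= t" for t
 unfolding A_def
 by (intro trig_sum_l2_diff K(1) tm V t tr_top_finite z)
 have dx: "(l2norm {0<..<L} (%x. dx_top L H (p t) x - dx_top L H (p' t) x))^2 = (\<Sum>j\<in>K. (norm (B j t))^2)" if t: "0 <= t" for t
 unfolding B_def
 by (intro trig_sum_l2_diff K(1) dm V t dx_top_finite(2) z)
 define F where "F t = w * (\<Sum>j\<in>K. (norm (A j t))^2) + (\<Sum>j\<in>K. (norm (B j t))^2)" for t
 have cF: "cts {0..T} F" unfolding F_def by (intro cints cont)
 have "boundary_misfit L H bt c T p pt p' pt' = (LBINT t:{0..T}. F t)"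
 unfolding boundary_misfit_def w_def[symmetric]
 by (rule set_lebesgue_integral_cong) (auto simp: F_def tr dx)
 also have "... = integral {0..T} F"
 by (rule set_borel_integral_eq_integral(2)[OF borel_integrable_atLeastAtMost'[OF cF]])
 also have "... >= integral {0..T} (%t. w * (norm (A k t))^2)"
 proof (rule integral_le)
 show "(%t. w * (norm (A k t))^2) integrable_on {0..T}" by (intro int_cont cints cont)
 show "F integrable_on {0..T}" by (rule int_cont[OF cF])
 fix t
 have "(norm (A k t))^2 <= (\<Sum>j\<in>K. (norm (A j t))^2)" by (rule member_le_sum) (use K in auto)
 hence "w * (norm (A k t))^2 <= w * (\<Sum>j\<in>K. (norm (A j t))^2)" using w by (intro mult_left_mono) (simp_all add: w_def)
 moreover have "0 <= (\<Sum>j\<in>K. (norm (B j t))^2)" by (simp add: sum_nonneg)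
 ultimately show "w * (norm (A k t))^2 <= F t" by (simp add: F_def)
 qed
 finally show ?thesis by (simp add: w_def A_def)
qed


text \<open>The initial energy of the difference contains the square of its y-derivative at time 0,
  which is \<open>h - h'\<close> because the pressures start from \<open>mu * u\<close> and
  \<open>mu' * u'\<close> times \<open>phi L k\<close>. The initial speeds, about which nothing is
  assumed here, contribute a nonnegative term to that energy.\<close>

lemma mode_energy_le:
 assumes ap: "acoustic_pressure L H bt c k mu u p pt" "acoustic_pressure L H bt c k mu' u' p' pt'"
 and bt: "0 < bt" and W: "W1inf H c" and pos: "ALL y:{0<..<H}. 0 < c y"
 and Li: "Linf {0<..<H} (%y. 1 / (c y)^2)" and T: "2 * theta H c * H < T"
 and h: "!!y. y : {0..H} ==> ((%y. mu y * u y) hrd h y) (at y within {0..H})"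
 "!!y. y : {0..H} ==> ((%y. mu' y * u' y) hrd h' y) (at y within {0..H})"
 shows "integral {0..H} (%y. (h y - h' y)^2) <= 2 * exp ((lam L k)^2 * (1 + H^2) * H) * boundary_misfit L H bt c T p pt p' pt'"
 "0 <= boundary_misfit L H bt c T p pt p' pt'"
proof -
 obtain G where c: "cts {0..H} c" "!!y. y : {0..H} ==> 0 < c y" and th: "0 <= theta H c"
 and th_le: "!!y. y : {0..H} ==> 1 / (c y)^2 <= (theta H c)^2" and G: "cts {0..H} G" "G H = 0"
 "mono_on {0..H} (%y. exp (- G y))" "mono_on {0..H} (%y. 1 / (c y)^2 * exp (- G y))"
 and CM: "C_M H bt c = H * exp (G 0) * (1 / (c H)^2 + bt^2)"
 using sound_speed[OF W H pos Li, of bt] by blast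
 have T0: "0 <= T" using T th H by (meson less_imp_le mult_nonneg_nonneg order_trans zero_le_numeral)
 define La where "La = (lam L k)^2"
 define w where "w = C_M H bt c / (T - 2 * theta H c * H)"
 have w0: "0 <= w" unfolding w_def CM using T H by (intro divide_nonneg_nonneg mult_nonneg_nonneg add_nonneg_nonneg) auto
 have ch: "cts {0..H} (%y. mu y * u y)" "cts {0..H} (%y. mu' y * u' y)"
 by (rule DERIV_continuous_on[OF h(1)], simp, rule DERIV_continuous_on[OF h(2)])
 obtain N :: nat and f0 f1 where sol: "acoustic_solution L H bt c f0 f1 p pt"
 and z: "ALL j t. j ~: {- int N..int N} \<union> {k} --> 0 <= t -->
 low_mode L H j (dy (p t)) H = 0 & low_mode L H j (dy (pt t)) H = 0"
 and i: "ALL y:{0..H}. low_mode L H k (dy (p 0)) y = cor (mu y * u y)"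
 by (rule acoustic_modes[OF ap(1) c bt ch(1)])
 obtain N' :: nat and f0' f1' where sol': "acoustic_solution L H bt c f0' f1' p' pt'"
 and z': "ALL j t. j ~: {- int N'..int N'} \<union> {k} --> 0 <= t -->
 low_mode L H j (dy (p' t)) H = 0 & low_mode L H j (dy (pt' t)) H = 0"
 and i': "ALL y:{0..H}. low_mode L H k (dy (p' 0)) y = cor (mu' y * u' y)"
 by (rule acoustic_modes[OF ap(2) c bt ch(2)])
 define K where "K = ({- int N..int N} \<union> {- int N'..int N'}) \<union> {k}"
 define a where "a t = low_mode L H k (dy (pt t)) H - low_mode L H k (dy (pt' t)) H" for t
 have misfit: "(w + bt) * integral {0..T} (%t. (norm (a t))^2) <= boundary_misfit L H bt c T p pt p' pt'"
 unfolding w_def a_def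
 by (rule boundary_misfit_ge[OF sol sol' c, of K]) (use z z' w0 bt T0 in \<open>auto simp: K_def w_def\<close>)
 have ca: "cts {0..T} a"
 proof -
 have "H : {0..H}" using H by simp
 hence "cts {0..} a" unfolding a_def
 by (intro continuous_on_diff wave_mode_continuous_t(2)[OF acoustic_wave_mode[OF sol c]] wave_mode_continuous_t(2)[OF acoustic_wave_mode[OF sol' c]])
 thus ?thesis by (rule cont_sub) auto
 qed
 have int0: "0 <= integral {0..T} (%t. (norm (a t))^2)"
 by (intro integral_nonneg int_cont cints ca) simp
 hence "0 <= (w + bt) * integral {0..T} (%t. (norm (a t))^2)" using w0 bt by simp
 thus "0 <= boundary_misfit L H bt c T p pt p' pt'" using misfit by linarith
 define sg where "sg y = 1 / (c y)^2" for y
 have sg: "cts {0..H} sg" "!!y. y : {0..H} ==> 0 < sg y"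
 using inverse_square_continuous_pos[OF c] by (simp_all add: sg_def[abs_def])
 interpret D: wave_data H bt La sg "%t y. Re (low_mode L H k (dy (p t)) y - low_mode L H k (dy (p' t)) y)"
 "%t y. Re (low_mode L H k (dy (pt t)) y - low_mode L H k (dy (pt' t)) y)"
 "%t y. Re (flux_mode bt k (p t) (pt t) y - flux_mode bt k (p' t) (pt' t) y)"
 by unfold_locales
 (use wave_mode_linear_diff[OF acoustic_wave_mode[OF sol c, folded sg_def[abs_def]] acoustic_wave_mode[OF sol' c, folded sg_def[abs_def]] bounded_linear_Re sg(1)]
 H bt sg in \<open>auto simp: La_def\<close>)
 have b: "Re (flux_mode bt k (p 0) (pt 0) y - flux_mode bt k (p' 0) (pt' 0) y) = h y - h' y" if y: "y : {0..H}" for y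
 proof -
 have "((%y. mu y * u y - mu' y * u' y) hrd Re (flux_mode bt k (p 0) (pt 0) y - flux_mode bt k (p' 0) (pt' 0) y)) (at y within {0..H})"
 by (rule has_real_derivative_transform[OF y _ D.P_y[OF order_refl y]]) (simp add: i i')
 moreover have "((%y. mu y * u y - mu' y * u' y) hrd h y - h' y) (at y within {0..H})"
 by (intro DERIV_diff h y)
 ultimately show ?thesis
 using vector_derivative_unique_within_closed_interval[of 0 H y] y H
 by (simp add: real_deriv_iff)
 qed
 have "integral {0..H} (%y. (h y - h' y)^2) = integral {0..H} (%y. (Re (flux_mode bt k (p 0) (pt 0) y - flux_mode bt k (p' 0) (pt' 0) y))^2)"
 by (intro hk_integral_cong) (simp only: b)
 also have "... <= D.E0"
 unfolding D.E0_def
 proof (rule integral_le)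
 have z0: "0 : {0..0::real}" by simp
 note cy = cont2_y[OF D.cont(1) z0] cont2_y[OF D.cont(2) z0] cont2_y[OF D.cont(3) z0]
 show "(%y. (Re (flux_mode bt k (p 0) (pt 0) y - flux_mode bt k (p' 0) (pt' 0) y))^2) integrable_on {0..H}"
 by (intro int_cont continuous_on_power cy)
 show "(%y. sg y * (Re (low_mode L H k (dy (pt 0)) y - low_mode L H k (dy (pt' 0)) y))^2 +
 (Re (flux_mode bt k (p 0) (pt 0) y - flux_mode bt k (p' 0) (pt' 0) y))^2 +
 La * (Re (low_mode L H k (dy (p 0)) y - low_mode L H k (dy (p' 0)) y))^2) integrable_on {0..H}"
 by (intro int_cont continuous_on_add continuous_on_mult continuous_on_power continuous_on_const sg cy)
 fix y assume y: "y : {0..H}"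
 have "0 <= sg y * (Re (low_mode L H k (dy (pt 0)) y - low_mode L H k (dy (pt' 0)) y))^2" using sg(2)[OF y] by simp
 moreover have "0 <= La * (Re (low_mode L H k (dy (p 0)) y - low_mode L H k (dy (p' 0)) y))^2" by (simp add: La_def)
 ultimately show "(Re (flux_mode bt k (p 0) (pt 0) y - flux_mode bt k (p' 0) (pt' 0) y))^2 \<le>
 sg y * (Re (low_mode L H k (dy (pt 0)) y - low_mode L H k (dy (pt' 0)) y))^2 +
 (Re (flux_mode bt k (p 0) (pt 0) y - flux_mode bt k (p' 0) (pt' 0) y))^2 +
 La * (Re (low_mode L H k (dy (p 0)) y - low_mode L H k (dy (p' 0)) y))^2"
 by linarith
 qed
 also have "... <= (H * exp (G 0) * exp (La * (1 + H^2) * H) * (sg H + bt^2) / (T - 2 * theta H c * H) + 2 * bt) *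
 integral {0..T} (%t. (Re (low_mode L H k (dy (pt t)) H - low_mode L H k (dy (pt' t)) H))^2)"
 by (rule D.observability[OF th _ T G(1,2,3)]) (use th_le G(4) in \<open>auto simp: sg_def\<close>)
 also have "... <= (2 * exp (La * (1 + H^2) * H) * (w + bt)) * integral {0..T} (%t. (norm (a t))^2)"
 proof (rule mult_mono)
 \<comment> \<open>This exponential in \<open>La\<close> is at least 1, so it may be put in front of
   \<open>bt\<close> as well and be split off, leaving the factor \<open>w + bt\<close> of the
   misfit.\<close>
 define e where "e = exp (La * (1 + H^2) * H)"
 have e: "1 <= e" using H by (simp add: e_def La_def)
 have eq: "H * exp (G 0) * e * (sg H + bt^2) / (T - 2 * theta H c * H) = e * w" by (simp add: w_def CM sg_def)
 have "0 <= e * w" "bt <= e * bt" using e w0 bt by auto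
 thus "H * exp (G 0) * exp (La * (1 + H^2) * H) * (sg H + bt^2) / (T - 2 * theta H c * H) + 2 * bt <= 2 * exp (La * (1 + H^2) * H) * (w + bt)"
 unfolding e_def[symmetric] eq by (simp add: distrib_left)
 show "integral {0..T} (%t. (Re (low_mode L H k (dy (pt t)) H - low_mode L H k (dy (pt' t)) H))^2) <= integral {0..T} (%t. (norm (a t))^2)"
 unfolding a_def[symmetric]
 proof (rule integral_le)
 show "(%t. (Re (a t))^2) integrable_on {0..T}" "(%t. (norm (a t))^2) integrable_on {0..T}"
 by (intro int_cont cints ca)+
 show "(Re (a t))^2 <= (norm (a t))^2" for t by (simp add: cmod_power2)
 qed
 show "0 <= integral {0..T} (%t. (Re (low_mode L H k (dy (pt t)) H - low_mode L H k (dy (pt' t)) H))^2)"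
 unfolding a_def[symmetric] by (intro integral_nonneg int_cont cints ca) simp
 show "0 <= 2 * exp (La * (1 + H^2) * H) * (w + bt)" using w0 bt by simp
 qed
 also have "... <= 2 * exp (La * (1 + H^2) * H) * boundary_misfit L H bt c T p pt p' pt'"
 unfolding mult.assoc[of "2 * exp (La * (1 + H^2) * H)" "w + bt"] by (intro mult_left_mono misfit) auto
 finally show "integral {0..H} (%y. (h y - h' y)^2) <= 2 * exp ((lam L k)^2 * (1 + H^2) * H) * boundary_misfit L H bt c T p pt p' pt'"
 by (simp add: La_def)
qed

end

text \<open>The constants of the locale are built from \<open>H\<close>, \<open>K\<close>,
  \<open>La1\<close> and \<open>La2\<close> alone, so one \<open>C\<close> serves all pairs of media
  with these bounds.\<close>

lemma media_stability:
 obtains C where "0 <= C"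
 "!!D mu mu1 u1 g1 k1 u2 g2 k2 D' mu' mu1' u1' g1' k1' u2' g2' k2' dl y.
 media_pair H K La1 La2 D mu mu1 u1 g1 k1 u2 g2 k2 D' mu' mu1' u1' g1' k1' u2' g2' k2' dl ==> 0 < y ==> y <= H ==>
 abs (mu y - mu' y) <= C * dl / y^2 & abs (D y - D' y) <= C * dl / y^2"
proof -
 define C where "C = max 0 (max (media_pair.cmu H K La1 La2) (media_pair.cD H K La1 La2))"
 have C: "0 <= C" "media_pair.cmu H K La1 La2 <= C" "media_pair.cD H K La1 La2 <= C" by (auto simp: C_def)
 show ?thesis
 proof (rule that[OF C(1)])
 fix D mu mu1 u1 g1 k1 u2 g2 k2 D' mu' mu1' u1' g1' k1' u2' g2' k2' :: "real => real" and dl y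
 assume m: "media_pair H K La1 La2 D mu mu1 u1 g1 k1 u2 g2 k2 D' mu' mu1' u1' g1' k1' u2' g2' k2' dl" and y: "0 < y" "y <= H"
 have "0 <= dl" by (rule media_pair.dl0[OF m])
 hence "c * dl / y^2 <= C * dl / y^2" if "c <= C" for c using that by (intro divide_right_mono mult_right_mono) auto
 thus "abs (mu y - mu' y) <= C * dl / y^2 & abs (D y - D' y) <= C * dl / y^2"
 using media_pair.stability[OF m y] C order_trans by blast
 qed
qed


theorem theorem2p1:
  fixes L H D0 \<mu>0 M :: real
  assumes "L > 0" "H > 0" "D0 > 0" "\<mu>0 > 0" "M > max D0 \<mu>0"
  shows "\<exists>k0::int. \<forall>k1 k2::int. k0 \<le> k1 \<and> k1 < k2 \<longrightarrow>
    (\<exists>C>0. \<forall>(\<beta>::real) (c :: real \<Rightarrow> real) (cm::real) (T::real)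
       (D :: real \<Rightarrow> real) (\<mu> :: real \<Rightarrow> real) (D' :: real \<Rightarrow> real) (\<mu>' :: real \<Rightarrow> real)
       (u :: nat \<Rightarrow> real \<Rightarrow> real) (u' :: nat \<Rightarrow> real \<Rightarrow> real)
       (p :: nat \<Rightarrow> real \<Rightarrow> real \<times> real \<Rightarrow> complex) (pt :: nat \<Rightarrow> real \<Rightarrow> real \<times> real \<Rightarrow> complex)
       (p' :: nat \<Rightarrow> real \<Rightarrow> real \<times> real \<Rightarrow> complex) (pt' :: nat \<Rightarrow> real \<Rightarrow> real \<times> real \<Rightarrow> complex).
       \<beta> > 0 \<longrightarrow>
       W1inf H c \<longrightarrow> (\<forall>y\<in>{0<..<H}. c y > 0) \<longrightarrow>
       cm > 0 \<longrightarrow> (\<forall>y\<in>{0<..<H}. cm \<le> 1 / (c y)\<^sup>2) \<longrightarrow>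
       Linf {0<..<H} (\<lambda>y. 1 / (c y)\<^sup>2) \<longrightarrow>
       T > 2 * theta H c * H \<longrightarrow>
       (D, \<mu>) \<in> O_M H D0 \<mu>0 M \<longrightarrow> (D', \<mu>') \<in> O_M H D0 \<mu>0 M \<longrightarrow>
       D H = D' H \<longrightarrow> dI H D H = dI H D' H \<longrightarrow> dI H \<mu> H = dI H \<mu>' H \<longrightarrow>
       (\<forall>i\<in>{1, 2}. let k = (if i = 1 then k1 else k2) in
          optical_solution L H D \<mu> k (u i) \<and> optical_solution L H D' \<mu>' k (u' i) \<and>
          acoustic_pressure L H \<beta> c k \<mu> (u i) (p i) (pt i) \<and>
          acoustic_pressure L H \<beta> c k \<mu>' (u' i) (p' i) (pt' i)) \<longrightarrow>
       sup_norm H (\<lambda>y. (u_m L H D \<mu> k1 y)\<^sup>2 * (\<mu> y - \<mu>' y))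
         \<le> C * (\<Sum>i\<in>{1, 2}. boundary_misfit L H \<beta> c T (p i) (pt i) (p' i) (pt' i)) powr (1/4) \<and>
       sup_norm H (\<lambda>y. (u_m L H D \<mu> k1 y)\<^sup>2 * (D y - D' y))
         \<le> C * (\<Sum>i\<in>{1, 2}. boundary_misfit L H \<beta> c T (p i) (pt i) (p' i) (pt' i)) powr (1/4))"
proof (rule exI[of _ 0], intro allI impI, goal_cases)
 case (1 k1 k2)
 then have k: "0 \<le> k1 \<and> k1 < k2" .
 have L: "0 < L" and H: "0 < H" and D0: "0 < D0" and \<mu>0: "0 < \<mu>0" and M: "0 < M" using assms by auto
 interpret rectangle L H by unfold_locales (rule L, rule H)
 \<comment> \<open>The sign condition \<open>0 <= k1\<close> turns \<open>k1 < k2\<close> into a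
   strict inequality of the squared frequencies, as the monotonicity of the Wronskian
   requires.\<close>
 define \<Lambda>1 \<Lambda>2 where "\<Lambda>1 = (lam L k1)\<^sup>2" and "\<Lambda>2 = (lam L k2)\<^sup>2"
 have \<Lambda>: "0 \<le> \<Lambda>1" "\<Lambda>1 < \<Lambda>2"
 proof -
 have "lam L k1 < lam L k2" "0 \<le> lam L k1" using k L by (auto simp: lam_def intro!: divide_strict_right_mono)
 then show "0 \<le> \<Lambda>1" "\<Lambda>1 < \<Lambda>2" unfolding \<Lambda>1_def \<Lambda>2_def by (auto intro: power_strict_mono)
 qed
 obtain K1 where K1: "1 \<le> K1" "\<And>D \<mu> u. (D, \<mu>) \<in> O_M H D0 \<mu>0 M \<Longrightarrow> optical_solution L H D \<mu> k1 u \<Longrightarrow>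
 \<exists>g h. mode_data H K1 \<Lambda>1 D \<mu> (dI H \<mu>) u g h"
 using optical_mode_data[OF H D0 \<mu>0 M, where L=L and k=k1] unfolding \<Lambda>1_def by blast
 obtain K2 where K2: "1 \<le> K2" "\<And>D \<mu> u. (D, \<mu>) \<in> O_M H D0 \<mu>0 M \<Longrightarrow> optical_solution L H D \<mu> k2 u \<Longrightarrow>
 \<exists>g h. mode_data H K2 \<Lambda>2 D \<mu> (dI H \<mu>) u g h"
 using optical_mode_data[OF H D0 \<mu>0 M, where L=L and k=k2] unfolding \<Lambda>2_def by blast
 define K where "K = max K1 K2"
 have K: "1 \<le> K" "0 < K1" "K1 \<le> K" "0 < K2" "K2 \<le> K" using K1 K2 by (auto simp: K_def)
 obtain C where C: "0 \<le> C" and stab: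
 "\<And>D \<mu> \<mu>1 u1 g1 k1 u2 g2 k2 D' \<mu>' \<mu>1' u1' g1' k1' u2' g2' k2' \<delta> y.
 media_pair H K \<Lambda>1 \<Lambda>2 D \<mu> \<mu>1 u1 g1 k1 u2 g2 k2 D' \<mu>' \<mu>1' u1' g1' k1' u2' g2' k2' \<delta> \<Longrightarrow> 0 < y \<Longrightarrow> y \<le> H \<Longrightarrow>
 \<bar>\<mu> y - \<mu>' y\<bar> \<le> C * \<delta> / y\<^sup>2 \<and> \<bar>D y - D' y\<bar> \<le> C * \<delta> / y\<^sup>2"
 using media_stability[of H K \<Lambda>1 \<Lambda>2] by blast
 \<comment> \<open>\<Lambda>2 is the larger squared frequency, so one energy constant serves both
   modes.\<close>
 define e where "e = 2 * exp (\<Lambda>2 * (1 + H\<^sup>2) * H)"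
 define A where "A = 8 * (2 * K)\<^sup>2 / min 1 H * e"
 \<comment> \<open>\<open>M / D0 / H^2\<close> bounds the square of \<open>u_m\<close> divided by
   \<open>y^2\<close>; the summand 1 makes the constant positive.\<close>
 define C' where "C' = M / D0 / H\<^sup>2 * (C * A powr (1/4)) + 1"
 have e0: "0 < e" by (simp add: e_def)
 have A0: "0 \<le> A" using H K e0 by (simp add: A_def)
 have C'0: "0 < C'" using M D0 H C by (auto simp: C'_def intro!: add_nonneg_pos mult_nonneg_nonneg divide_nonneg_nonneg)
 show ?case
 proof (intro exI[of _ C'] conjI[OF C'0] allI impI, goal_cases)
 case (1 \<beta> c cm T D \<mu> D' \<mu>' u u' p pt p' pt')
 note \<beta> = 1(1) and c = 1(2,3,6) and T = 1(7) and OM = 1(8,9) and top = 1(10,12)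
 have s1: "optical_solution L H D \<mu> k1 (u 1)" "optical_solution L H D' \<mu>' k1 (u' 1)"
 "acoustic_pressure L H \<beta> c k1 \<mu> (u 1) (p 1) (pt 1)" "acoustic_pressure L H \<beta> c k1 \<mu>' (u' 1) (p' 1) (pt' 1)"
 and s2: "optical_solution L H D \<mu> k2 (u 2)" "optical_solution L H D' \<mu>' k2 (u' 2)"
 "acoustic_pressure L H \<beta> c k2 \<mu> (u 2) (p 2) (pt 2)" "acoustic_pressure L H \<beta> c k2 \<mu>' (u' 2) (p' 2) (pt' 2)"
 using 1(13) by (auto simp: Let_def)
 obtain g1 h1 where d1: "mode_data H K \<Lambda>1 D \<mu> (dI H \<mu>) (u 1) g1 h1" using K1(2)[OF OM(1) s1(1)] mode_data_mono[OF _ K(2,3)] by blast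
 obtain g2 h2 where d2: "mode_data H K \<Lambda>2 D \<mu> (dI H \<mu>) (u 2) g2 h2" using K2(2)[OF OM(1) s2(1)] mode_data_mono[OF _ K(4,5)] by blast
 obtain g1' h1' where d1': "mode_data H K \<Lambda>1 D' \<mu>' (dI H \<mu>') (u' 1) g1' h1'" using K1(2)[OF OM(2) s1(2)] mode_data_mono[OF _ K(2,3)] by blast
 obtain g2' h2' where d2': "mode_data H K \<Lambda>2 D' \<mu>' (dI H \<mu>') (u' 2) g2' h2'" using K2(2)[OF OM(2) s2(2)] mode_data_mono[OF _ K(4,5)] by blast
 define m where "m i = boundary_misfit L H \<beta> c T (p i) (pt i) (p' i) (pt' i)" for i
 define S where "S = m 1 + m 2"
 have sum: "(\<Sum>i\<in>{1, 2}. m i) = S" by (simp add: S_def)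
 have hd: "((\<lambda>y. \<mu> y * u y) has_real_derivative h y) (at y within {0..H})" "\<bar>h y\<bar> \<le> K"
 if "mode_data H K \<Lambda> D \<mu> \<mu>1 u g h" "y \<in> {0..H}" for \<Lambda> D \<mu> \<mu>1 u g h y
 using that unfolding mode_data_def by blast+
 have Lip: "\<bar>h x - h y\<bar> \<le> K * \<bar>x - y\<bar>"
 if "mode_data H K \<Lambda> D \<mu> \<mu>1 u g h" "x \<in> {0..H}" "y \<in> {0..H}" for \<Lambda> D \<mu> \<mu>1 u g h x y
 using that unfolding mode_data_def by blast
 have m1: "integral {0..H} (\<lambda>y. (h1 y - h1' y)\<^sup>2) \<le> 2 * exp (\<Lambda>1 * (1 + H\<^sup>2) * H) * m 1" "0 \<le> m 1"
 unfolding m_def \<Lambda>1_def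
 by (rule mode_energy_le[OF s1(3,4) \<beta> c T], rule hd(1)[OF d1], simp, rule hd(1)[OF d1'], simp)+
 have m2: "integral {0..H} (\<lambda>y. (h2 y - h2' y)\<^sup>2) \<le> e * m 2" "0 \<le> m 2"
 unfolding m_def \<Lambda>2_def e_def
 by (rule mode_energy_le[OF s2(3,4) \<beta> c T], rule hd(1)[OF d2], simp, rule hd(1)[OF d2'], simp)+
 have "2 * exp (\<Lambda>1 * (1 + H\<^sup>2) * H) \<le> e" using \<Lambda> H by (simp add: e_def mult_right_mono)
 then have m1': "integral {0..H} (\<lambda>y. (h1 y - h1' y)\<^sup>2) \<le> e * m 1" using m1 mult_right_mono order_trans by blast
 have S0: "0 \<le> S" using m1 m2 by (simp add: S_def)
 have E: "integral {0..H} (\<lambda>y. (h1 y - h1' y)\<^sup>2) \<le> e * S" "integral {0..H} (\<lambda>y. (h2 y - h2' y)\<^sup>2) \<le> e * S"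
 using m1' m2 m1(2) e0 by (auto simp: S_def distrib_left intro: order_trans)
 \<comment> \<open>A uniform bound for the differences of the derivatives of the internal data:
   \<open>A\<close> collects the constants for which the fourth power of such a difference is at
   most \<open>A * S\<close>.\<close>
 define \<delta> where "\<delta> = (A * S) powr (1/4)"
 have \<delta>: "\<bar>h y - h' y\<bar> \<le> \<delta>"
 if h: "mode_data H K \<Lambda> D \<mu> \<mu>1 u g h" "mode_data H K \<Lambda> D' \<mu>' \<mu>1' u' g' h'"
 and E: "integral {0..H} (\<lambda>y. (h y - h' y)\<^sup>2) \<le> e * S" and y: "y \<in> {0..H}" for \<Lambda> D \<mu> \<mu>1 u g h D' \<mu>' \<mu>1' u' g' h' y
 proof -
 have Ld: "\<bar>(h x - h' x) - (h y - h' y)\<bar> \<le> (2 * K) * \<bar>x - y\<bar>" if "x \<in> {0..H}" "y \<in> {0..H}" for x y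
 using Lip[OF h(1) that] Lip[OF h(2) that] by linarith
 have "\<bar>h y - h' y\<bar>^4 \<le> 8 * (2 * K)\<^sup>2 / min 1 H * integral {0..H} (\<lambda>x. (h x - h' x)\<^sup>2)"
 proof (rule fourth_power_le_energy[OF H _ _ Ld _ y])
 show "\<bar>h y - h' y\<bar> \<le> 2 * K" if "y \<in> {0..H}" for y using hd(2)[OF h(1) that] hd(2)[OF h(2) that] by linarith
 have "(2 * K)-lipschitz_on {0..H} (\<lambda>y. h y - h' y)"
 by (rule lipschitz_onI) (use Ld K in \<open>auto simp: dist_real_def\<close>)
 then show "continuous_on {0..H} (\<lambda>y. h y - h' y)" by (rule lipschitz_on_continuous_on)
 qed (use K in auto)
 also have "\<dots> \<le> 8 * (2 * K)\<^sup>2 / min 1 H * (e * S)" using H by (intro mult_left_mono E) auto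
 finally have le: "\<bar>h y - h' y\<bar>^4 \<le> A * S" by (simp add: A_def mult.assoc)
 have "\<bar>h y - h' y\<bar> = (\<bar>h y - h' y\<bar>^4) powr (1/4)"
 proof (cases "h y - h' y = 0")
 case False
 then have "(\<bar>h y - h' y\<bar>^4) powr (1/4) = \<bar>h y - h' y\<bar> powr (4 * (1/4))" by (simp add: powr_powr flip: powr_numeral)
 then show ?thesis by simp
 qed simp
 also have "\<dots> \<le> \<delta>" unfolding \<delta>_def by (rule powr_mono2) (use le in auto)
 finally show ?thesis .
 qed
 interpret media_pair H K \<Lambda>1 \<Lambda>2 D \<mu> "dI H \<mu>" "u 1" g1 h1 "u 2" g2 h2 D' \<mu>' "dI H \<mu>'" "u' 1" g1' h1' "u' 2" g2' h2' \<delta>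
 by unfold_locales (use H K \<Lambda> d1 d2 d1' d2' top \<delta>[OF d1 d1' E(1)] \<delta>[OF d2 d2' E(2)] in auto)
 have pair: "media_pair H K \<Lambda>1 \<Lambda>2 D \<mu> (dI H \<mu>) (u 1) g1 h1 (u 2) g2 h2 D' \<mu>' (dI H \<mu>') (u' 1) g1' h1' (u' 2) g2' h2' \<delta>"
 by (rule media_pair_axioms)
 have DD: "D0 \<le> D y" "D y \<le> M" if "y \<in> {0..H}" for y
 proof -
 have "Cn_on H 3 D" "Cn_norm H 3 D \<le> M" "D0 < D y" using OM(1) that by (auto simp: O_M_def)
 then show "D0 \<le> D y" "D y \<le> M" using C3_bounds(3)[OF _ _ H that] by fastforce+
 qed
 have um: "(u_m L H D \<mu> k1 y)\<^sup>2 \<le> M / D0 * (y / H)\<^sup>2" if y: "y \<in> {0..H}" for y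
 by (rule u_m_bound[OF H y D0]) (use DD[OF y] DD[of H] H D0 in auto)
 have \<delta>_eq: "\<delta> = A powr (1/4) * S powr (1/4)" using A0 S0 by (simp add: \<delta>_def powr_mult)
 have fin: "sup_norm H (\<lambda>y. (u_m L H D \<mu> k1 y)\<^sup>2 * (f y - f' y)) \<le> C' * S powr (1/4)"
 if f: "\<And>y. 0 < y \<Longrightarrow> y \<le> H \<Longrightarrow> \<bar>f y - f' y\<bar> \<le> C * \<delta> / y\<^sup>2" for f f'
 unfolding sup_norm_def
 proof (rule cSUP_least)
 fix y assume y: "y \<in> {0..H}"
 show "\<bar>(u_m L H D \<mu> k1 y)\<^sup>2 * (f y - f' y)\<bar> \<le> C' * S powr (1/4)"
 proof (cases "y = 0")
 \<comment> \<open>The stability bound is available only for \<open>y > 0\<close>; at 0 the weight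
   itself vanishes.\<close>
 case True
 then show ?thesis using um[OF y] C'0 by simp
 next
 case False
 then have y': "0 < y" "y \<le> H" using y by auto
 have "\<bar>(u_m L H D \<mu> k1 y)\<^sup>2 * (f y - f' y)\<bar> \<le> M / D0 * (y / H)\<^sup>2 * (C * \<delta> / y\<^sup>2)"
 unfolding abs_mult abs_power2 by (rule mult_mono[OF um[OF y] f[OF y']]) (use M D0 in auto)
 also have "\<dots> = M / D0 / H\<^sup>2 * (C * A powr (1/4)) * S powr (1/4)"
 using y' H by (simp add: \<delta>_eq power_divide)
 also have "\<dots> \<le> C' * S powr (1/4)" unfolding C'_def by (intro mult_right_mono) auto
 finally show ?thesis .
 qed
 qed (use H in auto)
 show ?case unfolding m_def[symmetric] sum using fin stab[OF pair] by blast
 qed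
qed

end
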